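(* Consider the asymmetric auto-regressive model on a Galton-Watson tree described in the context, assumed super-critical ($m=2p_{1,0}+p_0+p_1>1$), let $W=\lim_{q\to\infty}m^{-q}|\mathbb{G}_q^*|$ (limit a.s. and in $L^2$), and let $\eta=\mathbb{P}(W=0)=1-\frac{m-1}{p_{1,0}}$. Let $U$ and $V$ be independent random variables, $U$ with the $\chi^2$ distribution with two degrees of freedom and $V$ Bernoulli with parameter $1-\eta$. Assume that the distribution of the ancestor $X_\emptyset$ has finite moments of all orders, and define the test statistic $$\zeta_n=\frac{|\mathbb{T}_n^{1,0}|}{2(\hat\sigma^n)^2(1-\hat\rho^n)}\Big\{(\hat\alpha_0^n-\hat\alpha_1^n)^2\big(\hat\mu_2^n-(\hat\mu_1^n)^2\big)+\big((\hat\alpha_0^n-\hat\alpha_1^n)\hat\mu_1^n+\hat\beta_0^n-\hat\beta_1^n\big)^2\Big\}.$$ Then, as $n\to\infty$: (1) under $H_0=\{(\alpha_0,\beta_0)=(\alpha_1,\beta_1)\}$, $\mathbf{1}_{\{|\mathbb{G}_n^*|>0\}}\zeta_n$ converges in distribution to $UV$; (2) under $H_1=\{(\alpha_0,\beta_0)\ne(\alpha_1,\beta_1)\}$, $\mathbf{1}_{\{|\mathbb{G}_n^*|>0\}}\zeta_n$ converges a.s. to $0$ on $\{W=0\}$ and to $+\infty$ on $\{W\ne0\}$.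
   Context: Tree: $\mathbb{G}_0=\{\emptyset\}$, $\mathbb{G}_k=\{0,1\}^k$ for $k\ge1$, $\mathbb{T}_r=\bigcup_{0\le k\le r}\mathbb{G}_k$, $\mathbb{T}=\bigcup_{k\ge0}\mathbb{G}_k$; the daughters of $i\in\mathbb{T}$ are $i0$ and $i1$. Model: $S=\mathbb{R}$, $\bar S=\mathbb{R}\cup\{\partial\}$, $\partial$ being the value of dead or non-existing cells. Parameters: $\alpha_0,\alpha_1,\alpha_0',\alpha_1'\in(-1,1)$; $\beta_0,\beta_1,\beta_0',\beta_1'\in\mathbb{R}$; $\sigma,\sigma_0,\sigma_1>0$; $\rho\in(-1,1)$; $p_{1,0},p_0,p_1\ge0$ with $p_{1,0}+p_0+p_1\le1$. $(X_i,i\in\mathbb{T})$ is a $\bar S$-valued process with $X_\emptyset\in\mathbb{R}$ such that, for each $k\ge 0$, conditionally on $(X_j)_{j\in\mathbb{T}_k}$, the pairs $(X_{i0},X_{i1})$, $i\in\mathbb{G}_k$, are independent, $(X_{i0},X_{i1})$ having law $P^*(X_i,\cdot)$, where $P^*(\partial,\cdot)=\delta_{(\partial,\partial)}$ and, for $x\in\mathbb{R}$, $P^*(x,\cdot)$ is the law of: with probability $p_{1,0}$, $(\alpha_0x+\beta_0+\varepsilon_0,\ \alpha_1x+\beta_1+\varepsilon_1)$ with $(\varepsilon_0,\varepsilon_1)$ centered bivariate Gaussian with covariance matrix $\sigma^2\begin{pmatrix}1&\rho\\\rho&1\end{pmatrix}$; with probability $p_0$, $(\alpha_0'x+\beta_0'+\varepsilon_0',\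 \partial)$ with $\varepsilon_0'\sim\mathcal{N}(0,\sigma_0^2)$; with probability $p_1$, $(\partial,\ \alpha_1'x+\beta_1'+\varepsilon_1')$ with $\varepsilon_1'\sim\mathcal{N}(0,\sigma_1^2)$; with probability $1-p_{1,0}-p_0-p_1$, $(\partial,\partial)$. Let $\mathbb{T}^*=\{i:X_i\ne\partial\}$, $J^*=J\cap\mathbb{T}^*$, $|J|$ the cardinality of $J$, $\theta=(\alpha_0,\beta_0,\alpha_1,\beta_1,\alpha_0',\beta_0',\alpha_1',\beta_1',p_{1,0},p_0,p_1)$ and $\kappa=(\sigma,\rho,\sigma_0,\sigma_1)$. Estimators (maximum likelihood from $\mathbb{T}_{n+1}^*$): let $\mathbb{T}_n^{1,0}$, $\mathbb{T}_n^0$, $\mathbb{T}_n^1$ be the sets of $i\in\mathbb{T}_n^*$ such that, respectively, both daughters are alive, only $i0$ is alive, only $i1$ is alive. For a finite set $J$ and numbers $(a_i)$ write $\langle a\rangle_J=|J|^{-1}\sum_{i\in J}a_i$. For $\delta\in\{0,1\}$, with $J=\mathbb{T}_n^{1,0}$, $$\hat\alpha_\delta^n=\frac{\langle X_iX_{i\delta}\rangle_J-\langle X_i\rangle_J\langle X_{i\delta}\rangle_J}{\langle X_i^2\rangle_J-\langle X_i\rangle_J^2},\qquad\hat\beta_\delta^n=\langle X_{i\delta}\rangle_J-\hat\alpha_\delta^n\langle X_i\rangle_J;$$ $\hat\alpha_\delta'^n,\hat\beta_\delta'^n$ are given by the same formulas with $J=\mathbb{T}_n^\delta$; $\hat p_{1,0}^n=|\mathbb{T}_n^{1,0}|/|\mathbb{T}_n^*|$,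 $\hat p_\delta^n=|\mathbb{T}_n^\delta|/|\mathbb{T}_n^*|$. With residues $\hat\varepsilon_{i\delta}=X_{i\delta}-\hat\alpha_\delta^nX_i-\hat\beta_\delta^n$ ($i\in\mathbb{T}_n^{1,0}$) and $\hat\varepsilon'_{i\delta}=X_{i\delta}-\hat\alpha_\delta'^nX_i-\hat\beta_\delta'^n$ ($i\in\mathbb{T}_n^\delta$): $$(\hat\sigma^n)^2=\frac{1}{2|\mathbb{T}_n^{1,0}|}\sum_{i\in\mathbb{T}_n^{1,0}}(\hat\varepsilon_{i0}^2+\hat\varepsilon_{i1}^2),\quad\hat\rho^n=\frac{1}{(\hat\sigma^n)^2|\mathbb{T}_n^{1,0}|}\sum_{i\in\mathbb{T}_n^{1,0}}\hat\varepsilon_{i0}\hat\varepsilon_{i1},\quad(\hat\sigma_\delta^n)^2=\frac{1}{|\mathbb{T}_n^\delta|}\sum_{i\in\mathbb{T}_n^\delta}\hat\varepsilon_{i\delta}'^2.$$ $\hat\theta^n$ and $\hat\kappa^n=(\hat\sigma^n,\hat\rho^n,\hat\sigma_0^n,\hat\sigma_1^n)$ collect these estimators in the order of $\theta$ and $\kappa$. Any quantity whose formula is undefined (empty index set or zero denominator) is given the value $0$. Functions $\mu_1,\mu_2$: with $m=2p_{1,0}+p_0+p_1$, put $\bar\alpha=\frac1m[p_{1,0}(\alpha_0+\alpha_1)+p_0\alpha_0'+p_1\alpha_1']$, $\bar\beta=\frac1m[p_{1,0}(\beta_0+\beta_1)+p_0\beta_0'+p_1\beta_1']$, $\overline{\alpha^2}=\frac1m[p_{1,0}(\alpha_0^2+\alpha_1^2)+p_0\alpha_0'^2+p_1\alpha_1'^2]$,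 $\overline{\beta^2}=\frac1m[p_{1,0}(\beta_0^2+\beta_1^2)+p_0\beta_0'^2+p_1\beta_1'^2]$, $\overline{\alpha\beta}=\frac1m[p_{1,0}(\alpha_0\beta_0+\alpha_1\beta_1)+p_0\alpha_0'\beta_0'+p_1\alpha_1'\beta_1']$, $\overline{\sigma^2}=\frac1m[2p_{1,0}\sigma^2+p_0\sigma_0^2+p_1\sigma_1^2]$, and $$\mu_1(\theta)=\frac{\bar\beta}{1-\bar\alpha},\qquad\mu_2(\theta,\kappa)=\frac{2\overline{\alpha\beta}\,\bar\beta/(1-\bar\alpha)+\overline{\beta^2}+\overline{\sigma^2}}{1-\overline{\alpha^2}}.$$ $\hat\mu_1^n=\mu_1(\hat\theta^n)$ and $\hat\mu_2^n=\mu_2(\hat\theta^n,\hat\kappa^n)$ (same formulas evaluated at the estimators). *)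

theory Defs
  imports "HOL-Probability.Probability"
begin

section \<open>Binary tree and state space\<close>

text \<open>A node of the tree is a finite word, \<^term>\<open>False\<close> and \<^term>\<open>True\<close> standing for the
  letters 0 and 1. The last letter is at the end of the list, so the daughters of \<open>i\<close> are
  \<open>i @ [False]\<close> and \<open>i @ [True]\<close>.\<close>

type_synonym node = "bool list"

definition generation :: "nat \<Rightarrow> node set" where
  "generation k = {i. length i = k}"

definition tree_upto :: "nat \<Rightarrow> node set" where
  "tree_upto r = (\<Union>k\<le>r. generation k)"

text \<open>The state space \<open>\<real> \<union> {\<partial>}\<close> is \<^typ>\<open>real option\<close> with \<^term>\<open>None\<close> as the cemetery point;
  its sigma-algebra is generated by the Borel sets of \<open>\<real>\<close> and \<open>{\<partial>}\<close>.\<close>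

definition state_space :: "real option measure" where
  "state_space = sigma UNIV (insert {None} ((`) Some ` sets borel))"

abbreviation state_pair_space :: "(real option \<times> real option) measure" where
  "state_pair_space \<equiv> state_space \<Otimes>\<^sub>M state_space"

section \<open>Parameters\<close>

record bar_theta =
  \<alpha>\<^sub>0 :: real
  \<beta>\<^sub>0 :: real
  \<alpha>\<^sub>1 :: real
  \<beta>\<^sub>1 :: real
  \<alpha>'\<^sub>0 :: real
  \<beta>'\<^sub>0 :: real
  \<alpha>'\<^sub>1 :: real
  \<beta>'\<^sub>1 :: real
  p\<^sub>1\<^sub>0 :: real
  p\<^sub>0 :: real
  p\<^sub>1 :: real

record bar_kappa =
  \<sigma> :: real
  \<rho> :: real
  \<sigma>\<^sub>0 :: real
  \<sigma>\<^sub>1 :: real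

definition admissible :: "bar_theta \<Rightarrow> bar_kappa \<Rightarrow> bool" where
  "admissible \<theta> \<kappa> \<longleftrightarrow>
     \<alpha>\<^sub>0 \<theta> \<in> {-1<..<1} \<and> \<alpha>\<^sub>1 \<theta> \<in> {-1<..<1} \<and> \<alpha>'\<^sub>0 \<theta> \<in> {-1<..<1} \<and> \<alpha>'\<^sub>1 \<theta> \<in> {-1<..<1} \<and>
     \<sigma> \<kappa> > 0 \<and> \<sigma>\<^sub>0 \<kappa> > 0 \<and> \<sigma>\<^sub>1 \<kappa> > 0 \<and> \<rho> \<kappa> \<in> {-1<..<1} \<and>
     p\<^sub>1\<^sub>0 \<theta> \<ge> 0 \<and> p\<^sub>0 \<theta> \<ge> 0 \<and> p\<^sub>1 \<theta> \<ge> 0 \<and> p\<^sub>1\<^sub>0 \<theta> + p\<^sub>0 \<theta> + p\<^sub>1 \<theta> \<le> 1"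

definition mean_offspring :: "bar_theta \<Rightarrow> real" where
  "mean_offspring \<theta> = 2 * p\<^sub>1\<^sub>0 \<theta> + p\<^sub>0 \<theta> + p\<^sub>1 \<theta>"

section \<open>Transition kernel\<close>

text \<open>Lebesgue density of the centered bivariate Gaussian law with non-singular covariance matrix
  with rows \<open>(a, c)\<close> and \<open>(c, b)\<close>.\<close>

definition bivariate_normal_density :: "real \<Rightarrow> real \<Rightarrow> real \<Rightarrow> real \<times> real \<Rightarrow> real" where
  "bivariate_normal_density a b c = (\<lambda>(x, y).
     exp (- (b * x\<^sup>2 - 2 * c * x * y + a * y\<^sup>2) / (2 * (a * b - c\<^sup>2))) / (2 * pi * sqrt (a * b - c\<^sup>2)))"

definition law_both :: "bar_theta \<Rightarrow> bar_kappa \<Rightarrow> real \<Rightarrow> (real option \<times> real option) measure" where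
  "law_both \<theta> \<kappa> x =
     distr (density (lborel :: (real \<times> real) measure)
             (bivariate_normal_density ((\<sigma> \<kappa>)\<^sup>2) ((\<sigma> \<kappa>)\<^sup>2) ((\<sigma> \<kappa>)\<^sup>2 * \<rho> \<kappa>)))
       state_pair_space
       (\<lambda>(\<epsilon>\<^sub>0, \<epsilon>\<^sub>1). (Some (\<alpha>\<^sub>0 \<theta> * x + \<beta>\<^sub>0 \<theta> + \<epsilon>\<^sub>0), Some (\<alpha>\<^sub>1 \<theta> * x + \<beta>\<^sub>1 \<theta> + \<epsilon>\<^sub>1)))"

definition law_only0 :: "bar_theta \<Rightarrow> bar_kappa \<Rightarrow> real \<Rightarrow> (real option \<times> real option) measure" where
  "law_only0 \<theta> \<kappa> x =
     distr (density lborel (normal_density 0 (\<sigma>\<^sub>0 \<kappa>))) state_pair_space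
       (\<lambda>\<epsilon>. (Some (\<alpha>'\<^sub>0 \<theta> * x + \<beta>'\<^sub>0 \<theta> + \<epsilon>), None))"

definition law_only1 :: "bar_theta \<Rightarrow> bar_kappa \<Rightarrow> real \<Rightarrow> (real option \<times> real option) measure" where
  "law_only1 \<theta> \<kappa> x =
     distr (density lborel (normal_density 0 (\<sigma>\<^sub>1 \<kappa>))) state_pair_space
       (\<lambda>\<epsilon>. (None, Some (\<alpha>'\<^sub>1 \<theta> * x + \<beta>'\<^sub>1 \<theta> + \<epsilon>)))"

definition law_dead :: "(real option \<times> real option) measure" where
  "law_dead = return state_pair_space (None, None)"

fun P_star :: "bar_theta \<Rightarrow> bar_kappa \<Rightarrow> real option \<Rightarrow> (real option \<times> real option) measure" where
  "P_star \<theta> \<kappa> None = law_dead"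
| "P_star \<theta> \<kappa> (Some x) = measure_of (space state_pair_space) (sets state_pair_space) (\<lambda>A.
     ennreal (p\<^sub>1\<^sub>0 \<theta>) * emeasure (law_both \<theta> \<kappa> x) A + ennreal (p\<^sub>0 \<theta>) * emeasure (law_only0 \<theta> \<kappa> x) A +
     ennreal (p\<^sub>1 \<theta>) * emeasure (law_only1 \<theta> \<kappa> x) A +
     ennreal (1 - p\<^sub>1\<^sub>0 \<theta> - p\<^sub>0 \<theta> - p\<^sub>1 \<theta>) * emeasure law_dead A)"

lemma sets_law [simp, measurable_cong]:
  "sets (law_both \<theta> \<kappa> x) = sets state_pair_space"
  "sets (law_only0 \<theta> \<kappa> x) = sets state_pair_space"
  "sets (law_only1 \<theta> \<kappa> x) = sets state_pair_space"
  "sets law_dead = sets state_pair_space"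
  by (simp_all add: law_both_def law_only0_def law_only1_def law_dead_def)

text \<open>The set function in \<^const>\<open>P_star\<close> is a measure, so \<^const>\<open>measure_of\<close> does not degenerate
  to the zero measure.\<close>

lemma emeasure_P_star_Some:
  assumes A: "A \<in> sets state_pair_space"
  shows "emeasure (P_star \<theta> \<kappa> (Some x)) A =
     ennreal (p\<^sub>1\<^sub>0 \<theta>) * emeasure (law_both \<theta> \<kappa> x) A + ennreal (p\<^sub>0 \<theta>) * emeasure (law_only0 \<theta> \<kappa> x) A +
     ennreal (p\<^sub>1 \<theta>) * emeasure (law_only1 \<theta> \<kappa> x) A +
     ennreal (1 - p\<^sub>1\<^sub>0 \<theta> - p\<^sub>0 \<theta> - p\<^sub>1 \<theta>) * emeasure law_dead A" (is "_ = ?f A")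
proof (rule emeasure_measure_of[OF P_star.simps(2)])
  show "countably_additive (sets (P_star \<theta> \<kappa> (Some x))) ?f"
  proof (rule countably_additiveI)
    fix B :: "nat \<Rightarrow> (real option \<times> real option) set"
    assume B: "range B \<subseteq> sets (P_star \<theta> \<kappa> (Some x))" "disjoint_family B"
    from B have B': "range B \<subseteq> sets state_pair_space" by simp
    show "(\<Sum>i. ?f (B i)) = ?f (\<Union>i. B i)"
      by (subst suminf_add[symmetric, OF summableI summableI] ennreal_suminf_cmult suminf_emeasure,
          use B B' in simp_all)+
  qed
qed (use A sets.sets_into_space in \<open>auto simp: positive_def\<close>)

section \<open>The process\<close>

definition past :: "'a measure \<Rightarrow> (node \<Rightarrow> 'a \<Rightarrow> real option) \<Rightarrow> nat \<Rightarrow> 'a measure" where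
  "past M X k = vimage_algebra (space M) (\<lambda>\<omega>. \<lambda>j\<in>tree_upto k. X j \<omega>)
     (\<Pi>\<^sub>M j\<in>tree_upto k. state_space)"

text \<open>The last assumption says that the conditional law of \<open>((X\<^sub>i\<^sub>0, X\<^sub>i\<^sub>1))\<close>, \<open>i\<close> in generation \<open>k\<close>, given
  \<open>(X\<^sub>j)\<close>, \<open>j\<close> in the tree up to generation \<open>k\<close>, is the product of the laws \<open>P\<^sup>*(X\<^sub>i, \<cdot>)\<close>;
  it is expressed on measurable rectangles.\<close>

locale bifurcating_ar = prob_space M
  for M :: "'a measure"
    and X :: "node \<Rightarrow> 'a \<Rightarrow> real option"
    and \<theta> :: bar_theta and \<kappa> :: bar_kappa +
  assumes admissible: "admissible \<theta> \<kappa>"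
    and X_measurable: "\<And>i. X i \<in> M \<rightarrow>\<^sub>M state_space"
    and ancestor_alive: "\<And>\<omega>. \<omega> \<in> space M \<Longrightarrow> X [] \<omega> \<noteq> None"
    and transition: "\<And>k B. (\<And>i. i \<in> generation k \<Longrightarrow> B i \<in> sets state_pair_space) \<Longrightarrow>
      AE \<omega> in M.
        real_cond_exp M (past M X k)
          (indicator {\<omega> \<in> space M. \<forall>i\<in>generation k. (X (i @ [False]) \<omega>, X (i @ [True]) \<omega>) \<in> B i}) \<omega> =
        (\<Prod>i\<in>generation k. measure (P_star \<theta> \<kappa> (X i \<omega>)) (B i))"

section \<open>Estimators\<close>

text \<open>Estimators are functions of a realisation \<open>x\<close> of the process. The convention that a quantity
  with an undefined formula has the value 0 is that of division by zero, except in \<open>\<mu>\<^sub>2\<close> below.\<close>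

definition alive :: "(node \<Rightarrow> real option) \<Rightarrow> node set \<Rightarrow> node set" where
  "alive x J = {i \<in> J. x i \<noteq> None}"

definition T_both :: "(node \<Rightarrow> real option) \<Rightarrow> nat \<Rightarrow> node set" where
  "T_both x n = {i \<in> alive x (tree_upto n). x (i @ [False]) \<noteq> None \<and> x (i @ [True]) \<noteq> None}"

definition T_only :: "bool \<Rightarrow> (node \<Rightarrow> real option) \<Rightarrow> nat \<Rightarrow> node set" where
  "T_only \<delta> x n = {i \<in> alive x (tree_upto n). x (i @ [\<delta>]) \<noteq> None \<and> x (i @ [\<not> \<delta>]) = None}"

abbreviation val :: "(node \<Rightarrow> real option) \<Rightarrow> node \<Rightarrow> real" where
  "val x i \<equiv> the (x i)"

definition avg :: "node set \<Rightarrow> (node \<Rightarrow> real) \<Rightarrow> real" where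
  "avg J a = (\<Sum>i\<in>J. a i) / real (card J)"

definition slope_hat :: "(node \<Rightarrow> real option) \<Rightarrow> node set \<Rightarrow> bool \<Rightarrow> real" where
  "slope_hat x J \<delta> =
     (avg J (\<lambda>i. val x i * val x (i @ [\<delta>])) - avg J (\<lambda>i. val x i) * avg J (\<lambda>i. val x (i @ [\<delta>]))) /
     (avg J (\<lambda>i. (val x i)\<^sup>2) - (avg J (\<lambda>i. val x i))\<^sup>2)"

definition intercept_hat :: "(node \<Rightarrow> real option) \<Rightarrow> node set \<Rightarrow> bool \<Rightarrow> real" where
  "intercept_hat x J \<delta> = avg J (\<lambda>i. val x (i @ [\<delta>])) - slope_hat x J \<delta> * avg J (\<lambda>i. val x i)"

definition residue :: "(node \<Rightarrow> real option) \<Rightarrow> node set \<Rightarrow> bool \<Rightarrow> node \<Rightarrow> real" where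
  "residue x J \<delta> i = val x (i @ [\<delta>]) - slope_hat x J \<delta> * val x i - intercept_hat x J \<delta>"

definition theta_hat :: "(node \<Rightarrow> real option) \<Rightarrow> nat \<Rightarrow> bar_theta" where
  "theta_hat x n = \<lparr>
     \<alpha>\<^sub>0 = slope_hat x (T_both x n) False,
     \<beta>\<^sub>0 = intercept_hat x (T_both x n) False,
     \<alpha>\<^sub>1 = slope_hat x (T_both x n) True,
     \<beta>\<^sub>1 = intercept_hat x (T_both x n) True,
     \<alpha>'\<^sub>0 = slope_hat x (T_only False x n) False,
     \<beta>'\<^sub>0 = intercept_hat x (T_only False x n) False,
     \<alpha>'\<^sub>1 = slope_hat x (T_only True x n) True,
     \<beta>'\<^sub>1 = intercept_hat x (T_only True x n) True,
     p\<^sub>1\<^sub>0 = real (card (T_both x n)) / real (card (alive x (tree_upto n))),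
     p\<^sub>0 = real (card (T_only False x n)) / real (card (alive x (tree_upto n))),
     p\<^sub>1 = real (card (T_only True x n)) / real (card (alive x (tree_upto n)))\<rparr>"

definition sigma2_hat :: "(node \<Rightarrow> real option) \<Rightarrow> nat \<Rightarrow> real" where
  "sigma2_hat x n =
     (\<Sum>i\<in>T_both x n. (residue x (T_both x n) False i)\<^sup>2 + (residue x (T_both x n) True i)\<^sup>2) /
     (2 * real (card (T_both x n)))"

definition rho_hat :: "(node \<Rightarrow> real option) \<Rightarrow> nat \<Rightarrow> real" where
  "rho_hat x n =
     (\<Sum>i\<in>T_both x n. residue x (T_both x n) False i * residue x (T_both x n) True i) /
     (sigma2_hat x n * real (card (T_both x n)))"

definition sigma2_only_hat :: "bool \<Rightarrow> (node \<Rightarrow> real option) \<Rightarrow> nat \<Rightarrow> real" where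
  "sigma2_only_hat \<delta> x n =
     (\<Sum>i\<in>T_only \<delta> x n. (residue x (T_only \<delta> x n) \<delta> i)\<^sup>2) / real (card (T_only \<delta> x n))"

definition kappa_hat :: "(node \<Rightarrow> real option) \<Rightarrow> nat \<Rightarrow> bar_kappa" where
  "kappa_hat x n = \<lparr>
     \<sigma> = sqrt (sigma2_hat x n),
     \<rho> = rho_hat x n,
     \<sigma>\<^sub>0 = sqrt (sigma2_only_hat False x n),
     \<sigma>\<^sub>1 = sqrt (sigma2_only_hat True x n)\<rparr>"

section \<open>The functions \<open>\<mu>\<^sub>1\<close>, \<open>\<mu>\<^sub>2\<close> and the test statistic\<close>

definition alpha_bar :: "bar_theta \<Rightarrow> real" where
  "alpha_bar \<theta> =
     (p\<^sub>1\<^sub>0 \<theta> * (\<alpha>\<^sub>0 \<theta> + \<alpha>\<^sub>1 \<theta>) + p\<^sub>0 \<theta> * \<alpha>'\<^sub>0 \<theta> + p\<^sub>1 \<theta> * \<alpha>'\<^sub>1 \<theta>) / mean_offspring \<theta>"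

definition beta_bar :: "bar_theta \<Rightarrow> real" where
  "beta_bar \<theta> =
     (p\<^sub>1\<^sub>0 \<theta> * (\<beta>\<^sub>0 \<theta> + \<beta>\<^sub>1 \<theta>) + p\<^sub>0 \<theta> * \<beta>'\<^sub>0 \<theta> + p\<^sub>1 \<theta> * \<beta>'\<^sub>1 \<theta>) / mean_offspring \<theta>"

definition alpha2_bar :: "bar_theta \<Rightarrow> real" where
  "alpha2_bar \<theta> =
     (p\<^sub>1\<^sub>0 \<theta> * ((\<alpha>\<^sub>0 \<theta>)\<^sup>2 + (\<alpha>\<^sub>1 \<theta>)\<^sup>2) + p\<^sub>0 \<theta> * (\<alpha>'\<^sub>0 \<theta>)\<^sup>2 + p\<^sub>1 \<theta> * (\<alpha>'\<^sub>1 \<theta>)\<^sup>2) / mean_offspring \<theta>"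

definition beta2_bar :: "bar_theta \<Rightarrow> real" where
  "beta2_bar \<theta> =
     (p\<^sub>1\<^sub>0 \<theta> * ((\<beta>\<^sub>0 \<theta>)\<^sup>2 + (\<beta>\<^sub>1 \<theta>)\<^sup>2) + p\<^sub>0 \<theta> * (\<beta>'\<^sub>0 \<theta>)\<^sup>2 + p\<^sub>1 \<theta> * (\<beta>'\<^sub>1 \<theta>)\<^sup>2) / mean_offspring \<theta>"

definition alpha_beta_bar :: "bar_theta \<Rightarrow> real" where
  "alpha_beta_bar \<theta> =
     (p\<^sub>1\<^sub>0 \<theta> * (\<alpha>\<^sub>0 \<theta> * \<beta>\<^sub>0 \<theta> + \<alpha>\<^sub>1 \<theta> * \<beta>\<^sub>1 \<theta>) + p\<^sub>0 \<theta> * \<alpha>'\<^sub>0 \<theta> * \<beta>'\<^sub>0 \<theta> + p\<^sub>1 \<theta> * \<alpha>'\<^sub>1 \<theta> * \<beta>'\<^sub>1 \<theta>) /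
     mean_offspring \<theta>"

definition sigma2_bar :: "bar_theta \<Rightarrow> bar_kappa \<Rightarrow> real" where
  "sigma2_bar \<theta> \<kappa> =
     (2 * p\<^sub>1\<^sub>0 \<theta> * (\<sigma> \<kappa>)\<^sup>2 + p\<^sub>0 \<theta> * (\<sigma>\<^sub>0 \<kappa>)\<^sup>2 + p\<^sub>1 \<theta> * (\<sigma>\<^sub>1 \<kappa>)\<^sup>2) / mean_offspring \<theta>"

definition mu1 :: "bar_theta \<Rightarrow> real" where
  "mu1 \<theta> = beta_bar \<theta> / (1 - alpha_bar \<theta>)"

text \<open>The case distinction is needed because the vanishing of the inner denominator alone would not
  make the total quotient 0.\<close>

definition mu2 :: "bar_theta \<Rightarrow> bar_kappa \<Rightarrow> real" where
  "mu2 \<theta> \<kappa> = (if alpha_bar \<theta> = 1 then 0 else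
     (2 * alpha_beta_bar \<theta> * beta_bar \<theta> / (1 - alpha_bar \<theta>) + beta2_bar \<theta> + sigma2_bar \<theta> \<kappa>) /
     (1 - alpha2_bar \<theta>))"

definition zeta :: "nat \<Rightarrow> (node \<Rightarrow> real option) \<Rightarrow> real" where
  "zeta n x = (let \<theta> = theta_hat x n; \<kappa> = kappa_hat x n in
     real (card (T_both x n)) / (2 * (\<sigma> \<kappa>)\<^sup>2 * (1 - \<rho> \<kappa>)) *
     ((\<alpha>\<^sub>0 \<theta> - \<alpha>\<^sub>1 \<theta>)\<^sup>2 * (mu2 \<theta> \<kappa> - (mu1 \<theta>)\<^sup>2) +
      ((\<alpha>\<^sub>0 \<theta> - \<alpha>\<^sub>1 \<theta>) * mu1 \<theta> + \<beta>\<^sub>0 \<theta> - \<beta>\<^sub>1 \<theta>)\<^sup>2))"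

section \<open>Limit laws\<close>

text \<open>Law of the sum of the squares of \<open>k\<close> independent standard normal variables.\<close>

definition chi_square_law :: "nat \<Rightarrow> real measure" where
  "chi_square_law k =
     distr (\<Pi>\<^sub>M i\<in>{..<k}. density lborel std_normal_density) borel (\<lambda>z. \<Sum>i<k. (z i)\<^sup>2)"

definition bernoulli_law :: "real \<Rightarrow> real measure" where
  "bernoulli_law p = distr (measure_pmf (bernoulli_pmf p)) borel of_bool"

end

theory Submission
  imports Defs
begin

text \<open>The daughters of the cells of a generation are realised from independent innovations (a type and two
  standard normal variables per cell), so that integrals over the past and the next generation can
  be computed by freezing the past. Sums over a generation, centred given the past, have variance
  of the order of the size of the generation; divided by \<open>m ^ k\<close> their squares are summable, and
  affine recurrences turn this into almost sure limits of all empirical moments, hence into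
  consistency of the estimators. Both the probability of extinction and that of \<open>W = 0\<close> are fixed
  points of the offspring generating function other than \<open>1\<close>, so the two events coincide; this settles
  the alternative.

  Under the null hypothesis the differences of the values of sisters, given the past, are centred
  Gaussian with the same variance. Up to a relative error that vanishes, the statistic is the squared
  norm of two normalised sums of such differences over the generations \<open>n div 2, \<dots>, n\<close>. With a
  normalisation known at generation \<open>n div 2\<close>, a truncated exponential martingale gives the limit of
  their joint characteristic function on survival. The Laplace transform of the squared norm is a
  Gaussian mixture of these characteristic functions, and Laplace transforms determine the limit law.\<close>

section \<open>Innovations of the daughters\<close>

text \<open>The obstacle to a central limit theorem is that the number of cells with two daughters
  grows like \<open>m ^ n\<close> times the random \<open>W\<close>, which no finite generation
  knows; a deterministic norming would leave a limit mixed over \<open>W\<close>. Extrapolating the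
  size of generation \<open>n div 2\<close> by a power of \<open>m\<close> gives a norming known to
  the martingale, and its compensator then tends to a constant. Half is late enough for this
  prediction and early enough for the discarded generations: by the law of large numbers alone they
  are of smaller order than \<open>m ^ (n div 2)\<close>, hence negligible against a scale of order
  \<open>sqrt (m ^ n)\<close>. The two sums are weighted by \<open>1\<close> and
  \<open>(z - mu1 \<theta>) / mu_sd\<close>, which are orthonormal for a law with first and second
  moments \<open>mu1\<close> and \<open>mu2\<close>. The bracket in the statistic is the mean square
  of the difference of two regression lines under such a law, and in these coordinates it is a
  Euclidean norm. Along a single path the coordinates need not stay bounded, so the error is
  controlled only relative to \<open>1\<close> plus the squared norm; test functions that are
  constant far out make this sufficient, and tightness does not have to be shown.\<close>

lemma space_state_space [simp]: "space state_space = UNIV"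
  by (simp add: state_space_def space_measure_of_conv)

text \<open>As \<open>{None}\<close> is a generator, containing the cemetery point imposes no
  condition, and only the real part of a set matters. Measurability of maps out of the state space
  thereby becomes a question about Borel sets.\<close>

lemma sets_state_space_iff: "A \<in> sets state_space \<longleftrightarrow> Some -` A \<in> sets borel"
proof
  assume "A \<in> sets state_space"
  then have "A \<in> sigma_sets UNIV (insert {None} ((`) Some ` sets borel))"
    by (simp add: state_space_def)
  then show "Some -` A \<in> sets borel"
  proof induction
    case (Basic a)
    have "Some -` Some ` B = B" for B :: "real set" by auto
    then show ?case using Basic by (auto simp: vimage_def)
  next
    case (Compl a)
    have "Some -` (UNIV - a) = space borel - Some -` a" by auto
    then show ?case using Compl by (metis sets.compl_sets)
  next
    case (Union a)
    then show ?case by (auto simp: vimage_Union)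
  qed auto
next
  assume *: "Some -` A \<in> sets borel"
  have none: "{None} \<in> sets state_space"
    by (auto simp: state_space_def)
  have "Some ` B \<in> sets state_space" if "B \<in> sets borel" for B
    using that by (auto simp: state_space_def)
  from this[OF *] have some: "Some ` (Some -` A) \<in> sets state_space" .
  show "A \<in> sets state_space"
  proof (cases "None \<in> A")
    case True
    then have "insert None (Some ` (Some -` A)) = A"
      by (auto simp: image_iff)
    with sets.Un[OF none some] show ?thesis by simp
  next
    case False
    then have "Some ` (Some -` A) = A"
    proof -
      have "a \<in> Some ` (Some -` A)" if "a \<in> A" for a
        using that False by (cases a) auto
      then show ?thesis by blast
    qed
    with some show ?thesis by simp
  qed
qed

lemma measurable_Some [measurable]: "Some \<in> borel \<rightarrow>\<^sub>M state_space"
  by (rule measurableI) (auto simp: sets_state_space_iff)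

lemma measurable_is_None [measurable (raw)]:
  assumes [measurable]: "s \<in> M \<rightarrow>\<^sub>M state_space"
  shows "Measurable.pred M (\<lambda>\<omega>. s \<omega> = None)"
proof -
  have "Measurable.pred state_space (\<lambda>s. s = None)"
    by (auto simp: pred_def sets_state_space_iff vimage_def)
  from measurable_compose[OF assms this] show ?thesis .
qed

text \<open>\<open>the None\<close> is some fixed real number and needs no separate treatment:
  pulled back along \<open>Some\<close>, the preimage of a set under \<open>the\<close> is the set
  itself.\<close>

lemma measurable_the [measurable]: "the \<in> borel_measurable state_space"
  by (rule measurableI) (auto simp: sets_state_space_iff vimage_def)

definition type_prob :: "bar_theta \<Rightarrow> bool \<times> bool \<Rightarrow> real" where
  "type_prob \<theta> \<tau> = (if fst \<tau> then (if snd \<tau> then p\<^sub>1\<^sub>0 \<theta> else p\<^sub>0 \<theta>)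
     else (if snd \<tau> then p\<^sub>1 \<theta> else 1 - p\<^sub>1\<^sub>0 \<theta> - p\<^sub>0 \<theta> - p\<^sub>1 \<theta>))"

definition daughter_type :: "bar_theta \<Rightarrow> (bool \<times> bool) pmf" where
  "daughter_type \<theta> = embed_pmf (type_prob \<theta>)"

lemma UNIV_types: "(UNIV :: (bool \<times> bool) set) = {(True, True), (True, False), (False, True), (False, False)}"
  by auto

text \<open>\<open>embed_pmf\<close> returns the given weights only if they are nonnegative and have
  total mass one; this is where admissibility enters.\<close>

lemma pmf_daughter_type:
  assumes "admissible \<theta> \<kappa>"
  shows "pmf (daughter_type \<theta>) \<tau> = type_prob \<theta> \<tau>"
proof -
  have nonneg: "type_prob \<theta> \<tau> \<ge> 0" for \<tau>
    using assms by (auto simp: type_prob_def admissible_def)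
  have "(\<integral>\<^sup>+\<tau>. ennreal (type_prob \<theta> \<tau>) \<partial>count_space UNIV) = ennreal (\<Sum>\<tau>\<in>UNIV. type_prob \<theta> \<tau>)"
    by (subst nn_integral_count_space_finite) (auto simp: nonneg)
  also have "\<dots> = 1"
    by (simp add: UNIV_types type_prob_def)
  finally show ?thesis
    unfolding daughter_type_def using nonneg by (intro pmf_embed_pmf) auto
qed

abbreviation gauss2 :: "(real \<times> real) measure" where
  "gauss2 \<equiv> std_normal_distribution \<Otimes>\<^sub>M std_normal_distribution"

definition noise :: "bar_theta \<Rightarrow> ((bool \<times> bool) \<times> real \<times> real) measure" where
  "noise \<theta> = measure_pmf (daughter_type \<theta>) \<Otimes>\<^sub>M gauss2"

lemma prob_space_std_normal: "prob_space std_normal_distribution"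
  using real_dist_normal_dist by (simp add: real_distribution_def)

lemma prob_space_gauss2: "prob_space gauss2"
  by (intro prob_space_pair prob_space_std_normal)

lemma prob_space_noise: "prob_space (noise \<theta>)"
  unfolding noise_def by (intro prob_space_pair prob_space_gauss2 prob_space_measure_pmf)

lemma sets_noise [measurable_cong, simp]:
  "sets (noise \<theta>) = sets (count_space UNIV \<Otimes>\<^sub>M (borel \<Otimes>\<^sub>M borel))"
  unfolding noise_def by (intro sets_pair_measure_cong) auto

lemma space_noise [simp]: "space (noise \<theta>) = UNIV"
  by (simp add: noise_def space_pair_measure)

lemma measurable_noise_type: "(f \<in> noise \<theta> \<rightarrow>\<^sub>M N) \<longleftrightarrow> (\<forall>\<tau>. (\<lambda>z. f (\<tau>, z)) \<in> borel \<Otimes>\<^sub>M borel \<rightarrow>\<^sub>M N)"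
proof
  assume f: "f \<in> noise \<theta> \<rightarrow>\<^sub>M N"
  show "\<forall>\<tau>. (\<lambda>z. f (\<tau>, z)) \<in> borel \<Otimes>\<^sub>M borel \<rightarrow>\<^sub>M N"
  proof
    fix \<tau> :: "bool \<times> bool"
    have "(\<lambda>z. (\<tau>, z)) \<in> borel \<Otimes>\<^sub>M borel \<rightarrow>\<^sub>M noise \<theta>"
      by measurable
    from measurable_compose[OF this f] show "(\<lambda>z. f (\<tau>, z)) \<in> borel \<Otimes>\<^sub>M borel \<rightarrow>\<^sub>M N" .
  qed
next
  assume f: "\<forall>\<tau>. (\<lambda>z. f (\<tau>, z)) \<in> borel \<Otimes>\<^sub>M borel \<rightarrow>\<^sub>M N"
  have "f \<in> count_space UNIV \<Otimes>\<^sub>M (borel \<Otimes>\<^sub>M borel) \<rightarrow>\<^sub>M N"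
    by (rule measurable_pair_measure_countable1) (use f in auto)
  then show "f \<in> noise \<theta> \<rightarrow>\<^sub>M N" by (simp cong: measurable_cong_sets)
qed

lemma nn_integral_noise:
  assumes adm: "admissible \<theta> \<kappa>" and f: "f \<in> borel_measurable (noise \<theta>)"
  shows "(\<integral>\<^sup>+\<xi>. f \<xi> \<partial>noise \<theta>) = (\<Sum>\<tau>\<in>UNIV. ennreal (type_prob \<theta> \<tau>) * (\<integral>\<^sup>+z. f (\<tau>, z) \<partial>gauss2))"
proof -
  interpret g: prob_space gauss2 by (rule prob_space_gauss2)
  have "(\<integral>\<^sup>+\<xi>. f \<xi> \<partial>noise \<theta>) = (\<integral>\<^sup>+\<tau>. (\<integral>\<^sup>+z. f (\<tau>, z) \<partial>gauss2) \<partial>measure_pmf (daughter_type \<theta>))"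
    using f unfolding noise_def by (intro g.nn_integral_fst[symmetric])
  also have "\<dots> = (\<Sum>\<tau>\<in>UNIV. (\<integral>\<^sup>+z. f (\<tau>, z) \<partial>gauss2) * ennreal (type_prob \<theta> \<tau>))"
    by (subst nn_integral_measure_pmf_support[where A=UNIV]) (auto simp: pmf_daughter_type[OF adm])
  finally show ?thesis by (simp add: mult.commute)
qed

text \<open>A type \<open>\<tau>\<close> tells which of the two daughters are alive. The innovation of a daughter is realised as a
  combination of two independent standard normal variables, via the Cholesky factor of the
  covariance matrix.\<close>

definition slope :: "bar_theta \<Rightarrow> bool \<times> bool \<Rightarrow> bool \<Rightarrow> real" where
  "slope \<theta> \<tau> \<delta> = (if \<tau> = (True, True) then (if \<delta> then \<alpha>\<^sub>1 \<theta> else \<alpha>\<^sub>0 \<theta>) else (if \<delta> then \<alpha>'\<^sub>1 \<theta> else \<alpha>'\<^sub>0 \<theta>))"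

definition icpt :: "bar_theta \<Rightarrow> bool \<times> bool \<Rightarrow> bool \<Rightarrow> real" where
  "icpt \<theta> \<tau> \<delta> = (if \<tau> = (True, True) then (if \<delta> then \<beta>\<^sub>1 \<theta> else \<beta>\<^sub>0 \<theta>) else (if \<delta> then \<beta>'\<^sub>1 \<theta> else \<beta>'\<^sub>0 \<theta>))"

definition load1 :: "bar_kappa \<Rightarrow> bool \<times> bool \<Rightarrow> bool \<Rightarrow> real" where
  "load1 \<kappa> \<tau> \<delta> = (if \<tau> = (True, True) then (if \<delta> then \<sigma> \<kappa> * \<rho> \<kappa> else \<sigma> \<kappa>) else (if \<delta> then \<sigma>\<^sub>1 \<kappa> else \<sigma>\<^sub>0 \<kappa>))"

definition load2 :: "bar_kappa \<Rightarrow> bool \<times> bool \<Rightarrow> bool \<Rightarrow> real" where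
  "load2 \<kappa> \<tau> \<delta> = (if \<tau> = (True, True) \<and> \<delta> then \<sigma> \<kappa> * sqrt (1 - (\<rho> \<kappa>)\<^sup>2) else 0)"

abbreviation living :: "bool \<times> bool \<Rightarrow> bool \<Rightarrow> bool" where
  "living \<tau> \<delta> \<equiv> (if \<delta> then snd \<tau> else fst \<tau>)"

definition daughter :: "bar_theta \<Rightarrow> bar_kappa \<Rightarrow> bool \<Rightarrow> real option \<Rightarrow> (bool \<times> bool) \<times> real \<times> real \<Rightarrow> real option" where
  "daughter \<theta> \<kappa> \<delta> s = (\<lambda>(\<tau>, z). if s \<noteq> None \<and> living \<tau> \<delta>
     then Some (slope \<theta> \<tau> \<delta> * the s + icpt \<theta> \<tau> \<delta> + (load1 \<kappa> \<tau> \<delta> * fst z + load2 \<kappa> \<tau> \<delta> * snd z)) else None)"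

definition daughters :: "bar_theta \<Rightarrow> bar_kappa \<Rightarrow> real option \<Rightarrow> (bool \<times> bool) \<times> real \<times> real \<Rightarrow> real option \<times> real option" where
  "daughters \<theta> \<kappa> s \<xi> = (daughter \<theta> \<kappa> False s \<xi>, daughter \<theta> \<kappa> True s \<xi>)"

lemma daughters_None [simp]: "daughters \<theta> \<kappa> None \<xi> = (None, None)"
  by (simp add: daughters_def daughter_def split: prod.splits)

lemma measurable_daughter [measurable (raw)]:
  assumes [measurable]: "s \<in> M \<rightarrow>\<^sub>M state_space" "\<xi> \<in> M \<rightarrow>\<^sub>M noise \<theta>'"
  shows "(\<lambda>\<omega>. daughter \<theta> \<kappa> \<delta> (s \<omega>) (\<xi> \<omega>)) \<in> M \<rightarrow>\<^sub>M state_space"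
proof -
  have [measurable]: "\<xi> \<in> M \<rightarrow>\<^sub>M count_space UNIV \<Otimes>\<^sub>M (borel \<Otimes>\<^sub>M borel)"
    using assms(2) by (simp cong: measurable_cong_sets)
  have [measurable]: "Measurable.pred M (\<lambda>\<omega>. living (fst (\<xi> \<omega>)) \<delta>)"
    by (rule measurable_compose[of "\<lambda>\<omega>. fst (\<xi> \<omega>)" _ "count_space UNIV"]) measurable
  show ?thesis unfolding daughter_def split_beta' by measurable
qed

lemma measurable_daughters [measurable (raw)]:
  assumes [measurable]: "s \<in> M \<rightarrow>\<^sub>M state_space" "\<xi> \<in> M \<rightarrow>\<^sub>M noise \<theta>'"
  shows "(\<lambda>\<omega>. daughters \<theta> \<kappa> (s \<omega>) (\<xi> \<omega>)) \<in> M \<rightarrow>\<^sub>M state_pair_space"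
  unfolding daughters_def by measurable

section \<open>Gaussian laws and the kernel as images of standard normal variables\<close>

lemma nn_integral_normal_density_affine:
  fixes f :: "real \<Rightarrow> ennreal"
  assumes s: "s > 0" and [measurable]: "f \<in> borel_measurable borel"
  shows "(\<integral>\<^sup>+y. ennreal (normal_density \<mu> s y) * f y \<partial>lborel) =
         (\<integral>\<^sup>+z. f (\<mu> + s * z) \<partial>std_normal_distribution)"
proof -
  have "(\<integral>\<^sup>+y. ennreal (normal_density \<mu> s y) * f y \<partial>lborel) =
    ennreal \<bar>s\<bar> * (\<integral>\<^sup>+z. ennreal (normal_density \<mu> s (\<mu> + s * z)) * f (\<mu> + s * z) \<partial>lborel)"
    using s by (intro nn_integral_real_affine) auto
  also have "\<dots> = (\<integral>\<^sup>+z. ennreal \<bar>s\<bar> * (ennreal (normal_density \<mu> s (\<mu> + s * z)) * f (\<mu> + s * z)) \<partial>lborel)"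
    by (rule nn_integral_cmult[symmetric]) measurable
  also have "\<dots> = (\<integral>\<^sup>+z. ennreal (std_normal_density z) * f (\<mu> + s * z) \<partial>lborel)"
  proof (intro nn_integral_cong)
    fix z
    have "\<bar>s\<bar> * normal_density \<mu> s (\<mu> + s * z) = std_normal_density z"
      using s by (simp add: normal_density_def real_sqrt_mult power_mult_distrib field_simps)
    then show "ennreal \<bar>s\<bar> * (ennreal (normal_density \<mu> s (\<mu> + s * z)) * f (\<mu> + s * z)) =
       ennreal (std_normal_density z) * f (\<mu> + s * z)"
      by (subst mult.assoc[symmetric]) (simp flip: ennreal_mult')
  qed
  also have "\<dots> = (\<integral>\<^sup>+z. f (\<mu> + s * z) \<partial>std_normal_distribution)"
    by (subst nn_integral_density) auto
  finally show ?thesis .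
qed

text \<open>Marginal density of the first coordinate times conditional density of the second: given
  \<open>x\<close>, the second coordinate is normal with mean \<open>r * x\<close> and variance
  \<open>s * s * (1 - r * r)\<close>. This is the Cholesky factorisation at the level of
  densities.\<close>

lemma bivariate_normal_density_factor:
  assumes s: "s > 0" and r: "-1 < r" "r < 1"
  shows "bivariate_normal_density (s\<^sup>2) (s\<^sup>2) (s\<^sup>2 * r) (x, y) =
     normal_density 0 s x * normal_density (r * x) (s * sqrt (1 - r\<^sup>2)) y"
proof -
  have r2: "1 - r\<^sup>2 > 0" using r by (simp add: abs_square_less_1 abs_less_iff)
  have det: "s\<^sup>2 * s\<^sup>2 - (s\<^sup>2 * r)\<^sup>2 = s\<^sup>2 * s\<^sup>2 * (1 - r\<^sup>2)"
    by (simp add: power_mult_distrib algebra_simps power2_eq_square)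
  have sq: "(s * sqrt (1 - r\<^sup>2))\<^sup>2 = s\<^sup>2 * (1 - r\<^sup>2)"
    using r2 by (simp add: power_mult_distrib)
  have e: "- (s\<^sup>2 * x\<^sup>2 - 2 * (s\<^sup>2 * r) * x * y + s\<^sup>2 * y\<^sup>2) / (2 * (s\<^sup>2 * s\<^sup>2 * (1 - r\<^sup>2))) =
     - x\<^sup>2 / (2 * s\<^sup>2) + - (y - r * x)\<^sup>2 / (2 * (s\<^sup>2 * (1 - r\<^sup>2)))"
    using s r2 by (simp add: divide_simps) (simp add: algebra_simps power2_eq_square power4_eq_xxxx)
  have c1: "sqrt (s\<^sup>2 * s\<^sup>2 * (1 - r\<^sup>2)) = s * s * sqrt (1 - r\<^sup>2)"
    using s by (subst real_sqrt_mult, subst real_sqrt_mult) simp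
  have c2: "sqrt (2 * pi * s\<^sup>2) = sqrt (2 * pi) * s" "sqrt (2 * pi * (s\<^sup>2 * (1 - r\<^sup>2))) = sqrt (2 * pi) * (s * sqrt (1 - r\<^sup>2))"
    using s by (simp_all add: real_sqrt_mult)
  have c: "1 / (2 * pi * (s * s * sqrt (1 - r\<^sup>2))) = 1 / (sqrt (2 * pi) * s) * (1 / (sqrt (2 * pi) * (s * sqrt (1 - r\<^sup>2))))"
    by simp
  show ?thesis
    unfolding bivariate_normal_density_def normal_density_def split det sq e exp_add c1 c2
    using c by (simp add: field_simps)
qed

lemma nn_integral_gauss2:
  assumes [measurable]: "f \<in> borel_measurable (borel \<Otimes>\<^sub>M borel)"
  shows "(\<integral>\<^sup>+z. f z \<partial>gauss2) = (\<integral>\<^sup>+z1. (\<integral>\<^sup>+z2. f (z1, z2) \<partial>std_normal_distribution) \<partial>std_normal_distribution)"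
proof -
  interpret prob_space std_normal_distribution by (rule prob_space_std_normal)
  show ?thesis by (intro nn_integral_fst[symmetric]) measurable
qed

text \<open>An affine substitution in the conditional density, followed by one in the marginal
  density, turns both into standard normal ones; the coefficients that appear are the entries of the
  Cholesky factor.\<close>

lemma nn_integral_bivariate_normal:
  assumes s: "s > 0" and r: "-1 < r" "r < 1" and [measurable]: "f \<in> borel_measurable (borel \<Otimes>\<^sub>M borel)"
  shows "(\<integral>\<^sup>+e. ennreal (bivariate_normal_density (s\<^sup>2) (s\<^sup>2) (s\<^sup>2 * r) e) * f e \<partial>(lborel :: (real \<times> real) measure)) =
     (\<integral>\<^sup>+z. f (s * fst z, s * r * fst z + s * sqrt (1 - r\<^sup>2) * snd z) \<partial>gauss2)" (is "?L = ?R")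
proof -
  define s' where "s' = s * sqrt (1 - r\<^sup>2)"
  have s': "s' > 0" using s r by (simp add: s'_def abs_square_less_1 abs_less_iff)
  have f': "(\<lambda>e. f e) \<in> borel_measurable (borel \<Otimes>\<^sub>M borel)" by measurable
  have d: "(\<lambda>e. ennreal (bivariate_normal_density (s\<^sup>2) (s\<^sup>2) (s\<^sup>2 * r) e)) \<in> borel_measurable (lborel \<Otimes>\<^sub>M lborel)"
    unfolding bivariate_normal_density_def split_beta' by measurable
  note [measurable] = this
  have "?L = (\<integral>\<^sup>+e. ennreal (bivariate_normal_density (s\<^sup>2) (s\<^sup>2) (s\<^sup>2 * r) e) * f e \<partial>(lborel \<Otimes>\<^sub>M lborel))"
    by (simp add: lborel_prod)
  also have "\<dots> = (\<integral>\<^sup>+x. (\<integral>\<^sup>+y. ennreal (bivariate_normal_density (s\<^sup>2) (s\<^sup>2) (s\<^sup>2 * r) (x, y)) * f (x, y) \<partial>lborel) \<partial>lborel)"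
    by (rule lborel.nn_integral_fst[symmetric]) measurable
  also have "\<dots> = (\<integral>\<^sup>+x. ennreal (normal_density 0 s x) * (\<integral>\<^sup>+y. ennreal (normal_density (r * x) s' y) * f (x, y) \<partial>lborel) \<partial>lborel)"
    by (intro nn_integral_cong, subst nn_integral_cmult[symmetric])
       (auto simp: bivariate_normal_density_factor[OF s r] ennreal_mult'' mult.assoc s'_def)
  also have "\<dots> = (\<integral>\<^sup>+x. ennreal (normal_density 0 s x) * (\<integral>\<^sup>+z2. f (x, r * x + s' * z2) \<partial>std_normal_distribution) \<partial>lborel)"
    by (intro nn_integral_cong, subst nn_integral_normal_density_affine[OF s']) auto
  also have "\<dots> = (\<integral>\<^sup>+z1. (\<integral>\<^sup>+z2. f (0 + s * z1, r * (0 + s * z1) + s' * z2) \<partial>std_normal_distribution) \<partial>std_normal_distribution)"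
  proof -
    interpret prob_space std_normal_distribution by (rule prob_space_std_normal)
    show ?thesis
      by (intro nn_integral_normal_density_affine[OF s]) measurable
  qed
  also have "\<dots> = ?R"
    by (subst nn_integral_gauss2) (auto simp: s'_def mult_ac)
  finally show ?thesis .
qed

text \<open>Each component of the mixture corresponds to one type of the noise. When a single
  daughter lives, its \<open>load2\<close> vanishes and the second normal variable integrates out.
  This links the kernel to the realisation of the daughters by innovations.\<close>

lemma emeasure_P_star:
  assumes adm: "admissible \<theta> \<kappa>" and B [measurable]: "B \<in> sets state_pair_space"
  shows "emeasure (P_star \<theta> \<kappa> s) B = (\<integral>\<^sup>+\<xi>. indicator B (daughters \<theta> \<kappa> s \<xi>) \<partial>noise \<theta>)"
proof (cases s)
  case None
  interpret prob_space "noise \<theta>" by (rule prob_space_noise)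
  show ?thesis using B emeasure_space_1 by (simp add: None law_dead_def)
next
  case (Some x)
  interpret g: prob_space gauss2 by (rule prob_space_gauss2)
  interpret g1: prob_space std_normal_distribution by (rule prob_space_std_normal)
  have adm': "\<sigma> \<kappa> > 0" "\<sigma>\<^sub>0 \<kappa> > 0" "\<sigma>\<^sub>1 \<kappa> > 0" "-1 < \<rho> \<kappa>" "\<rho> \<kappa> < 1"
    using adm by (auto simp: admissible_def)
  have [measurable]: "bivariate_normal_density a b c \<in> borel_measurable (borel \<Otimes>\<^sub>M borel)" for a b c
    unfolding bivariate_normal_density_def by measurable
  have 1: "emeasure (law_both \<theta> \<kappa> x) B = (\<integral>\<^sup>+z. indicator B (daughters \<theta> \<kappa> (Some x) ((True, True), z)) \<partial>gauss2)"
  proof -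
    have m: "(\<lambda>(\<epsilon>\<^sub>0, \<epsilon>\<^sub>1). (Some (\<alpha>\<^sub>0 \<theta> * x + \<beta>\<^sub>0 \<theta> + \<epsilon>\<^sub>0), Some (\<alpha>\<^sub>1 \<theta> * x + \<beta>\<^sub>1 \<theta> + \<epsilon>\<^sub>1))) \<in> borel \<Otimes>\<^sub>M borel \<rightarrow>\<^sub>M state_pair_space" (is "?F \<in> _")
      by measurable
    have "emeasure (law_both \<theta> \<kappa> x) B = (\<integral>\<^sup>+e. indicator B e \<partial>law_both \<theta> \<kappa> x)"
      by simp
    also have "\<dots> = (\<integral>\<^sup>+e. indicator B (?F e) \<partial>(density (lborel :: (real \<times> real) measure)
             (bivariate_normal_density ((\<sigma> \<kappa>)\<^sup>2) ((\<sigma> \<kappa>)\<^sup>2) ((\<sigma> \<kappa>)\<^sup>2 * \<rho> \<kappa>))))"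
      unfolding law_both_def using m[unfolded borel_prod]
      by (intro nn_integral_distr) (auto cong: measurable_cong_sets)
    also have "\<dots> = (\<integral>\<^sup>+e. ennreal (bivariate_normal_density ((\<sigma> \<kappa>)\<^sup>2) ((\<sigma> \<kappa>)\<^sup>2) ((\<sigma> \<kappa>)\<^sup>2 * \<rho> \<kappa>) e) * indicator B (?F e) \<partial>(lborel :: (real \<times> real) measure))"
      using m by (intro nn_integral_density) (auto simp: borel_prod[symmetric])
    also have "\<dots> = (\<integral>\<^sup>+z. indicator B (?F (\<sigma> \<kappa> * fst z, \<sigma> \<kappa> * \<rho> \<kappa> * fst z + \<sigma> \<kappa> * sqrt (1 - (\<rho> \<kappa>)\<^sup>2) * snd z)) \<partial>gauss2)"
      using m by (intro nn_integral_bivariate_normal adm') measurable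
    also have "\<dots> = (\<integral>\<^sup>+z. indicator B (daughters \<theta> \<kappa> (Some x) ((True, True), z)) \<partial>gauss2)"
      by (simp add: daughters_def daughter_def slope_def icpt_def load1_def load2_def)
    finally show ?thesis .
  qed
  have 2: "emeasure (law_only0 \<theta> \<kappa> x) B = (\<integral>\<^sup>+z. indicator B (daughters \<theta> \<kappa> (Some x) ((True, False), z)) \<partial>gauss2)"
  proof -
    have "emeasure (law_only0 \<theta> \<kappa> x) B = (\<integral>\<^sup>+e. indicator B e \<partial>law_only0 \<theta> \<kappa> x)"
      by simp
    also have "\<dots> = (\<integral>\<^sup>+e. ennreal (normal_density 0 (\<sigma>\<^sub>0 \<kappa>) e) * indicator B (Some (\<alpha>'\<^sub>0 \<theta> * x + \<beta>'\<^sub>0 \<theta> + e), None) \<partial>lborel)"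
      unfolding law_only0_def by (subst nn_integral_distr, simp, simp, subst nn_integral_density) simp_all
    also have "\<dots> = (\<integral>\<^sup>+z. indicator B (Some (\<alpha>'\<^sub>0 \<theta> * x + \<beta>'\<^sub>0 \<theta> + (0 + \<sigma>\<^sub>0 \<kappa> * z)), None) \<partial>std_normal_distribution)"
      by (intro nn_integral_normal_density_affine adm') measurable
    also have "\<dots> = (\<integral>\<^sup>+z. indicator B (daughters \<theta> \<kappa> (Some x) ((True, False), z)) \<partial>gauss2)"
      by (subst nn_integral_gauss2)
         (auto simp: daughters_def daughter_def slope_def icpt_def load1_def load2_def g1.emeasure_space_1[simplified])
    finally show ?thesis .
  qed
  have 3: "emeasure (law_only1 \<theta> \<kappa> x) B = (\<integral>\<^sup>+z. indicator B (daughters \<theta> \<kappa> (Some x) ((False, True), z)) \<partial>gauss2)"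
  proof -
    have "emeasure (law_only1 \<theta> \<kappa> x) B = (\<integral>\<^sup>+e. indicator B e \<partial>law_only1 \<theta> \<kappa> x)"
      by simp
    also have "\<dots> = (\<integral>\<^sup>+e. ennreal (normal_density 0 (\<sigma>\<^sub>1 \<kappa>) e) * indicator B (None, Some (\<alpha>'\<^sub>1 \<theta> * x + \<beta>'\<^sub>1 \<theta> + e)) \<partial>lborel)"
      unfolding law_only1_def by (subst nn_integral_distr, simp, simp, subst nn_integral_density) simp_all
    also have "\<dots> = (\<integral>\<^sup>+z. indicator B (None, Some (\<alpha>'\<^sub>1 \<theta> * x + \<beta>'\<^sub>1 \<theta> + (0 + \<sigma>\<^sub>1 \<kappa> * z))) \<partial>std_normal_distribution)"
      by (intro nn_integral_normal_density_affine adm') measurable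
    also have "\<dots> = (\<integral>\<^sup>+z. indicator B (daughters \<theta> \<kappa> (Some x) ((False, True), z)) \<partial>gauss2)"
      by (subst nn_integral_gauss2)
         (auto simp: daughters_def daughter_def slope_def icpt_def load1_def load2_def g1.emeasure_space_1[simplified])
    finally show ?thesis .
  qed
  have 4: "emeasure law_dead B = (\<integral>\<^sup>+z. indicator B (daughters \<theta> \<kappa> (Some x) ((False, False), z)) \<partial>gauss2)"
    using B g.emeasure_space_1 by (simp add: daughters_def daughter_def law_dead_def)
  show ?thesis
    unfolding Some emeasure_P_star_Some[OF B]
    by (subst nn_integral_noise[OF adm]) (auto simp: 1 2 3 4 UNIV_types type_prob_def add_ac)
qed

section \<open>The next generation given the past\<close>

lemma finite_generation [simp]: "finite (generation k)"
  using finite_lists_length_eq[of "UNIV :: bool set" k] by (simp add: generation_def)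

lemma tree_upto_iff: "i \<in> tree_upto n \<longleftrightarrow> length i \<le> n"
  by (auto simp: tree_upto_def generation_def)

lemma finite_tree_upto [simp]: "finite (tree_upto n)"
  by (simp add: tree_upto_def)

lemma daughter_in_generation [simp]: "i @ [\<delta>] \<in> generation (Suc k) \<longleftrightarrow> i \<in> generation k"
  by (auto simp: generation_def)

context bifurcating_ar
begin

declare X_measurable [measurable]

abbreviation F :: "nat \<Rightarrow> 'a measure" where
  "F k \<equiv> past M X k"

definition ch :: "node \<Rightarrow> 'a \<Rightarrow> real option \<times> real option" where
  "ch i \<omega> = (X (i @ [False]) \<omega>, X (i @ [True]) \<omega>)"

lemma measurable_ch [measurable]: "ch i \<in> M \<rightarrow>\<^sub>M state_pair_space"
  unfolding ch_def by measurable

lemma space_F [simp]: "space (F k) = space M"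
  by (simp add: past_def)

lemma space_in_F: "space M \<in> sets (F k)"
  by (metis sets.top space_F)

lemma measurable_X_F: "length j \<le> k \<Longrightarrow> X j \<in> F k \<rightarrow>\<^sub>M state_space"
proof -
  assume j: "length j \<le> k"
  have 1: "(\<lambda>\<omega>. \<lambda>j\<in>tree_upto k. X j \<omega>) \<in> F k \<rightarrow>\<^sub>M (\<Pi>\<^sub>M j\<in>tree_upto k. state_space)"
    unfolding past_def by (rule measurable_vimage_algebra1) (auto simp: space_PiM)
  have 2: "(\<lambda>f. f j) \<in> (\<Pi>\<^sub>M j\<in>tree_upto k. state_space) \<rightarrow>\<^sub>M state_space"
    using j by (intro measurable_component_singleton) (simp add: tree_upto_iff)
  show ?thesis
    using measurable_compose[OF 1 2] j by (simp add: tree_upto_iff)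
qed

lemma subalgebra_F: "subalgebra M (F k)"
proof -
  have "(\<lambda>\<omega>. \<lambda>j\<in>tree_upto k. X j \<omega>) \<in> M \<rightarrow>\<^sub>M (\<Pi>\<^sub>M j\<in>tree_upto k. state_space)"
    by measurable
  then show ?thesis
    unfolding subalgebra_def past_def
    by (auto simp: sets_vimage_algebra2 space_PiM intro!: measurable_sets)
qed

lemma measurable_from_F: "f \<in> F k \<rightarrow>\<^sub>M N \<Longrightarrow> f \<in> M \<rightarrow>\<^sub>M N"
  using measurable_from_subalg[OF subalgebra_F] .

lemma measurable_id_F: "(\<lambda>\<omega>. \<omega>) \<in> M \<rightarrow>\<^sub>M F k"
  by (rule measurable_from_F[OF measurable_ident_sets[OF refl]])

sublocale noise: prob_space "noise \<theta>"
  by (rule prob_space_noise)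

lemma emeasure_P_star':
  assumes B: "B \<in> sets state_pair_space"
  shows "ennreal (measure (P_star \<theta> \<kappa> s) B) = (\<integral>\<^sup>+\<xi>. indicator B (daughters \<theta> \<kappa> s \<xi>) \<partial>noise \<theta>)"
proof -
  have "(\<integral>\<^sup>+\<xi>. indicator B (daughters \<theta> \<kappa> s \<xi>) \<partial>noise \<theta>) \<le> (\<integral>\<^sup>+\<xi>. 1 \<partial>noise \<theta>)"
    by (intro nn_integral_mono) (auto simp: indicator_def)
  also have "\<dots> = 1" using noise.emeasure_space_1 by simp
  finally show ?thesis
    unfolding measure_def emeasure_P_star[OF admissible B]
    by (subst ennreal_enn2real) (auto simp: le_less_trans[OF _ ennreal_one_less_top])
qed

abbreviation noises :: "nat \<Rightarrow> (node \<Rightarrow> (bool \<times> bool) \<times> real \<times> real) measure" where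
  "noises k \<equiv> \<Pi>\<^sub>M i\<in>generation k. noise \<theta>"

abbreviation pairs :: "nat \<Rightarrow> (node \<Rightarrow> real option \<times> real option) measure" where
  "pairs k \<equiv> \<Pi>\<^sub>M i\<in>generation k. state_pair_space"

lemma prob_space_noises: "prob_space (noises k)"
  by (intro prob_space_PiM prob_space_noise)

text \<open>The conditional law of the process, integrated over an event \<open>A\<close> of the
  past. The assumption speaks of real conditional expectations, while the innovations enter through
  nonnegative integrals; the finite measure allows the passage between the two.\<close>

lemma rectangle_law:
  assumes A: "A \<in> sets (F k)" and B: "\<And>i. i \<in> generation k \<Longrightarrow> B i \<in> sets state_pair_space"
  shows "emeasure M {\<omega> \<in> space M. \<omega> \<in> A \<and> (\<forall>i\<in>generation k. ch i \<omega> \<in> B i)} =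
    (\<integral>\<^sup>+\<omega>. indicator A \<omega> * (\<Prod>i\<in>generation k. \<integral>\<^sup>+\<xi>. indicator (B i) (daughters \<theta> \<kappa> (X i \<omega>) \<xi>) \<partial>noise \<theta>) \<partial>M)"
proof -
  interpret finite_measure_subalgebra M "F k"
    by standard (rule subalgebra_F)
  have AM [measurable]: "A \<in> sets M" using A subalgebra_F by (auto simp: subalgebra_def)
  define C where "C = {\<omega> \<in> space M. \<forall>i\<in>generation k. ch i \<omega> \<in> B i}"
  have [measurable]: "C \<in> sets M"
    unfolding C_def
  proof (intro sets.sets_Collect_finite_All finite_generation)
    fix i assume "i \<in> generation k"
    note B[OF this, measurable]
    show "{\<omega> \<in> space M. ch i \<omega> \<in> B i} \<in> sets M" by measurable
  qed
  define p where "p \<omega> = (\<Prod>i\<in>generation k. measure (P_star \<theta> \<kappa> (X i \<omega>)) (B i))" for \<omega>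
  have p_eq: "ennreal (p \<omega>) = (\<Prod>i\<in>generation k. \<integral>\<^sup>+\<xi>. indicator (B i) (daughters \<theta> \<kappa> (X i \<omega>) \<xi>) \<partial>noise \<theta>)" for \<omega>
    unfolding p_def using B by (simp add: prod_ennreal[symmetric] emeasure_P_star')
  have p0: "p \<omega> \<ge> 0" for \<omega> by (simp add: p_def prod_nonneg)
  have "(\<lambda>\<omega>. ennreal (p \<omega>)) \<in> borel_measurable M"
    unfolding p_eq
  proof (intro borel_measurable_prod_ennreal)
    fix i assume "i \<in> generation k"
    note B[OF this, measurable]
    show "(\<lambda>\<omega>. \<integral>\<^sup>+\<xi>. indicator (B i) (daughters \<theta> \<kappa> (X i \<omega>) \<xi>) \<partial>noise \<theta>) \<in> borel_measurable M"
      by measurable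
  qed
  from borel_measurable_enn2real[OF this] have pm [measurable]: "p \<in> borel_measurable M"
    using p0 by simp
  have ae: "AE \<omega> in M. real_cond_exp M (F k) (indicator C) \<omega> = p \<omega>"
    using transition[OF B] unfolding C_def p_def ch_def by simp
  have int: "integrable M (indicator C :: _ \<Rightarrow> real)"
    by (intro integrable_real_indicator) (auto simp: less_top[symmetric])
  have "measure M (A \<inter> C) = (\<integral>\<omega>. indicator A \<omega> * indicator C \<omega> \<partial>M)"
    by (simp add: indicator_inter_arith[symmetric])
  also have "\<dots> = (\<integral>\<omega>. indicator A \<omega> * real_cond_exp M (F k) (indicator C) \<omega> \<partial>M)"
    using real_cond_exp_intA[OF int A] by (simp add: set_lebesgue_integral_def)
  also have "\<dots> = (\<integral>\<omega>. indicator A \<omega> * p \<omega> \<partial>M)"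
    using ae by (intro integral_cong_AE) auto
  finally have eq: "measure M (A \<inter> C) = (\<integral>\<omega>. indicator A \<omega> * p \<omega> \<partial>M)" .
  have "integrable M (\<lambda>\<omega>. indicator A \<omega> * real_cond_exp M (F k) (indicator C) \<omega>)"
    using integrable_mult_indicator[OF AM real_cond_exp_int(1)[OF int]] by simp
  then have "integrable M (\<lambda>\<omega>. indicator A \<omega> * p \<omega>)"
    by (rule integrable_cong_AE_imp) (use ae in auto)
  then have "(\<integral>\<^sup>+\<omega>. ennreal (indicator A \<omega> * p \<omega>) \<partial>M) = ennreal (measure M (A \<inter> C))"
    unfolding eq by (intro nn_integral_eq_integral) (auto simp: p0)
  moreover have "{\<omega> \<in> space M. \<omega> \<in> A \<and> (\<forall>i\<in>generation k. ch i \<omega> \<in> B i)} = A \<inter> C"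
    using sets.sets_into_space[OF AM] by (auto simp: C_def)
  ultimately show ?thesis
    by (simp add: emeasure_eq_measure ennreal_mult' p_eq ennreal_indicator)
qed

lemma measurable_joint_daughters [measurable]:
  "(\<lambda>(\<omega>, \<xi>). \<lambda>i\<in>generation k. daughters \<theta> \<kappa> (X i \<omega>) (\<xi> i)) \<in> M \<Otimes>\<^sub>M noises k \<rightarrow>\<^sub>M pairs k"
  unfolding split_beta' by (intro measurable_restrict) measurable

lemma measurable_joint_ch [measurable]:
  "(\<lambda>\<omega>. \<lambda>i\<in>generation k. ch i \<omega>) \<in> M \<rightarrow>\<^sub>M pairs k"
  by (intro measurable_restrict) measurable

text \<open>Products of a past event with a rectangle form an intersection-stable generator, and on
  these both laws are known. The first component carries the sigma-algebra of the past and not that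
  of \<open>M\<close>: the fresh innovations reproduce the next generation jointly with the past
  only.\<close>

lemma joint_law:
  "distr M (F k \<Otimes>\<^sub>M pairs k) (\<lambda>\<omega>. (\<omega>, \<lambda>i\<in>generation k. ch i \<omega>)) =
   distr (M \<Otimes>\<^sub>M noises k) (F k \<Otimes>\<^sub>M pairs k)
     (\<lambda>(\<omega>, \<xi>). (\<omega>, \<lambda>i\<in>generation k. daughters \<theta> \<kappa> (X i \<omega>) (\<xi> i)))" (is "?L = ?R")
proof -
  interpret N: prob_space "noises k" by (rule prob_space_noises)
  interpret P: product_prob_space "\<lambda>i. noise \<theta>" "generation k" by standard
  define E where "E = {A \<times> (\<Pi>\<^sub>E i\<in>generation k. B i) | A B. A \<in> sets (F k) \<and> B \<in> generation k \<rightarrow> sets state_pair_space}"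
  define \<Omega> where "\<Omega> = space M \<times> (\<Pi>\<^sub>E i\<in>generation k. (UNIV :: (real option \<times> real option) set))"
  have f1: "(\<lambda>\<omega>. (\<omega>, \<lambda>i\<in>generation k. ch i \<omega>)) \<in> M \<rightarrow>\<^sub>M F k \<Otimes>\<^sub>M pairs k"
    by (intro measurable_Pair measurable_id_F measurable_joint_ch)
  have f2: "(\<lambda>(\<omega>, \<xi>). (\<omega>, \<lambda>i\<in>generation k. daughters \<theta> \<kappa> (X i \<omega>) (\<xi> i))) \<in> M \<Otimes>\<^sub>M noises k \<rightarrow>\<^sub>M F k \<Otimes>\<^sub>M pairs k"
    using measurable_joint_daughters unfolding split_beta'
    by (intro measurable_Pair measurable_compose[OF measurable_fst measurable_id_F])
  have spp: "space state_pair_space = UNIV" by (simp add: space_pair_measure)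
  have gen: "sets (F k \<Otimes>\<^sub>M pairs k) = sigma_sets \<Omega> E"
  proof -
    have "sets (F k \<Otimes>\<^sub>M pairs k) = sets (sigma (space (F k) \<times> space (pairs k))
       {a \<times> b | a b. a \<in> sets (F k) \<and> b \<in> prod_algebra (generation k) (\<lambda>_. state_pair_space)})"
    proof (rule sets_pair_eq)
      show "sets (F k) = sigma_sets (space (F k)) (sets (F k))" using sets.sigma_sets_eq[of "F k"] by simp
      show "sets (pairs k) = sigma_sets (space (pairs k)) (prod_algebra (generation k) (\<lambda>_. state_pair_space))"
        by (simp add: sets_PiM space_PiM)
      show "prod_algebra (generation k) (\<lambda>_. state_pair_space) \<subseteq> Pow (space (pairs k))"
        using prod_algebra_sets_into_space by (simp add: space_PiM)
      show "{space (F k)} \<subseteq> sets (F k)" using space_in_F[of k] by simp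
      have "space (pairs k) \<in> prod_algebra (generation k) (\<lambda>_. state_pair_space)"
        by (auto simp: prod_algebra_eq_finite space_PiM)
      then show "{space (pairs k)} \<subseteq> prod_algebra (generation k) (\<lambda>_. state_pair_space)" by simp
    qed (use sets.sets_into_space[of _ "F k"] in auto)
    also have "{a \<times> b | a b. a \<in> sets (F k) \<and> b \<in> prod_algebra (generation k) (\<lambda>_. state_pair_space)} = E"
      unfolding E_def by (auto simp: prod_algebra_eq_finite)
    also have "space (F k) \<times> space (pairs k) = \<Omega>"
      by (simp add: \<Omega>_def space_PiM spp)
    also have "sets (sigma \<Omega> E) = sigma_sets \<Omega> E"
    proof (rule sets_measure_of)
      show "E \<subseteq> Pow \<Omega>"
        unfolding E_def \<Omega>_def using sets.sets_into_space[of _ "F k"] by fastforce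
    qed
    finally show ?thesis .
  qed
  show ?thesis
  proof (rule measure_eqI_generator_eq[of E \<Omega> _ _ "\<lambda>_. \<Omega>"])
    show "Int_stable E"
    proof (rule Int_stableI)
      fix a b assume "a \<in> E" "b \<in> E"
      then obtain A B A' B' where "a = A \<times> (\<Pi>\<^sub>E i\<in>generation k. B i)" "b = A' \<times> (\<Pi>\<^sub>E i\<in>generation k. B' i)"
        and m: "A \<in> sets (F k)" "A' \<in> sets (F k)"
          "B \<in> generation k \<rightarrow> sets state_pair_space" "B' \<in> generation k \<rightarrow> sets state_pair_space"
        unfolding E_def by blast
      then have "a \<inter> b = (A \<inter> A') \<times> (\<Pi>\<^sub>E i\<in>generation k. B i \<inter> B' i)"
        by (simp add: Times_Int_Times PiE_Int)
      moreover have "(\<lambda>i. B i \<inter> B' i) \<in> generation k \<rightarrow> sets state_pair_space" using m by auto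
      ultimately show "a \<inter> b \<in> E" unfolding E_def using m by blast
    qed
    show "E \<subseteq> Pow \<Omega>"
      unfolding E_def \<Omega>_def using sets.sets_into_space[of _ "F k"] by fastforce
    show "sets ?L = sigma_sets \<Omega> E" "sets ?R = sigma_sets \<Omega> E" by (simp_all add: gen)
    have "\<Omega> = space M \<times> (\<Pi>\<^sub>E i\<in>generation k. (\<lambda>_. UNIV) i)" by (simp add: \<Omega>_def)
    moreover have "(\<lambda>_. UNIV) \<in> generation k \<rightarrow> sets state_pair_space" using sets.top[of state_pair_space] spp by auto
    moreover note space_in_F
    ultimately show "range (\<lambda>_::nat. \<Omega>) \<subseteq> E" unfolding E_def by blast
    show "emeasure ?L \<Omega> \<noteq> \<infinity>" for i :: nat
    proof -
      interpret L: prob_space ?L by (rule prob_space_distr[OF f1])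
      show ?thesis by simp
    qed
  next
    fix Y assume "Y \<in> E"
    then obtain A B where Y: "Y = A \<times> (\<Pi>\<^sub>E i\<in>generation k. B i)" and A: "A \<in> sets (F k)"
      and B: "\<And>i. i \<in> generation k \<Longrightarrow> B i \<in> sets state_pair_space"
      unfolding E_def by blast
    have AM [measurable]: "A \<in> sets M" using A subalgebra_F by (auto simp: subalgebra_def)
    have Y_m: "Y \<in> sets (F k \<Otimes>\<^sub>M pairs k)"
      unfolding Y using A B by (intro pair_measureI sets_PiM_I_finite) auto
    have "emeasure ?L Y = emeasure M {\<omega> \<in> space M. \<omega> \<in> A \<and> (\<forall>i\<in>generation k. ch i \<omega> \<in> B i)}"
      by (subst emeasure_distr[OF f1 Y_m]) (auto simp: Y intro!: arg_cong[where f="emeasure M"])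
    also have "\<dots> = (\<integral>\<^sup>+\<omega>. indicator A \<omega> * (\<Prod>i\<in>generation k. \<integral>\<^sup>+\<xi>. indicator (B i) (daughters \<theta> \<kappa> (X i \<omega>) \<xi>) \<partial>noise \<theta>) \<partial>M)"
      by (rule rectangle_law[OF A B])
    also have "\<dots> = (\<integral>\<^sup>+\<omega>. (\<integral>\<^sup>+\<xi>. indicator Y (\<omega>, \<lambda>i\<in>generation k. daughters \<theta> \<kappa> (X i \<omega>) (\<xi> i)) \<partial>noises k) \<partial>M)"
    proof (intro nn_integral_cong)
      fix \<omega> assume \<omega> [measurable]: "\<omega> \<in> space M"
      have "(\<integral>\<^sup>+\<xi>. indicator Y (\<omega>, \<lambda>i\<in>generation k. daughters \<theta> \<kappa> (X i \<omega>) (\<xi> i)) \<partial>noises k) =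
        (\<integral>\<^sup>+\<xi>. indicator A \<omega> * (\<Prod>i\<in>generation k. indicator (B i) (daughters \<theta> \<kappa> (X i \<omega>) (\<xi> i))) \<partial>noises k)"
      proof (intro nn_integral_cong)
        fix \<xi> :: "node \<Rightarrow> (bool \<times> bool) \<times> real \<times> real"
        have "(\<Prod>i\<in>generation k. indicator (B i) (daughters \<theta> \<kappa> (X i \<omega>) (\<xi> i))) =
          (indicator {\<xi>. \<forall>i\<in>generation k. daughters \<theta> \<kappa> (X i \<omega>) (\<xi> i) \<in> B i} \<xi> :: ennreal)"
          by (auto simp: indicator_def intro!: prod.neutral)
        then show "indicator Y (\<omega>, \<lambda>i\<in>generation k. daughters \<theta> \<kappa> (X i \<omega>) (\<xi> i)) =
          indicator A \<omega> * (\<Prod>i\<in>generation k. indicator (B i) (daughters \<theta> \<kappa> (X i \<omega>) (\<xi> i)) :: ennreal)"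
          by (auto simp: Y indicator_def PiE_iff)
      qed
      also have "\<dots> = indicator A \<omega> * (\<integral>\<^sup>+\<xi>. (\<Prod>i\<in>generation k. indicator (B i) (daughters \<theta> \<kappa> (X i \<omega>) (\<xi> i))) \<partial>noises k)"
      proof (rule nn_integral_cmult, intro borel_measurable_prod_ennreal)
        fix i assume i: "i \<in> generation k"
        note B[OF i, measurable]
        show "(\<lambda>\<xi>. indicator (B i) (daughters \<theta> \<kappa> (X i \<omega>) (\<xi> i)) :: ennreal) \<in> borel_measurable (noises k)"
          using i by measurable
      qed
      also have "(\<integral>\<^sup>+\<xi>. (\<Prod>i\<in>generation k. indicator (B i) (daughters \<theta> \<kappa> (X i \<omega>) (\<xi> i))) \<partial>noises k) =
        (\<Prod>i\<in>generation k. \<integral>\<^sup>+\<xi>. indicator (B i) (daughters \<theta> \<kappa> (X i \<omega>) \<xi>) \<partial>noise \<theta>)"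
      proof (rule P.product_nn_integral_prod[OF finite_generation])
        fix i assume i: "i \<in> generation k"
        note B[OF i, measurable]
        show "(\<lambda>\<xi>. indicator (B i) (daughters \<theta> \<kappa> (X i \<omega>) \<xi>)) \<in> borel_measurable (noise \<theta>)"
          by measurable
      qed
      finally show "indicator A \<omega> * (\<Prod>i\<in>generation k. \<integral>\<^sup>+\<xi>. indicator (B i) (daughters \<theta> \<kappa> (X i \<omega>) \<xi>) \<partial>noise \<theta>) =
        (\<integral>\<^sup>+\<xi>. indicator Y (\<omega>, \<lambda>i\<in>generation k. daughters \<theta> \<kappa> (X i \<omega>) (\<xi> i)) \<partial>noises k)" ..
    qed
    also have "\<dots> = (\<integral>\<^sup>+p. indicator Y ((\<lambda>(\<omega>, \<xi>). (\<omega>, \<lambda>i\<in>generation k. daughters \<theta> \<kappa> (X i \<omega>) (\<xi> i))) p) \<partial>(M \<Otimes>\<^sub>M noises k))"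
      using measurable_compose[OF f2 borel_measurable_indicator[OF Y_m]]
      by (subst N.nn_integral_fst[symmetric]) auto
    also have "\<dots> = emeasure ?R Y"
      using f2 Y_m by (subst nn_integral_distr[symmetric, where f="indicator Y"]) auto
    finally show "emeasure ?L Y = emeasure ?R Y" .
  qed (simp add: \<Omega>_def)
qed

text \<open>On the right the outer variable fixes the past and the inner integral is over
  independent innovations, so that any function of the past and the next generation is treated cell
  by cell.\<close>

lemma nn_integral_step:
  assumes H: "H \<in> borel_measurable (F k \<Otimes>\<^sub>M pairs k)"
  shows "(\<integral>\<^sup>+\<omega>. H (\<omega>, \<lambda>i\<in>generation k. ch i \<omega>) \<partial>M) =
    (\<integral>\<^sup>+\<omega>. (\<integral>\<^sup>+\<xi>. H (\<omega>, \<lambda>i\<in>generation k. daughters \<theta> \<kappa> (X i \<omega>) (\<xi> i)) \<partial>noises k) \<partial>M)"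
proof -
  interpret N: prob_space "noises k" by (rule prob_space_noises)
  have f1: "(\<lambda>\<omega>. (\<omega>, \<lambda>i\<in>generation k. ch i \<omega>)) \<in> M \<rightarrow>\<^sub>M F k \<Otimes>\<^sub>M pairs k"
    by (intro measurable_Pair measurable_id_F measurable_joint_ch)
  have f2: "(\<lambda>(\<omega>, \<xi>). (\<omega>, \<lambda>i\<in>generation k. daughters \<theta> \<kappa> (X i \<omega>) (\<xi> i))) \<in> M \<Otimes>\<^sub>M noises k \<rightarrow>\<^sub>M F k \<Otimes>\<^sub>M pairs k"
    using measurable_joint_daughters unfolding split_beta'
    by (intro measurable_Pair measurable_compose[OF measurable_fst measurable_id_F])
  have "(\<integral>\<^sup>+\<omega>. H (\<omega>, \<lambda>i\<in>generation k. ch i \<omega>) \<partial>M) =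
    integral\<^sup>N (distr M (F k \<Otimes>\<^sub>M pairs k) (\<lambda>\<omega>. (\<omega>, \<lambda>i\<in>generation k. ch i \<omega>))) H"
    using f1 H by (simp add: nn_integral_distr)
  also have "\<dots> = (\<integral>\<^sup>+p. H ((\<lambda>(\<omega>, \<xi>). (\<omega>, \<lambda>i\<in>generation k. daughters \<theta> \<kappa> (X i \<omega>) (\<xi> i))) p) \<partial>(M \<Otimes>\<^sub>M noises k))"
    unfolding joint_law using f2 H by (simp add: nn_integral_distr)
  also have "\<dots> = (\<integral>\<^sup>+\<omega>. (\<integral>\<^sup>+\<xi>. H (\<omega>, \<lambda>i\<in>generation k. daughters \<theta> \<kappa> (X i \<omega>) (\<xi> i)) \<partial>noises k) \<partial>M)"
    using measurable_compose[OF f2 H] by (subst N.nn_integral_fst[symmetric]) auto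
  finally show ?thesis .
qed

lemma nn_integral_step1:
  assumes i: "i \<in> generation k" and g [measurable]: "g \<in> borel_measurable (state_space \<Otimes>\<^sub>M state_pair_space)"
  shows "(\<integral>\<^sup>+\<omega>. g (X i \<omega>, ch i \<omega>) \<partial>M) = (\<integral>\<^sup>+\<omega>. (\<integral>\<^sup>+\<xi>. g (X i \<omega>, daughters \<theta> \<kappa> (X i \<omega>) \<xi>) \<partial>noise \<theta>) \<partial>M)"
proof -
  interpret P: product_prob_space "\<lambda>i. noise \<theta>" "generation k" by standard
  define H where "H = (\<lambda>p. g (X i (fst p), snd p i))"
  have [measurable]: "X i \<in> F k \<rightarrow>\<^sub>M state_space" using i by (intro measurable_X_F) (simp add: generation_def)
  have H: "H \<in> borel_measurable (F k \<Otimes>\<^sub>M pairs k)"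
    unfolding H_def using i by measurable
  have "(\<integral>\<^sup>+\<omega>. g (X i \<omega>, ch i \<omega>) \<partial>M) = (\<integral>\<^sup>+\<omega>. (\<integral>\<^sup>+\<xi>. g (X i \<omega>, daughters \<theta> \<kappa> (X i \<omega>) (\<xi> i)) \<partial>noises k) \<partial>M)"
    using nn_integral_step[OF H] i by (simp add: H_def)
  also have "\<dots> = (\<integral>\<^sup>+\<omega>. (\<integral>\<^sup>+\<xi>. g (X i \<omega>, daughters \<theta> \<kappa> (X i \<omega>) \<xi>) \<partial>noise \<theta>) \<partial>M)"
  proof (intro nn_integral_cong)
    fix \<omega> assume [measurable]: "\<omega> \<in> space M"
    have "(\<integral>\<^sup>+\<xi>. g (X i \<omega>, daughters \<theta> \<kappa> (X i \<omega>) \<xi>) \<partial>(distr (noises k) (noise \<theta>) (\<lambda>\<xi>. \<xi> i))) =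
      (\<integral>\<^sup>+\<xi>. g (X i \<omega>, daughters \<theta> \<kappa> (X i \<omega>) (\<xi> i)) \<partial>noises k)"
      using i by (intro nn_integral_distr) measurable
    then show "(\<integral>\<^sup>+\<xi>. g (X i \<omega>, daughters \<theta> \<kappa> (X i \<omega>) (\<xi> i)) \<partial>noises k) =
       (\<integral>\<^sup>+\<xi>. g (X i \<omega>, daughters \<theta> \<kappa> (X i \<omega>) \<xi>) \<partial>noise \<theta>)"
      by (simp add: P.PiM_component[OF i])
  qed
  finally show ?thesis .
qed

text \<open>With one factor per cell, independence of the innovations turns the inner integral into
  a product of integrals over a single cell. It serves three kinds of factors: equal to 1 except at
  two cells (variances), powers of a number (generating functions), and compensated complex
  exponentials (the martingale).\<close>

lemma integral_step_prod:
  fixes g :: "node \<Rightarrow> 'a \<Rightarrow> real option \<times> real option \<Rightarrow> 'b :: {real_normed_field, banach, second_countable_topology}"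
  assumes Y: "Y \<in> borel_measurable (F k)"
    and g: "\<And>i. i \<in> generation k \<Longrightarrow> (\<lambda>(\<omega>, y). g i \<omega> y) \<in> borel_measurable (F k \<Otimes>\<^sub>M state_pair_space)"
    and int: "integrable M (\<lambda>\<omega>. Y \<omega> * (\<Prod>i\<in>generation k. g i \<omega> (ch i \<omega>)))"
    and int1: "\<And>i \<omega>. i \<in> generation k \<Longrightarrow> \<omega> \<in> space M \<Longrightarrow> integrable (noise \<theta>) (\<lambda>\<xi>. g i \<omega> (daughters \<theta> \<kappa> (X i \<omega>) \<xi>))"
  shows "(\<integral>\<omega>. Y \<omega> * (\<Prod>i\<in>generation k. g i \<omega> (ch i \<omega>)) \<partial>M) =
    (\<integral>\<omega>. Y \<omega> * (\<Prod>i\<in>generation k. \<integral>\<xi>. g i \<omega> (daughters \<theta> \<kappa> (X i \<omega>) \<xi>) \<partial>noise \<theta>) \<partial>M)"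
proof -
  interpret N: prob_space "noises k" by (rule prob_space_noises)
  interpret MN: pair_prob_space M "noises k" ..
  interpret P: product_prob_space "\<lambda>i. noise \<theta>" "generation k" by standard
  define H where "H = (\<lambda>p. Y (fst p) * (\<Prod>i\<in>generation k. g i (fst p) (snd p i)))"
  have H: "H \<in> borel_measurable (F k \<Otimes>\<^sub>M pairs k)"
    unfolding H_def
  proof (intro borel_measurable_times borel_measurable_prod measurable_compose[OF measurable_fst Y])
    fix i assume i: "i \<in> generation k"
    have "(\<lambda>p. (fst p, snd p i)) \<in> F k \<Otimes>\<^sub>M pairs k \<rightarrow>\<^sub>M F k \<Otimes>\<^sub>M state_pair_space"
      using i by measurable
    from measurable_compose[OF this g[OF i]] show "(\<lambda>p. g i (fst p) (snd p i)) \<in> borel_measurable (F k \<Otimes>\<^sub>M pairs k)"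
      by simp
  qed
  have f1: "(\<lambda>\<omega>. (\<omega>, \<lambda>i\<in>generation k. ch i \<omega>)) \<in> M \<rightarrow>\<^sub>M F k \<Otimes>\<^sub>M pairs k"
    by (intro measurable_Pair measurable_id_F measurable_joint_ch)
  have f2: "(\<lambda>(\<omega>, \<xi>). (\<omega>, \<lambda>i\<in>generation k. daughters \<theta> \<kappa> (X i \<omega>) (\<xi> i))) \<in> M \<Otimes>\<^sub>M noises k \<rightarrow>\<^sub>M F k \<Otimes>\<^sub>M pairs k"
    using measurable_joint_daughters unfolding split_beta'
    by (intro measurable_Pair measurable_compose[OF measurable_fst measurable_id_F])
  have Heq: "H (\<omega>, \<lambda>i\<in>generation k. ch i \<omega>) = Y \<omega> * (\<Prod>i\<in>generation k. g i \<omega> (ch i \<omega>))" for \<omega>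
    by (simp add: H_def)
  have "integrable (distr M (F k \<Otimes>\<^sub>M pairs k) (\<lambda>\<omega>. (\<omega>, \<lambda>i\<in>generation k. ch i \<omega>))) H"
    using int by (subst integrable_distr_eq[OF f1 H]) (simp add: Heq)
  then have i2: "integrable (M \<Otimes>\<^sub>M noises k) (\<lambda>p. H ((\<lambda>(\<omega>, \<xi>). (\<omega>, \<lambda>i\<in>generation k. daughters \<theta> \<kappa> (X i \<omega>) (\<xi> i))) p))"
    unfolding joint_law by (subst (asm) integrable_distr_eq[OF f2 H])
  have "(\<integral>\<omega>. Y \<omega> * (\<Prod>i\<in>generation k. g i \<omega> (ch i \<omega>)) \<partial>M) =
    integral\<^sup>L (distr M (F k \<Otimes>\<^sub>M pairs k) (\<lambda>\<omega>. (\<omega>, \<lambda>i\<in>generation k. ch i \<omega>))) H"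
    by (subst integral_distr[OF f1 H]) (simp add: Heq)
  also have "\<dots> = (\<integral>p. H ((\<lambda>(\<omega>, \<xi>). (\<omega>, \<lambda>i\<in>generation k. daughters \<theta> \<kappa> (X i \<omega>) (\<xi> i))) p) \<partial>(M \<Otimes>\<^sub>M noises k))"
    unfolding joint_law by (rule integral_distr[OF f2 H])
  also have "\<dots> = (\<integral>\<omega>. (\<integral>\<xi>. H (\<omega>, \<lambda>i\<in>generation k. daughters \<theta> \<kappa> (X i \<omega>) (\<xi> i)) \<partial>noises k) \<partial>M)"
    using MN.integral_fst'[OF i2] by simp
  also have "\<dots> = (\<integral>\<omega>. Y \<omega> * (\<Prod>i\<in>generation k. \<integral>\<xi>. g i \<omega> (daughters \<theta> \<kappa> (X i \<omega>) \<xi>) \<partial>noise \<theta>) \<partial>M)"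
  proof (intro Bochner_Integration.integral_cong refl)
    fix \<omega> assume \<omega>: "\<omega> \<in> space M"
    have "(\<integral>\<xi>. H (\<omega>, \<lambda>i\<in>generation k. daughters \<theta> \<kappa> (X i \<omega>) (\<xi> i)) \<partial>noises k) =
      (\<integral>\<xi>. Y \<omega> * (\<Prod>i\<in>generation k. g i \<omega> (daughters \<theta> \<kappa> (X i \<omega>) (\<xi> i))) \<partial>noises k)"
      by (simp add: H_def)
    also have "\<dots> = Y \<omega> * (\<integral>\<xi>. (\<Prod>i\<in>generation k. g i \<omega> (daughters \<theta> \<kappa> (X i \<omega>) (\<xi> i))) \<partial>noises k)"
      by (rule integral_mult_right_zero)
    also have "(\<integral>\<xi>. (\<Prod>i\<in>generation k. g i \<omega> (daughters \<theta> \<kappa> (X i \<omega>) (\<xi> i))) \<partial>noises k) =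
      (\<Prod>i\<in>generation k. \<integral>\<xi>. g i \<omega> (daughters \<theta> \<kappa> (X i \<omega>) \<xi>) \<partial>noise \<theta>)"
      by (rule P.product_integral_prod[OF finite_generation int1[OF _ \<omega>]])
    finally show "(\<integral>\<xi>. H (\<omega>, \<lambda>i\<in>generation k. daughters \<theta> \<kappa> (X i \<omega>) (\<xi> i)) \<partial>noises k) =
      Y \<omega> * (\<Prod>i\<in>generation k. \<integral>\<xi>. g i \<omega> (daughters \<theta> \<kappa> (X i \<omega>) \<xi>) \<partial>noise \<theta>)" .
  qed
  finally show ?thesis .
qed

end

section \<open>Moments along the tree\<close>

text \<open>\<open>b * x + w\<close> is the convex combination, with weights
  \<open>\<bar>b\<bar>\<close> and \<open>1 - \<bar>b\<bar>\<close>, of \<open>sgn b * x\<close> and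
  \<open>w / (1 - \<bar>b\<bar>)\<close>, and the fourth power is convex (convexity of the square,
  used twice). The gain over the crude bound is the coefficient of \<open>x ^ 4\<close>, which is
  less than 1, so that fourth moments contract from one generation to the next.\<close>

lemma quartic_convex:
  fixes b :: real assumes b: "\<bar>b\<bar> < 1"
  shows "(b * x + w) ^ 4 \<le> \<bar>b\<bar> * x ^ 4 + w ^ 4 / (1 - \<bar>b\<bar>) ^ 3"
proof -
  define t where "t = \<bar>b\<bar>"
  define u where "u = sgn b * x"
  define y where "y = w / (1 - t)"
  have t: "0 \<le> t" "t < 1" using b by (auto simp: t_def)
  have sq: "(t * p + (1 - t) * q)\<^sup>2 \<le> t * p\<^sup>2 + (1 - t) * q\<^sup>2" for p q
  proof -
    have "t * p\<^sup>2 + (1 - t) * q\<^sup>2 - (t * p + (1 - t) * q)\<^sup>2 = t * (1 - t) * (p - q)\<^sup>2"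
      by (simp add: algebra_simps power2_eq_square)
    moreover have "t * (1 - t) * (p - q)\<^sup>2 \<ge> 0" using t by simp
    ultimately show ?thesis by linarith
  qed
  have "b * x + w = t * u + (1 - t) * y"
    using t by (simp add: t_def u_def y_def abs_mult_sgn mult.assoc[symmetric] abs_sgn)
  then have "(b * x + w) ^ 4 = ((t * u + (1 - t) * y)\<^sup>2)\<^sup>2" by simp
  also have "\<dots> \<le> (t * u\<^sup>2 + (1 - t) * y\<^sup>2)\<^sup>2"
    by (intro power_mono sq) auto
  also have "\<dots> \<le> t * (u\<^sup>2)\<^sup>2 + (1 - t) * (y\<^sup>2)\<^sup>2" by (rule sq)
  also have "t * (u\<^sup>2)\<^sup>2 = t * x ^ 4"
    by (auto simp: t_def u_def power_mult_distrib sgn_if)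
  also have "(1 - t) * (y\<^sup>2)\<^sup>2 = w ^ 4 / (1 - t) ^ 3"
    using t by (simp add: y_def power_divide power4_eq_xxxx power3_eq_cube)
  finally show ?thesis by (simp add: t_def)
qed

lemma quartic_affine_bound:
  fixes b c l1 l2 :: real assumes b: "\<bar>b\<bar> < 1"
  obtains C where "C \<ge> 0"
    "\<And>x z1 z2. (b * x + c + (l1 * z1 + l2 * z2)) ^ 4 \<le> \<bar>b\<bar> * x ^ 4 + C * (1 + z1 ^ 4 + z2 ^ 4)"
proof -
  \<comment> \<open>The factor 64 is 8 * 8: the inequality \<open>two\<close> is applied twice to
    split a sum of three terms. Dividing by the cube in \<open>C\<close> is the price of the
    convexity estimate.\<close>
  define D where "D = 64 * (c ^ 4 + l1 ^ 4 + l2 ^ 4)"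
  define C where "C = D / (1 - \<bar>b\<bar>) ^ 3"
  have D: "D \<ge> 0" by (simp add: D_def)
  have two: "(p + q) ^ 4 \<le> 8 * (p ^ 4 + q ^ 4)" for p q :: real
  proof -
    have "(p + q)\<^sup>2 \<le> 2 * p\<^sup>2 + 2 * q\<^sup>2"
      using sum_squares_bound[of p q] by (simp add: power2_sum)
    then have "((p + q)\<^sup>2)\<^sup>2 \<le> (2 * p\<^sup>2 + 2 * q\<^sup>2)\<^sup>2" by (intro power_mono) auto
    also have "\<dots> \<le> 8 * ((p\<^sup>2)\<^sup>2 + (q\<^sup>2)\<^sup>2)"
      using sum_squares_bound[of "p\<^sup>2" "q\<^sup>2"] by (simp add: power2_sum algebra_simps power2_eq_square)
    finally show ?thesis by simp
  qed
  have main: "(b * x + c + (l1 * z1 + l2 * z2)) ^ 4 \<le> \<bar>b\<bar> * x ^ 4 + C * (1 + z1 ^ 4 + z2 ^ 4)" for x z1 z2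
  proof -
    have "(c + (l1 * z1 + l2 * z2)) ^ 4 \<le> 8 * (c ^ 4 + (l1 * z1 + l2 * z2) ^ 4)" by (rule two)
    also have "\<dots> \<le> 8 * (c ^ 4 + 8 * ((l1 * z1) ^ 4 + (l2 * z2) ^ 4))"
      by (intro mult_left_mono add_left_mono two) auto
    also have "\<dots> \<le> 64 * (c ^ 4 + l1 ^ 4 * z1 ^ 4 + l2 ^ 4 * z2 ^ 4)"
      by (simp add: power_mult_distrib)
    also have "\<dots> \<le> D * (1 + z1 ^ 4 + z2 ^ 4)"
    proof -
      have "0 \<le> c ^ 4 * z1 ^ 4 + c ^ 4 * z2 ^ 4 + l1 ^ 4 + l1 ^ 4 * z2 ^ 4 + l2 ^ 4 + l2 ^ 4 * z1 ^ 4"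
        by simp
      then show ?thesis by (simp add: D_def algebra_simps)
    qed
    finally have w: "(c + (l1 * z1 + l2 * z2)) ^ 4 / (1 - \<bar>b\<bar>) ^ 3 \<le> C * (1 + z1 ^ 4 + z2 ^ 4)"
      using b by (simp add: C_def divide_right_mono)
    show ?thesis
      using quartic_convex[OF b, of x "c + (l1 * z1 + l2 * z2)"] w by (simp add: add.assoc)
  qed
  show ?thesis by (rule that[OF _ main]) (use D b in \<open>simp add: C_def\<close>)
qed

text \<open>A dead cell contributes 0 even for exponent 0, so the population size is the empirical
  moment of order 0 and obeys the same recurrences as the others.\<close>

definition pw :: "nat \<Rightarrow> real option \<Rightarrow> real" where
  "pw j s = (if s = None then 0 else (the s) ^ j)"

lemma pw_None [simp]: "pw j None = 0" and pw_Some [simp]: "pw j (Some x) = x ^ j"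
  by (simp_all add: pw_def)

lemma measurable_pw [measurable]: "pw j \<in> borel_measurable state_space"
  unfolding pw_def by measurable

lemma slope_bound:
  assumes "admissible \<theta> \<kappa>" shows "\<bar>slope \<theta> \<tau> \<delta>\<bar> < 1"
  using assms by (auto simp: slope_def admissible_def abs_less_iff)

text \<open>There are finitely many pairs of a type and a daughter, so the maximum of the slopes is
  still less than 1 and a single pair of constants serves all of them.\<close>

lemma daughter_quartic_bound:
  assumes adm: "admissible \<theta> \<kappa>"
  obtains a C where "0 \<le> a" "a < 1" "0 \<le> C"
    "\<And>\<tau> \<delta> x z. pw 4 (daughter \<theta> \<kappa> \<delta> (Some x) (\<tau>, z)) \<le>
       of_bool (living \<tau> \<delta>) * (a * x ^ 4 + C * (1 + fst z ^ 4 + snd z ^ 4))"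
proof -
  have "\<exists>C\<ge>0. \<forall>x z1 z2. (slope \<theta> \<tau> \<delta> * x + icpt \<theta> \<tau> \<delta> + (load1 \<kappa> \<tau> \<delta> * z1 + load2 \<kappa> \<tau> \<delta> * z2)) ^ 4
     \<le> \<bar>slope \<theta> \<tau> \<delta>\<bar> * x ^ 4 + C * (1 + z1 ^ 4 + z2 ^ 4)" for \<tau> \<delta>
    by (rule quartic_affine_bound[OF slope_bound[OF adm]]) blast
  then obtain C where C: "\<And>\<tau> \<delta>. C \<tau> \<delta> \<ge> 0" "\<And>\<tau> \<delta> x z1 z2. (slope \<theta> \<tau> \<delta> * x + icpt \<theta> \<tau> \<delta> + (load1 \<kappa> \<tau> \<delta> * z1 + load2 \<kappa> \<tau> \<delta> * z2)) ^ 4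
     \<le> \<bar>slope \<theta> \<tau> \<delta>\<bar> * x ^ 4 + C \<tau> \<delta> * (1 + z1 ^ 4 + z2 ^ 4)"
    by metis
  define a where "a = Max (range (\<lambda>(\<tau>, \<delta>). \<bar>slope \<theta> \<tau> \<delta>\<bar>))"
  define C' where "C' = Max (range (\<lambda>(\<tau>, \<delta>). C \<tau> \<delta>))"
  have a: "\<bar>slope \<theta> \<tau> \<delta>\<bar> \<le> a" for \<tau> \<delta>
    unfolding a_def by (rule Max_ge) (auto intro: image_eqI[of _ _ "(\<tau>, \<delta>)"])
  have C': "C \<tau> \<delta> \<le> C'" for \<tau> \<delta>
    unfolding C'_def by (rule Max_ge) (auto intro: image_eqI[of _ _ "(\<tau>, \<delta>)"])
  have "a \<in> range (\<lambda>(\<tau>, \<delta>). \<bar>slope \<theta> \<tau> \<delta>\<bar>)"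
    unfolding a_def by (rule Max_in) auto
  then have a1: "a < 1" using slope_bound[OF adm] by auto
  show ?thesis
  proof
    show "0 \<le> a" using a[of "(True, True)" True] by linarith
    show "0 \<le> C'" using C(1)[of "(True, True)" True] C'[of "(True, True)" True] by linarith
    show "a < 1" by fact
    fix \<tau> \<delta> x and z :: "real \<times> real"
    have "(slope \<theta> \<tau> \<delta> * x + icpt \<theta> \<tau> \<delta> + (load1 \<kappa> \<tau> \<delta> * fst z + load2 \<kappa> \<tau> \<delta> * snd z)) ^ 4 \<le>
      \<bar>slope \<theta> \<tau> \<delta>\<bar> * x ^ 4 + C \<tau> \<delta> * (1 + fst z ^ 4 + snd z ^ 4)" by (rule C(2))
    also have "\<dots> \<le> a * x ^ 4 + C' * (1 + fst z ^ 4 + snd z ^ 4)"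
      by (intro add_mono mult_right_mono a C') auto
    finally show "pw 4 (daughter \<theta> \<kappa> \<delta> (Some x) (\<tau>, z)) \<le>
       of_bool (living \<tau> \<delta>) * (a * x ^ 4 + C' * (1 + fst z ^ 4 + snd z ^ 4))"
      by (auto simp: daughter_def)
  qed
qed

lemma gauss2_moment:
  "integrable gauss2 (\<lambda>z. fst z ^ a * snd z ^ b)"
  "(\<integral>z. fst z ^ a * snd z ^ b \<partial>gauss2) = (\<integral>x. x ^ a \<partial>std_normal_distribution) * (\<integral>x. x ^ b \<partial>std_normal_distribution)"
proof -
  interpret N: prob_space std_normal_distribution by (rule prob_space_std_normal)
  interpret P: pair_prob_space std_normal_distribution std_normal_distribution ..
  note i = integrable_std_normal_distribution_moment
  have abs: "integrable std_normal_distribution (\<lambda>x. \<bar>x ^ k\<bar>)" for k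
    using integrable_norm[OF i[of k]] by simp
  show *: "integrable gauss2 (\<lambda>z. fst z ^ a * snd z ^ b)"
  proof (rule P.Fubini_integrable)
    show "integrable std_normal_distribution (\<lambda>x. \<integral>y. norm (fst (x, y) ^ a * snd (x, y) ^ b) \<partial>std_normal_distribution)"
      using abs by (simp add: abs_mult)
  qed (use i in auto)
  show "(\<integral>z. fst z ^ a * snd z ^ b \<partial>gauss2) = (\<integral>x. x ^ a \<partial>std_normal_distribution) * (\<integral>x. x ^ b \<partial>std_normal_distribution)"
    using P.integral_fst'[OF *] by simp
qed

lemma std_normal_moments:
  "(\<integral>x. x \<partial>std_normal_distribution) = 0"
  "(\<integral>x. x\<^sup>2 \<partial>std_normal_distribution) = 1"
  "(\<integral>x. x ^ 4 \<partial>std_normal_distribution) = 3"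
proof -
  show "(\<integral>x. x \<partial>std_normal_distribution) = 0"
    using integral_std_normal_distribution_moment_odd[of 1] by simp
  show "(\<integral>x. x\<^sup>2 \<partial>std_normal_distribution) = 1"
    using std_normal_distribution_even_moments(1)[of 1] by simp
  show "(\<integral>x. x ^ 4 \<partial>std_normal_distribution) = 3"
    using std_normal_distribution_even_moments(1)[of 2] by (simp add: fact_numeral)
qed

text \<open>All conditional means of interest are those of polynomials of degree at most two in the
  two normal variables. Odd and mixed terms vanish and both variances are 1, which leaves three
  coefficients.\<close>

lemma gauss2_quadratic:
  "integrable gauss2 (\<lambda>z. c0 + c1 * fst z + c2 * snd z + c3 * (fst z)\<^sup>2 + c4 * (fst z * snd z) + c5 * (snd z)\<^sup>2)"
  "(\<integral>z. c0 + c1 * fst z + c2 * snd z + c3 * (fst z)\<^sup>2 + c4 * (fst z * snd z) + c5 * (snd z)\<^sup>2 \<partial>gauss2) = c0 + c3 + c5"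
proof -
  interpret N: prob_space std_normal_distribution by (rule prob_space_std_normal)
  interpret g: prob_space gauss2 by (rule prob_space_gauss2)
  note i = gauss2_moment(1)
  note i' = i[of 1 0, simplified] i[of 0 1, simplified] i[of 2 0, simplified] i[of 1 1, simplified] i[of 0 2, simplified]
  note e = gauss2_moment(2)
  note e' = e[of 1 0, simplified] e[of 0 1, simplified] e[of 2 0, simplified] e[of 1 1, simplified] e[of 0 2, simplified]
  show "integrable gauss2 (\<lambda>z. c0 + c1 * fst z + c2 * snd z + c3 * (fst z)\<^sup>2 + c4 * (fst z * snd z) + c5 * (snd z)\<^sup>2)"
    using i' by simp
  show "(\<integral>z. c0 + c1 * fst z + c2 * snd z + c3 * (fst z)\<^sup>2 + c4 * (fst z * snd z) + c5 * (snd z)\<^sup>2 \<partial>gauss2) = c0 + c3 + c5"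
    using i' N.prob_space g.prob_space by (simp add: e' std_normal_moments)
qed

lemma gauss2_quartic: "(\<integral>\<^sup>+z. ennreal (c + C * (1 + fst z ^ 4 + snd z ^ 4)) \<partial>gauss2) = ennreal (c + 7 * C)"
  if "0 \<le> c" "0 \<le> C"
proof -
  interpret N: prob_space std_normal_distribution by (rule prob_space_std_normal)
  interpret g: prob_space gauss2 by (rule prob_space_gauss2)
  note i = gauss2_moment(1)
  note i' = i[of 4 0, simplified] i[of 0 4, simplified]
  note e = gauss2_moment(2)
  note e' = e[of 4 0, simplified] e[of 0 4, simplified]
  have "(\<integral>\<^sup>+z. ennreal (c + C * (1 + fst z ^ 4 + snd z ^ 4)) \<partial>gauss2) = ennreal (\<integral>z. c + C * (1 + fst z ^ 4 + snd z ^ 4) \<partial>gauss2)"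
    using i' that by (intro nn_integral_eq_integral) auto
  \<comment> \<open>The fourth moment of a standard normal variable is 3, whence 7 = 1 + 3 +
    3.\<close>
  also have "(\<integral>z. c + C * (1 + fst z ^ 4 + snd z ^ 4) \<partial>gauss2) = c + 7 * C"
    using i' N.prob_space g.prob_space by (simp add: e' std_normal_moments)
  finally show ?thesis .
qed

lemma integrable_noise:
  fixes h :: "_ \<Rightarrow> 'b :: {banach, second_countable_topology}"
  assumes adm: "admissible \<theta> \<kappa>" and h: "\<And>\<tau>. integrable gauss2 (\<lambda>z. h (\<tau>, z))"
  shows "integrable (noise \<theta>) h"
proof (rule integrableI_bounded)
  have [measurable_cong]: "sets gauss2 = sets (borel \<Otimes>\<^sub>M borel)"
    by (intro sets_pair_measure_cong) auto
  show m: "h \<in> borel_measurable (noise \<theta>)"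
    unfolding measurable_noise_type using borel_measurable_integrable[OF h] by (simp cong: measurable_cong_sets)
  have "(\<integral>\<^sup>+\<xi>. ennreal (norm (h \<xi>)) \<partial>noise \<theta>) =
    (\<Sum>\<tau>\<in>UNIV. ennreal (type_prob \<theta> \<tau>) * (\<integral>\<^sup>+z. norm (h (\<tau>, z)) \<partial>gauss2))"
    by (intro nn_integral_noise[OF adm] measurable_compose[OF m, of "\<lambda>x. ennreal (norm x)"]) simp
  also have "\<dots> < \<infinity>"
    using h by (auto simp: integrable_iff_bounded ennreal_mult_less_top)
  finally show "(\<integral>\<^sup>+\<xi>. ennreal (norm (h \<xi>)) \<partial>noise \<theta>) < \<infinity>" .
qed

lemma integral_noise:
  fixes h :: "_ \<Rightarrow> 'b :: {banach, second_countable_topology}"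
  assumes adm: "admissible \<theta> \<kappa>" and h: "\<And>\<tau>. integrable gauss2 (\<lambda>z. h (\<tau>, z))"
  shows "(\<integral>\<xi>. h \<xi> \<partial>noise \<theta>) = (\<Sum>\<tau>\<in>UNIV. type_prob \<theta> \<tau> *\<^sub>R (\<integral>z. h (\<tau>, z) \<partial>gauss2))"
proof -
  interpret g: prob_space gauss2 by (rule prob_space_gauss2)
  interpret P: pair_prob_space "measure_pmf (daughter_type \<theta>)" gauss2 ..
  have "(\<integral>\<xi>. h \<xi> \<partial>noise \<theta>) = (\<integral>\<tau>. (\<integral>z. h (\<tau>, z) \<partial>gauss2) \<partial>measure_pmf (daughter_type \<theta>))"
    using P.integral_fst'[of h] integrable_noise[OF adm h] unfolding noise_def by simp
  also have "\<dots> = (\<Sum>\<tau>\<in>UNIV. type_prob \<theta> \<tau> *\<^sub>R (\<integral>z. h (\<tau>, z) \<partial>gauss2))"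
    by (subst integral_measure_pmf[where A=UNIV]) (auto simp: pmf_daughter_type[OF adm])
  finally show ?thesis .
qed

text \<open>The argument of \<open>g\<close> is a triple of a mother and her two daughters. At the
  mother's value this is the conditional expectation of \<open>g\<close> given the past.\<close>

definition cond_mean :: "bar_theta \<Rightarrow> bar_kappa \<Rightarrow> (real option \<times> real option \<times> real option \<Rightarrow> real) \<Rightarrow> real option \<Rightarrow> real" where
  "cond_mean \<theta> \<kappa> g s = (\<integral>\<xi>. g (s, daughters \<theta> \<kappa> s \<xi>) \<partial>noise \<theta>)"

lemma cond_mean_quadratic:
  assumes adm: "admissible \<theta> \<kappa>"
    and g: "\<And>\<tau> z. g (Some x, daughters \<theta> \<kappa> (Some x) (\<tau>, z)) =
      c0 \<tau> + c1 \<tau> * fst z + c2 \<tau> * snd z + c3 \<tau> * (fst z)\<^sup>2 + c4 \<tau> * (fst z * snd z) + c5 \<tau> * (snd z)\<^sup>2"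
  shows "cond_mean \<theta> \<kappa> g (Some x) = (\<Sum>\<tau>\<in>UNIV. type_prob \<theta> \<tau> * (c0 \<tau> + c3 \<tau> + c5 \<tau>))"
  unfolding cond_mean_def by (subst integral_noise[OF adm]) (simp_all only: g gauss2_quadratic real_scaleR_def)

lemma cond_mean_None:
  assumes "g (None, None, None) = 0"
  shows "cond_mean \<theta> \<kappa> g None = 0"
  using assms by (simp add: cond_mean_def)

text \<open>Setting the function to 0 off the cells of type \<open>\<tau>\<close> replaces a sum
  over a random set of cells by a sum over a whole, deterministic generation.\<close>

definition stat :: "bool \<times> bool \<Rightarrow> (real \<Rightarrow> real \<Rightarrow> real \<Rightarrow> real) \<Rightarrow> real option \<times> real option \<times> real option \<Rightarrow> real" where
  "stat \<tau> f = (\<lambda>(s, y0, y1). if s \<noteq> None \<and> (y0 \<noteq> None) = fst \<tau> \<and> (y1 \<noteq> None) = snd \<tau>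
     then f (the s) (the y0) (the y1) else 0)"

definition daughter_val :: "bar_theta \<Rightarrow> bar_kappa \<Rightarrow> bool \<times> bool \<Rightarrow> bool \<Rightarrow> real \<Rightarrow> real \<times> real \<Rightarrow> real" where
  "daughter_val \<theta> \<kappa> \<tau> \<delta> x z = slope \<theta> \<tau> \<delta> * x + icpt \<theta> \<tau> \<delta> + (load1 \<kappa> \<tau> \<delta> * fst z + load2 \<kappa> \<tau> \<delta> * snd z)"

lemma stat_daughters:
  "stat \<tau> f (Some x, daughters \<theta> \<kappa> (Some x) (\<tau>', z)) =
     (if \<tau>' = \<tau> then f x (if fst \<tau> then daughter_val \<theta> \<kappa> \<tau> False x z else the None) (if snd \<tau> then daughter_val \<theta> \<kappa> \<tau> True x z else the None) else 0)"
  by (cases \<tau>; cases \<tau>') (auto simp: stat_def daughters_def daughter_def daughter_val_def)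

lemma cond_mean_stat:
  assumes adm: "admissible \<theta> \<kappa>"
    and f: "\<And>z. f x (if fst \<tau> then daughter_val \<theta> \<kappa> \<tau> False x z else the None) (if snd \<tau> then daughter_val \<theta> \<kappa> \<tau> True x z else the None) =
      c0 + c1 * fst z + c2 * snd z + c3 * (fst z)\<^sup>2 + c4 * (fst z * snd z) + c5 * (snd z)\<^sup>2"
  shows "cond_mean \<theta> \<kappa> (stat \<tau> f) (Some x) = type_prob \<theta> \<tau> * (c0 + c3 + c5)"
proof -
  have "cond_mean \<theta> \<kappa> (stat \<tau> f) (Some x) = (\<Sum>\<tau>'\<in>UNIV. type_prob \<theta> \<tau>' *
    ((if \<tau>' = \<tau> then c0 else 0) + (if \<tau>' = \<tau> then c3 else 0) + (if \<tau>' = \<tau> then c5 else 0)))"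
    by (rule cond_mean_quadratic[OF adm, where ?c1.0="\<lambda>\<tau>'. if \<tau>' = \<tau> then c1 else 0"
        and ?c2.0="\<lambda>\<tau>'. if \<tau>' = \<tau> then c2 else 0" and ?c4.0="\<lambda>\<tau>'. if \<tau>' = \<tau> then c4 else 0"])
       (simp add: stat_daughters f)
  also have "\<dots> = (\<Sum>\<tau>'\<in>UNIV. if \<tau>' = \<tau> then type_prob \<theta> \<tau>' * (c0 + c3 + c5) else 0)"
    by (intro sum.cong) auto
  also have "\<dots> = type_prob \<theta> \<tau> * (c0 + c3 + c5)" by simp
  finally show ?thesis .
qed

text \<open>Quadratic growth in the living values only: the bound has no term for dead cells, so a
  tame function vanishes when all three cells are dead. The square of a tame function is controlled
  by fourth moments.\<close>

definition tame :: "(real option \<times> real option \<times> real option \<Rightarrow> real) \<Rightarrow> bool" where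
  "tame g \<longleftrightarrow> g \<in> borel_measurable (state_space \<Otimes>\<^sub>M state_pair_space) \<and>
     (\<exists>C\<ge>0. \<forall>s y0 y1. \<bar>g (s, y0, y1)\<bar> \<le> C * (pw 0 s + pw 2 s + pw 0 y0 + pw 2 y0 + pw 0 y1 + pw 2 y1))"

lemma pw_even_nonneg [simp]: "0 \<le> pw 0 s" "0 \<le> pw 2 s" "0 \<le> pw 4 s"
  by (simp_all add: pw_def)

lemma tame_measurable: "tame g \<Longrightarrow> g \<in> borel_measurable (state_space \<Otimes>\<^sub>M state_pair_space)"
  by (simp add: tame_def)

lemma tame_None: "tame g \<Longrightarrow> g (None, None, None) = 0"
  unfolding tame_def by (metis abs_le_zero_iff add.right_neutral mult_zero_right pw_None)

lemma tame_square:
  assumes "tame g"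
  obtains C where "C \<ge> 0" "\<And>s y. (g (s, y))\<^sup>2 \<le> C * (pw 0 s + pw 4 s + (pw 0 (fst y) + pw 4 (fst y)) + (pw 0 (snd y) + pw 4 (snd y)))"
proof -
  obtain C where C: "C \<ge> 0" "\<And>s y0 y1. \<bar>g (s, y0, y1)\<bar> \<le> C * (pw 0 s + pw 2 s + pw 0 y0 + pw 2 y0 + pw 0 y1 + pw 2 y1)"
    using assms by (auto simp: tame_def)
  have sq: "(pw 0 s + pw 2 s)\<^sup>2 \<le> 2 * (pw 0 s + pw 4 s)" for s
  proof (cases s)
    case (Some x)
    have "2 * x\<^sup>2 \<le> 1 + x ^ 4" using sum_squares_bound[of 1 "x\<^sup>2"] by simp
    then show ?thesis by (simp add: Some power2_sum)
  qed simp
  have three: "(a + b + c)\<^sup>2 \<le> 3 * (a\<^sup>2 + b\<^sup>2 + c\<^sup>2)" for a b c :: real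
    using sum_squares_bound[of a b] sum_squares_bound[of b c] sum_squares_bound[of a c]
    by (simp add: power2_eq_square algebra_simps)
  \<comment> \<open>The constant 6 is 3 * 2: the factor 3 for the square of a sum of three terms,
    the factor 2 from \<open>sq\<close>.\<close>
  have "(g (s, y))\<^sup>2 \<le> 6 * C\<^sup>2 * (pw 0 s + pw 4 s + (pw 0 (fst y) + pw 4 (fst y)) + (pw 0 (snd y) + pw 4 (snd y)))" for s y
  proof -
    obtain y0 y1 where y: "y = (y0, y1)" by (cases y)
    have "(g (s, y))\<^sup>2 \<le> (C * ((pw 0 s + pw 2 s) + (pw 0 y0 + pw 2 y0) + (pw 0 y1 + pw 2 y1)))\<^sup>2"
      using C(2)[of s y0 y1] unfolding y by (intro abs_le_square_iff[THEN iffD1]) (simp add: C(1) algebra_simps)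
    also have "\<dots> = C\<^sup>2 * ((pw 0 s + pw 2 s) + (pw 0 y0 + pw 2 y0) + (pw 0 y1 + pw 2 y1))\<^sup>2"
      by (simp add: power_mult_distrib)
    also have "\<dots> \<le> C\<^sup>2 * (3 * ((pw 0 s + pw 2 s)\<^sup>2 + (pw 0 y0 + pw 2 y0)\<^sup>2 + (pw 0 y1 + pw 2 y1)\<^sup>2))"
      by (intro mult_left_mono three) auto
    also have "\<dots> \<le> C\<^sup>2 * (3 * (2 * (pw 0 s + pw 4 s) + 2 * (pw 0 y0 + pw 4 y0) + 2 * (pw 0 y1 + pw 4 y1)))"
      by (intro mult_left_mono add_mono sq) auto
    finally show ?thesis by (simp add: y algebra_simps)
  qed
  then show ?thesis by (intro that[of "6 * C\<^sup>2"]) auto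
qed

lemma tameI:
  assumes "g \<in> borel_measurable (state_space \<Otimes>\<^sub>M state_pair_space)" "C \<ge> 0"
    "\<And>s y0 y1. \<bar>g (s, y0, y1)\<bar> \<le> C * (pw 0 s + pw 2 s + pw 0 y0 + pw 2 y0 + pw 0 y1 + pw 2 y1)"
  shows "tame g"
  using assms unfolding tame_def by blast

lemma generation_Suc:
  "generation (Suc k) = (\<lambda>i. i @ [False]) ` generation k \<union> (\<lambda>i. i @ [True]) ` generation k"
proof (intro set_eqI iffI)
  fix j assume j: "j \<in> generation (Suc k)"
  then have "j \<noteq> []" by (auto simp: generation_def)
  then obtain i \<delta> where "j = i @ [\<delta>]" by (metis append_butlast_last_id)
  with j show "j \<in> (\<lambda>i. i @ [False]) ` generation k \<union> (\<lambda>i. i @ [True]) ` generation k"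
    by (cases \<delta>) auto
qed (auto simp: generation_def)

lemma sum_generation_Suc:
  "(\<Sum>j\<in>generation (Suc k). \<phi> j) = (\<Sum>i\<in>generation k. \<phi> (i @ [False]) + (\<phi> (i @ [True]) :: 'c :: comm_monoid_add))"
  unfolding generation_Suc by (subst sum.union_disjoint) (auto simp: sum.reindex inj_on_def sum.distrib)

lemma generation_0 [simp]: "generation 0 = {[]}"
  by (auto simp: generation_def)

text \<open>The fourth moment of the ancestor starts the induction that bounds fourth moments along
  the tree; these in turn bound the variances of sums of functions of quadratic growth.\<close>

locale supercritical_bar = bifurcating_ar +
  assumes supercritical: "mean_offspring \<theta> > 1"
    and moment4: "integrable M (\<lambda>\<omega>. \<bar>the (X [] \<omega>)\<bar> ^ 4)"
begin

abbreviation "m \<equiv> mean_offspring \<theta>"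

lemma m_gt_0 [simp]: "m > 0" "m \<noteq> 0" "m \<ge> 0" using supercritical by auto

text \<open>One step of the tree acts on the moments of order 0, 1 and 2 by a triangular system. The
  factor \<open>m\<close> is the growth of the population and cancels against the norming by
  \<open>m ^ k\<close>; what is left are the barred averages of the parameters.\<close>

lemma cond_mean_pw:
  "cond_mean \<theta> \<kappa> (\<lambda>(s, y0, y1). pw 0 y0 + pw 0 y1) s = m * pw 0 s"
  "cond_mean \<theta> \<kappa> (\<lambda>(s, y0, y1). pw 1 y0 + pw 1 y1) s = m * (alpha_bar \<theta> * pw 1 s + beta_bar \<theta> * pw 0 s)"
  "cond_mean \<theta> \<kappa> (\<lambda>(s, y0, y1). pw 2 y0 + pw 2 y1) s =
     m * (alpha2_bar \<theta> * pw 2 s + 2 * alpha_beta_bar \<theta> * pw 1 s + (beta2_bar \<theta> + sigma2_bar \<theta> \<kappa>) * pw 0 s)"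
proof -
  have rho: "1 - (\<rho> \<kappa>)\<^sup>2 > 0" using admissible by (auto simp: admissible_def abs_square_less_1 abs_less_iff)
  have mb: "m * alpha_bar \<theta> = p\<^sub>1\<^sub>0 \<theta> * (\<alpha>\<^sub>0 \<theta> + \<alpha>\<^sub>1 \<theta>) + p\<^sub>0 \<theta> * \<alpha>'\<^sub>0 \<theta> + p\<^sub>1 \<theta> * \<alpha>'\<^sub>1 \<theta>"
    "m * beta_bar \<theta> = p\<^sub>1\<^sub>0 \<theta> * (\<beta>\<^sub>0 \<theta> + \<beta>\<^sub>1 \<theta>) + p\<^sub>0 \<theta> * \<beta>'\<^sub>0 \<theta> + p\<^sub>1 \<theta> * \<beta>'\<^sub>1 \<theta>"
    "m * alpha2_bar \<theta> = p\<^sub>1\<^sub>0 \<theta> * ((\<alpha>\<^sub>0 \<theta>)\<^sup>2 + (\<alpha>\<^sub>1 \<theta>)\<^sup>2) + p\<^sub>0 \<theta> * (\<alpha>'\<^sub>0 \<theta>)\<^sup>2 + p\<^sub>1 \<theta> * (\<alpha>'\<^sub>1 \<theta>)\<^sup>2"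
    "m * beta2_bar \<theta> = p\<^sub>1\<^sub>0 \<theta> * ((\<beta>\<^sub>0 \<theta>)\<^sup>2 + (\<beta>\<^sub>1 \<theta>)\<^sup>2) + p\<^sub>0 \<theta> * (\<beta>'\<^sub>0 \<theta>)\<^sup>2 + p\<^sub>1 \<theta> * (\<beta>'\<^sub>1 \<theta>)\<^sup>2"
    "m * alpha_beta_bar \<theta> = p\<^sub>1\<^sub>0 \<theta> * (\<alpha>\<^sub>0 \<theta> * \<beta>\<^sub>0 \<theta> + \<alpha>\<^sub>1 \<theta> * \<beta>\<^sub>1 \<theta>) + p\<^sub>0 \<theta> * \<alpha>'\<^sub>0 \<theta> * \<beta>'\<^sub>0 \<theta> + p\<^sub>1 \<theta> * \<alpha>'\<^sub>1 \<theta> * \<beta>'\<^sub>1 \<theta>"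
    "m * sigma2_bar \<theta> \<kappa> = 2 * p\<^sub>1\<^sub>0 \<theta> * (\<sigma> \<kappa>)\<^sup>2 + p\<^sub>0 \<theta> * (\<sigma>\<^sub>0 \<kappa>)\<^sup>2 + p\<^sub>1 \<theta> * (\<sigma>\<^sub>1 \<kappa>)\<^sup>2"
    by (simp_all add: alpha_bar_def beta_bar_def alpha2_bar_def beta2_bar_def alpha_beta_bar_def sigma2_bar_def)
  let ?l = "\<lambda>\<tau> f. of_bool (fst \<tau>) * f \<tau> False + of_bool (snd \<tau>) * (f \<tau> True :: real)"
  show "cond_mean \<theta> \<kappa> (\<lambda>(s, y0, y1). pw 0 y0 + pw 0 y1) s = m * pw 0 s"
  proof (cases s)
    case (Some x)
    show ?thesis unfolding Some
      by (subst cond_mean_quadratic[OF admissible, where ?c0.0="\<lambda>\<tau>. ?l \<tau> (\<lambda>\<tau> \<delta>. 1)" and ?c1.0="\<lambda>_. 0" and ?c2.0="\<lambda>_. 0"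
            and ?c3.0="\<lambda>_. 0" and ?c4.0="\<lambda>_. 0" and ?c5.0="\<lambda>_. 0"])
         (auto simp: daughters_def daughter_def UNIV_types type_prob_def mean_offspring_def)
  qed (simp add: cond_mean_None)
  show "cond_mean \<theta> \<kappa> (\<lambda>(s, y0, y1). pw 1 y0 + pw 1 y1) s = m * (alpha_bar \<theta> * pw 1 s + beta_bar \<theta> * pw 0 s)"
  proof (cases s)
    case (Some x)
    have "cond_mean \<theta> \<kappa> (\<lambda>(s, y0, y1). pw 1 y0 + pw 1 y1) (Some x) = (m * alpha_bar \<theta>) * x + (m * beta_bar \<theta>)"
      unfolding mb
      by (subst cond_mean_quadratic[OF admissible, where ?c0.0="\<lambda>\<tau>. ?l \<tau> (\<lambda>\<tau> \<delta>. slope \<theta> \<tau> \<delta> * x + icpt \<theta> \<tau> \<delta>)"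
            and ?c1.0="\<lambda>\<tau>. ?l \<tau> (load1 \<kappa>)" and ?c2.0="\<lambda>\<tau>. ?l \<tau> (load2 \<kappa>)"
            and ?c3.0="\<lambda>_. 0" and ?c4.0="\<lambda>_. 0" and ?c5.0="\<lambda>_. 0"])
         (auto simp: daughters_def daughter_def UNIV_types type_prob_def slope_def icpt_def algebra_simps)
    then show ?thesis by (simp add: Some algebra_simps)
  qed (simp add: cond_mean_None)
  show "cond_mean \<theta> \<kappa> (\<lambda>(s, y0, y1). pw 2 y0 + pw 2 y1) s =
     m * (alpha2_bar \<theta> * pw 2 s + 2 * alpha_beta_bar \<theta> * pw 1 s + (beta2_bar \<theta> + sigma2_bar \<theta> \<kappa>) * pw 0 s)"
  proof (cases s)
    case (Some x)
    have "cond_mean \<theta> \<kappa> (\<lambda>(s, y0, y1). pw 2 y0 + pw 2 y1) (Some x) =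
       (m * alpha2_bar \<theta>) * x\<^sup>2 + 2 * (m * alpha_beta_bar \<theta>) * x + (m * beta2_bar \<theta>) + (m * sigma2_bar \<theta> \<kappa>)"
      unfolding mb
      using rho
      by (subst cond_mean_quadratic[OF admissible, where ?c0.0="\<lambda>\<tau>. ?l \<tau> (\<lambda>\<tau> \<delta>. (slope \<theta> \<tau> \<delta> * x + icpt \<theta> \<tau> \<delta>)\<^sup>2)"
            and ?c1.0="\<lambda>\<tau>. ?l \<tau> (\<lambda>\<tau> \<delta>. 2 * (slope \<theta> \<tau> \<delta> * x + icpt \<theta> \<tau> \<delta>) * load1 \<kappa> \<tau> \<delta>)"
            and ?c2.0="\<lambda>\<tau>. ?l \<tau> (\<lambda>\<tau> \<delta>. 2 * (slope \<theta> \<tau> \<delta> * x + icpt \<theta> \<tau> \<delta>) * load2 \<kappa> \<tau> \<delta>)"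
            and ?c3.0="\<lambda>\<tau>. ?l \<tau> (\<lambda>\<tau> \<delta>. (load1 \<kappa> \<tau> \<delta>)\<^sup>2)" and ?c4.0="\<lambda>\<tau>. ?l \<tau> (\<lambda>\<tau> \<delta>. 2 * load1 \<kappa> \<tau> \<delta> * load2 \<kappa> \<tau> \<delta>)"
            and ?c5.0="\<lambda>\<tau>. ?l \<tau> (\<lambda>\<tau> \<delta>. (load2 \<kappa> \<tau> \<delta>)\<^sup>2)"])
         (auto simp: daughters_def daughter_def UNIV_types type_prob_def slope_def icpt_def load1_def load2_def
            power_mult_distrib power2_sum algebra_simps power2_eq_square real_sqrt_mult_self)
    then show ?thesis by (simp add: Some algebra_simps)
  qed (simp add: cond_mean_None)
qed

lemma nn_noise_count:
  "(\<integral>\<^sup>+\<xi>. ennreal (pw 0 (fst (daughters \<theta> \<kappa> s \<xi>)) + pw 0 (snd (daughters \<theta> \<kappa> s \<xi>))) \<partial>noise \<theta>) = ennreal (m * pw 0 s)"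
proof -
  have m1: "(\<lambda>\<xi>. pw 0 (fst (daughters \<theta> \<kappa> s \<xi>)) + pw 0 (snd (daughters \<theta> \<kappa> s \<xi>))) \<in> borel_measurable (noise \<theta>)"
    by measurable
  have "integrable (noise \<theta>) (\<lambda>\<xi>. pw 0 (fst (daughters \<theta> \<kappa> s \<xi>)) + pw 0 (snd (daughters \<theta> \<kappa> s \<xi>)))"
    by (rule noise.integrable_const_bound[where B=2]) (use m1 in \<open>auto simp: pw_def intro!: AE_I2\<close>)
  then have "(\<integral>\<^sup>+\<xi>. ennreal (pw 0 (fst (daughters \<theta> \<kappa> s \<xi>)) + pw 0 (snd (daughters \<theta> \<kappa> s \<xi>))) \<partial>noise \<theta>) =
    ennreal (\<integral>\<xi>. pw 0 (fst (daughters \<theta> \<kappa> s \<xi>)) + pw 0 (snd (daughters \<theta> \<kappa> s \<xi>)) \<partial>noise \<theta>)"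
    by (intro nn_integral_eq_integral) auto
  also have "(\<integral>\<xi>. pw 0 (fst (daughters \<theta> \<kappa> s \<xi>)) + pw 0 (snd (daughters \<theta> \<kappa> s \<xi>)) \<partial>noise \<theta>) = m * pw 0 s"
    using cond_mean_pw(1)[of s] by (simp add: cond_mean_def split_beta')
  finally show ?thesis .
qed

lemma nn_noise_quartic:
  obtains a C where "0 \<le> a" "a < 1" "0 \<le> C"
   "\<And>s. (\<integral>\<^sup>+\<xi>. ennreal (pw 4 (fst (daughters \<theta> \<kappa> s \<xi>)) + pw 4 (snd (daughters \<theta> \<kappa> s \<xi>))) \<partial>noise \<theta>)
      \<le> ennreal (m * (a * pw 4 s + C * pw 0 s))"
proof -
  obtain a C where aC: "0 \<le> a" "a < 1" "0 \<le> C" and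
    b: "\<And>\<tau> \<delta> x z. pw 4 (daughter \<theta> \<kappa> \<delta> (Some x) (\<tau>, z)) \<le>
       of_bool (living \<tau> \<delta>) * (a * x ^ 4 + C * (1 + fst z ^ 4 + snd z ^ 4))"
    by (rule daughter_quartic_bound[OF admissible]) blast
  have "(\<integral>\<^sup>+\<xi>. ennreal (pw 4 (fst (daughters \<theta> \<kappa> s \<xi>)) + pw 4 (snd (daughters \<theta> \<kappa> s \<xi>))) \<partial>noise \<theta>)
      \<le> ennreal (m * (a * pw 4 s + (7 * C) * pw 0 s))" for s
  proof (cases s)
    case (Some x)
    define n where "n \<tau> = of_bool (fst \<tau>) + (of_bool (snd \<tau>) :: real)" for \<tau> :: "bool \<times> bool"
    have n0: "n \<tau> \<ge> 0" for \<tau> by (simp add: n_def)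
    have "(\<integral>\<^sup>+\<xi>. ennreal (pw 4 (fst (daughters \<theta> \<kappa> s \<xi>)) + pw 4 (snd (daughters \<theta> \<kappa> s \<xi>))) \<partial>noise \<theta>) =
      (\<Sum>\<tau>\<in>UNIV. ennreal (type_prob \<theta> \<tau>) * (\<integral>\<^sup>+z. ennreal (pw 4 (fst (daughters \<theta> \<kappa> s (\<tau>, z))) + pw 4 (snd (daughters \<theta> \<kappa> s (\<tau>, z)))) \<partial>gauss2))"
      by (intro nn_integral_noise[OF admissible]) measurable
    also have "\<dots> \<le> (\<Sum>\<tau>\<in>UNIV. ennreal (type_prob \<theta> \<tau>) * (\<integral>\<^sup>+z. ennreal (n \<tau> * (a * x ^ 4) + (n \<tau> * C) * (1 + fst z ^ 4 + snd z ^ 4)) \<partial>gauss2))"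
    proof (intro sum_mono mult_left_mono nn_integral_mono ennreal_leI)
      fix \<tau> :: "bool \<times> bool" and z :: "real \<times> real"
      show "pw 4 (fst (daughters \<theta> \<kappa> s (\<tau>, z))) + pw 4 (snd (daughters \<theta> \<kappa> s (\<tau>, z)))
        \<le> n \<tau> * (a * x ^ 4) + (n \<tau> * C) * (1 + fst z ^ 4 + snd z ^ 4)"
        using b[of False x \<tau> z] b[of True x \<tau> z] by (simp add: daughters_def Some n_def algebra_simps)
    qed auto
    also have "\<dots> = (\<Sum>\<tau>\<in>UNIV. ennreal (type_prob \<theta> \<tau>) * ennreal (n \<tau> * (a * x ^ 4) + 7 * (n \<tau> * C)))"
      using aC n0 by (subst gauss2_quartic) auto
    also have "\<dots> = ennreal (\<Sum>\<tau>\<in>UNIV. type_prob \<theta> \<tau> * (n \<tau> * (a * x ^ 4) + 7 * (n \<tau> * C)))"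
      using aC n0 admissible by (subst sum_ennreal[symmetric]) (auto simp: ennreal_mult' type_prob_def admissible_def)
    also have "(\<Sum>\<tau>\<in>UNIV. type_prob \<theta> \<tau> * (n \<tau> * (a * x ^ 4) + 7 * (n \<tau> * C))) = m * (a * x ^ 4 + 7 * C)"
      by (simp add: UNIV_types type_prob_def n_def mean_offspring_def algebra_simps)
    finally show ?thesis by (simp add: Some)
  qed simp
  with aC show ?thesis by (intro that[of a "7 * C"]) auto
qed

lemma ch_fst_snd: "fst (ch i \<omega>) = X (i @ [False]) \<omega>" "snd (ch i \<omega>) = X (i @ [True]) \<omega>"
  by (simp_all add: ch_def)

lemma nn_sum_generation_Suc:
  assumes p: "j = 0 \<or> j = 2 \<or> j = 4"
  shows "(\<integral>\<^sup>+\<omega>. (\<Sum>i\<in>generation (Suc k). ennreal (pw j (X i \<omega>))) \<partial>M) =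
   (\<Sum>i\<in>generation k. \<integral>\<^sup>+\<omega>. (\<integral>\<^sup>+\<xi>. ennreal (pw j (fst (daughters \<theta> \<kappa> (X i \<omega>) \<xi>)) + pw j (snd (daughters \<theta> \<kappa> (X i \<omega>) \<xi>))) \<partial>noise \<theta>) \<partial>M)"
proof -
  have p0: "pw j s \<ge> 0" for s using p by auto
  have "(\<integral>\<^sup>+\<omega>. (\<Sum>i\<in>generation (Suc k). ennreal (pw j (X i \<omega>))) \<partial>M) =
    (\<integral>\<^sup>+\<omega>. (\<Sum>i\<in>generation k. ennreal (pw j (fst (ch i \<omega>)) + pw j (snd (ch i \<omega>)))) \<partial>M)"
    unfolding sum_generation_Suc ch_fst_snd using p0 by (intro nn_integral_cong sum.cong) auto
  also have "\<dots> = (\<Sum>i\<in>generation k. \<integral>\<^sup>+\<omega>. ennreal (pw j (fst (ch i \<omega>)) + pw j (snd (ch i \<omega>))) \<partial>M)"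
    by (intro nn_integral_sum) measurable
  also have "\<dots> = (\<Sum>i\<in>generation k. \<integral>\<^sup>+\<omega>. (\<integral>\<^sup>+\<xi>. ennreal (pw j (fst (daughters \<theta> \<kappa> (X i \<omega>) \<xi>)) + pw j (snd (daughters \<theta> \<kappa> (X i \<omega>) \<xi>))) \<partial>noise \<theta>) \<partial>M)"
    using nn_integral_step1[where g="\<lambda>p. ennreal (pw j (fst (snd p)) + pw j (snd (snd p)))"]
    by (intro sum.cong refl) simp
  finally show ?thesis .
qed

lemma nn_sum_pw:
  "(\<Sum>i\<in>generation k. \<integral>\<^sup>+\<omega>. ennreal (pw j (X i \<omega>)) \<partial>M) = (\<integral>\<^sup>+\<omega>. (\<Sum>i\<in>generation k. ennreal (pw j (X i \<omega>))) \<partial>M)"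
  by (intro nn_integral_sum[symmetric]) measurable

lemma expected_size: "(\<integral>\<^sup>+\<omega>. (\<Sum>i\<in>generation k. ennreal (pw 0 (X i \<omega>))) \<partial>M) = ennreal (m ^ k)"
proof (induction k)
  case 0
  have "(\<integral>\<^sup>+\<omega>. (\<Sum>i\<in>generation 0. ennreal (pw 0 (X i \<omega>))) \<partial>M) = (\<integral>\<^sup>+\<omega>. 1 \<partial>M)"
    using ancestor_alive by (intro nn_integral_cong) (auto simp: pw_def)
  then show ?case using emeasure_space_1 by simp
next
  case (Suc k)
  have "(\<integral>\<^sup>+\<omega>. (\<Sum>i\<in>generation (Suc k). ennreal (pw 0 (X i \<omega>))) \<partial>M) =
     (\<Sum>i\<in>generation k. \<integral>\<^sup>+\<omega>. ennreal m * ennreal (pw 0 (X i \<omega>)) \<partial>M)"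
    by (subst nn_sum_generation_Suc) (simp_all add: nn_noise_count ennreal_mult' del: ennreal_plus)
  also have "\<dots> = ennreal m * (\<Sum>i\<in>generation k. \<integral>\<^sup>+\<omega>. ennreal (pw 0 (X i \<omega>)) \<partial>M)"
    by (simp add: nn_integral_cmult sum_distrib_left)
  also have "\<dots> = ennreal (m ^ Suc k)"
    unfolding nn_sum_pw Suc by (simp add: ennreal_mult')
  finally show ?case .
qed

lemma expected_quartic:
  obtains C where "0 \<le> C" "\<And>k. (\<integral>\<^sup>+\<omega>. (\<Sum>i\<in>generation k. ennreal (pw 0 (X i \<omega>) + pw 4 (X i \<omega>))) \<partial>M) \<le> ennreal (C * m ^ k)"
proof -
  obtain a C where aC: "0 \<le> a" "a < 1" "0 \<le> C"
   "\<And>s. (\<integral>\<^sup>+\<xi>. ennreal (pw 4 (fst (daughters \<theta> \<kappa> s \<xi>)) + pw 4 (snd (daughters \<theta> \<kappa> s \<xi>))) \<partial>noise \<theta>)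
      \<le> ennreal (m * (a * pw 4 s + C * pw 0 s))"
    by (rule nn_noise_quartic) blast
  define c0 where "c0 = (\<integral>\<omega>. \<bar>the (X [] \<omega>)\<bar> ^ 4 \<partial>M)"
  \<comment> \<open>The second entry is the fixed point of the map taking \<open>D\<close> to
    \<open>a * D + C\<close>. A bound above this value is preserved by one generation, and the first
    entry starts the induction.\<close>
  define D where "D = max c0 (C / (1 - a))"
  have D: "D \<ge> 0" "a * D + C \<le> D"
  proof -
    have "0 \<le> C / (1 - a)" using aC by simp
    then show "D \<ge> 0" by (simp add: D_def)
    have "C / (1 - a) \<le> D" by (simp add: D_def)
    then have "C \<le> D * (1 - a)" using aC by (simp add: field_simps)
    then show "a * D + C \<le> D" by (simp add: algebra_simps)
  qed
  have quart: "(\<integral>\<^sup>+\<omega>. (\<Sum>i\<in>generation k. ennreal (pw 4 (X i \<omega>))) \<partial>M) \<le> ennreal (D * m ^ k)" for k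
  proof (induction k)
    case 0
    have "(\<integral>\<^sup>+\<omega>. (\<Sum>i\<in>generation 0. ennreal (pw 4 (X i \<omega>))) \<partial>M) = (\<integral>\<^sup>+\<omega>. ennreal (\<bar>the (X [] \<omega>)\<bar> ^ 4) \<partial>M)"
      using ancestor_alive by (intro nn_integral_cong) (fastforce simp: pw_def)
    also have "\<dots> = ennreal c0" unfolding c0_def by (intro nn_integral_eq_integral moment4) auto
    also have "\<dots> \<le> ennreal (D * m ^ 0)" by (auto simp: D_def intro: ennreal_leI)
    finally show ?case .
  next
    case (Suc k)
    have "(\<integral>\<^sup>+\<omega>. (\<Sum>i\<in>generation (Suc k). ennreal (pw 4 (X i \<omega>))) \<partial>M) \<le>
       (\<Sum>i\<in>generation k. \<integral>\<^sup>+\<omega>. ennreal (m * (a * pw 4 (X i \<omega>) + C * pw 0 (X i \<omega>))) \<partial>M)"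
      by (subst nn_sum_generation_Suc, simp) (intro sum_mono nn_integral_mono aC(4))
    also have "\<dots> = (\<Sum>i\<in>generation k. \<integral>\<^sup>+\<omega>. ennreal (m * a) * ennreal (pw 4 (X i \<omega>)) + ennreal (m * C) * ennreal (pw 0 (X i \<omega>)) \<partial>M)"
      using aC by (intro sum.cong nn_integral_cong refl) (simp add: ennreal_mult'[symmetric] distrib_left mult.assoc)
    also have "\<dots> = ennreal (m * a) * (\<Sum>i\<in>generation k. \<integral>\<^sup>+\<omega>. ennreal (pw 4 (X i \<omega>)) \<partial>M) + ennreal (m * C) * (\<Sum>i\<in>generation k. \<integral>\<^sup>+\<omega>. ennreal (pw 0 (X i \<omega>)) \<partial>M)"
      by (simp add: nn_integral_add nn_integral_cmult sum.distrib sum_distrib_left)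
    also have "\<dots> \<le> ennreal (m * a) * ennreal (D * m ^ k) + ennreal (m * C) * ennreal (m ^ k)"
      unfolding nn_sum_pw expected_size by (intro add_mono mult_left_mono Suc) auto
    also have "\<dots> = ennreal (m ^ Suc k * (a * D + C))"
      using aC D by (simp add: ennreal_mult'[symmetric] ennreal_plus[symmetric] algebra_simps del: ennreal_plus)
    also have "\<dots> \<le> ennreal (D * m ^ Suc k)"
      using mult_left_mono[OF D(2), of "m ^ Suc k"] by (intro ennreal_leI) (simp add: mult_ac)
    finally show ?case .
  qed
  have "(\<integral>\<^sup>+\<omega>. (\<Sum>i\<in>generation k. ennreal (pw 0 (X i \<omega>) + pw 4 (X i \<omega>))) \<partial>M) \<le> ennreal ((1 + D) * m ^ k)" for k
  proof -
    have "(\<integral>\<^sup>+\<omega>. (\<Sum>i\<in>generation k. ennreal (pw 0 (X i \<omega>) + pw 4 (X i \<omega>))) \<partial>M) =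
      (\<integral>\<^sup>+\<omega>. (\<Sum>i\<in>generation k. ennreal (pw 0 (X i \<omega>))) \<partial>M) + (\<integral>\<^sup>+\<omega>. (\<Sum>i\<in>generation k. ennreal (pw 4 (X i \<omega>))) \<partial>M)"
      by (subst nn_integral_add[symmetric]) (auto simp: sum.distrib)
    also have "\<dots> \<le> ennreal (m ^ k) + ennreal (D * m ^ k)"
      unfolding expected_size by (intro add_left_mono quart)
    also have "\<dots> = ennreal ((1 + D) * m ^ k)"
      using D by (simp add: ennreal_plus[symmetric] algebra_simps del: ennreal_plus)
    finally show ?thesis .
  qed
  with D show ?thesis by (intro that[of "1 + D"]) auto
qed

end

section \<open>Laws of large numbers\<close>

context supercritical_bar
begin

lemma noise_square_integrable:
  assumes g: "tame g"
  shows "integrable (noise \<theta>) (\<lambda>\<xi>. (g (s, daughters \<theta> \<kappa> s \<xi>))\<^sup>2)"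
proof (rule integrableI_bounded)
  note [measurable] = tame_measurable[OF g]
  show "(\<lambda>\<xi>. (g (s, daughters \<theta> \<kappa> s \<xi>))\<^sup>2) \<in> borel_measurable (noise \<theta>)" by measurable
  obtain C where C: "C \<ge> 0" "\<And>s y. (g (s, y))\<^sup>2 \<le> C * (pw 0 s + pw 4 s + (pw 0 (fst y) + pw 4 (fst y)) + (pw 0 (snd y) + pw 4 (snd y)))"
    by (rule tame_square[OF g]) blast
  obtain a D where D: "0 \<le> a" "a < 1" "0 \<le> D"
   "\<And>s. (\<integral>\<^sup>+\<xi>. ennreal (pw 4 (fst (daughters \<theta> \<kappa> s \<xi>)) + pw 4 (snd (daughters \<theta> \<kappa> s \<xi>))) \<partial>noise \<theta>)
      \<le> ennreal (m * (a * pw 4 s + D * pw 0 s))"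
    by (rule nn_noise_quartic) blast
  have "(\<integral>\<^sup>+\<xi>. ennreal (norm ((g (s, daughters \<theta> \<kappa> s \<xi>))\<^sup>2)) \<partial>noise \<theta>) \<le>
    (\<integral>\<^sup>+\<xi>. ennreal (C * (pw 0 s + pw 4 s)) + ennreal C * ennreal (pw 0 (fst (daughters \<theta> \<kappa> s \<xi>)) + pw 0 (snd (daughters \<theta> \<kappa> s \<xi>)))
       + ennreal C * ennreal (pw 4 (fst (daughters \<theta> \<kappa> s \<xi>)) + pw 4 (snd (daughters \<theta> \<kappa> s \<xi>))) \<partial>noise \<theta>)"
  proof (intro nn_integral_mono)
    fix \<xi> :: "(bool \<times> bool) \<times> real \<times> real"
    have "norm ((g (s, daughters \<theta> \<kappa> s \<xi>))\<^sup>2) \<le> C * (pw 0 s + pw 4 s) +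
       C * (pw 0 (fst (daughters \<theta> \<kappa> s \<xi>)) + pw 0 (snd (daughters \<theta> \<kappa> s \<xi>))) +
       C * (pw 4 (fst (daughters \<theta> \<kappa> s \<xi>)) + pw 4 (snd (daughters \<theta> \<kappa> s \<xi>)))"
      using C(2)[of s "daughters \<theta> \<kappa> s \<xi>"] by (simp add: algebra_simps)
    then have "ennreal (norm ((g (s, daughters \<theta> \<kappa> s \<xi>))\<^sup>2)) \<le> ennreal (C * (pw 0 s + pw 4 s) +
       C * (pw 0 (fst (daughters \<theta> \<kappa> s \<xi>)) + pw 0 (snd (daughters \<theta> \<kappa> s \<xi>))) +
       C * (pw 4 (fst (daughters \<theta> \<kappa> s \<xi>)) + pw 4 (snd (daughters \<theta> \<kappa> s \<xi>))))"
      by (rule ennreal_leI)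
    also have "\<dots> = ennreal (C * (pw 0 s + pw 4 s)) + ennreal C * ennreal (pw 0 (fst (daughters \<theta> \<kappa> s \<xi>)) + pw 0 (snd (daughters \<theta> \<kappa> s \<xi>)))
       + ennreal C * ennreal (pw 4 (fst (daughters \<theta> \<kappa> s \<xi>)) + pw 4 (snd (daughters \<theta> \<kappa> s \<xi>)))"
      using C(1) by (subst ennreal_plus, simp_all add: ennreal_mult'[symmetric] del: ennreal_plus, subst ennreal_plus) auto
    finally show "ennreal (norm ((g (s, daughters \<theta> \<kappa> s \<xi>))\<^sup>2)) \<le> \<dots>" .
  qed
  also have "\<dots> = ennreal (C * (pw 0 s + pw 4 s)) * emeasure (noise \<theta>) (space (noise \<theta>)) +
     ennreal C * ennreal (m * pw 0 s) +
     ennreal C * (\<integral>\<^sup>+\<xi>. ennreal (pw 4 (fst (daughters \<theta> \<kappa> s \<xi>)) + pw 4 (snd (daughters \<theta> \<kappa> s \<xi>))) \<partial>noise \<theta>)"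
    by (simp add: nn_integral_add nn_integral_cmult nn_noise_count del: ennreal_plus)
  also have "\<dots> < \<infinity>"
    using le_less_trans[OF D(4)[of s] ennreal_less_top] noise.emeasure_space_1
    by (auto simp: ennreal_mult_less_top simp del: space_noise)
  finally show "(\<integral>\<^sup>+\<xi>. ennreal (norm ((g (s, daughters \<theta> \<kappa> s \<xi>))\<^sup>2)) \<partial>noise \<theta>) < \<infinity>" .
qed

lemma noise_integrable:
  assumes g: "tame g"
  shows "integrable (noise \<theta>) (\<lambda>\<xi>. g (s, daughters \<theta> \<kappa> s \<xi>))"
proof -
  note [measurable] = tame_measurable[OF g]
  show ?thesis
    by (rule noise.square_integrable_imp_integrable[OF _ noise_square_integrable[OF g]]) measurable
qed

lemma measurable_cond_mean [measurable]:
  assumes g: "tame g"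
  shows "cond_mean \<theta> \<kappa> g \<in> borel_measurable state_space"
proof -
  note [measurable] = tame_measurable[OF g]
  show ?thesis unfolding cond_mean_def by measurable
qed

text \<open>The mothers are in generation \<open>k\<close> and the daughters in generation
  \<open>Suc k\<close>, so two expected population sizes contribute; hence the factor
  \<open>1 + m\<close> in the constant.\<close>

lemma second_moment_bound:
  assumes g: "tame g"
  obtains C where "C \<ge> 0" "\<And>k. (\<Sum>i\<in>generation k. \<integral>\<^sup>+\<omega>. ennreal ((g (X i \<omega>, ch i \<omega>))\<^sup>2) \<partial>M) \<le> ennreal (C * m ^ k)"
proof -
  note [measurable] = tame_measurable[OF g]
  obtain C where C: "C \<ge> 0" "\<And>s y. (g (s, y))\<^sup>2 \<le> C * (pw 0 s + pw 4 s + (pw 0 (fst y) + pw 4 (fst y)) + (pw 0 (snd y) + pw 4 (snd y)))"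
    by (rule tame_square[OF g]) blast
  obtain D where D: "0 \<le> D" "\<And>k. (\<integral>\<^sup>+\<omega>. (\<Sum>i\<in>generation k. ennreal (pw 0 (X i \<omega>) + pw 4 (X i \<omega>))) \<partial>M) \<le> ennreal (D * m ^ k)"
    by (rule expected_quartic) blast
  let ?e = "\<lambda>s. ennreal (pw 0 s + pw 4 s)"
  have "(\<Sum>i\<in>generation k. \<integral>\<^sup>+\<omega>. ennreal ((g (X i \<omega>, ch i \<omega>))\<^sup>2) \<partial>M) \<le> ennreal (C * D * (1 + m) * m ^ k)" for k
  proof -
    have "(\<Sum>i\<in>generation k. \<integral>\<^sup>+\<omega>. ennreal ((g (X i \<omega>, ch i \<omega>))\<^sup>2) \<partial>M) =
      (\<integral>\<^sup>+\<omega>. (\<Sum>i\<in>generation k. ennreal ((g (X i \<omega>, ch i \<omega>))\<^sup>2)) \<partial>M)"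
      by (intro nn_integral_sum[symmetric]) measurable
    also have "\<dots> \<le> (\<integral>\<^sup>+\<omega>. (\<Sum>i\<in>generation k. ennreal C * (?e (X i \<omega>) + (?e (X (i @ [False]) \<omega>) + ?e (X (i @ [True]) \<omega>)))) \<partial>M)"
    proof (intro nn_integral_mono sum_mono)
      fix \<omega> i
      have "ennreal ((g (X i \<omega>, ch i \<omega>))\<^sup>2) \<le> ennreal (C * (pw 0 (X i \<omega>) + pw 4 (X i \<omega>) + ((pw 0 (X (i @ [False]) \<omega>) + pw 4 (X (i @ [False]) \<omega>)) + (pw 0 (X (i @ [True]) \<omega>) + pw 4 (X (i @ [True]) \<omega>)))))"
        using C(2)[of "X i \<omega>" "ch i \<omega>"] by (intro ennreal_leI) (simp add: ch_fst_snd add_ac)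
      also have "\<dots> = ennreal C * (?e (X i \<omega>) + (?e (X (i @ [False]) \<omega>) + ?e (X (i @ [True]) \<omega>)))"
        using C(1) by (simp add: ennreal_mult)
      finally show "ennreal ((g (X i \<omega>, ch i \<omega>))\<^sup>2) \<le> \<dots>" .
    qed
    also have "\<dots> = ennreal C * ((\<integral>\<^sup>+\<omega>. (\<Sum>i\<in>generation k. ?e (X i \<omega>)) \<partial>M) + (\<integral>\<^sup>+\<omega>. (\<Sum>i\<in>generation (Suc k). ?e (X i \<omega>)) \<partial>M))"
      unfolding sum_generation_Suc
      by (subst nn_integral_add[symmetric]) (auto simp: sum_distrib_left[symmetric] sum.distrib nn_integral_cmult simp del: ennreal_plus)
    also have "\<dots> \<le> ennreal C * (ennreal (D * m ^ k) + ennreal (D * m ^ Suc k))"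
      by (intro mult_left_mono add_mono D) auto
    also have "\<dots> = ennreal (C * D * (1 + m) * m ^ k)"
      using C D by (simp add: ennreal_mult'[symmetric] ennreal_plus[symmetric] algebra_simps del: ennreal_plus)
    finally show ?thesis .
  qed
  with C D show ?thesis by (intro that[of "C * D * (1 + m)"]) auto
qed

definition dev :: "nat \<Rightarrow> (real option \<times> real option \<times> real option \<Rightarrow> real) \<Rightarrow> 'a \<Rightarrow> real" where
  "dev k g \<omega> = (\<Sum>i\<in>generation k. g (X i \<omega>, ch i \<omega>) - cond_mean \<theta> \<kappa> g (X i \<omega>))"

lemma measurable_dev [measurable]: "tame g \<Longrightarrow> dev k g \<in> borel_measurable M"
  unfolding dev_def using tame_measurable[of g] by measurable

text \<open>Given the past, the summands of different cells are independent and centred, so the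
  mixed terms of the square have mean 0 and the variance is of the order of the population, not of
  its square. Centring at the conditional mean only decreases second moments.\<close>

lemma dev_variance:
  assumes g: "tame g"
  shows "(\<integral>\<^sup>+\<omega>. ennreal ((dev k g \<omega>)\<^sup>2) \<partial>M) \<le> (\<Sum>i\<in>generation k. \<integral>\<^sup>+\<omega>. ennreal ((g (X i \<omega>, ch i \<omega>))\<^sup>2) \<partial>M)"
proof -
  note [measurable] = tame_measurable[OF g] measurable_cond_mean[OF g]
  define \<psi> where "\<psi> i \<omega> = g (X i \<omega>, ch i \<omega>) - cond_mean \<theta> \<kappa> g (X i \<omega>)" for i \<omega>
  have m\<psi> [measurable]: "\<psi> i \<in> borel_measurable M" for i unfolding \<psi>_def by measurable
  obtain C where C: "C \<ge> 0" "\<And>k. (\<Sum>i\<in>generation k. \<integral>\<^sup>+\<omega>. ennreal ((g (X i \<omega>, ch i \<omega>))\<^sup>2) \<partial>M) \<le> ennreal (C * m ^ k)"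
    by (rule second_moment_bound[OF g]) blast
  have sq: "(\<integral>\<^sup>+\<omega>. ennreal ((\<psi> i \<omega>)\<^sup>2) \<partial>M) \<le> (\<integral>\<^sup>+\<omega>. ennreal ((g (X i \<omega>, ch i \<omega>))\<^sup>2) \<partial>M)" if i: "i \<in> generation k" for i
  proof -
    have "(\<integral>\<^sup>+\<omega>. ennreal ((\<psi> i \<omega>)\<^sup>2) \<partial>M) =
      (\<integral>\<^sup>+\<omega>. (\<integral>\<^sup>+\<xi>. ennreal ((g (X i \<omega>, daughters \<theta> \<kappa> (X i \<omega>) \<xi>) - cond_mean \<theta> \<kappa> g (X i \<omega>))\<^sup>2) \<partial>noise \<theta>) \<partial>M)"
      using nn_integral_step1[OF i, of "\<lambda>p. ennreal ((g p - cond_mean \<theta> \<kappa> g (fst p))\<^sup>2)"] by (simp add: \<psi>_def)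
    also have "\<dots> \<le> (\<integral>\<^sup>+\<omega>. (\<integral>\<^sup>+\<xi>. ennreal ((g (X i \<omega>, daughters \<theta> \<kappa> (X i \<omega>) \<xi>))\<^sup>2) \<partial>noise \<theta>) \<partial>M)"
    proof (rule nn_integral_mono)
      fix \<omega>
      define h where "h \<xi> = g (X i \<omega>, daughters \<theta> \<kappa> (X i \<omega>) \<xi>)" for \<xi>
      have ih: "integrable (noise \<theta>) h" "integrable (noise \<theta>) (\<lambda>\<xi>. (h \<xi>)\<^sup>2)"
        unfolding h_def using noise_integrable[OF g] noise_square_integrable[OF g] by auto
      have i2: "integrable (noise \<theta>) (\<lambda>\<xi>. (h \<xi> - noise.expectation h)\<^sup>2)"
        using ih by (simp add: power2_diff)
      have "(\<integral>\<^sup>+\<xi>. ennreal ((h \<xi> - noise.expectation h)\<^sup>2) \<partial>noise \<theta>) = ennreal (noise.variance h)"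
        using i2 by (intro nn_integral_eq_integral) auto
      also have "noise.variance h = noise.expectation (\<lambda>\<xi>. (h \<xi>)\<^sup>2) - (noise.expectation h)\<^sup>2"
        using ih by (rule noise.variance_eq)
      also have "ennreal \<dots> \<le> ennreal (noise.expectation (\<lambda>\<xi>. (h \<xi>)\<^sup>2))" by (intro ennreal_leI) simp
      also have "\<dots> = (\<integral>\<^sup>+\<xi>. ennreal ((h \<xi>)\<^sup>2) \<partial>noise \<theta>)"
        using ih by (intro nn_integral_eq_integral[symmetric]) auto
      finally show "(\<integral>\<^sup>+\<xi>. ennreal ((g (X i \<omega>, daughters \<theta> \<kappa> (X i \<omega>) \<xi>) - cond_mean \<theta> \<kappa> g (X i \<omega>))\<^sup>2) \<partial>noise \<theta>) \<le>
         (\<integral>\<^sup>+\<xi>. ennreal ((g (X i \<omega>, daughters \<theta> \<kappa> (X i \<omega>) \<xi>))\<^sup>2) \<partial>noise \<theta>)"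
        by (simp add: h_def cond_mean_def)
    qed
    also have "\<dots> = (\<integral>\<^sup>+\<omega>. ennreal ((g (X i \<omega>, ch i \<omega>))\<^sup>2) \<partial>M)"
      using nn_integral_step1[OF i, of "\<lambda>p. ennreal ((g p)\<^sup>2)"] by simp
    finally show ?thesis .
  qed
  have isq: "integrable M (\<lambda>\<omega>. (\<psi> i \<omega>)\<^sup>2)" if i: "i \<in> generation k" for i
  proof (rule integrableI_bounded)
    have "(\<integral>\<^sup>+\<omega>. ennreal ((g (X i \<omega>, ch i \<omega>))\<^sup>2) \<partial>M) \<le> (\<Sum>i\<in>generation k. \<integral>\<^sup>+\<omega>. ennreal ((g (X i \<omega>, ch i \<omega>))\<^sup>2) \<partial>M)"
      using i by (intro member_le_sum) auto
    with sq[OF i] C(2)[of k] show "(\<integral>\<^sup>+\<omega>. ennreal (norm ((\<psi> i \<omega>)\<^sup>2)) \<partial>M) < \<infinity>"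
      by (auto intro: le_less_trans[OF order_trans[OF _ order_trans]])
  qed measurable
  have imul: "integrable M (\<lambda>\<omega>. \<psi> i \<omega> * \<psi> j \<omega>)" if i: "i \<in> generation k" "j \<in> generation k" for i j
  proof (rule Bochner_Integration.integrable_bound[of M "\<lambda>\<omega>. (\<psi> i \<omega>)\<^sup>2 + (\<psi> j \<omega>)\<^sup>2"])
    show "integrable M (\<lambda>\<omega>. (\<psi> i \<omega>)\<^sup>2 + (\<psi> j \<omega>)\<^sup>2)" using isq i by simp
    have "\<bar>x * y\<bar> \<le> x\<^sup>2 + y\<^sup>2" for x y :: real
    proof -
      have "0 \<le> \<bar>x\<bar> * \<bar>y\<bar>" by simp
      then show ?thesis
        using sum_squares_bound[of "\<bar>x\<bar>" "\<bar>y\<bar>"] unfolding abs_mult power2_abs by linarith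
    qed
    then show "AE \<omega> in M. norm (\<psi> i \<omega> * \<psi> j \<omega>) \<le> norm ((\<psi> i \<omega>)\<^sup>2 + (\<psi> j \<omega>)\<^sup>2)" by simp
  qed measurable
  have cross: "(\<integral>\<omega>. \<psi> i \<omega> * \<psi> j \<omega> \<partial>M) = 0" if ij: "i \<in> generation k" "j \<in> generation k" "i \<noteq> j" for i j
  proof -
    \<comment> \<open>The factor 1 at all other cells brings a product over two cells into the form
      of a product over the whole generation.\<close>
    define f where "f l \<omega> y = (if l = i \<or> l = j then g (X l \<omega>, y) - cond_mean \<theta> \<kappa> g (X l \<omega>) else 1)" for l \<omega> y
    have prod: "(\<Prod>l\<in>generation k. f l \<omega> (ch l \<omega>)) = \<psi> i \<omega> * \<psi> j \<omega>" for \<omega>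
    proof -
      have "(\<Prod>l\<in>generation k. f l \<omega> (ch l \<omega>)) = (\<Prod>l\<in>{i, j}. f l \<omega> (ch l \<omega>))"
        using ij by (intro prod.mono_neutral_right) (auto simp: f_def)
      then show ?thesis using ij by (simp add: f_def \<psi>_def)
    qed
    have "(\<integral>\<omega>. 1 * (\<Prod>l\<in>generation k. f l \<omega> (ch l \<omega>)) \<partial>M) =
      (\<integral>\<omega>. 1 * (\<Prod>l\<in>generation k. \<integral>\<xi>. f l \<omega> (daughters \<theta> \<kappa> (X l \<omega>) \<xi>) \<partial>noise \<theta>) \<partial>M)"
    proof (rule integral_step_prod)
      fix l assume l: "l \<in> generation k"
      have [measurable]: "X l \<in> F k \<rightarrow>\<^sub>M state_space" using l by (intro measurable_X_F) (simp add: generation_def)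
      show "(\<lambda>(\<omega>, y). f l \<omega> y) \<in> borel_measurable (F k \<Otimes>\<^sub>M state_pair_space)"
        unfolding f_def by measurable
      show "integrable (noise \<theta>) (\<lambda>\<xi>. f l \<omega> (daughters \<theta> \<kappa> (X l \<omega>) \<xi>))" for \<omega>
        unfolding f_def using noise_integrable[OF g, of "X l \<omega>"] by (cases "l = i \<or> l = j") simp_all
    qed (use imul ij in \<open>simp_all add: prod\<close>)
    also have "\<dots> = (\<integral>\<omega>. 0 \<partial>M)"
    proof (intro Bochner_Integration.integral_cong refl)
      fix \<omega>
      have "(\<integral>\<xi>. f i \<omega> (daughters \<theta> \<kappa> (X i \<omega>) \<xi>) \<partial>noise \<theta>) = 0"
        using noise_integrable[OF g, of "X i \<omega>"] noise.prob_space by (simp add: f_def cond_mean_def)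
      then show "1 * (\<Prod>l\<in>generation k. \<integral>\<xi>. f l \<omega> (daughters \<theta> \<kappa> (X l \<omega>) \<xi>) \<partial>noise \<theta>) = 0"
        using ij by (auto intro!: prod_zero)
    qed
    finally show ?thesis by (simp add: prod)
  qed
  have dev_sq: "(dev k g \<omega>)\<^sup>2 = (\<Sum>i\<in>generation k. \<Sum>j\<in>generation k. \<psi> i \<omega> * \<psi> j \<omega>)" for \<omega>
    by (simp add: dev_def \<psi>_def power2_eq_square sum_product)
  have "(\<integral>\<^sup>+\<omega>. ennreal ((dev k g \<omega>)\<^sup>2) \<partial>M) = ennreal (\<integral>\<omega>. (dev k g \<omega>)\<^sup>2 \<partial>M)"
  proof (rule nn_integral_eq_integral)
    show "integrable M (\<lambda>\<omega>. (dev k g \<omega>)\<^sup>2)"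
      unfolding dev_sq by (intro Bochner_Integration.integrable_sum imul)
  qed simp
  also have "(\<integral>\<omega>. (dev k g \<omega>)\<^sup>2 \<partial>M) = (\<Sum>i\<in>generation k. \<Sum>j\<in>generation k. \<integral>\<omega>. \<psi> i \<omega> * \<psi> j \<omega> \<partial>M)"
    unfolding dev_sq by (simp add: imul)
  also have "\<dots> = (\<Sum>i\<in>generation k. \<Sum>j\<in>generation k. if j = i then \<integral>\<omega>. (\<psi> i \<omega>)\<^sup>2 \<partial>M else 0)"
    using cross by (intro sum.cong refl) (auto simp: power2_eq_square)
  also have "\<dots> = (\<Sum>i\<in>generation k. \<integral>\<omega>. (\<psi> i \<omega>)\<^sup>2 \<partial>M)"
    by simp
  also have "ennreal \<dots> = (\<Sum>i\<in>generation k. ennreal (\<integral>\<omega>. (\<psi> i \<omega>)\<^sup>2 \<partial>M))"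
    by (subst sum_ennreal) auto
  also have "\<dots> = (\<Sum>i\<in>generation k. \<integral>\<^sup>+\<omega>. ennreal ((\<psi> i \<omega>)\<^sup>2) \<partial>M)"
    by (intro sum.cong nn_integral_eq_integral[symmetric] refl isq) auto
  also have "\<dots> \<le> (\<Sum>i\<in>generation k. \<integral>\<^sup>+\<omega>. ennreal ((g (X i \<omega>, ch i \<omega>))\<^sup>2) \<partial>M)"
    by (intro sum_mono sq)
  finally show ?thesis .
qed

text \<open>The weights \<open>(\<surd>m)\<^sup>k\<close> grow slower than the variances of \<open>dev k g / m ^ k\<close> decay; the same
  estimate then gives almost sure summability and, for the population size, convergence in
  mean square.\<close>

lemma dev_weighted_sum:
  assumes g: "tame g"
  shows "(\<integral>\<^sup>+\<omega>. (\<Sum>k. ennreal (sqrt m ^ k * (dev k g \<omega> / m ^ k)\<^sup>2)) \<partial>M) < \<infinity>"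
proof -
  note [measurable] = measurable_dev[OF g]
  obtain C where C: "C \<ge> 0" "\<And>k. (\<Sum>i\<in>generation k. \<integral>\<^sup>+\<omega>. ennreal ((g (X i \<omega>, ch i \<omega>))\<^sup>2) \<partial>M) \<le> ennreal (C * m ^ k)"
    by (rule second_moment_bound[OF g]) blast
  \<comment> \<open>The weight \<open>sqrt m ^ k\<close>, the norming
    \<open>(m ^ k) * (m ^ k)\<close> and the variance of order \<open>m ^ k\<close> combine to the
    \<open>k\<close>-th power of this ratio.\<close>
  define r where "r = 1 / sqrt m"
  have r: "0 \<le> r" "r < 1" using supercritical by (auto simp: r_def)
  have "(\<integral>\<^sup>+\<omega>. (\<Sum>k. ennreal (sqrt m ^ k * (dev k g \<omega> / m ^ k)\<^sup>2)) \<partial>M) =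
    (\<Sum>k. \<integral>\<^sup>+\<omega>. ennreal (sqrt m ^ k * (dev k g \<omega> / m ^ k)\<^sup>2) \<partial>M)"
    by (intro nn_integral_suminf) measurable
  also have "\<dots> \<le> (\<Sum>k. ennreal (C * r ^ k))"
  proof (intro suminf_le allI summableI)
    fix k
    have "(\<integral>\<^sup>+\<omega>. ennreal (sqrt m ^ k * (dev k g \<omega> / m ^ k)\<^sup>2) \<partial>M) =
      (\<integral>\<^sup>+\<omega>. ennreal (sqrt m ^ k / (m ^ k)\<^sup>2) * ennreal ((dev k g \<omega>)\<^sup>2) \<partial>M)"
      by (intro nn_integral_cong) (simp add: ennreal_mult'[symmetric] power_divide)
    also have "\<dots> = ennreal (sqrt m ^ k / (m ^ k)\<^sup>2) * (\<integral>\<^sup>+\<omega>. ennreal ((dev k g \<omega>)\<^sup>2) \<partial>M)"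
      by (intro nn_integral_cmult) measurable
    also have "\<dots> \<le> ennreal (sqrt m ^ k / (m ^ k)\<^sup>2) * ennreal (C * m ^ k)"
      by (intro mult_left_mono order_trans[OF dev_variance[OF g] C(2)]) auto
    also have "\<dots> = ennreal (C * r ^ k)"
    proof -
      have "sqrt m ^ k / (m ^ k)\<^sup>2 * (C * m ^ k) = C * (sqrt m ^ k / m ^ k)"
        by (simp add: power2_eq_square)
      also have "sqrt m ^ k / m ^ k = r ^ k"
      proof -
        have "sqrt m / m = r" unfolding r_def by (subst frac_eq_eq) simp_all
        then show ?thesis by (metis power_divide)
      qed
      finally show ?thesis by (simp add: ennreal_mult'[symmetric])
    qed
    finally show "(\<integral>\<^sup>+\<omega>. ennreal (sqrt m ^ k * (dev k g \<omega> / m ^ k)\<^sup>2) \<partial>M) \<le> ennreal (C * r ^ k)" .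
  qed
  also have "\<dots> < \<infinity>"
    using r C by (subst suminf_ennreal2) (auto intro!: summable_mult summable_geometric)
  finally show ?thesis .
qed

lemma dev_summable:
  assumes g: "tame g"
  shows "AE \<omega> in M. summable (\<lambda>k. sqrt m ^ k * (dev k g \<omega> / m ^ k)\<^sup>2)"
proof -
  note [measurable] = measurable_dev[OF g]
  have "AE \<omega> in M. (\<Sum>k. ennreal (sqrt m ^ k * (dev k g \<omega> / m ^ k)\<^sup>2)) \<noteq> \<infinity>"
    using dev_weighted_sum[OF g] by (intro nn_integral_noteq_infinite) auto
  then show ?thesis
  proof eventually_elim
    case (elim \<omega>)
    show ?case by (rule summable_suminf_not_top) (use elim in auto)
  qed
qed

end

context supercritical_bar
begin

lemma dev_null:
  assumes g: "tame g"
  shows "AE \<omega> in M. (\<lambda>k. dev k g \<omega> / m ^ k) \<longlonglongrightarrow> 0"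
  using dev_summable[OF g]
proof eventually_elim
  case (elim \<omega>)
  have le: "(dev k g \<omega> / m ^ k)\<^sup>2 \<le> sqrt m ^ k * (dev k g \<omega> / m ^ k)\<^sup>2" for k
  proof -
    have "1 \<le> sqrt m" using supercritical by simp
    then have "1 \<le> sqrt m ^ k" by (rule one_le_power)
    then have "1 * (dev k g \<omega> / m ^ k)\<^sup>2 \<le> sqrt m ^ k * (dev k g \<omega> / m ^ k)\<^sup>2"
      by (rule mult_right_mono) (rule zero_le_power2)
    then show ?thesis by (simp only: mult_1_left)
  qed
  have "(\<lambda>k. (dev k g \<omega> / m ^ k)\<^sup>2) \<longlonglongrightarrow> 0"
    by (rule tendsto_sandwich[where f="\<lambda>_. 0" and h="\<lambda>k. sqrt m ^ k * (dev k g \<omega> / m ^ k)\<^sup>2",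
          OF always_eventually always_eventually tendsto_const summable_LIMSEQ_zero[OF elim]])
       (use le in \<open>blast intro: zero_le_power2\<close>)+
  then have "(\<lambda>k. \<bar>dev k g \<omega> / m ^ k\<bar>) \<longlonglongrightarrow> 0"
    using tendsto_real_sqrt by fastforce
  then show ?case by (rule tendsto_rabs_zero_cancel)
qed

text \<open>The process is given by its conditional laws alone, so daughters of dead cells are dead
  only almost surely. As there are countably many nodes, one null set serves them all.\<close>

lemma dead_daughters: "AE \<omega> in M. \<forall>i::node. X i \<omega> = None \<longrightarrow> ch i \<omega> = (None, None)"
proof (subst AE_all_countable, intro allI)
  fix i :: node
  define k where "k = length i"
  have i: "i \<in> generation k" by (simp add: k_def generation_def)
  define g :: "real option \<times> real option \<times> real option \<Rightarrow> ennreal" where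
    "g = (\<lambda>p. if fst p = None \<and> \<not> (fst (snd p) = None \<and> snd (snd p) = None) then 1 else 0)"
  have [measurable]: "g \<in> borel_measurable (state_space \<Otimes>\<^sub>M state_pair_space)"
    unfolding g_def by measurable
  have "(\<integral>\<^sup>+\<omega>. g (X i \<omega>, ch i \<omega>) \<partial>M) = (\<integral>\<^sup>+\<omega>. (\<integral>\<^sup>+\<xi>. g (X i \<omega>, daughters \<theta> \<kappa> (X i \<omega>) \<xi>) \<partial>noise \<theta>) \<partial>M)"
    by (rule nn_integral_step1[OF i]) measurable
  also have "\<dots> = (\<integral>\<^sup>+\<omega>. (\<integral>\<^sup>+\<xi>. 0 \<partial>noise \<theta>) \<partial>M)"
    by (intro nn_integral_cong) (auto simp: g_def)
  finally have "AE \<omega> in M. g (X i \<omega>, ch i \<omega>) = 0"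
    by (subst nn_integral_0_iff_AE[symmetric]) simp_all
  then show "AE \<omega> in M. X i \<omega> = None \<longrightarrow> ch i \<omega> = (None, None)"
    by eventually_elim (auto simp: g_def prod_eq_iff split: if_splits)
qed

end

section \<open>Recurrences and series of real numbers\<close>

lemma tendsto_affine_recurrence:
  fixes u v :: "nat \<Rightarrow> real"
  assumes a: "\<bar>a\<bar> < 1" and u: "\<And>n. u (Suc n) = a * u n + v n" and v: "v \<longlonglongrightarrow> L"
  shows "u \<longlonglongrightarrow> L / (1 - a)"
proof -
  define l where "l = L / (1 - a)"
  have "l * (1 - a) = L" using a by (auto simp: l_def)
  then have L: "L = l - a * l" by (simp add: algebra_simps)
  have "\<forall>\<^sub>F n in sequentially. \<bar>u n - l\<bar> < e" if e: "e > 0" for e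
  proof -
    \<comment> \<open>With this choice \<open>\<bar>a\<bar> * (e / 2) + d\<close> is again
      \<open>e / 2\<close>: the constant part of the bound reproduces itself while the rest decays
      geometrically.\<close>
    define d where "d = (e / 2) * (1 - \<bar>a\<bar>)"
    have d: "d > 0" using e a by (simp add: d_def)
    obtain N where N: "\<And>n. n \<ge> N \<Longrightarrow> \<bar>v n - L\<bar> < d"
      using v[THEN tendstoD, OF d] by (auto simp: eventually_sequentially dist_real_def)
    have bound: "\<bar>u (N + n) - l\<bar> \<le> \<bar>a\<bar> ^ n * \<bar>u N - l\<bar> + e / 2" for n
    proof (induction n)
      case 0 then show ?case using e by simp
    next
      case (Suc n)
      have "u (N + Suc n) - l = a * (u (N + n) - l) + (v (N + n) - L)"
        by (simp add: u L algebra_simps)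
      then have "\<bar>u (N + Suc n) - l\<bar> \<le> \<bar>a\<bar> * \<bar>u (N + n) - l\<bar> + \<bar>v (N + n) - L\<bar>"
        by (metis abs_mult abs_triangle_ineq)
      also have "\<dots> \<le> \<bar>a\<bar> * (\<bar>a\<bar> ^ n * \<bar>u N - l\<bar> + e / 2) + d"
        using Suc N[of "N + n"] by (intro add_mono mult_left_mono) auto
      also have "\<dots> = \<bar>a\<bar> ^ Suc n * \<bar>u N - l\<bar> + e / 2"
        by (simp add: d_def field_simps)
      finally show ?case .
    qed
    have "(\<lambda>n. \<bar>a\<bar> ^ n * \<bar>u N - l\<bar> + e / 2) \<longlonglongrightarrow> 0 * \<bar>u N - l\<bar> + e / 2"
      using a by (intro tendsto_intros LIMSEQ_power_zero) simp
    then have "\<forall>\<^sub>F n in sequentially. \<bar>a\<bar> ^ n * \<bar>u N - l\<bar> + e / 2 < e"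
      by (rule order_tendstoD) (use e in simp)
    then have "\<forall>\<^sub>F n in sequentially. \<bar>u (N + n) - l\<bar> < e"
      by eventually_elim (use bound in \<open>blast intro: le_less_trans\<close>)
    then have "\<forall>\<^sub>F n in sequentially. \<bar>u (n + N) - l\<bar> < e" by (simp add: add.commute)
    then show ?thesis by (subst (asm) eventually_sequentially_seg[where P="\<lambda>n. \<bar>u n - l\<bar> < e"])
  qed
  then show ?thesis unfolding l_def[symmetric] by (intro tendstoI) (simp add: dist_real_def)
qed

text \<open>The average satisfies an affine recurrence with contraction factor \<open>1 / m\<close>.
  The weights concentrate on the last generations, and the factor in the limit is the sum of the
  geometric series in \<open>1 / m\<close>.\<close>

lemma tendsto_geometric_average:
  fixes u :: "nat \<Rightarrow> real"
  assumes m: "m > 1" and u: "u \<longlonglongrightarrow> L"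
  shows "(\<lambda>n. (\<Sum>k\<le>n. m ^ k * u k) / m ^ n) \<longlonglongrightarrow> L * (m / (m - 1))"
proof -
  have "(\<lambda>n. (\<Sum>k\<le>n. m ^ k * u k) / m ^ n) \<longlonglongrightarrow> L / (1 - 1 / m)"
  proof (rule tendsto_affine_recurrence[where v="\<lambda>n. u (Suc n)"])
    show "(\<Sum>k\<le>Suc n. m ^ k * u k) / m ^ Suc n = 1 / m * ((\<Sum>k\<le>n. m ^ k * u k) / m ^ n) + u (Suc n)" for n
      using m by (simp add: field_simps)
    show "(\<lambda>n. u (Suc n)) \<longlonglongrightarrow> L" using u by (rule LIMSEQ_Suc)
  qed (use m in simp)
  also have "L / (1 - 1 / m) = L * (m / (m - 1))" using m by (simp add: field_simps)
  finally show ?thesis .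
qed

text \<open>Cauchy-Schwarz splits a tail of increments into a geometric tail and the total of
  \<open>t\<close>. The factor depending on \<open>k\<close> is thus deterministic, so that
  finiteness of the mean of \<open>suminf t\<close> gives a rate in mean square besides the pathwise
  limit.\<close>

lemma convergent_weighted_increments:
  fixes s t :: "nat \<Rightarrow> real"
  assumes r: "0 < r" "r < 1" and t: "summable t" "\<And>j. t j \<ge> 0"
    and d: "\<And>j. (s (Suc j) - s j)\<^sup>2 \<le> r ^ j * t j"
  shows "convergent s" "(lim s - s k)\<^sup>2 \<le> r ^ k / (1 - r) * suminf t"
proof -
  \<comment> \<open>This crude bound by two summable sequences gives convergence; the quantitative
    estimate further down keeps the product \<open>r ^ j * t j\<close>.\<close>
  have am: "\<bar>s (Suc j) - s j\<bar> \<le> r ^ j + t j" for j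
  proof -
    have "0 \<le> r ^ j * t j" using t(2)[of j] r by simp
    moreover have "(r ^ j + t j)\<^sup>2 = (r ^ j)\<^sup>2 + (t j)\<^sup>2 + 2 * (r ^ j * t j)"
      by (simp add: power2_sum)
    ultimately have "(s (Suc j) - s j)\<^sup>2 \<le> (r ^ j + t j)\<^sup>2"
      using d[of j] zero_le_power2[of "r ^ j"] zero_le_power2[of "t j"] by linarith
    then show ?thesis using abs_le_square_iff[of "s (Suc j) - s j" "r ^ j + t j"] t(2)[of j] r by simp
  qed
  have "summable (\<lambda>j. s (Suc j) - s j)"
    by (rule summable_comparison_test'[of "\<lambda>j. r ^ j + t j"])
       (use r t am in \<open>auto intro!: summable_add summable_geometric\<close>)
  then have "convergent (\<lambda>n. s 0 + (\<Sum>j<n. s (Suc j) - s j))"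
    by (intro convergent_add convergent_const) (simp add: summable_iff_convergent)
  then show conv: "convergent s" by (simp add: sum_lessThan_telescope)
  have fin: "(s (k + n) - s k)\<^sup>2 \<le> r ^ k / (1 - r) * suminf t" for n
  proof -
    let ?J = "{k..<k + n}"
    have "s (k + n) - s k = (\<Sum>j\<in>?J. s (Suc j) - s j)"
      by (subst sum_Suc_diff') auto
    then have "\<bar>s (k + n) - s k\<bar> \<le> (\<Sum>j\<in>?J. \<bar>s (Suc j) - s j\<bar>)" by (metis sum_abs)
    also have "\<dots> \<le> (\<Sum>j\<in>?J. sqrt (r ^ j) * sqrt (t j))"
      using d by (intro sum_mono) (metis real_sqrt_abs real_sqrt_le_iff real_sqrt_mult)
    finally have "(s (k + n) - s k)\<^sup>2 \<le> (\<Sum>j\<in>?J. sqrt (r ^ j) * sqrt (t j))\<^sup>2"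
      by (metis abs_ge_zero power2_abs power_mono)
    also have "\<dots> \<le> (\<Sum>j\<in>?J. (sqrt (r ^ j))\<^sup>2) * (\<Sum>j\<in>?J. (sqrt (t j))\<^sup>2)"
      by (rule Cauchy_Schwarz_ineq_sum)
    also have "\<dots> = (\<Sum>j\<in>?J. r ^ j) * (\<Sum>j\<in>?J. t j)"
      using r t by simp
    also have "\<dots> \<le> r ^ k / (1 - r) * suminf t"
    proof (intro mult_mono)
      have "(\<Sum>j\<in>?J. r ^ j) = r ^ k * (\<Sum>j<n. r ^ j)"
        using sum.shift_bounds_nat_ivl[of "\<lambda>j. r ^ j" 0 k n]
        by (simp add: power_add sum_distrib_left lessThan_atLeast0 add.commute mult.commute)
      also have "\<dots> \<le> r ^ k * (1 / (1 - r))"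
        using r sum_le_suminf[OF summable_geometric[of r], of "{..<n}"] by (intro mult_left_mono) (auto simp: suminf_geometric)
      finally show "(\<Sum>j\<in>?J. r ^ j) \<le> r ^ k / (1 - r)" by simp
      show "(\<Sum>j\<in>?J. t j) \<le> suminf t" by (intro sum_le_suminf t) auto
      show "0 \<le> r ^ k / (1 - r)" using r by simp
      show "0 \<le> (\<Sum>j\<in>?J. t j)" by (intro sum_nonneg t)
    qed
    finally show ?thesis .
  qed
  have "s \<longlonglongrightarrow> lim s" using conv by (simp add: convergent_LIMSEQ_iff)
  then have "(\<lambda>n. s (n + k)) \<longlonglongrightarrow> lim s" by (rule LIMSEQ_ignore_initial_segment)
  then have "(\<lambda>n. (s (n + k) - s k)\<^sup>2) \<longlonglongrightarrow> (lim s - s k)\<^sup>2" by (intro tendsto_intros)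
  then show "(lim s - s k)\<^sup>2 \<le> r ^ k / (1 - r) * suminf t"
    by (rule LIMSEQ_le_const2) (use fin in \<open>simp add: add.commute[of _ k]\<close>)
qed

section \<open>Empirical moments of a generation and the population limit\<close>

definition pwsum :: "nat \<Rightarrow> real option \<times> real option \<times> real option \<Rightarrow> real" where
  "pwsum j = (\<lambda>(s, y0, y1). pw j y0 + pw j y1)"

lemma tame_pwsum: assumes "j \<le> 2" shows "tame (pwsum j)"
proof (rule tameI[of _ 1])
  show "pwsum j \<in> borel_measurable (state_space \<Otimes>\<^sub>M state_pair_space)"
    unfolding pwsum_def split_beta' by measurable
  have "\<bar>pw j y\<bar> \<le> pw 0 y + pw 2 y" for y
  proof -
    have "j = 0 \<or> j = 1 \<or> j = 2" using assms by auto
    moreover have "\<bar>x\<bar> \<le> 1 + x\<^sup>2" for x :: real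
      using sum_squares_bound[of "\<bar>x\<bar>" 1] by (simp add: power2_eq_square)
    ultimately show ?thesis by (cases y) auto
  qed
  then show "\<bar>pwsum j (s, y0, y1)\<bar> \<le> 1 * (pw 0 s + pw 2 s + pw 0 y0 + pw 2 y0 + pw 0 y1 + pw 2 y1)" for s y0 y1
    unfolding pwsum_def using abs_triangle_ineq[of "pw j y0" "pw j y1"] pw_even_nonneg(1,2)[of s]
    by (smt (verit) case_prod_conv)
qed simp

context supercritical_bar
begin

definition S :: "nat \<Rightarrow> nat \<Rightarrow> 'a \<Rightarrow> real" where
  "S j k \<omega> = (\<Sum>i\<in>generation k. pw j (X i \<omega>)) / m ^ k"

lemma measurable_S [measurable]: "S j k \<in> borel_measurable M"
  unfolding S_def by measurable

lemma S_Suc: "S j (Suc k) \<omega> = ((\<Sum>i\<in>generation k. cond_mean \<theta> \<kappa> (pwsum j) (X i \<omega>)) / m ^ k + dev k (pwsum j) \<omega> / m ^ k) / m"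
proof -
  have "(\<Sum>i\<in>generation (Suc k). pw j (X i \<omega>)) = (\<Sum>i\<in>generation k. pwsum j (X i \<omega>, ch i \<omega>))"
    by (simp add: sum_generation_Suc pwsum_def ch_def)
  also have "\<dots> = (\<Sum>i\<in>generation k. cond_mean \<theta> \<kappa> (pwsum j) (X i \<omega>)) + dev k (pwsum j) \<omega>"
    by (simp add: dev_def sum_subtractf)
  finally show ?thesis by (simp add: S_def field_simps)
qed

lemma S0_Suc: "S 0 (Suc k) \<omega> = S 0 k \<omega> + dev k (pwsum 0) \<omega> / m ^ k / m"
  unfolding S_Suc pwsum_def cond_mean_pw by (simp add: S_def sum_distrib_left[symmetric] add_divide_distrib)

lemma S1_Suc: "S 1 (Suc k) \<omega> = alpha_bar \<theta> * S 1 k \<omega> + (beta_bar \<theta> * S 0 k \<omega> + dev k (pwsum 1) \<omega> / m ^ k / m)"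
proof -
  have "(\<Sum>i\<in>generation k. cond_mean \<theta> \<kappa> (pwsum 1) (X i \<omega>)) / m ^ k = m * (alpha_bar \<theta> * S 1 k \<omega> + beta_bar \<theta> * S 0 k \<omega>)"
    unfolding pwsum_def cond_mean_pw S_def sum_distrib_left[symmetric] sum.distrib by (simp add: field_simps)
  then show ?thesis unfolding S_Suc by (simp add: add_divide_distrib)
qed

lemma S2_Suc: "S 2 (Suc k) \<omega> = alpha2_bar \<theta> * S 2 k \<omega> +
   (2 * alpha_beta_bar \<theta> * S 1 k \<omega> + (beta2_bar \<theta> + sigma2_bar \<theta> \<kappa>) * S 0 k \<omega> + dev k (pwsum 2) \<omega> / m ^ k / m)"
proof -
  have "(\<Sum>i\<in>generation k. cond_mean \<theta> \<kappa> (pwsum 2) (X i \<omega>)) / m ^ k =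
     m * (alpha2_bar \<theta> * S 2 k \<omega> + 2 * alpha_beta_bar \<theta> * S 1 k \<omega> + (beta2_bar \<theta> + sigma2_bar \<theta> \<kappa>) * S 0 k \<omega>)"
    unfolding pwsum_def cond_mean_pw S_def sum_distrib_left[symmetric] sum.distrib by (simp add: field_simps)
  then show ?thesis unfolding S_Suc by (simp add: add_divide_distrib)
qed

definition W :: "'a \<Rightarrow> real" where "W \<omega> = lim (\<lambda>k. S 0 k \<omega>)"

lemma measurable_W [measurable]: "W \<in> borel_measurable M"
  unfolding W_def by measurable

text \<open>The population size has no drift after norming, so its increments are centred sums. The
  same random series bounds the distance to the limit for every \<open>k\<close>; it has a finite
  mean, and integrating the bound gives convergence in mean square.\<close>

lemma S0_limit_bound:
  "AE \<omega> in M. (\<lambda>k. S 0 k \<omega>) \<longlonglongrightarrow> W \<omega> \<and>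
    (\<forall>k. ennreal ((S 0 k \<omega> - W \<omega>)\<^sup>2) \<le> ennreal ((1 / sqrt m) ^ k / (1 - 1 / sqrt m)) *
       (\<Sum>j. ennreal (sqrt m ^ j * (dev j (pwsum 0) \<omega> / m ^ j)\<^sup>2)))"
  using dev_summable[OF tame_pwsum[of 0, simplified]]
proof eventually_elim
  case (elim \<omega>)
  define t where "t j = sqrt m ^ j * (dev j (pwsum 0) \<omega> / m ^ j)\<^sup>2" for j
  define r where "r = 1 / sqrt m"
  have r: "0 < r" "r < 1" using supercritical by (auto simp: r_def)
  have t: "summable t" "\<And>j. t j \<ge> 0" using elim by (simp_all add: t_def[abs_def])
  have rt: "r ^ j * t j = (dev j (pwsum 0) \<omega> / m ^ j)\<^sup>2" for j
    by (simp add: r_def t_def power_divide)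
  have d: "(S 0 (Suc j) \<omega> - S 0 j \<omega>)\<^sup>2 \<le> r ^ j * t j" for j
  proof -
    have "(S 0 (Suc j) \<omega> - S 0 j \<omega>)\<^sup>2 = (dev j (pwsum 0) \<omega> / m ^ j)\<^sup>2 / m\<^sup>2"
      by (simp add: S0_Suc power_divide power_mult_distrib)
    also have "\<dots> \<le> (dev j (pwsum 0) \<omega> / m ^ j)\<^sup>2 / 1"
      using supercritical by (intro divide_left_mono) (auto intro: one_le_power)
    finally show ?thesis by (simp add: rt)
  qed
  note c = convergent_weighted_increments[OF r t d]
  have "(\<lambda>k. S 0 k \<omega>) \<longlonglongrightarrow> W \<omega>"
    using c(1) by (simp add: convergent_LIMSEQ_iff W_def)
  moreover have "ennreal ((S 0 k \<omega> - W \<omega>)\<^sup>2) \<le> ennreal (r ^ k / (1 - r)) * (\<Sum>j. ennreal (t j))" for k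
  proof -
    have "ennreal ((S 0 k \<omega> - W \<omega>)\<^sup>2) \<le> ennreal (r ^ k / (1 - r) * suminf t)"
      using c(2)[of k] by (intro ennreal_leI) (simp add: W_def power2_commute)
    also have "\<dots> = ennreal (r ^ k / (1 - r)) * ennreal (suminf t)"
      using r by (intro ennreal_mult') simp
    also have "ennreal (suminf t) = (\<Sum>j. ennreal (t j))"
      by (rule suminf_ennreal2[OF t(2,1), symmetric])
    finally show ?thesis .
  qed
  ultimately show ?case by (simp add: r_def t_def)
qed

lemma S0_tendsto_W: "AE \<omega> in M. (\<lambda>k. S 0 k \<omega>) \<longlonglongrightarrow> W \<omega>"
  using S0_limit_bound by eventually_elim simp

lemma S0_L2: "(\<lambda>k. \<integral>\<^sup>+\<omega>. ennreal ((S 0 k \<omega> - W \<omega>)\<^sup>2) \<partial>M) \<longlonglongrightarrow> 0"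
proof -
  note [measurable] = measurable_dev[OF tame_pwsum[of 0, simplified]]
  define K where "K = (\<integral>\<^sup>+\<omega>. (\<Sum>j. ennreal (sqrt m ^ j * (dev j (pwsum 0) \<omega> / m ^ j)\<^sup>2)) \<partial>M)"
  have K: "K < \<infinity>" unfolding K_def by (rule dev_weighted_sum[OF tame_pwsum]) simp
  have le: "(\<integral>\<^sup>+\<omega>. ennreal ((S 0 k \<omega> - W \<omega>)\<^sup>2) \<partial>M) \<le> ennreal ((1 / sqrt m) ^ k / (1 - 1 / sqrt m)) * K" for k
  proof -
    have "(\<integral>\<^sup>+\<omega>. ennreal ((S 0 k \<omega> - W \<omega>)\<^sup>2) \<partial>M) \<le> (\<integral>\<^sup>+\<omega>. ennreal ((1 / sqrt m) ^ k / (1 - 1 / sqrt m)) *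
       (\<Sum>j. ennreal (sqrt m ^ j * (dev j (pwsum 0) \<omega> / m ^ j)\<^sup>2)) \<partial>M)"
      by (rule nn_integral_mono_AE) (use S0_limit_bound in eventually_elim, blast)
    also have "\<dots> = ennreal ((1 / sqrt m) ^ k / (1 - 1 / sqrt m)) * K"
      unfolding K_def by (rule nn_integral_cmult) measurable
    finally show ?thesis .
  qed
  have "(\<lambda>k. (1 / sqrt m) ^ k / (1 - 1 / sqrt m)) \<longlonglongrightarrow> 0 / (1 - 1 / sqrt m)"
    using supercritical by (intro tendsto_intros LIMSEQ_power_zero) auto
  then have "(\<lambda>k. ennreal ((1 / sqrt m) ^ k / (1 - 1 / sqrt m)) * K) \<longlonglongrightarrow> ennreal 0 * K"
    using K ennreal_tendsto_cmult[OF _ tendsto_ennrealI, of K "\<lambda>k. (1 / sqrt m) ^ k / (1 - 1 / sqrt m)" 0 sequentially]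
    by (simp add: mult.commute)
  then have lim: "(\<lambda>k. ennreal ((1 / sqrt m) ^ k / (1 - 1 / sqrt m)) * K) \<longlonglongrightarrow> 0" by simp
  show ?thesis
    by (rule tendsto_sandwich[OF _ _ tendsto_const lim]) (simp_all add: le always_eventually del: ennreal_eq_0_iff)
qed

lemma W_nonneg: "AE \<omega> in M. W \<omega> \<ge> 0"
  using S0_tendsto_W by eventually_elim (rule LIMSEQ_le_const, auto simp: S_def sum_nonneg)

lemma nn_integral_S0: "(\<integral>\<^sup>+\<omega>. ennreal (S 0 k \<omega>) \<partial>M) = 1"
proof -
  have "(\<integral>\<^sup>+\<omega>. ennreal (S 0 k \<omega>) \<partial>M) = (\<integral>\<^sup>+\<omega>. ennreal (1 / m ^ k) * (\<Sum>i\<in>generation k. ennreal (pw 0 (X i \<omega>))) \<partial>M)"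
    by (intro nn_integral_cong) (simp add: S_def ennreal_mult'[symmetric] sum_nonneg)
  also have "\<dots> = ennreal (1 / m ^ k) * ennreal (m ^ k)"
    by (subst nn_integral_cmult, measurable) (subst expected_size, rule refl)
  also have "\<dots> = 1" by (simp add: ennreal_mult'[symmetric])
  finally show ?thesis .
qed

text \<open>The normed sizes have mean 1, hence second moment at least 1 by
  \<open>2 * s \<le> 1 + s * s\<close>. If \<open>W\<close> were almost surely 0, convergence in
  mean square would force these second moments to 0.\<close>

lemma W_not_null: "\<not> (AE \<omega> in M. W \<omega> = 0)"
proof
  assume W0: "AE \<omega> in M. W \<omega> = 0"
  have "(\<integral>\<^sup>+\<omega>. ennreal ((S 0 k \<omega> - W \<omega>)\<^sup>2) \<partial>M) = (\<integral>\<^sup>+\<omega>. ennreal ((S 0 k \<omega>)\<^sup>2) \<partial>M)" for k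
    by (intro nn_integral_cong_AE) (use W0 in eventually_elim, simp)
  then have lim: "(\<lambda>k. \<integral>\<^sup>+\<omega>. ennreal ((S 0 k \<omega>)\<^sup>2) \<partial>M) \<longlonglongrightarrow> 0" using S0_L2 by simp
  have "1 \<le> (\<integral>\<^sup>+\<omega>. ennreal ((S 0 k \<omega>)\<^sup>2) \<partial>M)" for k
  proof -
    have "2 * (\<integral>\<^sup>+\<omega>. ennreal (S 0 k \<omega>) \<partial>M) = (\<integral>\<^sup>+\<omega>. 2 * ennreal (S 0 k \<omega>) \<partial>M)"
      by (rule nn_integral_cmult[symmetric]) measurable
    also have "\<dots> \<le> (\<integral>\<^sup>+\<omega>. 1 + ennreal ((S 0 k \<omega>)\<^sup>2) \<partial>M)"
    proof (intro nn_integral_mono)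
      fix \<omega>
      have "S 0 k \<omega> \<ge> 0" by (simp add: S_def sum_nonneg)
      then have "2 * ennreal (S 0 k \<omega>) = ennreal (2 * S 0 k \<omega>)" by (simp add: ennreal_mult')
      also have "\<dots> \<le> ennreal (1 + (S 0 k \<omega>)\<^sup>2)"
        using sum_squares_bound[of 1 "S 0 k \<omega>"] by (intro ennreal_leI) simp
      also have "\<dots> = 1 + ennreal ((S 0 k \<omega>)\<^sup>2)" by simp
      finally show "2 * ennreal (S 0 k \<omega>) \<le> 1 + ennreal ((S 0 k \<omega>)\<^sup>2)" .
    qed
    also have "\<dots> = 1 + (\<integral>\<^sup>+\<omega>. ennreal ((S 0 k \<omega>)\<^sup>2) \<partial>M)"
      using emeasure_space_1 by (subst nn_integral_add) auto
    finally have "1 + 1 \<le> 1 + (\<integral>\<^sup>+\<omega>. ennreal ((S 0 k \<omega>)\<^sup>2) \<partial>M)"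
      unfolding nn_integral_S0 by simp
    then show ?thesis by (simp add: ennreal_add_left_cancel_le del: one_add_one)
  qed
  from LIMSEQ_le_const[OF lim] this have "(1::ennreal) \<le> 0" by blast
  then show False by simp
qed

end

section \<open>Extinction\<close>

lemma prod_generation_Suc:
  "(\<Prod>j\<in>generation (Suc k). \<phi> j) = (\<Prod>i\<in>generation k. \<phi> (i @ [False]) * (\<phi> (i @ [True]) :: 'c :: comm_monoid_mult))"
  unfolding generation_Suc by (subst prod.union_disjoint) (auto simp: prod.reindex inj_on_def prod.distrib)

lemma power_at_top:
  assumes "(c::real) > 1" shows "filterlim (\<lambda>n. c ^ n) at_top sequentially"
proof -
  have "filterlim (\<lambda>n. inverse ((1 / c) ^ n)) at_top sequentially"
    using assms by (intro filterlim_inverse_at_top LIMSEQ_power_zero) auto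
  then show ?thesis by (simp add: power_divide)
qed

definition offspring_gf :: "bar_theta \<Rightarrow> real \<Rightarrow> real" where
  "offspring_gf \<theta> s = p\<^sub>1\<^sub>0 \<theta> * s\<^sup>2 + (p\<^sub>0 \<theta> + p\<^sub>1 \<theta>) * s + (1 - p\<^sub>1\<^sub>0 \<theta> - p\<^sub>0 \<theta> - p\<^sub>1 \<theta>)"

context supercritical_bar
begin

definition Z :: "nat \<Rightarrow> 'a \<Rightarrow> nat" where
  "Z k \<omega> = card (alive (\<lambda>i. X i \<omega>) (generation k))"

lemma Z_sum: "Z k \<omega> = (\<Sum>i\<in>generation k. if X i \<omega> = None then 0 else 1)"
proof -
  have "(\<Sum>i\<in>generation k. if X i \<omega> = None then 0 else 1) = (\<Sum>i\<in>{i \<in> generation k. X i \<omega> \<noteq> None}. 1::nat)"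
    by (subst sum.inter_filter) (auto intro: sum.cong)
  then show ?thesis by (simp add: Z_def alive_def)
qed

lemma real_Z: "real (Z k \<omega>) = (\<Sum>i\<in>generation k. pw 0 (X i \<omega>))"
  by (auto simp: Z_sum pw_def intro: sum.cong)

lemma S0_Z: "S 0 k \<omega> = real (Z k \<omega>) / m ^ k"
  by (simp add: S_def real_Z)

lemma measurable_Z [measurable]: "Z k \<in> M \<rightarrow>\<^sub>M count_space UNIV"
  unfolding Z_sum by measurable

definition gf :: "nat \<Rightarrow> real \<Rightarrow> real" where
  "gf k s = (\<integral>\<omega>. s ^ Z k \<omega> \<partial>M)"

lemma gf_0: "gf 0 s = s"
proof -
  have "gf 0 s = (\<integral>\<omega>. s \<partial>M)" unfolding gf_def
    using ancestor_alive by (intro Bochner_Integration.integral_cong) (fastforce simp: Z_sum)+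
  then show ?thesis by (simp add: prob_space)
qed

text \<open>Given generation \<open>k\<close>, each living cell contributes the offspring generating
  function and each dead cell the factor 1, so the last generation is integrated out and the
  argument changes.\<close>

lemma gf_Suc:
  assumes s: "0 \<le> s" "s \<le> 1"
  shows "gf (Suc k) s = gf k (offspring_gf \<theta> s)"
proof -
  let ?c = "\<lambda>y. if y = None then 1 else s"
  have c: "0 \<le> ?c y" "?c y \<le> 1" for y :: "real option" using s by auto
  have pow: "s ^ Z k \<omega> = (\<Prod>i\<in>generation k. if X i \<omega> = None then 1 else s)" for s :: real and k \<omega>
    unfolding Z_sum power_sum by (intro prod.cong) auto
  have "gf (Suc k) s = (\<integral>\<omega>. 1 * (\<Prod>i\<in>generation k. ?c (fst (ch i \<omega>)) * ?c (snd (ch i \<omega>))) \<partial>M)"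
    unfolding gf_def pow prod_generation_Suc by (simp add: ch_def)
  also have "\<dots> = (\<integral>\<omega>. 1 * (\<Prod>i\<in>generation k. \<integral>\<xi>. ?c (fst (daughters \<theta> \<kappa> (X i \<omega>) \<xi>)) * ?c (snd (daughters \<theta> \<kappa> (X i \<omega>) \<xi>)) \<partial>noise \<theta>) \<partial>M)"
  proof (rule integral_step_prod)
    show "integrable M (\<lambda>\<omega>. 1 * (\<Prod>i\<in>generation k. ?c (fst (ch i \<omega>)) * ?c (snd (ch i \<omega>))))"
    proof (rule integrable_const_bound[where B=1])
      have "0 \<le> (\<Prod>i\<in>generation k. ?c (fst (ch i \<omega>)) * ?c (snd (ch i \<omega>)))" for \<omega>
        using c by (intro prod_nonneg mult_nonneg_nonneg) blast+
      moreover have "(\<Prod>i\<in>generation k. ?c (fst (ch i \<omega>)) * ?c (snd (ch i \<omega>))) \<le> 1" for \<omega>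
        using c by (intro prod_le_1 conjI mult_nonneg_nonneg mult_le_one) blast+
      ultimately show "AE \<omega> in M. norm (1 * (\<Prod>i\<in>generation k. ?c (fst (ch i \<omega>)) * ?c (snd (ch i \<omega>)))) \<le> 1"
        by (simp add: abs_of_nonneg)
    qed measurable
    show "integrable (noise \<theta>) (\<lambda>\<xi>. ?c (fst (daughters \<theta> \<kappa> (X i \<omega>) \<xi>)) * ?c (snd (daughters \<theta> \<kappa> (X i \<omega>) \<xi>)))" for i \<omega>
    proof (rule noise.integrable_const_bound[where B=1])
      show "AE \<xi> in noise \<theta>. norm (?c (fst (daughters \<theta> \<kappa> (X i \<omega>) \<xi>)) * ?c (snd (daughters \<theta> \<kappa> (X i \<omega>) \<xi>))) \<le> 1"
        using s by (auto simp: mult_le_one)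
    qed measurable
  qed measurable
  also have "\<dots> = (\<integral>\<omega>. (\<Prod>i\<in>generation k. if X i \<omega> = None then 1 else offspring_gf \<theta> s) \<partial>M)"
  proof -
    interpret g: prob_space gauss2 by (rule prob_space_gauss2)
    have "(\<integral>\<xi>. ?c (fst (daughters \<theta> \<kappa> y \<xi>)) * ?c (snd (daughters \<theta> \<kappa> y \<xi>)) \<partial>noise \<theta>) = (if y = None then 1 else offspring_gf \<theta> s)" for y
    proof (cases y)
      case None then show ?thesis by (simp add: noise.prob_space[simplified])
    next
      case (Some x)
      have cd: "?c (fst (daughters \<theta> \<kappa> y (\<tau>, z))) * ?c (snd (daughters \<theta> \<kappa> y (\<tau>, z))) = (if fst \<tau> then s else 1) * (if snd \<tau> then s else 1)" for \<tau> z
        by (simp add: Some daughters_def daughter_def)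
      show ?thesis
        by (subst integral_noise[OF admissible])
           (simp_all only: cd, auto simp: UNIV_types type_prob_def offspring_gf_def Some g.prob_space power2_eq_square algebra_simps)
    qed
    then show ?thesis by simp
  qed
  also have "\<dots> = gf k (offspring_gf \<theta> s)" by (simp add: gf_def pow)
  finally show ?thesis .
qed

lemma params_nonneg: "p\<^sub>1\<^sub>0 \<theta> \<ge> 0" "p\<^sub>0 \<theta> \<ge> 0" "p\<^sub>1 \<theta> \<ge> 0" "p\<^sub>1\<^sub>0 \<theta> + p\<^sub>0 \<theta> + p\<^sub>1 \<theta> \<le> 1"
  using admissible by (auto simp: admissible_def)

lemma p10_pos: "p\<^sub>1\<^sub>0 \<theta> > 0"
  using supercritical params_nonneg by (simp add: mean_offspring_def)

lemma offspring_gf_range: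
  assumes s: "0 \<le> s" "s \<le> 1" shows "0 \<le> offspring_gf \<theta> s" "offspring_gf \<theta> s \<le> 1"
proof -
  show "0 \<le> offspring_gf \<theta> s" using s params_nonneg by (auto simp: offspring_gf_def intro!: add_nonneg_nonneg)
  have "p\<^sub>1\<^sub>0 \<theta> * s\<^sup>2 \<le> p\<^sub>1\<^sub>0 \<theta> * 1" using s params_nonneg by (intro mult_left_mono power_le_one) auto
  moreover have "(p\<^sub>0 \<theta> + p\<^sub>1 \<theta>) * s \<le> (p\<^sub>0 \<theta> + p\<^sub>1 \<theta>) * 1" using s params_nonneg by (intro mult_left_mono) auto
  ultimately show "offspring_gf \<theta> s \<le> 1" by (simp add: offspring_gf_def)
qed

text \<open>An iterate commutes with the map itself, so the offspring function may be applied last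
  instead of first. In this order, passing to the limit in \<open>k\<close> yields a fixed point
  equation.\<close>

lemma gf_Suc':
  assumes s: "0 \<le> s" "s \<le> 1"
  shows "gf (Suc k) s = offspring_gf \<theta> (gf k s)"
  using s
proof (induction k arbitrary: s)
  case 0 then show ?case by (simp add: gf_Suc gf_0)
next
  case (Suc k)
  have "gf (Suc (Suc k)) s = gf (Suc k) (offspring_gf \<theta> s)" using Suc.prems by (rule gf_Suc)
  also have "\<dots> = offspring_gf \<theta> (gf k (offspring_gf \<theta> s))" using Suc offspring_gf_range by blast
  also have "gf k (offspring_gf \<theta> s) = gf (Suc k) s" using Suc.prems by (rule gf_Suc[symmetric])
  finally show ?case .
qed

lemma tendsto_offspring_gf [tendsto_intros]:
  "(u \<longlongrightarrow> l) Fl \<Longrightarrow> ((\<lambda>k. offspring_gf \<theta> (u k)) \<longlongrightarrow> offspring_gf \<theta> l) Fl"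
  unfolding offspring_gf_def by (intro tendsto_intros)

text \<open>Each cell has at most two daughters, so the fixed point equation is quadratic; dividing
  by the known root 1 leaves a linear equation for the other one.\<close>

lemma offspring_gf_fixed:
  assumes "offspring_gf \<theta> s = s" "s \<noteq> 1"
  shows "s = 1 - (m - 1) / p\<^sub>1\<^sub>0 \<theta>"
proof -
  have "(s - 1) * (p\<^sub>1\<^sub>0 \<theta> * s - (1 - p\<^sub>1\<^sub>0 \<theta> - p\<^sub>0 \<theta> - p\<^sub>1 \<theta>)) = offspring_gf \<theta> s - s"
    by (simp add: offspring_gf_def algebra_simps power2_eq_square)
  with assms have "p\<^sub>1\<^sub>0 \<theta> * s = 1 - p\<^sub>1\<^sub>0 \<theta> - p\<^sub>0 \<theta> - p\<^sub>1 \<theta>" by simp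
  then show ?thesis using p10_pos by (simp add: mean_offspring_def field_simps)
qed

section \<open>Laplace transform of the population limit and the probability that it
  vanishes\<close>

definition laplace_W :: "real \<Rightarrow> real" where
  "laplace_W l = (\<integral>\<omega>. exp (- l * W \<omega>) \<partial>M)"

lemma gf_tendsto_laplace:
  assumes l: "l \<ge> 0"
  shows "(\<lambda>k. gf k (exp (- l / m ^ k))) \<longlonglongrightarrow> laplace_W l"
proof -
  have eq: "gf k (exp (- l / m ^ k)) = (\<integral>\<omega>. exp (- l * S 0 k \<omega>) \<partial>M)" for k
    unfolding gf_def S0_Z by (simp add: exp_of_nat_mult[symmetric] mult_ac)
  show ?thesis unfolding eq laplace_W_def
  proof (rule integral_dominated_convergence[where w="\<lambda>_. 1"])
    show "AE \<omega> in M. (\<lambda>k. exp (- l * S 0 k \<omega>)) \<longlonglongrightarrow> exp (- l * W \<omega>)"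
      using S0_tendsto_W by eventually_elim (intro tendsto_intros)
    show "AE \<omega> in M. norm (exp (- l * S 0 k \<omega>)) \<le> 1" for k
      using l by (intro AE_I2) (simp add: S0_Z)
  qed auto
qed

text \<open>The Poincare functional equation of the population limit. It is the limit of the
  recursion of generating functions, as \<open>l / m ^ k\<close> is the same number as
  \<open>(m * l) / m ^ Suc k\<close>.\<close>

lemma laplace_W_fixed:
  assumes l: "l \<ge> 0"
  shows "laplace_W (m * l) = offspring_gf \<theta> (laplace_W l)"
proof (rule LIMSEQ_unique)
  show "(\<lambda>k. gf (Suc k) (exp (- (m * l) / m ^ Suc k))) \<longlonglongrightarrow> laplace_W (m * l)"
    using l by (intro LIMSEQ_Suc[OF gf_tendsto_laplace]) simp
  have "gf (Suc k) (exp (- (m * l) / m ^ Suc k)) = offspring_gf \<theta> (gf k (exp (- l / m ^ k)))" for k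
    using l by (subst gf_Suc') auto
  then show "(\<lambda>k. gf (Suc k) (exp (- (m * l) / m ^ Suc k))) \<longlonglongrightarrow> offspring_gf \<theta> (laplace_W l)"
    using l by (simp only:) (intro tendsto_intros gf_tendsto_laplace)
qed

definition ext_prob :: real where "ext_prob = measure M {\<omega> \<in> space M. W \<omega> = 0}"

text \<open>Along the arguments \<open>m ^ j\<close> the Laplace transform tends to the probability
  that \<open>W\<close> vanishes, and the functional equation turns this limit into a fixed point.
  It is not 1 because \<open>W\<close> is not almost surely 0.\<close>

lemma eta_value: "ext_prob = 1 - (m - 1) / p\<^sub>1\<^sub>0 \<theta>"
proof -
  have "(\<lambda>j. laplace_W (m ^ j)) \<longlonglongrightarrow> (\<integral>\<omega>. indicator {\<omega> \<in> space M. W \<omega> = 0} \<omega> \<partial>M)"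
    unfolding laplace_W_def
  proof (rule integral_dominated_convergence[where w="\<lambda>_. 1"])
    show "AE \<omega> in M. (\<lambda>j. exp (- (m ^ j) * W \<omega>)) \<longlonglongrightarrow> indicator {\<omega> \<in> space M. W \<omega> = 0} \<omega>"
      using W_nonneg AE_space
    proof eventually_elim
      case (elim \<omega>)
      show ?case
      proof (cases "W \<omega> = 0")
        case False
        with elim have W: "W \<omega> > 0" by simp
        have "filterlim (\<lambda>j. m ^ j) at_top sequentially"
          using supercritical by (intro power_at_top) simp
        then have "filterlim (\<lambda>j. m ^ j * W \<omega>) at_top sequentially"
          by (rule filterlim_at_top_mult_tendsto_pos[OF tendsto_const W])
        then have "(\<lambda>j. exp (- (m ^ j * W \<omega>))) \<longlonglongrightarrow> 0"
          by (intro filterlim_compose[OF exp_at_bot] filterlim_uminus_at_top[THEN iffD1]) simp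
        then show ?thesis using False by simp
      qed (use elim in simp)
    qed
    show "AE \<omega> in M. norm (exp (- (m ^ j) * W \<omega>)) \<le> 1" for j
      using W_nonneg by eventually_elim simp
  qed auto
  then have lim: "(\<lambda>j. laplace_W (m ^ j)) \<longlonglongrightarrow> ext_prob" by (simp add: ext_prob_def)
  have "(\<lambda>j. laplace_W (m ^ Suc j)) \<longlonglongrightarrow> offspring_gf \<theta> ext_prob"
    using tendsto_offspring_gf[OF lim] by (simp add: laplace_W_fixed)
  moreover have "(\<lambda>j. laplace_W (m ^ Suc j)) \<longlonglongrightarrow> ext_prob" using lim by (rule LIMSEQ_Suc)
  ultimately have fx: "offspring_gf \<theta> ext_prob = ext_prob" by (rule LIMSEQ_unique)
  have "ext_prob \<noteq> 1"
  proof
    assume "ext_prob = 1"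
    then have "AE \<omega> in M. \<omega> \<in> {\<omega> \<in> space M. W \<omega> = 0}"
      unfolding ext_prob_def by (subst (asm) prob_eq_1) auto
    then have "AE \<omega> in M. W \<omega> = 0" by eventually_elim simp
    with W_not_null show False by blast
  qed
  with fx show ?thesis by (rule offspring_gf_fixed)
qed

lemma dead_forever: "AE \<omega> in M. \<forall>k. Z k \<omega> = 0 \<longrightarrow> Z (Suc k) \<omega> = 0"
  using dead_daughters
proof eventually_elim
  case (elim \<omega>)
  show ?case
  proof (intro allI impI)
    fix k assume "Z k \<omega> = 0"
    then have "\<forall>i\<in>generation k. X i \<omega> = None" by (auto simp: Z_sum split: if_splits)
    with elim have "\<forall>i\<in>generation k. X (i @ [False]) \<omega> = None \<and> X (i @ [True]) \<omega> = None"
      by (auto simp: ch_def)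
    then show "Z (Suc k) \<omega> = 0" unfolding Z_sum sum_generation_Suc by simp
  qed
qed

lemma dead_forever': "AE \<omega> in M. \<forall>k n. k \<le> n \<longrightarrow> Z k \<omega> = 0 \<longrightarrow> Z n \<omega> = 0"
  using dead_forever
proof eventually_elim
  case (elim \<omega>)
  show ?case
  proof (intro allI impI)
    fix k n :: nat assume "k \<le> n" "Z k \<omega> = 0"
    then show "Z n \<omega> = 0" by (induction rule: dec_induct) (use elim in auto)
  qed
qed

lemma W_zero_iff_extinct: "AE \<omega> in M. W \<omega> = 0 \<longleftrightarrow> (\<exists>k. Z k \<omega> = 0)"
proof -
  define E where "E = {\<omega> \<in> space M. \<exists>k. Z k \<omega> = 0}"
  define E0 where "E0 = {\<omega> \<in> space M. W \<omega> = 0}"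
  have [measurable]: "E \<in> sets M" "E0 \<in> sets M" unfolding E_def E0_def by measurable
  have gf0: "gf k 0 = (\<integral>\<omega>. indicator {\<omega>. Z k \<omega> = 0} \<omega> \<partial>M)" for k
    unfolding gf_def by (intro Bochner_Integration.integral_cong) (auto simp: indicator_def power_0_left)
  have "(\<lambda>k. gf k 0) \<longlonglongrightarrow> (\<integral>\<omega>. indicator E \<omega> \<partial>M)"
    unfolding gf0
  proof (rule integral_dominated_convergence[where w="\<lambda>_. 1"])
    show "AE \<omega> in M. (\<lambda>k. indicator {\<omega>. Z k \<omega> = 0} \<omega> :: real) \<longlonglongrightarrow> indicator E \<omega>"
      using dead_forever' AE_space
    proof eventually_elim
      case (elim \<omega>)
      show ?case
      proof (cases "\<exists>k. Z k \<omega> = 0")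
        case True
        then obtain k where "Z k \<omega> = 0" by blast
        with elim have "\<forall>\<^sub>F n in sequentially. indicator {\<omega>. Z n \<omega> = 0} \<omega> = (1::real)"
          by (intro eventually_sequentiallyI[of k]) auto
        then show ?thesis using True elim by (intro tendsto_eventually) (simp add: E_def)
      qed (simp add: E_def)
    qed
  qed auto
  then have lim: "(\<lambda>k. gf k 0) \<longlonglongrightarrow> measure M E" by simp
  have "(\<lambda>k. gf (Suc k) 0) \<longlonglongrightarrow> offspring_gf \<theta> (measure M E)"
    using tendsto_offspring_gf[OF lim] by (simp add: gf_Suc')
  from LIMSEQ_unique[OF this LIMSEQ_Suc[OF lim]] have fx: "offspring_gf \<theta> (measure M E) = measure M E" .
  have sub: "AE \<omega> in M. \<omega> \<in> E \<longrightarrow> \<omega> \<in> E0"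
    using dead_forever' S0_tendsto_W AE_space
  proof eventually_elim
    case (elim \<omega>)
    show ?case
    proof
      assume "\<omega> \<in> E"
      then obtain k where "Z k \<omega> = 0" by (auto simp: E_def)
      with elim have "\<forall>\<^sub>F n in sequentially. S 0 n \<omega> = 0"
        by (intro eventually_sequentiallyI[of k]) (simp add: S0_Z)
      then have "(\<lambda>n. S 0 n \<omega>) \<longlonglongrightarrow> 0" by (rule tendsto_eventually)
      with elim have "W \<omega> = 0" using LIMSEQ_unique by blast
      with elim show "\<omega> \<in> E0" by (simp add: E0_def)
    qed
  qed
  have le: "measure M E \<le> measure M E0"
    by (rule finite_measure_mono_AE[OF sub]) simp
  have eta1: "ext_prob < 1" using supercritical p10_pos by (simp add: eta_value)
  \<comment> \<open>Extinction implies \<open>W = 0\<close> and the latter has probability less than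
    1, so the extinction probability is not 1 either; both are then the same root. Inclusion
    together with equal probability makes the difference of the events a null set.\<close>
  have eq: "measure M E = measure M E0"
    using offspring_gf_fixed[OF fx] le eta1 eta_value by (simp add: ext_prob_def E0_def)
  have "measure M (E0 - E) = measure M E0 - measure M (E0 \<inter> E)"
    by (rule finite_measure_Diff') auto
  also have "measure M (E0 \<inter> E) = measure M E"
    by (rule finite_measure_eq_AE) (use sub in auto)
  finally have "measure M (E0 - E) = 0" using eq by simp
  then have "AE \<omega> in M. \<omega> \<notin> E0 - E"
    by (intro AE_not_in) (auto simp: null_sets_def emeasure_eq_measure)
  with sub AE_space show ?thesis
    by eventually_elim (auto simp: E_def E0_def)
qed

end

section \<open>Consistency of the estimators\<close>

definition innovation_var :: "bar_kappa \<Rightarrow> bool \<times> bool \<Rightarrow> bool \<Rightarrow> real" where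
  "innovation_var \<kappa> \<tau> \<delta> = (load1 \<kappa> \<tau> \<delta>)\<^sup>2 + (load2 \<kappa> \<tau> \<delta>)\<^sup>2"

definition tsum :: "bool \<times> bool \<Rightarrow> (real \<Rightarrow> real \<Rightarrow> real \<Rightarrow> real) \<Rightarrow> (node \<Rightarrow> real option) \<Rightarrow> nat \<Rightarrow> real" where
  "tsum \<tau> f x k = (\<Sum>i\<in>generation k. stat \<tau> f (x i, x (i @ [False]), x (i @ [True])))"

definition monomial :: "bool \<Rightarrow> nat \<Rightarrow> nat \<Rightarrow> real \<Rightarrow> real \<Rightarrow> real \<Rightarrow> real" where
  "monomial \<delta> a b = (\<lambda>x y0 y1. x ^ a * (if \<delta> then y1 else y0) ^ b)"

text \<open>Limits of the empirical moments per living cell. Orders above 2 do not occur; the last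
  branch is meant for order 2.\<close>

definition stat_mom :: "bar_theta \<Rightarrow> bar_kappa \<Rightarrow> nat \<Rightarrow> real" where
  "stat_mom \<theta> \<kappa> a = (if a = 0 then 1 else if a = 1 then mu1 \<theta> else mu2 \<theta> \<kappa>)"

text \<open>The limiting mean of \<open>x ^ a * y ^ b\<close> for a mother \<open>x\<close> and a
  daughter \<open>y\<close> that is affine in \<open>x\<close> plus a centred innovation. The
  formula is meant for \<open>a + b \<le> 2\<close>; in particular the last branch presupposes
  \<open>a = 0\<close> and \<open>b = 2\<close>.\<close>

definition joint_mom :: "bar_theta \<Rightarrow> bar_kappa \<Rightarrow> bool \<times> bool \<Rightarrow> bool \<Rightarrow> nat \<Rightarrow> nat \<Rightarrow> real" where
  "joint_mom \<theta> \<kappa> \<tau> \<delta> a b = (if b = 0 then stat_mom \<theta> \<kappa> a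
     else if b = 1 then slope \<theta> \<tau> \<delta> * stat_mom \<theta> \<kappa> (Suc a) + icpt \<theta> \<tau> \<delta> * stat_mom \<theta> \<kappa> a
     else (slope \<theta> \<tau> \<delta>)\<^sup>2 * mu2 \<theta> \<kappa> + 2 * slope \<theta> \<tau> \<delta> * icpt \<theta> \<tau> \<delta> * mu1 \<theta> + (icpt \<theta> \<tau> \<delta>)\<^sup>2 + innovation_var \<kappa> \<tau> \<delta>)"

abbreviation both :: "bool \<times> bool" where "both \<equiv> (True, True)"

definition cross_mom :: "bar_theta \<Rightarrow> bar_kappa \<Rightarrow> real" where
  "cross_mom \<theta> \<kappa> = \<alpha>\<^sub>0 \<theta> * \<alpha>\<^sub>1 \<theta> * mu2 \<theta> \<kappa> + (\<alpha>\<^sub>0 \<theta> * \<beta>\<^sub>1 \<theta> + \<alpha>\<^sub>1 \<theta> * \<beta>\<^sub>0 \<theta>) * mu1 \<theta> + \<beta>\<^sub>0 \<theta> * \<beta>\<^sub>1 \<theta> + (\<sigma> \<kappa>)\<^sup>2 * \<rho> \<kappa>"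

text \<open>The only probabilistic input of the consistency of the estimators; \<open>w\<close> is the population limit.\<close>

definition typical :: "bar_theta \<Rightarrow> bar_kappa \<Rightarrow> real \<Rightarrow> (node \<Rightarrow> real option) \<Rightarrow> bool" where
  "typical \<theta> \<kappa> w x \<longleftrightarrow>
     (\<lambda>k. (\<Sum>i\<in>generation k. pw 0 (x i)) / mean_offspring \<theta> ^ k) \<longlonglongrightarrow> w \<and>
     (\<forall>\<tau> \<delta> a b. living \<tau> \<delta> \<longrightarrow> a + b \<le> 2 \<longrightarrow>
        (\<lambda>k. tsum \<tau> (monomial \<delta> a b) x k / mean_offspring \<theta> ^ k) \<longlonglongrightarrow> type_prob \<theta> \<tau> * w * joint_mom \<theta> \<kappa> \<tau> \<delta> a b) \<and>
     (\<lambda>k. tsum both (\<lambda>x y0 y1. y0 * y1) x k / mean_offspring \<theta> ^ k) \<longlonglongrightarrow> type_prob \<theta> both * w * cross_mom \<theta> \<kappa> \<and>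
     (\<forall>\<tau> i. type_prob \<theta> \<tau> = 0 \<longrightarrow> stat \<tau> (\<lambda>x y0 y1. 1) (x i, x (i @ [False]), x (i @ [True])) = 0)"

lemma measurable_stat:
  assumes f: "(\<lambda>(x, y0, y1). f x y0 y1) \<in> borel_measurable (borel \<Otimes>\<^sub>M borel \<Otimes>\<^sub>M borel)"
  shows "stat \<tau> f \<in> borel_measurable (state_space \<Otimes>\<^sub>M state_pair_space)"
proof -
  have "(\<lambda>p. (the (fst p), the (fst (snd p)), the (snd (snd p)))) \<in> state_space \<Otimes>\<^sub>M state_pair_space \<rightarrow>\<^sub>M borel \<Otimes>\<^sub>M borel \<Otimes>\<^sub>M borel"
    by measurable
  from measurable_compose[OF this f]
  have [measurable]: "(\<lambda>p. f (the (fst p)) (the (fst (snd p))) (the (snd (snd p)))) \<in> borel_measurable (state_space \<Otimes>\<^sub>M state_pair_space)"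
    by simp
  show ?thesis unfolding stat_def split_beta' by measurable
qed

text \<open>The value of a dead daughter must not enter the bound: \<open>pw\<close> vanishes there,
  while \<open>the None\<close> is an unspecified real that need not be 0. Hence the factors
  \<open>of_bool\<close>.\<close>

lemma tame_stat:
  assumes f: "(\<lambda>(x, y0, y1). f x y0 y1) \<in> borel_measurable (borel \<Otimes>\<^sub>M borel \<Otimes>\<^sub>M borel)"
    and b: "\<And>x y0 y1. \<bar>f x y0 y1\<bar> \<le> 1 + x\<^sup>2 + of_bool (fst \<tau>) * y0\<^sup>2 + of_bool (snd \<tau>) * y1\<^sup>2"
  shows "tame (stat \<tau> f)"
proof (rule tameI[OF measurable_stat[OF f], of 1])
  fix s y0 y1
  show "\<bar>stat \<tau> f (s, y0, y1)\<bar> \<le> 1 * (pw 0 s + pw 2 s + pw 0 y0 + pw 2 y0 + pw 0 y1 + pw 2 y1)"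
  proof (cases "s \<noteq> None \<and> (y0 \<noteq> None) = fst \<tau> \<and> (y1 \<noteq> None) = snd \<tau>")
    case True
    then show ?thesis using b[of "the s" "the y0" "the y1"] by (cases \<tau>; cases s; cases y0; cases y1) (auto simp: stat_def)
  next
    case False
    then have "stat \<tau> f (s, y0, y1) = 0" by (auto simp: stat_def)
    then show ?thesis by (simp add: add_nonneg_nonneg)
  qed
qed simp

lemma tame_monomial:
  assumes "living \<tau> \<delta>" "a + b \<le> 2"
  shows "tame (stat \<tau> (monomial \<delta> a b))"
proof (rule tame_stat)
  show "(\<lambda>(x, y0, y1). monomial \<delta> a b x y0 y1) \<in> borel_measurable (borel \<Otimes>\<^sub>M borel \<Otimes>\<^sub>M borel)"
    unfolding monomial_def split_beta' by measurable
  have gen: "\<bar>x ^ a * y ^ b\<bar> \<le> 1 + x\<^sup>2 + y\<^sup>2" for x y :: real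
  proof -
    have z: "\<bar>z\<bar> \<le> 1 + z\<^sup>2" for z :: real
      using sum_squares_bound[of "\<bar>z\<bar>" 1] zero_le_power2[of z] by (simp add: power2_eq_square)
    have "(a = 0 \<and> b = 0) \<or> (a = 1 \<and> b = 0) \<or> (a = 2 \<and> b = 0) \<or> (a = 0 \<and> b = 1) \<or> (a = 1 \<and> b = 1) \<or> (a = 0 \<and> b = 2)"
      using assms(2) by auto
    moreover have xy: "\<bar>x\<bar> \<le> 1 + x\<^sup>2 + y\<^sup>2" "\<bar>y\<bar> \<le> 1 + x\<^sup>2 + y\<^sup>2"
      using z[of x] z[of y] zero_le_power2[of x] zero_le_power2[of y] by linarith+
    moreover have "\<bar>x * y\<bar> \<le> 1 + x\<^sup>2 + y\<^sup>2"
    proof -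
      have "0 \<le> \<bar>x\<bar> * \<bar>y\<bar>" by simp
      then show ?thesis
        using sum_squares_bound[of "\<bar>x\<bar>" "\<bar>y\<bar>"] unfolding abs_mult power2_abs by linarith
    qed
    ultimately show ?thesis
      using xy by (elim disjE conjE) simp_all
  qed
  show "\<bar>monomial \<delta> a b x y0 y1\<bar> \<le> 1 + x\<^sup>2 + of_bool (fst \<tau>) * y0\<^sup>2 + of_bool (snd \<tau>) * y1\<^sup>2" for x y0 y1
    using assms(1) gen[of x "if \<delta> then y1 else y0"] unfolding monomial_def
    by (auto split: if_splits intro: order_trans)
qed

context supercritical_bar
begin

text \<open>The weights \<open>p\<^sub>1\<^sub>0\<close> (twice), \<open>p\<^sub>0\<close> and
  \<open>p\<^sub>1\<close> sum to \<open>m\<close>, so these are convex combinations of numbers of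
  modulus less than 1. They are the contraction factors of the recurrences for the empirical
  moments.\<close>

lemma alpha_bar_bounds: "\<bar>alpha_bar \<theta>\<bar> < 1" "\<bar>alpha2_bar \<theta>\<bar> < 1"
proof -
  have conv: "\<bar>(p\<^sub>1\<^sub>0 \<theta> * (a + b) + p\<^sub>0 \<theta> * c + p\<^sub>1 \<theta> * d) / m\<bar> < 1"
    if "\<bar>a\<bar> < 1" "\<bar>b\<bar> < 1" "\<bar>c\<bar> < 1" "\<bar>d\<bar> < 1" for a b c d
  proof -
    have "\<bar>p\<^sub>1\<^sub>0 \<theta> * (a + b) + p\<^sub>0 \<theta> * c + p\<^sub>1 \<theta> * d\<bar> \<le> p\<^sub>1\<^sub>0 \<theta> * (\<bar>a\<bar> + \<bar>b\<bar>) + p\<^sub>0 \<theta> * \<bar>c\<bar> + p\<^sub>1 \<theta> * \<bar>d\<bar>"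
    proof -
      have "\<bar>p\<^sub>1\<^sub>0 \<theta> * (a + b)\<bar> \<le> p\<^sub>1\<^sub>0 \<theta> * (\<bar>a\<bar> + \<bar>b\<bar>)"
        using params_nonneg by (simp add: abs_mult mult_left_mono)
      moreover have "\<bar>p\<^sub>0 \<theta> * c\<bar> = p\<^sub>0 \<theta> * \<bar>c\<bar>" "\<bar>p\<^sub>1 \<theta> * d\<bar> = p\<^sub>1 \<theta> * \<bar>d\<bar>" using params_nonneg by (simp_all add: abs_mult)
      ultimately show ?thesis by linarith
    qed
    also have "\<dots> < p\<^sub>1\<^sub>0 \<theta> * 2 + p\<^sub>0 \<theta> * 1 + p\<^sub>1 \<theta> * 1"
      using that p10_pos params_nonneg by (intro add_less_le_mono mult_strict_left_mono mult_left_mono) auto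
    finally show ?thesis by (simp add: mean_offspring_def)
  qed
  have b: "\<bar>\<alpha>\<^sub>0 \<theta>\<bar> < 1" "\<bar>\<alpha>\<^sub>1 \<theta>\<bar> < 1" "\<bar>\<alpha>'\<^sub>0 \<theta>\<bar> < 1" "\<bar>\<alpha>'\<^sub>1 \<theta>\<bar> < 1"
    using admissible by (auto simp: admissible_def abs_less_iff)
  have b2: "\<bar>x\<^sup>2\<bar> < 1" if "\<bar>x\<bar> < 1" for x :: real using that by (simp add: abs_square_less_1)
  show "\<bar>alpha_bar \<theta>\<bar> < 1" unfolding alpha_bar_def by (intro conv b)
  show "\<bar>alpha2_bar \<theta>\<bar> < 1" unfolding alpha2_bar_def by (intro conv b2 b)
qed

text \<open>The recurrences form a triangular system: order 0 drives order 1, and both drive order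
  2, the centred sums being vanishing perturbations. Solving for the fixed points produces
  \<open>mu1\<close> and \<open>mu2\<close>, each multiplied by \<open>W\<close>.\<close>

lemma S_tendsto: "AE \<omega> in M. \<forall>a\<le>2. (\<lambda>k. S a k \<omega>) \<longlonglongrightarrow> W \<omega> * stat_mom \<theta> \<kappa> a"
  using S0_tendsto_W dev_null[OF tame_pwsum[of 1, simplified]] dev_null[OF tame_pwsum[of 2, simplified]]
proof eventually_elim
  case (elim \<omega>)
  note S0 = elim(1)
  have d1: "(\<lambda>k. dev k (pwsum 1) \<omega> / m ^ k) \<longlonglongrightarrow> 0" using elim(2) by simp
  have "(\<lambda>k. beta_bar \<theta> * S 0 k \<omega> + dev k (pwsum 1) \<omega> / m ^ k / m) \<longlonglongrightarrow> beta_bar \<theta> * W \<omega> + 0 / m"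
    by (intro tendsto_intros S0 d1) simp
  from tendsto_affine_recurrence[OF alpha_bar_bounds(1) S1_Suc this]
  have S1: "(\<lambda>k. S 1 k \<omega>) \<longlonglongrightarrow> W \<omega> * mu1 \<theta>" by (simp add: mu1_def mult.commute)
  have "(\<lambda>k. 2 * alpha_beta_bar \<theta> * S 1 k \<omega> + (beta2_bar \<theta> + sigma2_bar \<theta> \<kappa>) * S 0 k \<omega> + dev k (pwsum 2) \<omega> / m ^ k / m)
    \<longlonglongrightarrow> 2 * alpha_beta_bar \<theta> * (W \<omega> * mu1 \<theta>) + (beta2_bar \<theta> + sigma2_bar \<theta> \<kappa>) * W \<omega> + 0 / m"
    by (intro tendsto_intros S0 S1 elim(3)) simp
  from tendsto_affine_recurrence[OF alpha_bar_bounds(2) S2_Suc this]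
  have "(\<lambda>k. S 2 k \<omega>) \<longlonglongrightarrow> (2 * alpha_beta_bar \<theta> * (W \<omega> * mu1 \<theta>) + (beta2_bar \<theta> + sigma2_bar \<theta> \<kappa>) * W \<omega> + 0 / m) / (1 - alpha2_bar \<theta>)" .
  also have "(2 * alpha_beta_bar \<theta> * (W \<omega> * mu1 \<theta>) + (beta2_bar \<theta> + sigma2_bar \<theta> \<kappa>) * W \<omega> + 0 / m) / (1 - alpha2_bar \<theta>) = W \<omega> * mu2 \<theta> \<kappa>"
    using alpha_bar_bounds by (auto simp: mu2_def mu1_def algebra_simps)
  finally have S2: "(\<lambda>k. S 2 k \<omega>) \<longlonglongrightarrow> W \<omega> * mu2 \<theta> \<kappa>" .
  show ?case
  proof (intro allI impI)
    fix a :: nat assume "a \<le> 2"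
    then have "a = 0 \<or> a = 1 \<or> a = 2" by auto
    then show "(\<lambda>k. S a k \<omega>) \<longlonglongrightarrow> W \<omega> * stat_mom \<theta> \<kappa> a"
      using S0 S1 S2 by (auto simp: stat_mom_def)
  qed
qed

text \<open>Up to a negligible centred sum, a sum over a generation is the sum of its conditional
  means. If these are quadratic in the mother's value, the limit is read off from the empirical
  moments of order at most 2.\<close>

lemma tsum_tendsto:
  assumes t: "tame (stat \<tau> f)"
    and K: "\<And>x. cond_mean \<theta> \<kappa> (stat \<tau> f) (Some x) = type_prob \<theta> \<tau> * (k0 + k1 * x + k2 * x\<^sup>2)"
  shows "AE \<omega> in M. (\<lambda>k. tsum \<tau> f (\<lambda>i. X i \<omega>) k / m ^ k) \<longlonglongrightarrow>
    type_prob \<theta> \<tau> * W \<omega> * (k0 + k1 * mu1 \<theta> + k2 * mu2 \<theta> \<kappa>)"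
  using S_tendsto dev_null[OF t]
proof eventually_elim
  case (elim \<omega>)
  have K': "cond_mean \<theta> \<kappa> (stat \<tau> f) s = type_prob \<theta> \<tau> * (k0 * pw 0 s + k1 * pw 1 s + k2 * pw 2 s)" for s
    by (cases s) (use K cond_mean_None[of "stat \<tau> f", OF tame_None[OF t]] in auto)
  have e1: "tsum \<tau> f (\<lambda>i. X i \<omega>) k = (\<Sum>i\<in>generation k. cond_mean \<theta> \<kappa> (stat \<tau> f) (X i \<omega>)) + dev k (stat \<tau> f) \<omega>" for k
    by (simp add: tsum_def dev_def sum_subtractf ch_def)
  have e2: "(\<Sum>i\<in>generation k. cond_mean \<theta> \<kappa> (stat \<tau> f) (X i \<omega>)) = m ^ k * (type_prob \<theta> \<tau> * (k0 * S 0 k \<omega> + k1 * S 1 k \<omega> + k2 * S 2 k \<omega>))" for k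
    unfolding K' S_def sum_distrib_left[symmetric] sum.distrib by (simp add: field_simps)
  have eq: "tsum \<tau> f (\<lambda>i. X i \<omega>) k / m ^ k = type_prob \<theta> \<tau> * (k0 * S 0 k \<omega> + k1 * S 1 k \<omega> + k2 * S 2 k \<omega>) + dev k (stat \<tau> f) \<omega> / m ^ k" for k
    unfolding e1 e2 by (simp add: add_divide_distrib)
  have s: "(\<lambda>k. S 0 k \<omega>) \<longlonglongrightarrow> W \<omega>" "(\<lambda>k. S 1 k \<omega>) \<longlonglongrightarrow> W \<omega> * mu1 \<theta>" "(\<lambda>k. S 2 k \<omega>) \<longlonglongrightarrow> W \<omega> * mu2 \<theta> \<kappa>"
    using elim(1)[rule_format, of 0] elim(1)[rule_format, of 1] elim(1)[rule_format, of 2] by (simp_all add: stat_mom_def)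
  have "(\<lambda>k. tsum \<tau> f (\<lambda>i. X i \<omega>) k / m ^ k) \<longlonglongrightarrow>
    type_prob \<theta> \<tau> * (k0 * W \<omega> + k1 * (W \<omega> * mu1 \<theta>) + k2 * (W \<omega> * mu2 \<theta> \<kappa>)) + 0"
    unfolding eq by (intro tendsto_intros s elim(2))
  then show ?case by (simp add: algebra_simps)
qed

lemma tsum_monomial_tendsto:
  assumes l: "living \<tau> \<delta>" and ab: "a + b \<le> 2"
  shows "AE \<omega> in M. (\<lambda>k. tsum \<tau> (monomial \<delta> a b) (\<lambda>i. X i \<omega>) k / m ^ k) \<longlonglongrightarrow>
     type_prob \<theta> \<tau> * W \<omega> * joint_mom \<theta> \<kappa> \<tau> \<delta> a b"
proof -
  let ?A = "slope \<theta> \<tau> \<delta>" and ?B = "icpt \<theta> \<tau> \<delta>"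
  have y: "(if \<delta> then (if snd \<tau> then daughter_val \<theta> \<kappa> \<tau> True x z else the None) else (if fst \<tau> then daughter_val \<theta> \<kappa> \<tau> False x z else the None)) = daughter_val \<theta> \<kappa> \<tau> \<delta> x z" for x z
    using l by (auto split: if_splits)
  note T = tsum_tendsto[OF tame_monomial[OF l ab]]
  note K = cond_mean_stat[OF admissible, where f="monomial \<delta> a b" and \<tau>=\<tau>]
  consider "b = 0" "a = 0" | "b = 0" "a = 1" | "b = 0" "a = 2" | "b = 1" "a = 0" | "b = 1" "a = 1" | "b = 2" "a = 0"
    using ab by linarith
  then show ?thesis
  proof cases
    case 1
    have "cond_mean \<theta> \<kappa> (stat \<tau> (monomial \<delta> a b)) (Some x) = type_prob \<theta> \<tau> * (1 + 0 * x + 0 * x\<^sup>2)" for x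
      using K[of x 1 0 0 0 0 0] by (simp add: monomial_def 1)
    from T[OF this] show ?thesis by (simp add: 1 joint_mom_def stat_mom_def)
  next
    case 2
    have "cond_mean \<theta> \<kappa> (stat \<tau> (monomial \<delta> a b)) (Some x) = type_prob \<theta> \<tau> * (0 + 1 * x + 0 * x\<^sup>2)" for x
      using K[of x x 0 0 0 0 0] by (simp add: monomial_def 2)
    from T[OF this] show ?thesis by (simp add: 2 joint_mom_def stat_mom_def)
  next
    case 3
    have "cond_mean \<theta> \<kappa> (stat \<tau> (monomial \<delta> a b)) (Some x) = type_prob \<theta> \<tau> * (0 + 0 * x + 1 * x\<^sup>2)" for x
      using K[of x "x\<^sup>2" 0 0 0 0 0] by (simp add: monomial_def 3)
    from T[OF this] show ?thesis by (simp add: 3 joint_mom_def stat_mom_def)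
  next
    case 4
    have "cond_mean \<theta> \<kappa> (stat \<tau> (monomial \<delta> a b)) (Some x) = type_prob \<theta> \<tau> * (?B + ?A * x + 0 * x\<^sup>2)" for x
      using K[of x "?A * x + ?B" "load1 \<kappa> \<tau> \<delta>" "load2 \<kappa> \<tau> \<delta>" 0 0 0] by (simp add: monomial_def 4 y daughter_val_def)
    from T[OF this] show ?thesis by (simp add: 4 joint_mom_def stat_mom_def algebra_simps)
  next
    case 5
    have "cond_mean \<theta> \<kappa> (stat \<tau> (monomial \<delta> a b)) (Some x) = type_prob \<theta> \<tau> * (0 + ?B * x + ?A * x\<^sup>2)" for x
      using K[of x "x * (?A * x + ?B)" "x * load1 \<kappa> \<tau> \<delta>" "x * load2 \<kappa> \<tau> \<delta>" 0 0 0]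
      by (simp add: monomial_def 5 y daughter_val_def algebra_simps power2_eq_square)
    from T[OF this] show ?thesis by (simp add: 5 joint_mom_def stat_mom_def algebra_simps)
  next
    case 6
    have "cond_mean \<theta> \<kappa> (stat \<tau> (monomial \<delta> a b)) (Some x) = type_prob \<theta> \<tau> * ((?B\<^sup>2 + innovation_var \<kappa> \<tau> \<delta>) + (2 * ?A * ?B) * x + ?A\<^sup>2 * x\<^sup>2)" for x
      using K[of x "(?A * x + ?B)\<^sup>2" "2 * (?A * x + ?B) * load1 \<kappa> \<tau> \<delta>" "2 * (?A * x + ?B) * load2 \<kappa> \<tau> \<delta>"
        "(load1 \<kappa> \<tau> \<delta>)\<^sup>2" "2 * load1 \<kappa> \<tau> \<delta> * load2 \<kappa> \<tau> \<delta>" "(load2 \<kappa> \<tau> \<delta>)\<^sup>2"]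
      by (simp add: monomial_def 6 y daughter_val_def innovation_var_def algebra_simps power2_eq_square)
    from T[OF this] show ?thesis by (simp add: 6 joint_mom_def stat_mom_def algebra_simps)
  qed
qed

lemma tsum_cross_tendsto:
  "AE \<omega> in M. (\<lambda>k. tsum both (\<lambda>x y0 y1. y0 * y1) (\<lambda>i. X i \<omega>) k / m ^ k) \<longlonglongrightarrow>
     type_prob \<theta> both * W \<omega> * cross_mom \<theta> \<kappa>"
proof -
  let ?e0 = "\<lambda>x. \<alpha>\<^sub>0 \<theta> * x + \<beta>\<^sub>0 \<theta>" and ?e1 = "\<lambda>x. \<alpha>\<^sub>1 \<theta> * x + \<beta>\<^sub>1 \<theta>"
  let ?q = "\<sigma> \<kappa> * sqrt (1 - (\<rho> \<kappa>)\<^sup>2)"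
  have t: "tame (stat both (\<lambda>x y0 y1. y0 * y1))"
  proof (rule tame_stat)
    show "(\<lambda>(x :: real, y0 :: real, y1 :: real). y0 * y1) \<in> borel_measurable (borel \<Otimes>\<^sub>M borel \<Otimes>\<^sub>M borel)"
      unfolding split_beta' by measurable
    show "\<bar>y0 * y1\<bar> \<le> 1 + x\<^sup>2 + of_bool (fst both) * y0\<^sup>2 + of_bool (snd both) * y1\<^sup>2" for x y0 y1 :: real
    proof -
      have "0 \<le> \<bar>y0\<bar> * \<bar>y1\<bar>" by simp
      then have "\<bar>y0 * y1\<bar> \<le> 1 + x\<^sup>2 + y0\<^sup>2 + y1\<^sup>2"
        using sum_squares_bound[of "\<bar>y0\<bar>" "\<bar>y1\<bar>"] zero_le_power2[of x] unfolding abs_mult power2_abs by linarith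
      then show ?thesis by simp
    qed
  qed
  have "cond_mean \<theta> \<kappa> (stat both (\<lambda>x y0 y1. y0 * y1)) (Some x) = type_prob \<theta> both *
    ((\<beta>\<^sub>0 \<theta> * \<beta>\<^sub>1 \<theta> + (\<sigma> \<kappa>)\<^sup>2 * \<rho> \<kappa>) + (\<alpha>\<^sub>0 \<theta> * \<beta>\<^sub>1 \<theta> + \<alpha>\<^sub>1 \<theta> * \<beta>\<^sub>0 \<theta>) * x + (\<alpha>\<^sub>0 \<theta> * \<alpha>\<^sub>1 \<theta>) * x\<^sup>2)" for x
    using cond_mean_stat[OF admissible, where f="\<lambda>x y0 y1. y0 * y1" and \<tau>=both, of x "?e0 x * ?e1 x" "?e0 x * (\<sigma> \<kappa> * \<rho> \<kappa>) + ?e1 x * \<sigma> \<kappa>"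
      "?e0 x * ?q" "\<sigma> \<kappa> * (\<sigma> \<kappa> * \<rho> \<kappa>)" "\<sigma> \<kappa> * ?q" 0]
    by (simp add: daughter_val_def slope_def icpt_def load1_def load2_def algebra_simps power2_eq_square)
  from tsum_tendsto[OF t this] show ?thesis by (simp add: cross_mom_def algebra_simps)
qed

text \<open>The regression on a type of probability 0 has no consistent estimators. As such cells
  never occur, their estimated frequency is exactly 0 and those estimators disappear from every
  formula in which they are multiplied by it.\<close>

lemma no_cells_of_null_type:
  assumes "type_prob \<theta> \<tau> = 0"
  shows "AE \<omega> in M. \<forall>i. stat \<tau> (\<lambda>x y0 y1. 1) (X i \<omega>, X (i @ [False]) \<omega>, X (i @ [True]) \<omega>) = 0"
proof (subst AE_all_countable, intro allI)
  fix i :: node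
  define k where "k = length i"
  have i: "i \<in> generation k" by (simp add: k_def generation_def)
  have [measurable]: "stat \<tau> (\<lambda>x y0 y1. 1) \<in> borel_measurable (state_space \<Otimes>\<^sub>M state_pair_space)"
    by (rule measurable_stat) simp
  have "(\<integral>\<^sup>+\<omega>. ennreal (stat \<tau> (\<lambda>x y0 y1. 1) (X i \<omega>, ch i \<omega>)) \<partial>M) =
    (\<integral>\<^sup>+\<omega>. (\<integral>\<^sup>+\<xi>. ennreal (stat \<tau> (\<lambda>x y0 y1. 1) (X i \<omega>, daughters \<theta> \<kappa> (X i \<omega>) \<xi>)) \<partial>noise \<theta>) \<partial>M)"
    by (rule nn_integral_step1[OF i]) measurable
  also have "\<dots> = (\<integral>\<^sup>+\<omega>. 0 \<partial>M)"
  proof (rule nn_integral_cong)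
    fix \<omega>
    show "(\<integral>\<^sup>+\<xi>. ennreal (stat \<tau> (\<lambda>x y0 y1. 1) (X i \<omega>, daughters \<theta> \<kappa> (X i \<omega>) \<xi>)) \<partial>noise \<theta>) = 0"
    proof (cases "X i \<omega>")
      case None then show ?thesis by (simp add: stat_def)
    next
      case (Some x)
      have z: "type_prob \<theta> \<tau>' = 0 \<or> stat \<tau> (\<lambda>x y0 y1. 1) (Some x, daughters \<theta> \<kappa> (Some x) (\<tau>', z)) = 0" for \<tau>' z
        using assms by (cases "\<tau>' = \<tau>") (auto simp: stat_daughters)
      have "(\<integral>\<^sup>+\<xi>. ennreal (stat \<tau> (\<lambda>x y0 y1. 1) (Some x, daughters \<theta> \<kappa> (Some x) \<xi>)) \<partial>noise \<theta>) =
        (\<Sum>\<tau>'\<in>UNIV. ennreal (type_prob \<theta> \<tau>') * (\<integral>\<^sup>+z. ennreal (stat \<tau> (\<lambda>x y0 y1. 1) (Some x, daughters \<theta> \<kappa> (Some x) (\<tau>', z))) \<partial>gauss2))"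
        by (rule nn_integral_noise[OF admissible]) measurable
      also have "\<dots> = 0"
      proof (intro sum.neutral ballI)
        fix \<tau>' :: "bool \<times> bool"
        show "ennreal (type_prob \<theta> \<tau>') * (\<integral>\<^sup>+z. ennreal (stat \<tau> (\<lambda>x y0 y1. 1) (Some x, daughters \<theta> \<kappa> (Some x) (\<tau>', z))) \<partial>gauss2) = 0"
          using z[of \<tau>'] by (cases "type_prob \<theta> \<tau>' = 0") auto
      qed
      finally show ?thesis by (simp add: Some)
    qed
  qed
  finally have "AE \<omega> in M. ennreal (stat \<tau> (\<lambda>x y0 y1. 1) (X i \<omega>, ch i \<omega>)) = 0"
    by (subst nn_integral_0_iff_AE[symmetric]) simp_all
  moreover have "stat \<tau> (\<lambda>x y0 y1. 1) p \<ge> 0" for p by (simp add: stat_def split_beta')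
  ultimately show "AE \<omega> in M. stat \<tau> (\<lambda>x y0 y1. 1) (X i \<omega>, X (i @ [False]) \<omega>, X (i @ [True]) \<omega>) = 0"
    by (auto simp: ch_def ennreal_eq_0_iff elim!: eventually_mono intro: antisym)
qed

lemma AE_typical: "AE \<omega> in M. typical \<theta> \<kappa> (W \<omega>) (\<lambda>i. X i \<omega>)"
proof -
  have 1: "AE \<omega> in M. \<forall>\<tau> \<delta> a b. living \<tau> \<delta> \<longrightarrow> a + b \<le> 2 \<longrightarrow>
        (\<lambda>k. tsum \<tau> (monomial \<delta> a b) (\<lambda>i. X i \<omega>) k / m ^ k) \<longlonglongrightarrow> type_prob \<theta> \<tau> * W \<omega> * joint_mom \<theta> \<kappa> \<tau> \<delta> a b"
  proof (intro AE_all_countable[THEN iffD2] allI)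
    fix \<tau> :: "bool \<times> bool" and \<delta> :: bool and a b :: nat
    show "AE \<omega> in M. living \<tau> \<delta> \<longrightarrow> a + b \<le> 2 \<longrightarrow>
        (\<lambda>k. tsum \<tau> (monomial \<delta> a b) (\<lambda>i. X i \<omega>) k / m ^ k) \<longlonglongrightarrow> type_prob \<theta> \<tau> * W \<omega> * joint_mom \<theta> \<kappa> \<tau> \<delta> a b"
    proof (cases "living \<tau> \<delta> \<and> a + b \<le> 2")
      case True
      then show ?thesis using tsum_monomial_tendsto[where \<tau>=\<tau> and \<delta>=\<delta> and a=a and b=b] by auto
    next
      case False then show ?thesis by (intro AE_I2) simp
    qed
  qed
  have 2: "AE \<omega> in M. \<forall>\<tau>. type_prob \<theta> \<tau> = 0 \<longrightarrow> (\<forall>i. stat \<tau> (\<lambda>x y0 y1. 1) (X i \<omega>, X (i @ [False]) \<omega>, X (i @ [True]) \<omega>) = 0)"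
  proof (rule AE_all_countable[THEN iffD2], rule allI)
    fix \<tau> :: "bool \<times> bool"
    show "AE \<omega> in M. type_prob \<theta> \<tau> = 0 \<longrightarrow> (\<forall>i. stat \<tau> (\<lambda>x y0 y1. 1) (X i \<omega>, X (i @ [False]) \<omega>, X (i @ [True]) \<omega>) = 0)"
      using no_cells_of_null_type[of \<tau>] by (cases "type_prob \<theta> \<tau> = 0") auto
  qed
  show ?thesis
    using S0_tendsto_W 1 tsum_cross_tendsto 2
    by eventually_elim (simp add: typical_def S_def)
qed

end

section \<open>Sums over the cells of one type in the tree\<close>

definition Tset :: "bool \<times> bool \<Rightarrow> (node \<Rightarrow> real option) \<Rightarrow> nat \<Rightarrow> node set" where
  "Tset \<tau> x n = {i \<in> tree_upto n. x i \<noteq> None \<and> (x (i @ [False]) \<noteq> None) = fst \<tau> \<and> (x (i @ [True]) \<noteq> None) = snd \<tau>}"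

lemma T_both_Tset: "T_both x n = Tset both x n"
  by (auto simp: T_both_def Tset_def alive_def)

lemma T_only_Tset: "T_only \<delta> x n = Tset (\<not> \<delta>, \<delta>) x n"
  by (cases \<delta>) (auto simp: T_only_def Tset_def alive_def)

lemma finite_Tset [simp]: "finite (Tset \<tau> x n)"
  by (simp add: Tset_def)

lemma sum_tree_upto: "(\<Sum>i\<in>tree_upto n. \<phi> i) = (\<Sum>k\<le>n. \<Sum>i\<in>generation k. (\<phi> i :: 'c :: comm_monoid_add))"
  unfolding tree_upto_def by (rule sum.UNION_disjoint) (auto simp: generation_def finite_generation[unfolded generation_def])

lemma sum_Tset: "(\<Sum>i\<in>Tset \<tau> x n. f (val x i) (val x (i @ [False])) (val x (i @ [True]))) = (\<Sum>k\<le>n. tsum \<tau> f x k)"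
proof -
  have "(\<Sum>i\<in>Tset \<tau> x n. f (val x i) (val x (i @ [False])) (val x (i @ [True]))) =
    (\<Sum>i\<in>tree_upto n. stat \<tau> f (x i, x (i @ [False]), x (i @ [True])))"
    unfolding Tset_def by (subst sum.inter_filter) (auto simp: stat_def intro!: sum.cong)
  then show ?thesis by (simp add: sum_tree_upto tsum_def)
qed

lemma card_Tset: "real (card (Tset \<tau> x n)) = (\<Sum>k\<le>n. tsum \<tau> (\<lambda>x y0 y1. 1) x k)"
  using sum_Tset[of "\<lambda>x y0 y1. 1" x \<tau> n] by simp

lemma card_alive_upto: "real (card (alive x (tree_upto n))) = (\<Sum>k\<le>n. \<Sum>i\<in>generation k. pw 0 (x i))"
proof -
  have "real (card (alive x (tree_upto n))) = (\<Sum>i\<in>{i \<in> tree_upto n. x i \<noteq> None}. 1)"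
    by (simp add: alive_def)
  also have "\<dots> = (\<Sum>i\<in>tree_upto n. pw 0 (x i))"
    by (subst sum.inter_filter) (auto simp: pw_def intro!: sum.cong)
  finally show ?thesis by (simp add: sum_tree_upto)
qed

lemma avg_add: "avg J (\<lambda>i. f i + g i) = avg J f + avg J g"
  by (simp add: avg_def sum.distrib add_divide_distrib)

lemma avg_diff: "avg J (\<lambda>i. f i - g i) = avg J f - avg J g"
  by (simp add: avg_def sum_subtractf diff_divide_distrib)

lemma avg_cmult: "avg J (\<lambda>i. c * f i) = c * avg J f"
  by (simp add: avg_def sum_distrib_left)

lemma avg_const: "card J > 0 \<Longrightarrow> avg J (\<lambda>i. c) = c"
  by (simp add: avg_def)

text \<open>Second moments of residues are rewritten in terms of the estimators and the empirical
  moments, whose limits are known. For \<open>y1 = y0\<close> this is the residual variance,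
  otherwise the covariance between sisters.\<close>

lemma avg_residues:
  assumes J: "card J > 0"
  shows "avg J (\<lambda>i. (y0 i - a0 * z i - b0) * (y1 i - a1 * z i - b1)) =
    avg J (\<lambda>i. y0 i * y1 i) - a1 * avg J (\<lambda>i. z i * y0 i) - b1 * avg J y0 - a0 * avg J (\<lambda>i. z i * y1 i)
    + a0 * a1 * avg J (\<lambda>i. (z i)\<^sup>2) + a0 * b1 * avg J z - b0 * avg J y1 + b0 * a1 * avg J z + b0 * b1"
proof -
  have "avg J (\<lambda>i. (y0 i - a0 * z i - b0) * (y1 i - a1 * z i - b1)) =
    avg J (\<lambda>i. y0 i * y1 i - a1 * (z i * y0 i) - b1 * y0 i - a0 * (z i * y1 i)
    + (a0 * a1) * (z i)\<^sup>2 + (a0 * b1) * z i - b0 * y1 i + (b0 * a1) * z i + b0 * b1)"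
    by (rule arg_cong[where f="avg J"]) (simp add: fun_eq_iff algebra_simps power2_eq_square)
  then show ?thesis by (simp only: avg_add avg_diff avg_cmult avg_const[OF J])
qed

context supercritical_bar
begin

lemma type_prob_nonneg: "type_prob \<theta> \<tau> \<ge> 0"
  using params_nonneg by (simp add: type_prob_def)

text \<open>A one-step variance decomposition: \<open>1 - alpha2_bar \<theta>\<close> times this
  variance equals \<open>sigma2_bar \<theta> \<kappa>\<close> plus a weighted mean of the squares of
  \<alpha> * \<mu> + \<beta> - \<mu> over the regression lines. The first term is positive and the
  second nonnegative.\<close>

lemma mu_variance_pos: "mu2 \<theta> \<kappa> - (mu1 \<theta>)\<^sup>2 > 0"
proof -
  define \<mu> where "\<mu> = mu1 \<theta>"
  have pos: "\<sigma> \<kappa> > 0" "\<sigma>\<^sub>0 \<kappa> > 0" "\<sigma>\<^sub>1 \<kappa> > 0" using admissible by (auto simp: admissible_def)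
  have mb: "p\<^sub>1\<^sub>0 \<theta> * (\<alpha>\<^sub>0 \<theta> + \<alpha>\<^sub>1 \<theta>) + p\<^sub>0 \<theta> * \<alpha>'\<^sub>0 \<theta> + p\<^sub>1 \<theta> * \<alpha>'\<^sub>1 \<theta> = m * alpha_bar \<theta>"
    "p\<^sub>1\<^sub>0 \<theta> * (\<beta>\<^sub>0 \<theta> + \<beta>\<^sub>1 \<theta>) + p\<^sub>0 \<theta> * \<beta>'\<^sub>0 \<theta> + p\<^sub>1 \<theta> * \<beta>'\<^sub>1 \<theta> = m * beta_bar \<theta>"
    "p\<^sub>1\<^sub>0 \<theta> * ((\<alpha>\<^sub>0 \<theta>)\<^sup>2 + (\<alpha>\<^sub>1 \<theta>)\<^sup>2) + p\<^sub>0 \<theta> * (\<alpha>'\<^sub>0 \<theta>)\<^sup>2 + p\<^sub>1 \<theta> * (\<alpha>'\<^sub>1 \<theta>)\<^sup>2 = m * alpha2_bar \<theta>"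
    "p\<^sub>1\<^sub>0 \<theta> * ((\<beta>\<^sub>0 \<theta>)\<^sup>2 + (\<beta>\<^sub>1 \<theta>)\<^sup>2) + p\<^sub>0 \<theta> * (\<beta>'\<^sub>0 \<theta>)\<^sup>2 + p\<^sub>1 \<theta> * (\<beta>'\<^sub>1 \<theta>)\<^sup>2 = m * beta2_bar \<theta>"
    "p\<^sub>1\<^sub>0 \<theta> * (\<alpha>\<^sub>0 \<theta> * \<beta>\<^sub>0 \<theta> + \<alpha>\<^sub>1 \<theta> * \<beta>\<^sub>1 \<theta>) + p\<^sub>0 \<theta> * \<alpha>'\<^sub>0 \<theta> * \<beta>'\<^sub>0 \<theta> + p\<^sub>1 \<theta> * \<alpha>'\<^sub>1 \<theta> * \<beta>'\<^sub>1 \<theta> = m * alpha_beta_bar \<theta>"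
    by (simp_all add: alpha_bar_def beta_bar_def alpha2_bar_def beta2_bar_def alpha_beta_bar_def)
  have m_sum: "p\<^sub>1\<^sub>0 \<theta> + p\<^sub>1\<^sub>0 \<theta> + p\<^sub>0 \<theta> + p\<^sub>1 \<theta> = m"
    by (simp add: mean_offspring_def)
  have fixp: "alpha_bar \<theta> * \<mu> + beta_bar \<theta> = \<mu>"
    using alpha_bar_bounds(1) by (simp add: \<mu>_def mu1_def field_simps)
  have "0 \<le> p\<^sub>1\<^sub>0 \<theta> * (\<alpha>\<^sub>0 \<theta> * \<mu> + \<beta>\<^sub>0 \<theta> - \<mu>)\<^sup>2 + p\<^sub>1\<^sub>0 \<theta> * (\<alpha>\<^sub>1 \<theta> * \<mu> + \<beta>\<^sub>1 \<theta> - \<mu>)\<^sup>2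
     + p\<^sub>0 \<theta> * (\<alpha>'\<^sub>0 \<theta> * \<mu> + \<beta>'\<^sub>0 \<theta> - \<mu>)\<^sup>2 + p\<^sub>1 \<theta> * (\<alpha>'\<^sub>1 \<theta> * \<mu> + \<beta>'\<^sub>1 \<theta> - \<mu>)\<^sup>2"
    using params_nonneg by (intro add_nonneg_nonneg mult_nonneg_nonneg) auto
  also have "\<dots> = (m * alpha2_bar \<theta>) * \<mu>\<^sup>2 + 2 * (m * alpha_beta_bar \<theta>) * \<mu> + m * beta2_bar \<theta>
     - 2 * \<mu> * ((m * alpha_bar \<theta>) * \<mu> + m * beta_bar \<theta>) + (p\<^sub>1\<^sub>0 \<theta> + p\<^sub>1\<^sub>0 \<theta> + p\<^sub>0 \<theta> + p\<^sub>1 \<theta>) * \<mu>\<^sup>2"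
    unfolding mb[symmetric] by (simp add: power2_eq_square algebra_simps)
  also have "\<dots> = m * (alpha2_bar \<theta> * \<mu>\<^sup>2 + 2 * alpha_beta_bar \<theta> * \<mu> + beta2_bar \<theta> - 2 * \<mu> * (alpha_bar \<theta> * \<mu> + beta_bar \<theta>) + \<mu>\<^sup>2)"
    unfolding m_sum by (simp add: algebra_simps)
  also have "\<dots> = m * (alpha2_bar \<theta> * \<mu>\<^sup>2 + 2 * alpha_beta_bar \<theta> * \<mu> + beta2_bar \<theta> - \<mu>\<^sup>2)"
    unfolding fixp by (simp add: power2_eq_square)
  finally have jensen: "0 \<le> alpha2_bar \<theta> * \<mu>\<^sup>2 + 2 * alpha_beta_bar \<theta> * \<mu> + beta2_bar \<theta> - \<mu>\<^sup>2"
    using m_gt_0(1) unfolding zero_le_mult_iff by linarith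
  have "0 < 2 * p\<^sub>1\<^sub>0 \<theta> * (\<sigma> \<kappa>)\<^sup>2" using p10_pos pos by simp
  moreover have "0 \<le> p\<^sub>0 \<theta> * (\<sigma>\<^sub>0 \<kappa>)\<^sup>2" "0 \<le> p\<^sub>1 \<theta> * (\<sigma>\<^sub>1 \<kappa>)\<^sup>2" using params_nonneg by simp_all
  ultimately have s2: "sigma2_bar \<theta> \<kappa> > 0" by (simp add: sigma2_bar_def)
  have a2: "1 - alpha2_bar \<theta> > 0" using alpha_bar_bounds(2) by linarith
  have "(1 - alpha2_bar \<theta>) * mu2 \<theta> \<kappa> = 2 * alpha_beta_bar \<theta> * \<mu> + beta2_bar \<theta> + sigma2_bar \<theta> \<kappa>"
    using a2 alpha_bar_bounds(1) by (auto simp: mu2_def \<mu>_def mu1_def)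
  then have "(1 - alpha2_bar \<theta>) * (mu2 \<theta> \<kappa> - \<mu>\<^sup>2) > 0"
    using jensen s2 by (simp add: algebra_simps)
  then show ?thesis using a2 by (simp add: zero_less_mult_iff \<mu>_def)
qed

text \<open>The sum of the geometric series in \<open>1 / m\<close>: the limiting ratio of a sum
  over the tree to the corresponding sum over its last generation.\<close>

definition tree_factor :: real where "tree_factor = m / (m - 1)"

lemma tree_factor_pos: "tree_factor > 0" using supercritical by (simp add: tree_factor_def)

lemma both_prob: "type_prob \<theta> both > 0" "type_prob \<theta> both = p\<^sub>1\<^sub>0 \<theta>"
  using p10_pos by (simp_all add: type_prob_def)

lemma sigma_pos: "\<sigma> \<kappa> > 0" using admissible by (simp add: admissible_def)

lemma slope_values:
  "slope \<theta> both False = \<alpha>\<^sub>0 \<theta>" "slope \<theta> both True = \<alpha>\<^sub>1 \<theta>" "slope \<theta> (True, False) False = \<alpha>'\<^sub>0 \<theta>" "slope \<theta> (False, True) True = \<alpha>'\<^sub>1 \<theta>"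
  "icpt \<theta> both False = \<beta>\<^sub>0 \<theta>" "icpt \<theta> both True = \<beta>\<^sub>1 \<theta>" "icpt \<theta> (True, False) False = \<beta>'\<^sub>0 \<theta>" "icpt \<theta> (False, True) True = \<beta>'\<^sub>1 \<theta>"
  "type_prob \<theta> both = p\<^sub>1\<^sub>0 \<theta>" "type_prob \<theta> (True, False) = p\<^sub>0 \<theta>" "type_prob \<theta> (False, True) = p\<^sub>1 \<theta>"
  by (simp_all add: slope_def icpt_def type_prob_def)

lemma sigma2_nonneg: "sigma2_hat x n \<ge> 0" "sigma2_only_hat \<delta> x n \<ge> 0"
  by (simp_all add: sigma2_hat_def sigma2_only_hat_def sum_nonneg)

lemma typicalD:
  assumes "typical \<theta> \<kappa> w x"
  shows "(\<lambda>k. (\<Sum>i\<in>generation k. pw 0 (x i)) / m ^ k) \<longlonglongrightarrow> w"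
    "\<And>\<tau> \<delta> a b. living \<tau> \<delta> \<Longrightarrow> a + b \<le> 2 \<Longrightarrow>
        (\<lambda>k. tsum \<tau> (monomial \<delta> a b) x k / m ^ k) \<longlonglongrightarrow> type_prob \<theta> \<tau> * w * joint_mom \<theta> \<kappa> \<tau> \<delta> a b"
    "(\<lambda>k. tsum both (\<lambda>x y0 y1. y0 * y1) x k / m ^ k) \<longlonglongrightarrow> type_prob \<theta> both * w * cross_mom \<theta> \<kappa>"
    "\<And>\<tau> i. type_prob \<theta> \<tau> = 0 \<Longrightarrow> stat \<tau> (\<lambda>x y0 y1. 1) (x i, x (i @ [False]), x (i @ [True])) = 0"
  using assms unfolding typical_def by blast+

lemma tree_sum_tendsto:
  assumes "(\<lambda>k. u k / m ^ k) \<longlonglongrightarrow> L"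
  shows "(\<lambda>n. (\<Sum>k\<le>n. u k) / m ^ n) \<longlonglongrightarrow> L * tree_factor"
  using tendsto_geometric_average[OF supercritical assms] by (simp add: tree_factor_def)

section \<open>Consistency along a fixed typical realisation with positive population limit\<close>

context
  fixes x :: "node \<Rightarrow> real option" and w :: real
  assumes tyx: "typical \<theta> \<kappa> w x" and w: "w > 0"
begin

lemma sum_Tset_tendsto:
  assumes l: "living \<tau> \<delta>" and ab: "a + b \<le> 2"
  shows "(\<lambda>n. (\<Sum>i\<in>Tset \<tau> x n. (val x i) ^ a * (val x (i @ [\<delta>])) ^ b) / m ^ n) \<longlonglongrightarrow>
    type_prob \<theta> \<tau> * w * joint_mom \<theta> \<kappa> \<tau> \<delta> a b * tree_factor"
proof -
  have "(\<Sum>i\<in>Tset \<tau> x n. (val x i) ^ a * (val x (i @ [\<delta>])) ^ b) = (\<Sum>k\<le>n. tsum \<tau> (monomial \<delta> a b) x k)" for n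
    unfolding sum_Tset[symmetric] by (intro sum.cong) (auto simp: monomial_def)
  then show ?thesis using tree_sum_tendsto[OF typicalD(2)[OF tyx l ab]] by simp
qed

lemma card_Tset_tendsto:
  assumes l: "living \<tau> \<delta>"
  shows "(\<lambda>n. real (card (Tset \<tau> x n)) / m ^ n) \<longlonglongrightarrow> type_prob \<theta> \<tau> * w * tree_factor"
  using sum_Tset_tendsto[OF l, of 0 0] by (simp add: joint_mom_def stat_mom_def)

lemma card_Tset_at_top:
  assumes l: "living \<tau> \<delta>" and p: "type_prob \<theta> \<tau> > 0"
  shows "filterlim (\<lambda>n. real (card (Tset \<tau> x n))) at_top sequentially"
proof -
  have "filterlim (\<lambda>n. real (card (Tset \<tau> x n)) / m ^ n * m ^ n) at_top sequentially"
    using p w tree_factor_pos by (intro filterlim_tendsto_pos_mult_at_top[OF card_Tset_tendsto[OF l]] power_at_top supercritical) simp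
  then show ?thesis by simp
qed

lemma card_Tset_pos:
  assumes "living \<tau> \<delta>" "type_prob \<theta> \<tau> > 0"
  shows "\<forall>\<^sub>F n in sequentially. card (Tset \<tau> x n) > 0"
  using card_Tset_at_top[OF assms] unfolding filterlim_at_top_dense by (metis (mono_tags, lifting) eventually_mono of_nat_0_less_iff)

lemma avg_Tset_tendsto:
  assumes l: "living \<tau> \<delta>" and p: "type_prob \<theta> \<tau> > 0" and ab: "a + b \<le> 2"
  shows "(\<lambda>n. avg (Tset \<tau> x n) (\<lambda>i. (val x i) ^ a * (val x (i @ [\<delta>])) ^ b)) \<longlonglongrightarrow> joint_mom \<theta> \<kappa> \<tau> \<delta> a b"
proof -
  have "(\<lambda>n. ((\<Sum>i\<in>Tset \<tau> x n. (val x i) ^ a * (val x (i @ [\<delta>])) ^ b) / m ^ n) / (real (card (Tset \<tau> x n)) / m ^ n)) \<longlonglongrightarrow>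
    (type_prob \<theta> \<tau> * w * joint_mom \<theta> \<kappa> \<tau> \<delta> a b * tree_factor) / (type_prob \<theta> \<tau> * w * tree_factor)"
    using p w tree_factor_pos by (intro tendsto_divide sum_Tset_tendsto[OF l ab] card_Tset_tendsto[OF l]) simp
  then show ?thesis using p w tree_factor_pos by (simp add: avg_def)
qed

lemma avg_tendsto:
  assumes l: "living \<tau> \<delta>" and p: "type_prob \<theta> \<tau> > 0"
  shows "(\<lambda>n. avg (Tset \<tau> x n) (\<lambda>i. val x i)) \<longlonglongrightarrow> mu1 \<theta>"
    "(\<lambda>n. avg (Tset \<tau> x n) (\<lambda>i. (val x i)\<^sup>2)) \<longlonglongrightarrow> mu2 \<theta> \<kappa>"
    "(\<lambda>n. avg (Tset \<tau> x n) (\<lambda>i. val x (i @ [\<delta>]))) \<longlonglongrightarrow> slope \<theta> \<tau> \<delta> * mu1 \<theta> + icpt \<theta> \<tau> \<delta>"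
    "(\<lambda>n. avg (Tset \<tau> x n) (\<lambda>i. val x i * val x (i @ [\<delta>]))) \<longlonglongrightarrow> slope \<theta> \<tau> \<delta> * mu2 \<theta> \<kappa> + icpt \<theta> \<tau> \<delta> * mu1 \<theta>"
    "(\<lambda>n. avg (Tset \<tau> x n) (\<lambda>i. val x (i @ [\<delta>]) * val x (i @ [\<delta>]))) \<longlonglongrightarrow>
      (slope \<theta> \<tau> \<delta>)\<^sup>2 * mu2 \<theta> \<kappa> + 2 * slope \<theta> \<tau> \<delta> * icpt \<theta> \<tau> \<delta> * mu1 \<theta> + (icpt \<theta> \<tau> \<delta>)\<^sup>2 + innovation_var \<kappa> \<tau> \<delta>"
  using avg_Tset_tendsto[OF l p, of 1 0] avg_Tset_tendsto[OF l p, of 2 0] avg_Tset_tendsto[OF l p, of 0 1]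
    avg_Tset_tendsto[OF l p, of 1 1] avg_Tset_tendsto[OF l p, of 0 2]
  by (simp_all add: joint_mom_def stat_mom_def power2_eq_square)

lemma slope_hat_tendsto:
  assumes l: "living \<tau> \<delta>" and p: "type_prob \<theta> \<tau> > 0"
  shows "(\<lambda>n. slope_hat x (Tset \<tau> x n) \<delta>) \<longlonglongrightarrow> slope \<theta> \<tau> \<delta>"
proof -
  let ?A = "slope \<theta> \<tau> \<delta>" and ?B = "icpt \<theta> \<tau> \<delta>"
  have "(\<lambda>n. slope_hat x (Tset \<tau> x n) \<delta>) \<longlonglongrightarrow>
    (?A * mu2 \<theta> \<kappa> + ?B * mu1 \<theta> - mu1 \<theta> * (?A * mu1 \<theta> + ?B)) / (mu2 \<theta> \<kappa> - (mu1 \<theta>)\<^sup>2)"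
    unfolding slope_hat_def using mu_variance_pos by (intro tendsto_intros avg_tendsto[OF l p]) simp
  also have "?A * mu2 \<theta> \<kappa> + ?B * mu1 \<theta> - mu1 \<theta> * (?A * mu1 \<theta> + ?B) = ?A * (mu2 \<theta> \<kappa> - (mu1 \<theta>)\<^sup>2)"
    by (simp add: algebra_simps power2_eq_square)
  finally show ?thesis using mu_variance_pos by simp
qed

lemma intercept_hat_tendsto:
  assumes l: "living \<tau> \<delta>" and p: "type_prob \<theta> \<tau> > 0"
  shows "(\<lambda>n. intercept_hat x (Tset \<tau> x n) \<delta>) \<longlonglongrightarrow> icpt \<theta> \<tau> \<delta>"
proof -
  have "(\<lambda>n. intercept_hat x (Tset \<tau> x n) \<delta>) \<longlonglongrightarrow> slope \<theta> \<tau> \<delta> * mu1 \<theta> + icpt \<theta> \<tau> \<delta> - slope \<theta> \<tau> \<delta> * mu1 \<theta>"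
    unfolding intercept_hat_def by (intro tendsto_intros avg_tendsto[OF l p] slope_hat_tendsto[OF l p])
  then show ?thesis by simp
qed

lemma residue_variance_tendsto:
  assumes l: "living \<tau> \<delta>" and p: "type_prob \<theta> \<tau> > 0"
  shows "(\<lambda>n. avg (Tset \<tau> x n) (\<lambda>i. (residue x (Tset \<tau> x n) \<delta> i)\<^sup>2)) \<longlonglongrightarrow> innovation_var \<kappa> \<tau> \<delta>"
proof -
  let ?J = "\<lambda>n. Tset \<tau> x n" and ?A = "slope \<theta> \<tau> \<delta>" and ?B = "icpt \<theta> \<tau> \<delta>"
  let ?a = "\<lambda>n. slope_hat x (?J n) \<delta>" and ?b = "\<lambda>n. intercept_hat x (?J n) \<delta>"
  let ?y = "\<lambda>i. val x (i @ [\<delta>])"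
  let ?E = "\<lambda>n. avg (?J n) (\<lambda>i. ?y i * ?y i) - ?a n * avg (?J n) (\<lambda>i. val x i * ?y i) - ?b n * avg (?J n) ?y - ?a n * avg (?J n) (\<lambda>i. val x i * ?y i)
    + ?a n * ?a n * avg (?J n) (\<lambda>i. (val x i)\<^sup>2) + ?a n * ?b n * avg (?J n) (\<lambda>i. val x i) - ?b n * avg (?J n) ?y + ?b n * ?a n * avg (?J n) (\<lambda>i. val x i) + ?b n * ?b n"
  let ?Y = "?A * mu1 \<theta> + ?B" and ?XY = "?A * mu2 \<theta> \<kappa> + ?B * mu1 \<theta>"
  let ?YY = "?A\<^sup>2 * mu2 \<theta> \<kappa> + 2 * ?A * ?B * mu1 \<theta> + ?B\<^sup>2 + innovation_var \<kappa> \<tau> \<delta>"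
  have "?E \<longlonglongrightarrow> ?YY - ?A * ?XY - ?B * ?Y - ?A * ?XY + ?A * ?A * mu2 \<theta> \<kappa> + ?A * ?B * mu1 \<theta> - ?B * ?Y + ?B * ?A * mu1 \<theta> + ?B * ?B"
    by (intro tendsto_intros avg_tendsto[OF l p] slope_hat_tendsto[OF l p] intercept_hat_tendsto[OF l p])
  also have "?YY - ?A * ?XY - ?B * ?Y - ?A * ?XY + ?A * ?A * mu2 \<theta> \<kappa> + ?A * ?B * mu1 \<theta> - ?B * ?Y + ?B * ?A * mu1 \<theta> + ?B * ?B = innovation_var \<kappa> \<tau> \<delta>"
    by (simp add: algebra_simps power2_eq_square)
  finally have E: "?E \<longlonglongrightarrow> innovation_var \<kappa> \<tau> \<delta>" .
  have sq: "avg (?J n) (\<lambda>i. (residue x (?J n) \<delta> i)\<^sup>2) = avg (?J n) (\<lambda>i. residue x (?J n) \<delta> i * residue x (?J n) \<delta> i)" for n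
    by (simp add: power2_eq_square)
  have "\<forall>\<^sub>F n in sequentially. ?E n = avg (?J n) (\<lambda>i. (residue x (?J n) \<delta> i)\<^sup>2)"
    using card_Tset_pos[OF l p] unfolding sq
    by eventually_elim (simp only: residue_def avg_residues)
  from tendsto_cong[OF this] E show ?thesis by blast
qed

lemma residue_covariance_tendsto:
  "(\<lambda>n. avg (Tset both x n) (\<lambda>i. residue x (Tset both x n) False i * residue x (Tset both x n) True i)) \<longlonglongrightarrow> (\<sigma> \<kappa>)\<^sup>2 * \<rho> \<kappa>"
proof -
  let ?J = "\<lambda>n. Tset both x n" and ?A = "slope \<theta> both" and ?B = "icpt \<theta> both"
  let ?a = "\<lambda>\<delta> n. slope_hat x (?J n) \<delta>" and ?b = "\<lambda>\<delta> n. intercept_hat x (?J n) \<delta>"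
  let ?y = "\<lambda>\<delta> i. val x (i @ [\<delta>])"
  have cr: "(\<lambda>n. avg (?J n) (\<lambda>i. ?y False i * ?y True i)) \<longlonglongrightarrow> cross_mom \<theta> \<kappa>"
  proof -
    have "(\<lambda>n. ((\<Sum>i\<in>?J n. ?y False i * ?y True i) / m ^ n) / (real (card (?J n)) / m ^ n)) \<longlonglongrightarrow>
      (type_prob \<theta> both * w * cross_mom \<theta> \<kappa> * tree_factor) / (type_prob \<theta> both * w * tree_factor)"
    proof (intro tendsto_divide)
      show "(\<lambda>n. (\<Sum>i\<in>?J n. ?y False i * ?y True i) / m ^ n) \<longlonglongrightarrow> type_prob \<theta> both * w * cross_mom \<theta> \<kappa> * tree_factor"
        using tree_sum_tendsto[OF typicalD(3)[OF tyx]] by (simp add: sum_Tset[symmetric])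
      show "(\<lambda>n. real (card (?J n)) / m ^ n) \<longlonglongrightarrow> type_prob \<theta> both * w * tree_factor"
        by (rule card_Tset_tendsto[where \<delta>=True]) simp
    qed (use both_prob w tree_factor_pos in auto)
    then show ?thesis using both_prob w tree_factor_pos by (simp add: avg_def)
  qed
  have l: "living both False" "living both True" by auto
  note t = avg_tendsto[OF l(1) both_prob(1)] avg_tendsto[OF l(2) both_prob(1)] slope_hat_tendsto[OF l(1) both_prob(1)] slope_hat_tendsto[OF l(2) both_prob(1)]
    intercept_hat_tendsto[OF l(1) both_prob(1)] intercept_hat_tendsto[OF l(2) both_prob(1)]
  let ?E = "\<lambda>n. avg (?J n) (\<lambda>i. ?y False i * ?y True i) - ?a True n * avg (?J n) (\<lambda>i. val x i * ?y False i) - ?b True n * avg (?J n) (?y False) - ?a False n * avg (?J n) (\<lambda>i. val x i * ?y True i)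
    + ?a False n * ?a True n * avg (?J n) (\<lambda>i. (val x i)\<^sup>2) + ?a False n * ?b True n * avg (?J n) (\<lambda>i. val x i) - ?b False n * avg (?J n) (?y True) + ?b False n * ?a True n * avg (?J n) (\<lambda>i. val x i) + ?b False n * ?b True n"
  let ?Y = "\<lambda>\<delta>. ?A \<delta> * mu1 \<theta> + ?B \<delta>" and ?XY = "\<lambda>\<delta>. ?A \<delta> * mu2 \<theta> \<kappa> + ?B \<delta> * mu1 \<theta>"
  have "?E \<longlonglongrightarrow> cross_mom \<theta> \<kappa> - ?A True * ?XY False - ?B True * ?Y False - ?A False * ?XY True + ?A False * ?A True * mu2 \<theta> \<kappa> + ?A False * ?B True * mu1 \<theta> - ?B False * ?Y True + ?B False * ?A True * mu1 \<theta> + ?B False * ?B True"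
    by (intro tendsto_intros t cr)
  also have "cross_mom \<theta> \<kappa> - ?A True * ?XY False - ?B True * ?Y False - ?A False * ?XY True + ?A False * ?A True * mu2 \<theta> \<kappa> + ?A False * ?B True * mu1 \<theta> - ?B False * ?Y True + ?B False * ?A True * mu1 \<theta> + ?B False * ?B True = (\<sigma> \<kappa>)\<^sup>2 * \<rho> \<kappa>"
    by (simp add: slope_def icpt_def cross_mom_def algebra_simps power2_eq_square)
  finally have E: "?E \<longlonglongrightarrow> (\<sigma> \<kappa>)\<^sup>2 * \<rho> \<kappa>" .
  have "\<forall>\<^sub>F n in sequentially. ?E n = avg (?J n) (\<lambda>i. residue x (?J n) False i * residue x (?J n) True i)"
    using card_Tset_pos[OF l(1) both_prob(1)]
    by eventually_elim (simp only: residue_def avg_residues)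
  from tendsto_cong[OF this] E show ?thesis by blast
qed

lemma sigma2_hat_avg: "sigma2_hat x n = (avg (Tset both x n) (\<lambda>i. (residue x (Tset both x n) False i)\<^sup>2) + avg (Tset both x n) (\<lambda>i. (residue x (Tset both x n) True i)\<^sup>2)) / 2"
  by (simp add: sigma2_hat_def T_both_Tset avg_def sum.distrib add_divide_distrib)

lemma sigma2_hat_tendsto: "(\<lambda>n. sigma2_hat x n) \<longlonglongrightarrow> (\<sigma> \<kappa>)\<^sup>2"
proof -
  have rho: "1 - (\<rho> \<kappa>)\<^sup>2 > 0" using admissible by (auto simp: admissible_def abs_square_less_1 abs_less_iff)
  have l: "living both False" "living both True" by auto
  have "(\<lambda>n. sigma2_hat x n) \<longlonglongrightarrow> (innovation_var \<kappa> both False + innovation_var \<kappa> both True) / 2"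
    unfolding sigma2_hat_avg by (intro tendsto_intros residue_variance_tendsto l both_prob) simp
  also have "(innovation_var \<kappa> both False + innovation_var \<kappa> both True) / 2 = (\<sigma> \<kappa>)\<^sup>2"
    using rho by (simp add: innovation_var_def load1_def load2_def power_mult_distrib algebra_simps)
  finally show ?thesis .
qed

lemma rho_hat_tendsto: "(\<lambda>n. rho_hat x n) \<longlonglongrightarrow> \<rho> \<kappa>"
proof -
  have "(\<lambda>n. avg (Tset both x n) (\<lambda>i. residue x (Tset both x n) False i * residue x (Tset both x n) True i) / sigma2_hat x n)
    \<longlonglongrightarrow> (\<sigma> \<kappa>)\<^sup>2 * \<rho> \<kappa> / (\<sigma> \<kappa>)\<^sup>2"
    using sigma_pos by (intro tendsto_divide residue_covariance_tendsto sigma2_hat_tendsto) simp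
  moreover have "rho_hat x n = avg (Tset both x n) (\<lambda>i. residue x (Tset both x n) False i * residue x (Tset both x n) True i) / sigma2_hat x n" for n
    by (simp add: rho_hat_def T_both_Tset avg_def mult.commute)
  ultimately show ?thesis using sigma_pos by simp
qed

definition phat :: "bool \<times> bool \<Rightarrow> nat \<Rightarrow> real" where
  "phat \<tau> n = real (card (Tset \<tau> x n)) / real (card (alive x (tree_upto n)))"

lemma phat_tendsto:
  assumes l: "living \<tau> \<delta>" shows "phat \<tau> \<longlonglongrightarrow> type_prob \<theta> \<tau>"
proof -
  have a: "(\<lambda>n. real (card (alive x (tree_upto n))) / m ^ n) \<longlonglongrightarrow> w * tree_factor"
    unfolding card_alive_upto by (rule tree_sum_tendsto[OF typicalD(1)[OF tyx]])
  have "(\<lambda>n. (real (card (Tset \<tau> x n)) / m ^ n) / (real (card (alive x (tree_upto n))) / m ^ n)) \<longlonglongrightarrow> type_prob \<theta> \<tau> * w * tree_factor / (w * tree_factor)"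
    using w tree_factor_pos by (intro tendsto_divide card_Tset_tendsto[OF l] a) simp
  then show ?thesis unfolding phat_def[abs_def] using w tree_factor_pos by simp
qed

lemma phat_null: "type_prob \<theta> \<tau> = 0 \<Longrightarrow> phat \<tau> n = 0"
  using typicalD(4)[OF tyx, of \<tau>] by (simp add: phat_def card_Tset tsum_def)

text \<open>Convergence of \<open>u\<close> is only required for types of positive probability. For
  a null type \<open>phat\<close> is 0 for every \<open>n\<close>, so the product is 0 whatever
  value the undefined estimator has been given.\<close>

lemma phat_mult_tendsto:
  assumes l: "living \<tau> \<delta>" and u: "type_prob \<theta> \<tau> > 0 \<Longrightarrow> u \<longlonglongrightarrow> L"
  shows "(\<lambda>n. phat \<tau> n * u n) \<longlonglongrightarrow> type_prob \<theta> \<tau> * L"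
proof (cases "type_prob \<theta> \<tau> = 0")
  case False
  then show ?thesis using type_prob_nonneg[of \<tau>] by (intro tendsto_mult phat_tendsto[OF l] u) simp
qed (simp add: phat_null)

lemma sigma2_only_tendsto:
  assumes "type_prob \<theta> (\<not> \<delta>, \<delta>) > 0"
  shows "(\<lambda>n. sigma2_only_hat \<delta> x n) \<longlonglongrightarrow> (if \<delta> then \<sigma>\<^sub>1 \<kappa> else \<sigma>\<^sub>0 \<kappa>)\<^sup>2"
  using residue_variance_tendsto[where \<tau>="(\<not> \<delta>, \<delta>)" and \<delta>=\<delta>] assms
  by (auto simp: sigma2_only_hat_def T_only_Tset avg_def innovation_var_def load1_def load2_def split: if_splits)

lemma theta_hat_simps:
  "\<alpha>\<^sub>0 (theta_hat x n) = slope_hat x (Tset both x n) False" "\<beta>\<^sub>0 (theta_hat x n) = intercept_hat x (Tset both x n) False"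
  "\<alpha>\<^sub>1 (theta_hat x n) = slope_hat x (Tset both x n) True" "\<beta>\<^sub>1 (theta_hat x n) = intercept_hat x (Tset both x n) True"
  "\<alpha>'\<^sub>0 (theta_hat x n) = slope_hat x (Tset (True, False) x n) False" "\<beta>'\<^sub>0 (theta_hat x n) = intercept_hat x (Tset (True, False) x n) False"
  "\<alpha>'\<^sub>1 (theta_hat x n) = slope_hat x (Tset (False, True) x n) True" "\<beta>'\<^sub>1 (theta_hat x n) = intercept_hat x (Tset (False, True) x n) True"
  "p\<^sub>1\<^sub>0 (theta_hat x n) = phat both n" "p\<^sub>0 (theta_hat x n) = phat (True, False) n" "p\<^sub>1 (theta_hat x n) = phat (False, True) n"
  by (simp_all add: theta_hat_def T_both_Tset T_only_Tset phat_def)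

lemma kappa_hat_simps:
  "(\<sigma> (kappa_hat x n))\<^sup>2 = sigma2_hat x n" "\<rho> (kappa_hat x n) = rho_hat x n"
  "(\<sigma>\<^sub>0 (kappa_hat x n))\<^sup>2 = sigma2_only_hat False x n" "(\<sigma>\<^sub>1 (kappa_hat x n))\<^sup>2 = sigma2_only_hat True x n"
  by (simp_all add: kappa_hat_def sigma2_nonneg)

lemma phat_poly_tendsto:
  assumes l: "living \<tau> \<delta>"
  shows "(\<lambda>n. phat \<tau> n * (slope_hat x (Tset \<tau> x n) \<delta> ^ a * intercept_hat x (Tset \<tau> x n) \<delta> ^ b)) \<longlonglongrightarrow>
     type_prob \<theta> \<tau> * (slope \<theta> \<tau> \<delta> ^ a * icpt \<theta> \<tau> \<delta> ^ b)"
  by (intro phat_mult_tendsto[OF l] tendsto_intros slope_hat_tendsto[OF l] intercept_hat_tendsto[OF l])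

lemma mean_hat_tendsto: "(\<lambda>n. mean_offspring (theta_hat x n)) \<longlonglongrightarrow> m"
proof -
  have "(\<lambda>n. mean_offspring (theta_hat x n)) \<longlonglongrightarrow> 2 * type_prob \<theta> both + type_prob \<theta> (True, False) + type_prob \<theta> (False, True)"
    unfolding mean_offspring_def theta_hat_simps
    by (intro tendsto_intros phat_tendsto[where \<tau>=both and \<delta>=True] phat_tendsto[where \<tau>="(True, False)" and \<delta>=False]
        phat_tendsto[where \<tau>="(False, True)" and \<delta>=True]) auto
  then show ?thesis by (simp add: slope_values mean_offspring_def)
qed

lemma bars_tendsto:
  "(\<lambda>n. alpha_bar (theta_hat x n)) \<longlonglongrightarrow> alpha_bar \<theta>"
  "(\<lambda>n. beta_bar (theta_hat x n)) \<longlonglongrightarrow> beta_bar \<theta>"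
  "(\<lambda>n. alpha2_bar (theta_hat x n)) \<longlonglongrightarrow> alpha2_bar \<theta>"
  "(\<lambda>n. beta2_bar (theta_hat x n)) \<longlonglongrightarrow> beta2_bar \<theta>"
  "(\<lambda>n. alpha_beta_bar (theta_hat x n)) \<longlonglongrightarrow> alpha_beta_bar \<theta>"
  "(\<lambda>n. sigma2_bar (theta_hat x n) (kappa_hat x n)) \<longlonglongrightarrow> sigma2_bar \<theta> \<kappa>"
proof -
  have l: "living both False" "living both True" "living (True, False) False" "living (False, True) True" by auto
  define P where "P \<tau> \<delta> a b n = phat \<tau> n * (slope_hat x (Tset \<tau> x n) \<delta> ^ a * intercept_hat x (Tset \<tau> x n) \<delta> ^ b)" for \<tau> \<delta> a b n
  define Q where "Q \<tau> \<delta> a b = type_prob \<theta> \<tau> * (slope \<theta> \<tau> \<delta> ^ a * icpt \<theta> \<tau> \<delta> ^ b)" for \<tau> \<delta> a b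
  have main: "(\<lambda>n. (P both False a b n + P both True a b n + P (True, False) False a b n + P (False, True) True a b n) / mean_offspring (theta_hat x n))
    \<longlonglongrightarrow> (Q both False a b + Q both True a b + Q (True, False) False a b + Q (False, True) True a b) / m" for a b
    unfolding P_def Q_def by (intro tendsto_intros phat_poly_tendsto l mean_hat_tendsto) simp
  show "(\<lambda>n. alpha_bar (theta_hat x n)) \<longlonglongrightarrow> alpha_bar \<theta>"
    using main[of 1 0] by (simp add: P_def Q_def alpha_bar_def theta_hat_simps slope_values algebra_simps)
  show "(\<lambda>n. beta_bar (theta_hat x n)) \<longlonglongrightarrow> beta_bar \<theta>"
    using main[of 0 1] by (simp add: P_def Q_def beta_bar_def theta_hat_simps slope_values algebra_simps)
  show "(\<lambda>n. alpha2_bar (theta_hat x n)) \<longlonglongrightarrow> alpha2_bar \<theta>"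
    using main[of 2 0] by (simp add: P_def Q_def alpha2_bar_def theta_hat_simps slope_values algebra_simps)
  show "(\<lambda>n. beta2_bar (theta_hat x n)) \<longlonglongrightarrow> beta2_bar \<theta>"
    using main[of 0 2] by (simp add: P_def Q_def beta2_bar_def theta_hat_simps slope_values algebra_simps)
  show "(\<lambda>n. alpha_beta_bar (theta_hat x n)) \<longlonglongrightarrow> alpha_beta_bar \<theta>"
    using main[of 1 1] by (simp add: P_def Q_def alpha_beta_bar_def theta_hat_simps slope_values algebra_simps)
  have "(\<lambda>n. (2 * phat both n * sigma2_hat x n + phat (True, False) n * sigma2_only_hat False x n + phat (False, True) n * sigma2_only_hat True x n) / mean_offspring (theta_hat x n))
    \<longlonglongrightarrow> (2 * type_prob \<theta> both * (\<sigma> \<kappa>)\<^sup>2 + type_prob \<theta> (True, False) * (\<sigma>\<^sub>0 \<kappa>)\<^sup>2 + type_prob \<theta> (False, True) * (\<sigma>\<^sub>1 \<kappa>)\<^sup>2) / m"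
    using sigma2_only_tendsto[of False] sigma2_only_tendsto[of True]
    by (intro tendsto_intros phat_mult_tendsto[OF l(3)] phat_mult_tendsto[OF l(4)] phat_tendsto[OF l(1)] sigma2_hat_tendsto mean_hat_tendsto) simp_all
  then show "(\<lambda>n. sigma2_bar (theta_hat x n) (kappa_hat x n)) \<longlonglongrightarrow> sigma2_bar \<theta> \<kappa>"
    by (simp add: sigma2_bar_def theta_hat_simps kappa_hat_simps slope_values)
qed

lemma mu1_hat_tendsto: "(\<lambda>n. mu1 (theta_hat x n)) \<longlonglongrightarrow> mu1 \<theta>"
  unfolding mu1_def using alpha_bar_bounds(1) by (intro tendsto_intros bars_tendsto) auto

lemma mu2_hat_tendsto: "(\<lambda>n. mu2 (theta_hat x n) (kappa_hat x n)) \<longlonglongrightarrow> mu2 \<theta> \<kappa>"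
proof -
  let ?t = "\<lambda>n. theta_hat x n"
  have "(\<lambda>n. (2 * alpha_beta_bar (?t n) * beta_bar (?t n) / (1 - alpha_bar (?t n)) + beta2_bar (?t n) + sigma2_bar (?t n) (kappa_hat x n)) / (1 - alpha2_bar (?t n)))
    \<longlonglongrightarrow> (2 * alpha_beta_bar \<theta> * beta_bar \<theta> / (1 - alpha_bar \<theta>) + beta2_bar \<theta> + sigma2_bar \<theta> \<kappa>) / (1 - alpha2_bar \<theta>)"
    using alpha_bar_bounds by (intro tendsto_intros bars_tendsto) auto
  also have "(2 * alpha_beta_bar \<theta> * beta_bar \<theta> / (1 - alpha_bar \<theta>) + beta2_bar \<theta> + sigma2_bar \<theta> \<kappa>) / (1 - alpha2_bar \<theta>) = mu2 \<theta> \<kappa>"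
    using alpha_bar_bounds by (auto simp: mu2_def)
  finally have lim: "(\<lambda>n. (2 * alpha_beta_bar (?t n) * beta_bar (?t n) / (1 - alpha_bar (?t n)) + beta2_bar (?t n) + sigma2_bar (?t n) (kappa_hat x n)) / (1 - alpha2_bar (?t n)))
    \<longlonglongrightarrow> mu2 \<theta> \<kappa>" .
  \<comment> \<open>Eventually the default branch in the definition of \<open>mu2\<close> is not
    taken, and the limit of the plain quotient applies.\<close>
  have "\<forall>\<^sub>F n in sequentially. alpha_bar (?t n) < 1"
    by (rule order_tendstoD(2)[OF bars_tendsto(1)]) (use alpha_bar_bounds(1) in auto)
  then have "\<forall>\<^sub>F n in sequentially. (2 * alpha_beta_bar (?t n) * beta_bar (?t n) / (1 - alpha_bar (?t n)) + beta2_bar (?t n) + sigma2_bar (?t n) (kappa_hat x n)) / (1 - alpha2_bar (?t n)) = mu2 (?t n) (kappa_hat x n)"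
    by eventually_elim (simp add: mu2_def)
  from tendsto_cong[OF this] lim show ?thesis by blast
qed

lemma zeta_expand:
  "zeta n x = real (card (Tset both x n)) * (1 / (2 * sigma2_hat x n * (1 - rho_hat x n)) *
     ((slope_hat x (Tset both x n) False - slope_hat x (Tset both x n) True)\<^sup>2 * (mu2 (theta_hat x n) (kappa_hat x n) - (mu1 (theta_hat x n))\<^sup>2) +
      ((slope_hat x (Tset both x n) False - slope_hat x (Tset both x n) True) * mu1 (theta_hat x n) + intercept_hat x (Tset both x n) False - intercept_hat x (Tset both x n) True)\<^sup>2))"
  by (simp add: zeta_def Let_def theta_hat_simps kappa_hat_simps T_both_Tset)

text \<open>The factor beside the number of cells tends to a positive limit: it is, up to a positive
  constant, the mean square of a nonzero affine function. If the slopes differ, positivity of the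
  variance is used; if they agree, the intercepts must differ.\<close>

lemma zeta_at_top:
  assumes H1: "(\<alpha>\<^sub>0 \<theta>, \<beta>\<^sub>0 \<theta>) \<noteq> (\<alpha>\<^sub>1 \<theta>, \<beta>\<^sub>1 \<theta>)"
  shows "filterlim (\<lambda>n. zeta n x) at_top sequentially"
proof -
  have l: "living both False" "living both True" by auto
  have rho: "\<rho> \<kappa> < 1" using admissible by (simp add: admissible_def)
  let ?L = "1 / (2 * (\<sigma> \<kappa>)\<^sup>2 * (1 - \<rho> \<kappa>)) * ((\<alpha>\<^sub>0 \<theta> - \<alpha>\<^sub>1 \<theta>)\<^sup>2 * (mu2 \<theta> \<kappa> - (mu1 \<theta>)\<^sup>2) + ((\<alpha>\<^sub>0 \<theta> - \<alpha>\<^sub>1 \<theta>) * mu1 \<theta> + \<beta>\<^sub>0 \<theta> - \<beta>\<^sub>1 \<theta>)\<^sup>2)"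
  have lim: "(\<lambda>n. 1 / (2 * sigma2_hat x n * (1 - rho_hat x n)) *
     ((slope_hat x (Tset both x n) False - slope_hat x (Tset both x n) True)\<^sup>2 * (mu2 (theta_hat x n) (kappa_hat x n) - (mu1 (theta_hat x n))\<^sup>2) +
      ((slope_hat x (Tset both x n) False - slope_hat x (Tset both x n) True) * mu1 (theta_hat x n) + intercept_hat x (Tset both x n) False - intercept_hat x (Tset both x n) True)\<^sup>2)) \<longlonglongrightarrow> ?L"
    using sigma_pos rho slope_hat_tendsto[OF l(1) both_prob(1)] slope_hat_tendsto[OF l(2) both_prob(1)]
      intercept_hat_tendsto[OF l(1) both_prob(1)] intercept_hat_tendsto[OF l(2) both_prob(1)]
    by (intro tendsto_intros sigma2_hat_tendsto rho_hat_tendsto mu1_hat_tendsto mu2_hat_tendsto) (simp_all add: slope_values)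
  have "?L > 0"
  proof (intro mult_pos_pos divide_pos_pos)
    show "0 < (\<alpha>\<^sub>0 \<theta> - \<alpha>\<^sub>1 \<theta>)\<^sup>2 * (mu2 \<theta> \<kappa> - (mu1 \<theta>)\<^sup>2) + ((\<alpha>\<^sub>0 \<theta> - \<alpha>\<^sub>1 \<theta>) * mu1 \<theta> + \<beta>\<^sub>0 \<theta> - \<beta>\<^sub>1 \<theta>)\<^sup>2"
    proof (cases "\<alpha>\<^sub>0 \<theta> = \<alpha>\<^sub>1 \<theta>")
      case True then show ?thesis using H1 by simp
    next
      case False then show ?thesis using mu_variance_pos by (intro add_pos_nonneg mult_pos_pos) auto
    qed
  qed (use sigma_pos rho in auto)
  then show ?thesis
    unfolding zeta_expand
    by (intro filterlim_at_top_mult_tendsto_pos[OF lim _ card_Tset_at_top[OF l(1) both_prob(1)]])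
qed

end

end

section \<open>The statistic under the null hypothesis\<close>

text \<open>Here \<open>a\<close> and \<open>b\<close> stand for the two normalised sums,
  \<open>e1\<close> and \<open>e2\<close> for the omitted early generations, and \<open>C\<close>,
  \<open>q\<close>, \<open>d\<close>, \<open>g\<close> for factors and errors due to estimated
  quantities. Nothing bounds \<open>a\<close> and \<open>b\<close>, so only the error relative to
  \<open>1 + a * a + b * b\<close> can be shown to vanish.\<close>

lemma quadratic_form_perturbation:
  fixes a b e1 e2 C g d q s :: "nat \<Rightarrow> real"
  assumes e: "e1 \<longlonglongrightarrow> 0" "e2 \<longlonglongrightarrow> 0" and C: "C \<longlonglongrightarrow> 1" and g: "g \<longlonglongrightarrow> 0" and d: "d \<longlonglongrightarrow> 0"
    and q: "(\<lambda>n. q n * l\<^sup>2) \<longlonglongrightarrow> 1"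
  shows "(\<lambda>n. (C n * (q n * (l * b n + e2 n - d n * (a n + e1 n))\<^sup>2 + (a n + e1 n + g n * (l * b n + e2 n - d n * (a n + e1 n)))\<^sup>2)
     - ((a n)\<^sup>2 + (b n)\<^sup>2)) / (1 + ((a n)\<^sup>2 + (b n)\<^sup>2))) \<longlonglongrightarrow> 0"
proof -
  define y where "y n = (a n)\<^sup>2 + (b n)\<^sup>2" for n
  \<comment> \<open>Division by \<open>t\<close> makes both coordinates bounded by 1, while null
    sequences stay null since \<open>t\<close> is at least 1. The quadratic expression is
    homogeneous in the coordinates and the errors \<open>e1\<close>, \<open>e2\<close>, so the whole
    quotient can be rewritten in the rescaled quantities.\<close>
  define t where "t n = sqrt (1 + y n)" for n
  have t: "t n > 0" "(t n)\<^sup>2 = 1 + y n" "1 \<le> t n" for n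
    by (simp_all add: t_def y_def add_pos_nonneg add_nonneg_nonneg)
  define a' where "a' n = a n / t n" for n
  define b' where "b' n = b n / t n" for n
  have ab: "\<bar>a' n\<bar> \<le> 1" "\<bar>b' n\<bar> \<le> 1" for n
  proof -
    have "\<bar>a n\<bar> \<le> t n" "\<bar>b n\<bar> \<le> t n"
      unfolding t_def y_def by (rule real_le_rsqrt, simp)+
    then show "\<bar>a' n\<bar> \<le> 1" "\<bar>b' n\<bar> \<le> 1" using t(1)[of n] by (simp_all add: a'_def b'_def)
  qed
  have e': "(\<lambda>n. e1 n / t n) \<longlonglongrightarrow> 0" "(\<lambda>n. e2 n / t n) \<longlonglongrightarrow> 0"
  proof -
    have "(\<lambda>n. f n / t n) \<longlonglongrightarrow> 0" if "f \<longlonglongrightarrow> 0" for f :: "nat \<Rightarrow> real"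
    proof (rule Lim_null_comparison)
      show "\<forall>\<^sub>F n in sequentially. norm (f n / t n) \<le> \<bar>f n\<bar>"
      proof (intro always_eventually allI)
        fix n
        have "\<bar>f n\<bar> * 1 \<le> \<bar>f n\<bar> * t n" using t(3)[of n] by (intro mult_left_mono) auto
        then show "norm (f n / t n) \<le> \<bar>f n\<bar>" using t(1)[of n] by (simp add: divide_simps abs_of_pos)
      qed
      show "(\<lambda>n. \<bar>f n\<bar>) \<longlonglongrightarrow> 0" using tendsto_rabs[OF that] by simp
    qed
    then show "(\<lambda>n. e1 n / t n) \<longlonglongrightarrow> 0" "(\<lambda>n. e2 n / t n) \<longlonglongrightarrow> 0" using e by auto
  qed
  have bz: "(\<lambda>n. f n * z n) \<longlonglongrightarrow> 0" if "f \<longlonglongrightarrow> 0" "\<And>n. \<bar>z n\<bar> \<le> B" for f z :: "nat \<Rightarrow> real" and B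
    by (rule tendsto_0_le[where K=B, OF that(1)]) (use that(2) in \<open>auto simp: abs_mult intro!: always_eventually mult_left_mono\<close>)
  define u where "u n = e2 n / t n - d n * (a' n + e1 n / t n)" for n
  define v where "v n = e1 n / t n + g n * (l * b' n + u n)" for n
  have u: "u \<longlonglongrightarrow> 0"
  proof -
    have "(\<lambda>n. e2 n / t n - (d n * a' n + d n * (e1 n / t n))) \<longlonglongrightarrow> 0 - (0 + 0 * 0)"
      by (intro tendsto_intros e' d bz[OF d ab(1)])
    then show ?thesis by (simp add: u_def[abs_def] distrib_left)
  qed
  have v: "v \<longlonglongrightarrow> 0"
  proof -
    have "(\<lambda>n. e1 n / t n + (l * (g n * b' n) + g n * u n)) \<longlonglongrightarrow> 0 + (l * 0 + 0 * 0)"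
      by (intro tendsto_intros e' g u bz[OF g ab(2)])
    then show ?thesis by (simp add: v_def[abs_def] algebra_simps)
  qed
  have ql: "(\<lambda>n. q n * l\<^sup>2 * C n) \<longlonglongrightarrow> 1 * 1" by (intro tendsto_intros q C)
  have l0: "l \<noteq> 0"
  proof
    assume "l = 0"
    with q have "(\<lambda>n. 0 :: real) \<longlonglongrightarrow> 1" by simp
    from LIMSEQ_unique[OF this tendsto_const] show False by simp
  qed
  have "(\<lambda>n. q n * l\<^sup>2 / l\<^sup>2) \<longlonglongrightarrow> 1 / l\<^sup>2" using l0 by (intro tendsto_intros q) simp
  then have q': "q \<longlonglongrightarrow> 1 / l\<^sup>2" using l0 by simp
  have b2: "\<bar>(a' n)\<^sup>2\<bar> \<le> 1" "\<bar>(b' n)\<^sup>2\<bar> \<le> 1" for n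
    using ab[of n] by (simp_all add: abs_square_le_1)
  have lim: "(\<lambda>n. (q n * l\<^sup>2 * C n - 1) * (b' n)\<^sup>2 + (C n - 1) * (a' n)\<^sup>2
     + C n * (q n * (2 * l * (u n * b' n) + (u n)\<^sup>2)) + C n * (2 * (v n * a' n) + (v n)\<^sup>2)) \<longlonglongrightarrow> 0 + 0 + 1 * (1 / l\<^sup>2 * (2 * l * 0 + 0\<^sup>2)) + 1 * (2 * 0 + 0\<^sup>2)"
  proof (intro tendsto_intros C q' u v bz[OF u ab(2)] bz[OF v ab(1)])
    have "(\<lambda>n. q n * l\<^sup>2 * C n - 1) \<longlonglongrightarrow> 0" using tendsto_diff[OF ql tendsto_const[of 1]] by simp
    then show "(\<lambda>n. (q n * l\<^sup>2 * C n - 1) * (b' n)\<^sup>2) \<longlonglongrightarrow> 0" by (rule bz[OF _ b2(2)])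
    have "(\<lambda>n. C n - 1) \<longlonglongrightarrow> 0" using tendsto_diff[OF C tendsto_const[of 1]] by simp
    then show "(\<lambda>n. (C n - 1) * (a' n)\<^sup>2) \<longlonglongrightarrow> 0" by (rule bz[OF _ b2(1)])
  qed
  have eq: "(C n * (q n * (l * b n + e2 n - d n * (a n + e1 n))\<^sup>2 + (a n + e1 n + g n * (l * b n + e2 n - d n * (a n + e1 n)))\<^sup>2)
     - ((a n)\<^sup>2 + (b n)\<^sup>2)) / (1 + ((a n)\<^sup>2 + (b n)\<^sup>2)) =
     (q n * l\<^sup>2 * C n - 1) * (b' n)\<^sup>2 + (C n - 1) * (a' n)\<^sup>2
     + C n * (q n * (2 * l * (u n * b' n) + (u n)\<^sup>2)) + C n * (2 * (v n * a' n) + (v n)\<^sup>2)" for n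
  proof -
    have tn: "t n \<noteq> 0" using t(1)[of n] by simp
    have ea: "a n = t n * a' n" "b n = t n * b' n" using tn by (simp_all add: a'_def b'_def)
    have eu: "l * b n + e2 n - d n * (a n + e1 n) = t n * (l * b' n + u n)"
      using tn by (simp add: u_def ea algebra_simps)
    have ev: "a n + e1 n + g n * (l * b n + e2 n - d n * (a n + e1 n)) = t n * (a' n + v n)"
      unfolding eu using tn by (simp add: v_def ea algebra_simps)
    have "(C n * (q n * (l * b n + e2 n - d n * (a n + e1 n))\<^sup>2 + (a n + e1 n + g n * (l * b n + e2 n - d n * (a n + e1 n)))\<^sup>2)
     - ((a n)\<^sup>2 + (b n)\<^sup>2)) = (t n)\<^sup>2 * (C n * (q n * (l * b' n + u n)\<^sup>2 + (a' n + v n)\<^sup>2) - ((a' n)\<^sup>2 + (b' n)\<^sup>2))"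
      unfolding ev unfolding eu unfolding ea power_mult_distrib by (simp add: algebra_simps)
    also have "\<dots> / (1 + ((a n)\<^sup>2 + (b n)\<^sup>2)) = C n * (q n * (l * b' n + u n)\<^sup>2 + (a' n + v n)\<^sup>2) - ((a' n)\<^sup>2 + (b' n)\<^sup>2)"
      unfolding t(2)[of n, unfolded y_def, symmetric] using tn by simp
    finally show ?thesis by (simp add: algebra_simps power2_eq_square)
  qed
  show ?thesis unfolding eq using lim by simp
qed

text \<open>The step function is Lipschitz and vanishes beyond \<open>b\<close>. Where
  \<open>y\<close> is bounded, a small relative error is a small absolute one; where
  \<open>y\<close> is large, so is \<open>x\<close>, and both values are 0.\<close>

lemma cts_step_diff_null:
  fixes x y :: "nat \<Rightarrow> real"
  assumes ratio: "(\<lambda>n. (x n - y n) / (1 + y n)) \<longlonglongrightarrow> 0" and y: "\<And>n. y n \<ge> 0" and ab: "a < b"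
  shows "(\<lambda>n. cts_step a b (x n) - cts_step a b (y n)) \<longlonglongrightarrow> 0"
proof -
  \<comment> \<open>The threshold is chosen such that a relative error of at most 1/4 and
    \<open>y > 2 * B\<close> give \<open>x \<ge> B\<close>, which is beyond the step.\<close>
  define B where "B = max (b + 1) 1"
  have B1: "B \<ge> 1" by (simp add: B_def)
  have lip: "\<bar>cts_step a b p - cts_step a b r\<bar> \<le> \<bar>p - r\<bar> / (b - a)" for p r
  proof -
    have c: "cts_step a b p = max 0 (min 1 ((b - p) / (b - a)))" for p
      using ab by (auto simp: cts_step_def min_def max_def divide_simps)
    have "\<bar>cts_step a b p - cts_step a b r\<bar> \<le> \<bar>(b - p) / (b - a) - (b - r) / (b - a)\<bar>"
      unfolding c by (simp add: min_def max_def abs_if)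
    also have "(b - p) / (b - a) - (b - r) / (b - a) = (r - p) / (b - a)"
      by (simp add: diff_divide_distrib)
    finally show ?thesis using ab by (simp add: abs_minus_commute abs_divide)
  qed
  define \<delta> where "\<delta> n = \<bar>(x n - y n) / (1 + y n)\<bar>" for n
  have \<delta>: "\<delta> \<longlonglongrightarrow> 0" using tendsto_rabs[OF ratio] by (simp add: \<delta>_def[abs_def])
  have xy: "\<bar>x n - y n\<bar> = \<delta> n * (1 + y n)" for n
    using y[of n] by (simp add: \<delta>_def abs_divide)
  have small: "\<forall>\<^sub>F n in sequentially. \<delta> n < 1 / (2 * (B + 1))"
    by (rule order_tendstoD(2)[OF \<delta>]) (use B1 in simp)
  show ?thesis
  proof (rule Lim_null_comparison)
    show "(\<lambda>n. \<delta> n * ((1 + 2 * B) / (b - a))) \<longlonglongrightarrow> 0" by (rule tendsto_mult_left_zero[OF \<delta>])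
    show "\<forall>\<^sub>F n in sequentially. norm (cts_step a b (x n) - cts_step a b (y n)) \<le> \<delta> n * ((1 + 2 * B) / (b - a))"
      using small
    proof eventually_elim
      case (elim n)
      show ?case
      proof (cases "y n \<le> 2 * B")
        case True
        have "norm (cts_step a b (x n) - cts_step a b (y n)) \<le> \<delta> n * (1 + y n) / (b - a)"
          using lip[of "x n" "y n"] by (simp add: xy)
        also have "\<dots> \<le> \<delta> n * (1 + 2 * B) / (b - a)"
          using True ab by (intro divide_right_mono mult_left_mono) (auto simp: \<delta>_def)
        finally show ?thesis by simp
      next
        case False
        have "\<delta> n \<le> 1 / 4" using elim B1 by (smt (verit) frac_le)
        then have "\<delta> n * (1 + y n) \<le> 1 / 4 * (1 + y n)" using y[of n] by (intro mult_right_mono) auto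
        then have "y n - x n \<le> 1 / 4 * (1 + y n)" using xy[of n] by linarith
        then have "4 * (y n - x n) \<le> 1 + y n" by simp
        moreover have "2 * B < y n" using False by simp
        ultimately have "x n \<ge> B" using B1 by argo
        moreover have "b \<le> B" by (simp add: B_def)
        ultimately have "x n \<ge> b" "y n \<ge> b" using \<open>2 * B < y n\<close> B1 by argo+
        then show ?thesis using ab B1 by (auto simp: cts_step_def \<delta>_def)
      qed
    qed
  qed
qed

lemma half_at_top: "filterlim (\<lambda>n::nat. n div 2) at_top sequentially"
  unfolding filterlim_at_top eventually_sequentially
  by (metis div_le_mono mult_2 nonzero_mult_div_cancel_left zero_neq_numeral)

context supercritical_bar
begin

text \<open>The variance of the difference of the innovations of two living sisters.\<close>

definition noise_var :: real where "noise_var = 2 * (\<sigma> \<kappa>)\<^sup>2 * (1 - \<rho> \<kappa>)"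

definition mu_sd :: real where "mu_sd = sqrt (mu2 \<theta> \<kappa> - (mu1 \<theta>)\<^sup>2)"

lemma noise_var_pos: "noise_var > 0"
  using sigma_pos admissible by (simp add: noise_var_def admissible_def)

lemma mu_sd_pos: "mu_sd > 0" "mu_sd\<^sup>2 = mu2 \<theta> \<kappa> - (mu1 \<theta>)\<^sup>2"
  using mu_variance_pos by (simp_all add: mu_sd_def)

text \<open>The square of \<open>scale x n\<close> predicts \<open>noise_var * card (T_both x n)\<close> from generation \<open>n div 2\<close>; the
  normalisation has to be known before the generations that it normalises.\<close>

definition scale :: "(node \<Rightarrow> real option) \<Rightarrow> nat \<Rightarrow> real" where
  "scale x n = sqrt (noise_var * (p\<^sub>1\<^sub>0 \<theta> * tree_factor) * m ^ (n - n div 2) * (\<Sum>i\<in>generation (n div 2). pw 0 (x i)))"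

text \<open>The weight depends on the mother, the difference of the sisters is the fresh noise. The
  sum starts at generation \<open>n div 2\<close>, the first one at which \<open>scale\<close> is
  known.\<close>

definition fluct :: "(real \<Rightarrow> real) \<Rightarrow> (node \<Rightarrow> real option) \<Rightarrow> nat \<Rightarrow> real" where
  "fluct f x n = (\<Sum>k\<in>{n div 2..n}. tsum both (\<lambda>z y0 y1. f z * (y0 - y1)) x k)"

text \<open>The weight functions of the two coordinates, \<open>1\<close> and
  \<open>(z - mu1 \<theta>) / mu_sd\<close>, are orthonormal with respect to the limiting moments;
  therefore the limits are uncorrelated with unit variance on survival.\<close>

definition coordA :: "(node \<Rightarrow> real option) \<Rightarrow> nat \<Rightarrow> real" where
  "coordA x n = fluct (\<lambda>z. 1) x n / scale x n"

definition coordB :: "(node \<Rightarrow> real option) \<Rightarrow> nat \<Rightarrow> real" where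
  "coordB x n = fluct (\<lambda>z. (z - mu1 \<theta>) / mu_sd) x n / scale x n"

lemma tsum_diff: "tsum \<tau> (\<lambda>z y0 y1. f z y0 y1 - g z y0 y1) x k = tsum \<tau> f x k - tsum \<tau> g x k"
  unfolding tsum_def sum_subtractf[symmetric] by (intro sum.cong) (auto simp: stat_def)

lemma tsum_cmult: "tsum \<tau> (\<lambda>z y0 y1. c * f z y0 y1) x k = c * tsum \<tau> f x k"
  unfolding tsum_def sum_distrib_left by (intro sum.cong) (auto simp: stat_def)

context
  fixes x :: "node \<Rightarrow> real option" and w :: real
  assumes tyx: "typical \<theta> \<kappa> w x" and w: "w > 0"
begin

text \<open>The size of generation \<open>n div 2\<close>, multiplied by the expected growth over
  the remaining \<open>n - n div 2\<close> generations, has after norming the same limit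
  \<open>w\<close> as the size of generation \<open>n\<close>.\<close>

lemma scale_sq_tendsto: "(\<lambda>n. (scale x n)\<^sup>2 / m ^ n) \<longlonglongrightarrow> noise_var * (p\<^sub>1\<^sub>0 \<theta> * tree_factor) * w"
proof -
  have eq: "(scale x n)\<^sup>2 / m ^ n = noise_var * (p\<^sub>1\<^sub>0 \<theta> * tree_factor) * ((\<Sum>i\<in>generation (n div 2). pw 0 (x i)) / m ^ (n div 2))" for n
  proof -
    have "m ^ n = m ^ (n - n div 2) * m ^ (n div 2)" by (simp add: power_add[symmetric])
    then show ?thesis
      using noise_var_pos p10_pos tree_factor_pos by (simp add: scale_def sum_nonneg)
  qed
  show ?thesis unfolding eq
    using filterlim_compose[OF typicalD(1)[OF tyx] half_at_top] by (intro tendsto_intros)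
qed

lemma scale_pos: "\<forall>\<^sub>F n in sequentially. scale x n > 0"
proof -
  have "\<forall>\<^sub>F n in sequentially. (scale x n)\<^sup>2 / m ^ n > 0"
    by (rule order_tendstoD(1)[OF scale_sq_tendsto]) (use noise_var_pos p10_pos tree_factor_pos w in simp)
  then show ?thesis
  proof eventually_elim
    case (elim n)
    moreover have "scale x n \<ge> 0" using noise_var_pos p10_pos tree_factor_pos by (simp add: scale_def sum_nonneg)
    ultimately show ?case by (cases "scale x n = 0") auto
  qed
qed

text \<open>The law of large numbers makes the sum over generations below \<open>n div 2\<close> of
  smaller order than \<open>m ^ (n div 2)\<close>, and \<open>scale\<close> is of order
  \<open>sqrt (m ^ n)\<close>, which is not smaller. No fluctuation estimate is required here
  because at most half of the generations are involved.\<close>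

lemma early_part_negligible:
  assumes u: "(\<lambda>k. u k / m ^ k) \<longlonglongrightarrow> 0"
  shows "(\<lambda>n. (\<Sum>k<n div 2. u k) / scale x n) \<longlonglongrightarrow> 0"
proof -
  have "(\<lambda>h. (\<Sum>k\<le>h. u k) / m ^ h - u h / m ^ h) \<longlonglongrightarrow> 0 * tree_factor - 0"
    by (intro tendsto_diff tree_sum_tendsto u)
  moreover have "(\<Sum>k\<le>h. u k) / m ^ h - u h / m ^ h = (\<Sum>k<h. u k) / m ^ h" for h
    by (simp add: lessThan_Suc_atMost[symmetric] add_divide_distrib)
  ultimately have "(\<lambda>h. (\<Sum>k<h. u k) / m ^ h) \<longlonglongrightarrow> 0" by simp
  from filterlim_compose[OF this half_at_top]
  have 1: "(\<lambda>n. (\<Sum>k<n div 2. u k) / m ^ (n div 2)) \<longlonglongrightarrow> 0" .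
  have "(\<lambda>n. ((\<Sum>k<n div 2. u k) / m ^ (n div 2))\<^sup>2 / ((scale x n)\<^sup>2 / m ^ n)) \<longlonglongrightarrow> 0\<^sup>2 / (noise_var * (p\<^sub>1\<^sub>0 \<theta> * tree_factor) * w)"
    using noise_var_pos p10_pos tree_factor_pos w by (intro tendsto_intros 1 scale_sq_tendsto) simp
  then have 2: "(\<lambda>n. ((\<Sum>k<n div 2. u k) / m ^ (n div 2))\<^sup>2 / ((scale x n)\<^sup>2 / m ^ n)) \<longlonglongrightarrow> 0" by simp
  have "(\<lambda>n. ((\<Sum>k<n div 2. u k) / scale x n)\<^sup>2) \<longlonglongrightarrow> 0"
  proof (rule Lim_null_comparison[OF _ 2], intro always_eventually allI)
    fix n
    let ?U = "(\<Sum>k<n div 2. u k)"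
    have "m ^ (n div 2) * m ^ (n div 2) \<le> m ^ n"
      unfolding power_add[symmetric] using supercritical by (intro power_increasing) auto
    then have le: "(m ^ (n div 2))\<^sup>2 \<le> m ^ n" by (simp add: power2_eq_square)
    have "?U\<^sup>2 / (scale x n)\<^sup>2 * 1 \<le> ?U\<^sup>2 / (scale x n)\<^sup>2 * (m ^ n / (m ^ (n div 2))\<^sup>2)"
      using le by (intro mult_left_mono) (auto simp: divide_simps)
    then show "norm ((?U / scale x n)\<^sup>2) \<le> (?U / m ^ (n div 2))\<^sup>2 / ((scale x n)\<^sup>2 / m ^ n)"
      by (simp add: power_divide mult.commute)
  qed
  then have "(\<lambda>n. sqrt (((\<Sum>k<n div 2. u k) / scale x n)\<^sup>2)) \<longlonglongrightarrow> sqrt 0" by (rule tendsto_real_sqrt)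
  then have "(\<lambda>n. \<bar>(\<Sum>k<n div 2. u k) / scale x n\<bar>) \<longlonglongrightarrow> 0" by simp
  then show ?thesis by (rule tendsto_rabs_zero_cancel)
qed

text \<open>Under the null hypothesis both sisters have the same limiting first moments, also
  jointly with the mother, so the limits cancel in the difference.\<close>

lemma tsum_noise_null:
  assumes H0: "\<alpha>\<^sub>0 \<theta> = \<alpha>\<^sub>1 \<theta>" "\<beta>\<^sub>0 \<theta> = \<beta>\<^sub>1 \<theta>"
  shows "(\<lambda>k. tsum both (\<lambda>z y0 y1. y0 - y1) x k / m ^ k) \<longlonglongrightarrow> 0"
    "(\<lambda>k. tsum both (\<lambda>z y0 y1. z * (y0 - y1)) x k / m ^ k) \<longlonglongrightarrow> 0"
proof -
  have l: "living both False" "living both True" by auto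
  have eq0: "tsum both (\<lambda>z y0 y1. y0 - y1) x k = tsum both (monomial False 0 1) x k - tsum both (monomial True 0 1) x k" for k
    by (simp add: tsum_diff[symmetric] monomial_def)
  have eq1: "tsum both (\<lambda>z y0 y1. z * (y0 - y1)) x k = tsum both (monomial False 1 1) x k - tsum both (monomial True 1 1) x k" for k
    by (simp add: tsum_diff[symmetric] monomial_def right_diff_distrib)
  show "(\<lambda>k. tsum both (\<lambda>z y0 y1. y0 - y1) x k / m ^ k) \<longlonglongrightarrow> 0"
    using tendsto_diff[OF typicalD(2)[OF tyx l(1), of 0 1] typicalD(2)[OF tyx l(2), of 0 1]] H0
    by (simp add: eq0 diff_divide_distrib joint_mom_def slope_def icpt_def)
  show "(\<lambda>k. tsum both (\<lambda>z y0 y1. z * (y0 - y1)) x k / m ^ k) \<longlonglongrightarrow> 0"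
    using tendsto_diff[OF typicalD(2)[OF tyx l(1), of 1 1] typicalD(2)[OF tyx l(2), of 1 1]] H0
    by (simp add: eq1 diff_divide_distrib joint_mom_def slope_def icpt_def)
qed

text \<open>Both regressions use the same cells and the same regressor, so the differences of the
  slopes and intercepts are linear in just two sums: those of the sister differences with weight 1
  and with the centred mother's value. The statistic is a quadratic form in these, with coefficients
  converging to those of the squared norm of \<open>coordA\<close> and
  \<open>coordB\<close>.\<close>

lemma zeta_close_H0:
  assumes H0: "\<alpha>\<^sub>0 \<theta> = \<alpha>\<^sub>1 \<theta>" "\<beta>\<^sub>0 \<theta> = \<beta>\<^sub>1 \<theta>"
  shows "(\<lambda>n. (zeta n x - ((coordA x n)\<^sup>2 + (coordB x n)\<^sup>2)) / (1 + ((coordA x n)\<^sup>2 + (coordB x n)\<^sup>2))) \<longlonglongrightarrow> 0"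
proof -
  have l: "living both False" "living both True" by auto
  let ?J = "\<lambda>n. Tset both x n"
  define N where "N n = real (card (?J n))" for n
  define R where "R n = scale x n" for n
  define D where "D i = val x (i @ [False]) - val x (i @ [True])" for i
  define Xb where "Xb n = avg (?J n) (\<lambda>i. val x i)" for n
  define V where "V n = avg (?J n) (\<lambda>i. (val x i)\<^sup>2) - (Xb n)\<^sup>2" for n
  define N1 where "N1 n = (\<Sum>i\<in>?J n. D i)" for n
  define N2 where "N2 n = (\<Sum>i\<in>?J n. (val x i - mu1 \<theta>) * D i)" for n
  define e1 where "e1 n = (\<Sum>k<n div 2. tsum both (\<lambda>z y0 y1. y0 - y1) x k) / R n" for n
  define e2 where "e2 n = (\<Sum>k<n div 2. tsum both (\<lambda>z y0 y1. (z - mu1 \<theta>) * (y0 - y1)) x k) / R n" for n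
  have split: "(\<Sum>k\<le>n. u k) = (\<Sum>k<n div 2. u k) + (\<Sum>k\<in>{n div 2..n}. u k)" for u :: "nat \<Rightarrow> real" and n
  proof -
    have "{..n} = {..<n div 2} \<union> {n div 2..n}" by auto
    then show ?thesis by (simp add: sum.union_disjoint[symmetric] ivl_disj_int)
  qed
  have Rpos: "\<forall>\<^sub>F n in sequentially. R n > 0" using scale_pos by (simp add: R_def)
  have N1: "\<forall>\<^sub>F n in sequentially. N1 n = R n * (coordA x n + e1 n)"
    using Rpos
  proof eventually_elim
    case (elim n)
    have "N1 n = (\<Sum>k\<le>n. tsum both (\<lambda>z y0 y1. y0 - y1) x k)" unfolding N1_def D_def by (rule sum_Tset[of "\<lambda>z y0 y1. y0 - y1"])
    then show ?case using elim by (simp add: split[of _ n] coordA_def fluct_def e1_def R_def field_simps)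
  qed
  have N2: "\<forall>\<^sub>F n in sequentially. N2 n = R n * (mu_sd * coordB x n + e2 n)"
    using Rpos
  proof eventually_elim
    case (elim n)
    have "N2 n = (\<Sum>k\<le>n. tsum both (\<lambda>z y0 y1. (z - mu1 \<theta>) * (y0 - y1)) x k)"
      unfolding N2_def D_def by (rule sum_Tset)
    moreover have "fluct (\<lambda>z. (z - mu1 \<theta>) / mu_sd) x n = (\<Sum>k\<in>{n div 2..n}. tsum both (\<lambda>z y0 y1. (z - mu1 \<theta>) * (y0 - y1)) x k) / mu_sd"
      unfolding fluct_def sum_divide_distrib
      using tsum_cmult[of both "1 / mu_sd" "\<lambda>z y0 y1. (z - mu1 \<theta>) * (y0 - y1)" x] by simp
    ultimately show ?case using elim mu_sd_pos(1) by (simp add: split[of _ n] coordB_def e2_def R_def field_simps)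
  qed
  have e1: "e1 \<longlonglongrightarrow> 0" unfolding e1_def[abs_def] R_def by (rule early_part_negligible[OF tsum_noise_null(1)[OF H0]])
  have e2: "e2 \<longlonglongrightarrow> 0" unfolding e2_def[abs_def] R_def
  proof (rule early_part_negligible)
    have "tsum both (\<lambda>z y0 y1. (z - mu1 \<theta>) * (y0 - y1)) x k =
      tsum both (\<lambda>z y0 y1. z * (y0 - y1)) x k - mu1 \<theta> * tsum both (\<lambda>z y0 y1. y0 - y1) x k" for k
      by (simp add: tsum_diff[symmetric] tsum_cmult[symmetric] left_diff_distrib)
    then show "(\<lambda>k. tsum both (\<lambda>z y0 y1. (z - mu1 \<theta>) * (y0 - y1)) x k / m ^ k) \<longlonglongrightarrow> 0"
      using tendsto_diff[OF tsum_noise_null(2)[OF H0] tendsto_mult_left[OF tsum_noise_null(1)[OF H0], of "mu1 \<theta>"]]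
      by (simp add: diff_divide_distrib)
  qed
  have Xb: "Xb \<longlonglongrightarrow> mu1 \<theta>" unfolding Xb_def[abs_def] by (rule avg_tendsto(1)[OF tyx w l(1) both_prob(1)])
  have V: "V \<longlonglongrightarrow> mu_sd\<^sup>2" unfolding V_def[abs_def] mu_sd_pos(2)
    by (intro tendsto_intros Xb avg_tendsto(2)[OF tyx w l(1) both_prob(1)])
  define mh1 where "mh1 n = mu1 (theta_hat x n)" for n
  define mh2 where "mh2 n = mu2 (theta_hat x n) (kappa_hat x n)" for n
  have mh1: "mh1 \<longlonglongrightarrow> mu1 \<theta>" unfolding mh1_def[abs_def] by (rule mu1_hat_tendsto[OF tyx w])
  have mh2: "mh2 \<longlonglongrightarrow> mu2 \<theta> \<kappa>" unfolding mh2_def[abs_def] by (rule mu2_hat_tendsto[OF tyx w])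
  \<comment> \<open>\<open>C\<close> compares the predicted with the estimated normalisation,
    \<open>q\<close> the estimated variance with the square of the empirical one. \<open>d\<close>
    is the error of centring at the true instead of the empirical mean. \<open>g\<close> measures
    the mismatch between the plug-in mean, which involves all types, and the empirical mean over
    cells with two daughters.\<close>
  define C where "C n = (R n)\<^sup>2 / (2 * sigma2_hat x n * (1 - rho_hat x n) * N n)" for n
  define q where "q n = (mh2 n - (mh1 n)\<^sup>2) / (V n)\<^sup>2" for n
  define d where "d n = Xb n - mu1 \<theta>" for n
  define g where "g n = (mh1 n - Xb n) / V n" for n
  have C: "C \<longlonglongrightarrow> 1"
  proof -
    have "(\<lambda>n. ((R n)\<^sup>2 / m ^ n) / (2 * sigma2_hat x n * (1 - rho_hat x n) * (N n / m ^ n))) \<longlonglongrightarrow>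
      (noise_var * (p\<^sub>1\<^sub>0 \<theta> * tree_factor) * w) / (2 * (\<sigma> \<kappa>)\<^sup>2 * (1 - \<rho> \<kappa>) * (type_prob \<theta> both * w * tree_factor))"
      unfolding R_def N_def
      using both_prob w tree_factor_pos sigma_pos admissible
      by (intro tendsto_intros scale_sq_tendsto sigma2_hat_tendsto[OF tyx w] rho_hat_tendsto[OF tyx w] card_Tset_tendsto[OF tyx w l(1)])
         (simp_all add: admissible_def)
    also have "(noise_var * (p\<^sub>1\<^sub>0 \<theta> * tree_factor) * w) / (2 * (\<sigma> \<kappa>)\<^sup>2 * (1 - \<rho> \<kappa>) * (type_prob \<theta> both * w * tree_factor)) = 1"
      using noise_var_pos w tree_factor_pos p10_pos unfolding both_prob(2) noise_var_def[symmetric] by simp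
    also have "(\<lambda>n. ((R n)\<^sup>2 / m ^ n) / (2 * sigma2_hat x n * (1 - rho_hat x n) * (N n / m ^ n))) = C"
      by (simp add: C_def fun_eq_iff)
    finally show ?thesis .
  qed
  have g: "g \<longlonglongrightarrow> 0"
    using tendsto_divide[OF tendsto_diff[OF mh1 Xb] V] mu_sd_pos(1) by (simp add: g_def[abs_def])
  have d: "d \<longlonglongrightarrow> 0" using tendsto_diff[OF Xb tendsto_const[of "mu1 \<theta>"]] by (simp add: d_def[abs_def])
  have q: "(\<lambda>n. q n * mu_sd\<^sup>2) \<longlonglongrightarrow> 1"
  proof -
    have "(\<lambda>n. q n * mu_sd\<^sup>2) \<longlonglongrightarrow> (mu2 \<theta> \<kappa> - (mu1 \<theta>)\<^sup>2) / (mu_sd\<^sup>2)\<^sup>2 * mu_sd\<^sup>2"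
      unfolding q_def using mu_sd_pos(1) by (intro tendsto_intros mh1 mh2 V) simp
    also have "(mu2 \<theta> \<kappa> - (mu1 \<theta>)\<^sup>2) / (mu_sd\<^sup>2)\<^sup>2 * mu_sd\<^sup>2 = 1"
      unfolding mu_sd_pos(2)[symmetric] using mu_sd_pos(1) by (simp add: power2_eq_square)
    finally show ?thesis .
  qed
  note lim = quadratic_form_perturbation[OF e1 e2 C g d q, of "coordB x" "coordA x"]
  have Vpos: "\<forall>\<^sub>F n in sequentially. V n > 0"
    by (rule order_tendstoD(1)[OF V]) (use mu_sd_pos(1) in simp)
  have "\<forall>\<^sub>F n in sequentially. zeta n x = C n * (q n * (mu_sd * coordB x n + e2 n - d n * (coordA x n + e1 n))\<^sup>2
     + (coordA x n + e1 n + g n * (mu_sd * coordB x n + e2 n - d n * (coordA x n + e1 n)))\<^sup>2)"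
    using N1 N2 Vpos card_Tset_pos[OF tyx w l(1) both_prob(1)]
  proof eventually_elim
    case (elim n)
    have Nn: "N n > 0" using elim(4) by (simp add: N_def)
    define P where "P = N1 n"
    \<comment> \<open>\<open>N2\<close> is centred at the true mean, the regression at the empirical
      one; the correction is a multiple of \<open>N1\<close>.\<close>
    define Q where "Q = N2 n - d n * N1 n"
    define A where "A = slope_hat x (?J n) False - slope_hat x (?J n) True"
    have avgD: "avg (?J n) (\<lambda>i. val x (i @ [False])) - avg (?J n) (\<lambda>i. val x (i @ [True])) = P / N n"
      unfolding avg_diff[symmetric] by (simp add: avg_def P_def N1_def D_def N_def)
    have avgXD: "avg (?J n) (\<lambda>i. val x i * val x (i @ [False])) - avg (?J n) (\<lambda>i. val x i * val x (i @ [True])) = (N2 n + mu1 \<theta> * N1 n) / N n"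
      unfolding avg_diff[symmetric] N2_def N1_def sum_distrib_left sum.distrib[symmetric]
      by (simp add: avg_def N_def D_def algebra_simps)
    have A0: "A = (avg (?J n) (\<lambda>i. val x i * val x (i @ [False])) - avg (?J n) (\<lambda>i. val x i * val x (i @ [True]))
       - Xb n * (avg (?J n) (\<lambda>i. val x (i @ [False])) - avg (?J n) (\<lambda>i. val x (i @ [True])))) / V n"
      unfolding A_def slope_hat_def Xb_def V_def diff_divide_distrib[symmetric] by (simp add: algebra_simps)
    have A: "A = Q / (N n * V n)"
    proof -
      have "(N2 n + mu1 \<theta> * N1 n) / N n - Xb n * (P / N n) = Q / N n"
        by (simp add: Q_def P_def d_def diff_divide_distrib add_divide_distrib algebra_simps)
      then show ?thesis unfolding A0 avgD avgXD by simp
    qed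
    have B: "intercept_hat x (?J n) False - intercept_hat x (?J n) True = P / N n - A * Xb n"
      unfolding avgD[symmetric] A_def intercept_hat_def Xb_def by (simp add: algebra_simps)
    have "zeta n x = N n * (1 / (2 * sigma2_hat x n * (1 - rho_hat x n)) * (A\<^sup>2 * (mh2 n - (mh1 n)\<^sup>2) + (A * mh1 n + (P / N n - A * Xb n))\<^sup>2))"
      unfolding zeta_expand[OF tyx w] A_def[symmetric] mh1_def[symmetric] mh2_def[symmetric] N_def[symmetric] B[symmetric]
      by (simp add: algebra_simps)
    also have "A * mh1 n + (P / N n - A * Xb n) = (P + g n * Q) / N n"
      unfolding A g_def using Nn elim(3) by (simp add: field_simps)
    also have "A\<^sup>2 * (mh2 n - (mh1 n)\<^sup>2) = q n * Q\<^sup>2 / (N n)\<^sup>2"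
      unfolding A q_def by (simp add: power_divide power_mult_distrib mult_ac)
    also have "N n * (1 / (2 * sigma2_hat x n * (1 - rho_hat x n)) * (q n * Q\<^sup>2 / (N n)\<^sup>2 + ((P + g n * Q) / N n)\<^sup>2)) =
       1 / (2 * sigma2_hat x n * (1 - rho_hat x n) * N n) * (q n * Q\<^sup>2 + (P + g n * Q)\<^sup>2)"
      using Nn by (simp add: power_divide add_divide_distrib[symmetric] power2_eq_square)
    also have "Q = R n * (mu_sd * coordB x n + e2 n - d n * (coordA x n + e1 n))"
      unfolding Q_def elim(1,2) by (simp add: algebra_simps)
    also have "P = R n * (coordA x n + e1 n)" unfolding P_def elim(1) ..
    finally show ?case
      by (simp add: C_def power_mult_distrib algebra_simps add_divide_distrib)
         (simp add: power2_eq_square algebra_simps add_divide_distrib)?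
  qed
  then have "\<forall>\<^sub>F n in sequentially. (C n * (q n * (mu_sd * coordB x n + e2 n - d n * (coordA x n + e1 n))\<^sup>2
     + (coordA x n + e1 n + g n * (mu_sd * coordB x n + e2 n - d n * (coordA x n + e1 n)))\<^sup>2) - ((coordA x n)\<^sup>2 + (coordB x n)\<^sup>2)) / (1 + ((coordA x n)\<^sup>2 + (coordB x n)\<^sup>2))
     = (zeta n x - ((coordA x n)\<^sup>2 + (coordB x n)\<^sup>2)) / (1 + ((coordA x n)\<^sup>2 + (coordB x n)\<^sup>2))"
    by eventually_elim simp
  from tendsto_cong[OF this] lim show ?thesis by blast
qed

end

end

section \<open>Conditional characteristic functions\<close>

text \<open>The generations below \<open>n div 2\<close> contribute a quantity of order
  \<open>c ^ (n div 2)\<close>, which disappears after division by \<open>c ^ n\<close>; the limit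
  is the one for the full sum.\<close>

lemma late_sum_tendsto:
  fixes u :: "nat \<Rightarrow> real"
  assumes m: "c > 1" and u: "(\<lambda>k. u k / c ^ k) \<longlonglongrightarrow> L"
  shows "(\<lambda>n. (\<Sum>k\<in>{n div 2..n}. u k) / c ^ n) \<longlonglongrightarrow> L * (c / (c - 1))"
proof -
  have T: "(\<lambda>n. (\<Sum>k\<le>n. u k) / c ^ n) \<longlonglongrightarrow> L * (c / (c - 1))"
    using tendsto_geometric_average[OF m u] m by simp
  have "(\<lambda>h. (\<Sum>k\<le>h. u k) / c ^ h - u h / c ^ h) \<longlonglongrightarrow> L * (c / (c - 1)) - L"
    by (intro tendsto_diff T u)
  moreover have "(\<Sum>k\<le>h. u k) / c ^ h - u h / c ^ h = (\<Sum>k<h. u k) / c ^ h" for h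
    by (simp add: lessThan_Suc_atMost[symmetric] add_divide_distrib)
  ultimately have E: "(\<lambda>h. (\<Sum>k<h. u k) / c ^ h) \<longlonglongrightarrow> L * (c / (c - 1)) - L" by simp
  have half2: "filterlim (\<lambda>n::nat. n - n div 2) at_top sequentially"
    unfolding filterlim_at_top eventually_sequentially
  proof (intro allI)
    fix Z :: nat
    show "\<exists>N. \<forall>n\<ge>N. Z \<le> n - n div 2" by (intro exI[of _ "2 * Z"]) auto
  qed
  have "(\<lambda>n. (\<Sum>k<n div 2. u k) / c ^ (n div 2) * (1 / c) ^ (n - n div 2)) \<longlonglongrightarrow> (L * (c / (c - 1)) - L) * 0"
    using m by (intro tendsto_mult filterlim_compose[OF E half_at_top] filterlim_compose[OF LIMSEQ_power_zero half2]) auto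
  moreover have "(\<Sum>k<n div 2. u k) / c ^ (n div 2) * (1 / c) ^ (n - n div 2) = (\<Sum>k<n div 2. u k) / c ^ n" for n
  proof -
    have "c ^ n = c ^ (n div 2) * c ^ (n - n div 2)" by (simp add: power_add[symmetric])
    then show ?thesis by (simp add: power_divide)
  qed
  ultimately have "(\<lambda>n. (\<Sum>k\<le>n. u k) / c ^ n - (\<Sum>k<n div 2. u k) / c ^ n) \<longlonglongrightarrow> L * (c / (c - 1)) - 0"
    by (intro tendsto_diff T) simp
  moreover have "(\<Sum>k\<le>n. u k) / c ^ n - (\<Sum>k<n div 2. u k) / c ^ n = (\<Sum>k\<in>{n div 2..n}. u k) / c ^ n" for n
  proof -
    have "{..n} = {..<n div 2} \<union> {n div 2..n}" by auto
    then have "(\<Sum>k\<le>n. u k) = (\<Sum>k<n div 2. u k) + (\<Sum>k\<in>{n div 2..n}. u k)"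
      by (simp add: sum.union_disjoint[symmetric] ivl_disj_int)
    then show ?thesis by (simp add: diff_divide_distrib[symmetric])
  qed
  ultimately show ?thesis by simp
qed

lemma integral_iexp_std_normal: "(CLINT z|std_normal_distribution. iexp (t * z)) = complex_of_real (exp (- (t\<^sup>2) / 2))"
  using char_std_normal_distribution by (simp add: char_def fun_eq_iff)

lemma integrable_iexp [simp]: "prob_space N \<Longrightarrow> f \<in> borel_measurable N \<Longrightarrow> complex_integrable N (\<lambda>z. iexp (f z))"
  by (rule finite_measure.integrable_const_bound[where B=1]) (auto simp: prob_space.finite_measure)

lemma gauss2_char:
  "(CLINT z|gauss2. iexp (a * fst z + b * snd z)) = complex_of_real (exp (- (a\<^sup>2 + b\<^sup>2) / 2))"
proof -
  interpret N: prob_space std_normal_distribution by (rule prob_space_std_normal)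
  interpret P: pair_prob_space std_normal_distribution std_normal_distribution ..
  have i: "complex_integrable gauss2 (\<lambda>z. iexp (a * fst z + b * snd z))"
    by (rule integrable_iexp[OF prob_space_gauss2]) measurable
  have "(CLINT z|gauss2. iexp (a * fst z + b * snd z)) =
    (CLINT x|std_normal_distribution. CLINT y|std_normal_distribution. iexp (a * x) * iexp (b * y))"
    using P.integral_fst'[OF i] by (simp add: distrib_left exp_add)
  also have "\<dots> = complex_of_real (exp (- (a\<^sup>2) / 2)) * complex_of_real (exp (- (b\<^sup>2) / 2))"
    by (simp only: integral_mult_left_zero integral_mult_right_zero integral_iexp_std_normal)
  also have "\<dots> = complex_of_real (exp (- (a\<^sup>2 + b\<^sup>2) / 2))"
    by (simp add: exp_add[symmetric] add_divide_distrib flip: of_real_mult)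
  finally show ?thesis .
qed

context supercritical_bar
begin

text \<open>The second exponential is the reciprocal of the characteristic function at
  \<open>c\<close> of a centred normal variable with variance \<open>noise_var\<close>. Cells
  without two living daughters get the factor 1, so the conditional mean is 1 for each type
  separately.\<close>

definition mart_factor :: "real \<Rightarrow> real option \<times> real option \<Rightarrow> complex" where
  "mart_factor c y = (if fst y \<noteq> None \<and> snd y \<noteq> None
     then iexp (c * (the (fst y) - the (snd y))) * complex_of_real (exp (noise_var * c\<^sup>2 / 2)) else 1)"

lemma measurable_mart_factor [measurable (raw)]:
  assumes [measurable]: "c \<in> borel_measurable N" "y \<in> N \<rightarrow>\<^sub>M state_pair_space"
  shows "(\<lambda>\<omega>. mart_factor (c \<omega>) (y \<omega>)) \<in> borel_measurable N"
  unfolding mart_factor_def by measurable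

lemma norm_mart_factor: "norm (mart_factor c y) \<le> exp (noise_var * c\<^sup>2 / 2)"
  using noise_var_pos by (auto simp: mart_factor_def norm_mult)

lemma integrable_mart_factor_noise: "complex_integrable (noise \<theta>) (\<lambda>\<xi>. mart_factor c (daughters \<theta> \<kappa> s \<xi>))"
  by (rule noise.integrable_const_bound[where B="exp (noise_var * c\<^sup>2 / 2)"]) (auto simp: norm_mart_factor)

text \<open>Under the null hypothesis the contribution of the mother cancels in the difference of
  the sisters. What is left is a combination of two independent standard normal variables with
  coefficients \<open>p\<close> and \<open>q\<close>, whose squares sum to \<open>noise_var\<close>
  times the square of \<open>c\<close>.\<close>

lemma integral_mart_factor_noise:
  assumes H0: "\<alpha>\<^sub>0 \<theta> = \<alpha>\<^sub>1 \<theta>" "\<beta>\<^sub>0 \<theta> = \<beta>\<^sub>1 \<theta>"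
  shows "(CLINT \<xi>|noise \<theta>. mart_factor c (daughters \<theta> \<kappa> s \<xi>)) = 1"
proof (cases s)
  case None
  then show ?thesis using noise.prob_space by (simp add: mart_factor_def)
next
  case (Some x)
  interpret g: prob_space gauss2 by (rule prob_space_gauss2)
  have rho: "1 - (\<rho> \<kappa>)\<^sup>2 > 0" using admissible by (auto simp: admissible_def abs_square_less_1 abs_less_iff)
  define p where "p = c * (\<sigma> \<kappa> * (1 - \<rho> \<kappa>))"
  define q where "q = - (c * (\<sigma> \<kappa> * sqrt (1 - (\<rho> \<kappa>)\<^sup>2)))"
  have pq: "p\<^sup>2 + q\<^sup>2 = noise_var * c\<^sup>2"
    using rho by (simp add: p_def q_def power_mult_distrib noise_var_def) (simp add: power2_eq_square algebra_simps)
  have b: "mart_factor c (daughters \<theta> \<kappa> s (both, z)) = iexp (p * fst z + q * snd z) * complex_of_real (exp (noise_var * c\<^sup>2 / 2))" for z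
    by (simp add: Some mart_factor_def daughters_def daughter_def slope_def icpt_def load1_def load2_def p_def q_def H0 algebra_simps)
  have o: "mart_factor c (daughters \<theta> \<kappa> s (\<tau>, z)) = 1" if "\<tau> \<noteq> both" for \<tau> z
    using that by (cases \<tau>) (auto simp: Some mart_factor_def daughters_def daughter_def)
  have val: "(CLINT z|gauss2. mart_factor c (daughters \<theta> \<kappa> s (\<tau>, z))) = 1" for \<tau>
  proof (cases "\<tau> = both")
    case True
    have "(CLINT z|gauss2. mart_factor c (daughters \<theta> \<kappa> s (\<tau>, z))) = complex_of_real (exp (- (p\<^sup>2 + q\<^sup>2) / 2)) * complex_of_real (exp (noise_var * c\<^sup>2 / 2))"
      unfolding True b by (simp only: integral_mult_left_zero gauss2_char)
    also have "\<dots> = 1" unfolding pq by (simp flip: of_real_mult exp_add)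
    finally show ?thesis .
  next
    case False then show ?thesis using g.prob_space by (simp add: o)
  qed
  have int: "integrable gauss2 (\<lambda>z. mart_factor c (daughters \<theta> \<kappa> s (\<tau>, z)))" for \<tau>
  proof (rule g.integrable_const_bound[where B="exp (noise_var * c\<^sup>2 / 2)"])
    have "(\<lambda>\<xi>. mart_factor c (daughters \<theta> \<kappa> s \<xi>)) \<in> borel_measurable (noise \<theta>)" by measurable
    then have "(\<lambda>z. mart_factor c (daughters \<theta> \<kappa> s (\<tau>, z))) \<in> borel_measurable (borel \<Otimes>\<^sub>M borel)"
      unfolding measurable_noise_type by blast
    then show "(\<lambda>z. mart_factor c (daughters \<theta> \<kappa> s (\<tau>, z))) \<in> borel_measurable gauss2"
      by (simp cong: measurable_cong_sets sets_pair_measure_cong)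
  qed (simp add: norm_mart_factor)
  show ?thesis
    by (subst integral_noise[OF admissible int])
       (simp add: val UNIV_types type_prob_def flip: scaleR_add_left)
qed

lemma measurable_tsum:
  assumes "(\<lambda>(x, y0, y1). f x y0 y1) \<in> borel_measurable (borel \<Otimes>\<^sub>M borel \<Otimes>\<^sub>M borel)"
  shows "(\<lambda>\<omega>. tsum \<tau> f (\<lambda>i. X i \<omega>) k) \<in> borel_measurable M"
proof -
  note [measurable] = measurable_stat[OF assms]
  show ?thesis unfolding tsum_def by measurable
qed

lemma measurable_coords [measurable]:
  "(\<lambda>\<omega>. coordA (\<lambda>i. X i \<omega>) n) \<in> borel_measurable M"
  "(\<lambda>\<omega>. coordB (\<lambda>i. X i \<omega>) n) \<in> borel_measurable M"
proof -
  note [measurable (raw)] = measurable_tsum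
  show "(\<lambda>\<omega>. coordA (\<lambda>i. X i \<omega>) n) \<in> borel_measurable M"
    unfolding coordA_def fluct_def scale_def by measurable
  show "(\<lambda>\<omega>. coordB (\<lambda>i. X i \<omega>) n) \<in> borel_measurable M"
    unfolding coordB_def fluct_def scale_def by measurable
qed

section \<open>The truncated exponential martingale in a fixed direction\<close>

context
  fixes t1 t2 :: real
begin

definition lin :: "real \<Rightarrow> real" where "lin z = t1 + t2 * ((z - mu1 \<theta>) / mu_sd)"

text \<open>The fraction is the limit of the load accumulated by all living cells; division by
  \<open>p\<^sub>1\<^sub>0\<close> appears because \<open>scale\<close> counts only the expected
  cells with two daughters. The added 1 leaves a margin, so that on survival the truncation is
  eventually not reached.\<close>

definition cap :: real where "cap = (t1\<^sup>2 + t2\<^sup>2) / (2 * p\<^sub>1\<^sub>0 \<theta>) + 1"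

definition wt :: "nat \<Rightarrow> node \<Rightarrow> 'a \<Rightarrow> real" where
  "wt n i \<omega> = (if X i \<omega> = None then 0 else lin (the (X i \<omega>)) / scale (\<lambda>i. X i \<omega>) n)"

definition load :: "nat \<Rightarrow> nat \<Rightarrow> 'a \<Rightarrow> real" where
  "load n k \<omega> = noise_var / 2 * (\<Sum>i\<in>generation k. (wt n i \<omega>)\<^sup>2)"

text \<open>The weights are switched off once the accumulated load of all living cells exceeds \<open>cap\<close>; in
  contrast to the load of the cells with two daughters, this is decided before the daughters are seen.\<close>

definition open_gen :: "nat \<Rightarrow> nat \<Rightarrow> 'a \<Rightarrow> bool" where
  "open_gen n k \<omega> \<longleftrightarrow> (\<Sum>j\<in>{n div 2..k}. load n j \<omega>) \<le> cap"

definition capped_wt :: "nat \<Rightarrow> nat \<Rightarrow> node \<Rightarrow> 'a \<Rightarrow> real" where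
  "capped_wt n k i \<omega> = (if open_gen n k \<omega> then wt n i \<omega> else 0)"

text \<open>The leading indicator is known at generation \<open>n div 2\<close>, the first one that
  contributes, and so passes through all conditional expectations. It removes the realisations on
  which \<open>scale\<close> is 0.\<close>

definition mart :: "nat \<Rightarrow> nat \<Rightarrow> 'a \<Rightarrow> complex" where
  "mart n k \<omega> = of_bool (Z (n div 2) \<omega> > 0) * (\<Prod>j\<in>{n div 2..<k}. \<Prod>i\<in>generation j. mart_factor (capped_wt n j i \<omega>) (ch i \<omega>))"

lemma measurable_pw_F: "length i \<le> k \<Longrightarrow> (\<lambda>\<omega>. pw j (X i \<omega>)) \<in> borel_measurable (F k)"
  by (rule measurable_compose[OF measurable_X_F measurable_pw])

lemma measurable_scale_F: "n div 2 \<le> k \<Longrightarrow> (\<lambda>\<omega>. scale (\<lambda>i. X i \<omega>) n) \<in> borel_measurable (F k)"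
proof -
  assume h: "n div 2 \<le> k"
  have [measurable]: "(\<lambda>\<omega>. \<Sum>i\<in>generation (n div 2). pw 0 (X i \<omega>)) \<in> borel_measurable (F k)"
    using h by (intro borel_measurable_sum measurable_pw_F) (auto simp: generation_def)
  show ?thesis unfolding scale_def by measurable
qed

lemma measurable_wt_F:
  assumes "n div 2 \<le> k" "length i \<le> k" shows "wt n i \<in> borel_measurable (F k)"
proof -
  note [measurable] = measurable_X_F[OF assms(2)] measurable_scale_F[OF assms(1)]
  show ?thesis unfolding wt_def lin_def by measurable
qed

lemma measurable_load_F:
  assumes "n div 2 \<le> k" "j \<le> k" shows "load n j \<in> borel_measurable (F k)"
  unfolding load_def using assms
  by (intro borel_measurable_times borel_measurable_const borel_measurable_sum borel_measurable_power measurable_wt_F)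
     (auto simp: generation_def)

lemma measurable_open_gen_F:
  assumes "n div 2 \<le> k" "j \<le> k" shows "Measurable.pred (F k) (open_gen n j)"
proof -
  have [measurable]: "(\<lambda>\<omega>. \<Sum>j\<in>{n div 2..j}. load n j \<omega>) \<in> borel_measurable (F k)"
    using assms by (intro borel_measurable_sum measurable_load_F) auto
  show ?thesis unfolding open_gen_def by measurable
qed

lemma measurable_capped_wt_F:
  assumes "n div 2 \<le> k" "j \<le> k" "length i \<le> k" shows "capped_wt n j i \<in> borel_measurable (F k)"
proof -
  note [measurable] = measurable_open_gen_F[OF assms(1,2)] measurable_wt_F[OF assms(1,3)]
  show ?thesis unfolding capped_wt_def by measurable
qed

lemma measurable_ch_F: "length i < k \<Longrightarrow> ch i \<in> F k \<rightarrow>\<^sub>M state_pair_space"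
  unfolding ch_def by (intro measurable_Pair measurable_X_F) auto

lemma measurable_alive_F:
  assumes "n div 2 \<le> k" shows "Measurable.pred (F k) (\<lambda>\<omega>. Z (n div 2) \<omega> > 0)"
proof -
  have "(\<lambda>\<omega>. real (Z (n div 2) \<omega>)) \<in> borel_measurable (F k)"
    unfolding real_Z using assms by (intro borel_measurable_sum measurable_pw_F) (auto simp: generation_def)
  then have "Measurable.pred (F k) (\<lambda>\<omega>. real (Z (n div 2) \<omega>) > 0)" by measurable
  then show ?thesis by simp
qed

lemma measurable_mart_F:
  assumes "n div 2 \<le> k" shows "mart n k \<in> borel_measurable (F k)"
proof -
  note [measurable] = measurable_alive_F[OF assms]
  have "(\<lambda>\<omega>. \<Prod>j\<in>{n div 2..<k}. \<Prod>i\<in>generation j. mart_factor (capped_wt n j i \<omega>) (ch i \<omega>)) \<in> borel_measurable (F k)"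
    using assms by (intro borel_measurable_prod measurable_mart_factor measurable_capped_wt_F measurable_ch_F) (auto simp: generation_def)
  note [measurable] = this
  show ?thesis unfolding mart_def by measurable
qed

lemma load_nonneg: "load n k \<omega> \<ge> 0"
  using noise_var_pos by (simp add: load_def sum_nonneg)

lemma cap_pos: "cap > 0" using p10_pos by (simp add: cap_def add_nonneg_pos)

text \<open>The load of a generation is counted in its own condition \<open>open_gen\<close>, so a
  generation that would exceed the cap is already closed and there is no overshoot.\<close>

lemma capped_load: "(\<Sum>j\<in>{n div 2..<k}. if open_gen n j \<omega> then load n j \<omega> else 0) \<le> cap"
proof (induction k)
  case 0 then show ?case using cap_pos by simp
next
  case (Suc k)
  show ?case
  proof (cases "n div 2 \<le> k")
    case True
    show ?thesis
    proof (cases "open_gen n k \<omega>")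
      case op: True
      have "(\<Sum>j\<in>{n div 2..<Suc k}. if open_gen n j \<omega> then load n j \<omega> else 0) \<le> (\<Sum>j\<in>{n div 2..<Suc k}. load n j \<omega>)"
        by (intro sum_mono) (auto simp: load_nonneg)
      also have "(\<Sum>j\<in>{n div 2..<Suc k}. load n j \<omega>) \<le> cap"
        using op by (simp only: open_gen_def atLeastLessThanSuc_atLeastAtMost)
      finally show ?thesis .
    next
      case False
      then show ?thesis using True Suc by simp
    qed
  qed (use cap_pos in simp)
qed

text \<open>Only the real exponentials contribute to the modulus, and their exponents add up to the
  capped load. The bound depends neither on \<open>n\<close> nor on the realisation, which is what
  the truncation is for: it permits dominated convergence.\<close>

lemma norm_mart: "norm (mart n k \<omega>) \<le> exp cap"
proof -
  have "norm (mart n k \<omega>) \<le> 1 * (\<Prod>j\<in>{n div 2..<k}. \<Prod>i\<in>generation j. norm (mart_factor (capped_wt n j i \<omega>) (ch i \<omega>)))"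
    unfolding mart_def norm_mult prod_norm[symmetric] by (intro mult_right_mono prod_nonneg) auto
  also have "\<dots> \<le> (\<Prod>j\<in>{n div 2..<k}. \<Prod>i\<in>generation j. exp (noise_var * (capped_wt n j i \<omega>)\<^sup>2 / 2))"
    by (simp only: mult_1_left) (intro prod_mono conjI prod_nonneg norm_ge_zero norm_mart_factor)
  also have "\<dots> = exp (\<Sum>j\<in>{n div 2..<k}. \<Sum>i\<in>generation j. noise_var * (capped_wt n j i \<omega>)\<^sup>2 / 2)"
    by (simp add: exp_sum)
  also have "(\<Sum>j\<in>{n div 2..<k}. \<Sum>i\<in>generation j. noise_var * (capped_wt n j i \<omega>)\<^sup>2 / 2) =
    (\<Sum>j\<in>{n div 2..<k}. if open_gen n j \<omega> then load n j \<omega> else 0)"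
    by (intro sum.cong refl) (simp add: capped_wt_def load_def sum_distrib_left)
  also have "exp \<dots> \<le> exp cap" using capped_load by simp
  finally show ?thesis .
qed

lemma integrable_mart: "n div 2 \<le> k \<Longrightarrow> complex_integrable M (mart n k)"
  by (rule integrable_const_bound[where B="exp cap"]) (auto simp: norm_mart intro: measurable_from_F[OF measurable_mart_F])

text \<open>The weights of a generation are known before its daughters, so each new generation
  multiplies by factors of conditional mean 1 and only the leading indicator remains.\<close>

lemma mart_expectation:
  assumes H0: "\<alpha>\<^sub>0 \<theta> = \<alpha>\<^sub>1 \<theta>" "\<beta>\<^sub>0 \<theta> = \<beta>\<^sub>1 \<theta>" and k: "n div 2 \<le> k"
  shows "(CLINT \<omega>|M. mart n k \<omega>) = complex_of_real (prob {\<omega> \<in> space M. Z (n div 2) \<omega> > 0})"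
  using k
proof (induction k rule: dec_induct)
  case base
  have "(CLINT \<omega>|M. mart n (n div 2) \<omega>) = (CLINT \<omega>|M. complex_of_real (indicator {\<omega> \<in> space M. Z (n div 2) \<omega> > 0} \<omega>))"
    by (intro Bochner_Integration.integral_cong) (auto simp: mart_def)
  also have "\<dots> = complex_of_real (\<integral>\<omega>. indicator {\<omega> \<in> space M. Z (n div 2) \<omega> > 0} \<omega> \<partial>M)"
    by (rule integral_complex_of_real)
  finally show ?case by simp
next
  case (step k)
  have eq: "mart n (Suc k) \<omega> = mart n k \<omega> * (\<Prod>i\<in>generation k. mart_factor (capped_wt n k i \<omega>) (ch i \<omega>))" for \<omega>
    using step.hyps by (simp add: mart_def)
  have "(CLINT \<omega>|M. mart n k \<omega> * (\<Prod>i\<in>generation k. mart_factor (capped_wt n k i \<omega>) (ch i \<omega>))) =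
    (CLINT \<omega>|M. mart n k \<omega> * (\<Prod>i\<in>generation k. CLINT \<xi>|noise \<theta>. mart_factor (capped_wt n k i \<omega>) (daughters \<theta> \<kappa> (X i \<omega>) \<xi>)))"
  proof (rule integral_step_prod)
    show "mart n k \<in> borel_measurable (F k)" using step.hyps by (intro measurable_mart_F) simp
    show "complex_integrable M (\<lambda>\<omega>. mart n k \<omega> * (\<Prod>i\<in>generation k. mart_factor (capped_wt n k i \<omega>) (ch i \<omega>)))"
      unfolding eq[symmetric] using step.hyps by (intro integrable_mart) simp
    fix i assume i: "i \<in> generation k"
    have [measurable]: "capped_wt n k i \<in> borel_measurable (F k)"
      using step.hyps i by (intro measurable_capped_wt_F) (auto simp: generation_def)
    show "(\<lambda>(\<omega>, y). mart_factor (capped_wt n k i \<omega>) y) \<in> borel_measurable (F k \<Otimes>\<^sub>M state_pair_space)"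
      by measurable
  qed (rule integrable_mart_factor_noise)
  also have "\<dots> = (CLINT \<omega>|M. mart n k \<omega>)" by (simp add: integral_mart_factor_noise[OF H0])
  finally show ?case using step.IH by (simp add: eq)
qed

definition clt_char :: "nat \<Rightarrow> 'a \<Rightarrow> complex" where
  "clt_char n \<omega> = of_bool (Z (n div 2) \<omega> > 0) * iexp (t1 * coordA (\<lambda>i. X i \<omega>) n + t2 * coordB (\<lambda>i. X i \<omega>) n)"

text \<open>The logarithm of the total compensation when no generation is closed. In contrast to
  \<open>load\<close> it counts only cells with two living daughters.\<close>

definition both_load :: "nat \<Rightarrow> 'a \<Rightarrow> real" where
  "both_load n \<omega> = noise_var / 2 * ((\<Sum>k\<in>{n div 2..n}. tsum both (\<lambda>z y0 y1. (lin z)\<^sup>2) (\<lambda>i. X i \<omega>) k) / (scale (\<lambda>i. X i \<omega>) n)\<^sup>2)"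

text \<open>Without truncation the martingale is the exponential of the fluctuations times the
  exponential of its compensator. Dead mothers have no living daughters, so every cell that is not
  of type \<open>both\<close> gives the factor 1 on either side.\<close>

lemma mart_open:
  assumes op: "open_gen n n \<omega>" and dead: "\<forall>i. X i \<omega> = None \<longrightarrow> ch i \<omega> = (None, None)"
  shows "mart n (Suc n) \<omega> = clt_char n \<omega> * complex_of_real (exp (both_load n \<omega>))"
proof -
  let ?x = "\<lambda>i. X i \<omega>"
  let ?s = "scale ?x n"
  have opj: "open_gen n j \<omega>" if "j \<in> {n div 2..<Suc n}" for j
  proof -
    have "(\<Sum>i\<in>{n div 2..j}. load n i \<omega>) \<le> (\<Sum>i\<in>{n div 2..n}. load n i \<omega>)"
      using that by (intro sum_mono2) (auto simp: load_nonneg)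
    then show ?thesis using op by (simp add: open_gen_def)
  qed
  define a where "a i = stat both (\<lambda>z y0 y1. lin z * (y0 - y1)) (X i \<omega>, X (i @ [False]) \<omega>, X (i @ [True]) \<omega>) / ?s" for i
  define b where "b i = noise_var / 2 * (stat both (\<lambda>z y0 y1. (lin z)\<^sup>2) (X i \<omega>, X (i @ [False]) \<omega>, X (i @ [True]) \<omega>) / ?s\<^sup>2)" for i
  have fac: "mart_factor (wt n i \<omega>) (ch i \<omega>) = iexp (a i) * complex_of_real (exp (b i))" for i
  proof (cases "X i \<omega> = None \<or> X (i @ [False]) \<omega> = None \<or> X (i @ [True]) \<omega> = None")
    case True
    then have "X (i @ [False]) \<omega> = None \<or> X (i @ [True]) \<omega> = None" using dead by (auto simp: ch_def)
    then show ?thesis by (auto simp: mart_factor_def a_def b_def stat_def ch_def)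
  next
    case False
    then show ?thesis by (auto simp: mart_factor_def a_def b_def stat_def ch_def wt_def power_divide)
  qed
  have "(\<Prod>j\<in>{n div 2..<Suc n}. \<Prod>i\<in>generation j. mart_factor (capped_wt n j i \<omega>) (ch i \<omega>)) =
    (\<Prod>j\<in>{n div 2..<Suc n}. \<Prod>i\<in>generation j. iexp (a i) * complex_of_real (exp (b i)))"
    by (intro prod.cong refl) (simp add: capped_wt_def opj fac)
  also have "\<dots> = (\<Prod>j\<in>{n div 2..<Suc n}. \<Prod>i\<in>generation j. iexp (a i)) * (\<Prod>j\<in>{n div 2..<Suc n}. \<Prod>i\<in>generation j. complex_of_real (exp (b i)))"
    by (simp add: prod.distrib)
  also have "(\<Prod>j\<in>{n div 2..<Suc n}. \<Prod>i\<in>generation j. iexp (a i)) = iexp (\<Sum>j\<in>{n div 2..<Suc n}. \<Sum>i\<in>generation j. a i)"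
    by (simp only: of_real_sum sum_distrib_left exp_sum finite_generation finite_atLeastLessThan)
  also have "(\<Prod>j\<in>{n div 2..<Suc n}. \<Prod>i\<in>generation j. complex_of_real (exp (b i))) = complex_of_real (exp (\<Sum>j\<in>{n div 2..<Suc n}. \<Sum>i\<in>generation j. b i))"
    by (simp only: exp_sum of_real_prod finite_generation finite_atLeastLessThan)
  also have "(\<Sum>j\<in>{n div 2..<Suc n}. \<Sum>i\<in>generation j. b i) = both_load n \<omega>"
    unfolding both_load_def b_def tsum_def sum_distrib_left sum_divide_distrib atLeastLessThanSuc_atLeastAtMost ..
  also have "(\<Sum>j\<in>{n div 2..<Suc n}. \<Sum>i\<in>generation j. a i) = fluct lin ?x n / ?s"
    unfolding fluct_def a_def tsum_def sum_divide_distrib atLeastLessThanSuc_atLeastAtMost ..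
  also have "fluct lin ?x n = t1 * fluct (\<lambda>z. 1) ?x n + t2 * fluct (\<lambda>z. (z - mu1 \<theta>) / mu_sd) ?x n"
    unfolding fluct_def tsum_def sum_distrib_left sum.distrib[symmetric]
    by (intro sum.cong refl) (auto simp: stat_def lin_def algebra_simps)
  finally show ?thesis
    by (simp add: mart_def clt_char_def coordA_def coordB_def add_divide_distrib mult.assoc)
qed

lemma lin_sq: "(lin z)\<^sup>2 = (t1 - t2 * mu1 \<theta> / mu_sd)\<^sup>2 + 2 * (t1 - t2 * mu1 \<theta> / mu_sd) * (t2 / mu_sd) * z + (t2 / mu_sd)\<^sup>2 * z\<^sup>2"
proof -
  have "lin z = (t1 - t2 * mu1 \<theta> / mu_sd) + (t2 / mu_sd) * z"
    by (simp add: lin_def diff_divide_distrib algebra_simps)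
  then show ?thesis by (simp only: power2_sum power_mult_distrib)
qed

text \<open>Orthonormality of \<open>1\<close> and \<open>(z - mu1 \<theta>) / mu_sd\<close> with
  respect to the limiting moments, written out in the coefficients of the polynomial in
  \<open>lin_sq\<close>.\<close>

lemma lin_sq_mean: "(t1 - t2 * mu1 \<theta> / mu_sd)\<^sup>2 + 2 * (t1 - t2 * mu1 \<theta> / mu_sd) * (t2 / mu_sd) * mu1 \<theta> + (t2 / mu_sd)\<^sup>2 * mu2 \<theta> \<kappa> = t1\<^sup>2 + t2\<^sup>2"
proof -
  have s: "mu_sd \<noteq> 0" "mu2 \<theta> \<kappa> = mu_sd\<^sup>2 + (mu1 \<theta>)\<^sup>2" using mu_sd_pos by auto
  show ?thesis unfolding s(2) using s(1) by (simp add: field_simps power2_eq_square)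
qed

text \<open>The squared scale and the sum of the squared weights over cells with two daughters both
  contain the factors \<open>p\<^sub>1\<^sub>0 \<theta>\<close>, \<open>W\<close> and
  \<open>tree_factor\<close>; in the quotient they cancel and a deterministic limit remains. The sum
  over all living cells lacks the factor \<open>p\<^sub>1\<^sub>0 \<theta>\<close> and therefore has
  a limit larger by its reciprocal, still below \<open>cap\<close>.\<close>

lemma load_limits:
  "AE \<omega> in M. W \<omega> > 0 \<longrightarrow> (\<lambda>n. both_load n \<omega>) \<longlonglongrightarrow> (t1\<^sup>2 + t2\<^sup>2) / 2 \<and>
     (\<forall>\<^sub>F n in sequentially. open_gen n n \<omega>)"
  using AE_typical S_tendsto
proof eventually_elim
  case (elim \<omega>)
  note tyx = elim(1)
  show ?case
  proof
    assume w: "W \<omega> > 0"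
    let ?x = "\<lambda>i. X i \<omega>"
    let ?c0 = "(t1 - t2 * mu1 \<theta> / mu_sd)\<^sup>2" and ?c1 = "2 * (t1 - t2 * mu1 \<theta> / mu_sd) * (t2 / mu_sd)" and ?c2 = "(t2 / mu_sd)\<^sup>2"
    have l: "living both False" by simp
    have "tsum both (\<lambda>z y0 y1. (lin z)\<^sup>2) ?x k = ?c0 * tsum both (monomial False 0 0) ?x k + ?c1 * tsum both (monomial False 1 0) ?x k + ?c2 * tsum both (monomial False 2 0) ?x k" for k
      unfolding tsum_def sum_distrib_left sum.distrib[symmetric]
      by (intro sum.cong refl) (auto simp: stat_def lin_sq monomial_def)
    then have "(\<lambda>k. tsum both (\<lambda>z y0 y1. (lin z)\<^sup>2) ?x k / m ^ k) \<longlonglongrightarrow>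
      ?c0 * (type_prob \<theta> both * W \<omega> * joint_mom \<theta> \<kappa> both False 0 0) + ?c1 * (type_prob \<theta> both * W \<omega> * joint_mom \<theta> \<kappa> both False 1 0)
      + ?c2 * (type_prob \<theta> both * W \<omega> * joint_mom \<theta> \<kappa> both False 2 0)"
      unfolding add_divide_distrib
      by (simp only: add_divide_distrib times_divide_eq_right[symmetric]) (intro tendsto_add tendsto_mult_left typicalD(2)[OF tyx l], simp_all)
    also have "?c0 * (type_prob \<theta> both * W \<omega> * joint_mom \<theta> \<kappa> both False 0 0) + ?c1 * (type_prob \<theta> both * W \<omega> * joint_mom \<theta> \<kappa> both False 1 0)
      + ?c2 * (type_prob \<theta> both * W \<omega> * joint_mom \<theta> \<kappa> both False 2 0) = p\<^sub>1\<^sub>0 \<theta> * W \<omega> * (?c0 + ?c1 * mu1 \<theta> + ?c2 * mu2 \<theta> \<kappa>)"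
      by (simp only: joint_mom_def stat_mom_def both_prob(2)) (simp add: algebra_simps)
    finally have "(\<lambda>k. tsum both (\<lambda>z y0 y1. (lin z)\<^sup>2) ?x k / m ^ k) \<longlonglongrightarrow> p\<^sub>1\<^sub>0 \<theta> * W \<omega> * (t1\<^sup>2 + t2\<^sup>2)"
      unfolding lin_sq_mean .
    from late_sum_tendsto[OF supercritical this]
    have num: "(\<lambda>n. (\<Sum>k\<in>{n div 2..n}. tsum both (\<lambda>z y0 y1. (lin z)\<^sup>2) ?x k) / m ^ n) \<longlonglongrightarrow> p\<^sub>1\<^sub>0 \<theta> * W \<omega> * (t1\<^sup>2 + t2\<^sup>2) * tree_factor"
      by (simp add: tree_factor_def)
    have "(\<lambda>n. noise_var / 2 * (((\<Sum>k\<in>{n div 2..n}. tsum both (\<lambda>z y0 y1. (lin z)\<^sup>2) ?x k) / m ^ n) / ((scale ?x n)\<^sup>2 / m ^ n))) \<longlonglongrightarrow>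
      noise_var / 2 * ((p\<^sub>1\<^sub>0 \<theta> * W \<omega> * (t1\<^sup>2 + t2\<^sup>2) * tree_factor) / (noise_var * (p\<^sub>1\<^sub>0 \<theta> * tree_factor) * W \<omega>))"
      using noise_var_pos p10_pos tree_factor_pos w by (intro tendsto_mult_left tendsto_divide num scale_sq_tendsto[OF tyx w]) simp
    also have "noise_var / 2 * ((p\<^sub>1\<^sub>0 \<theta> * W \<omega> * (t1\<^sup>2 + t2\<^sup>2) * tree_factor) / (noise_var * (p\<^sub>1\<^sub>0 \<theta> * tree_factor) * W \<omega>)) = (t1\<^sup>2 + t2\<^sup>2) / 2"
      using noise_var_pos p10_pos tree_factor_pos w by (simp add: field_simps)
    also have "(\<lambda>n. noise_var / 2 * (((\<Sum>k\<in>{n div 2..n}. tsum both (\<lambda>z y0 y1. (lin z)\<^sup>2) ?x k) / m ^ n) / ((scale ?x n)\<^sup>2 / m ^ n))) = (\<lambda>n. both_load n \<omega>)"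
      by (simp add: both_load_def fun_eq_iff)
    finally have 1: "(\<lambda>n. both_load n \<omega>) \<longlonglongrightarrow> (t1\<^sup>2 + t2\<^sup>2) / 2" .
    define v where "v k = (\<Sum>i\<in>generation k. ?c0 * pw 0 (X i \<omega>) + ?c1 * pw 1 (X i \<omega>) + ?c2 * pw 2 (X i \<omega>))" for k
    have vS: "v k / m ^ k = ?c0 * S 0 k \<omega> + ?c1 * S 1 k \<omega> + ?c2 * S 2 k \<omega>" for k
      by (simp add: v_def S_def sum.distrib sum_distrib_left add_divide_distrib)
    have s: "(\<lambda>k. S 0 k \<omega>) \<longlonglongrightarrow> W \<omega>" "(\<lambda>k. S 1 k \<omega>) \<longlonglongrightarrow> W \<omega> * mu1 \<theta>" "(\<lambda>k. S 2 k \<omega>) \<longlonglongrightarrow> W \<omega> * mu2 \<theta> \<kappa>"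
      using elim(2)[rule_format, of 0] elim(2)[rule_format, of 1] elim(2)[rule_format, of 2] by (simp_all add: stat_mom_def)
    have "(\<lambda>k. v k / m ^ k) \<longlonglongrightarrow> ?c0 * W \<omega> + ?c1 * (W \<omega> * mu1 \<theta>) + ?c2 * (W \<omega> * mu2 \<theta> \<kappa>)"
      unfolding vS by (intro tendsto_add tendsto_mult_left s)
    also have "?c0 * W \<omega> + ?c1 * (W \<omega> * mu1 \<theta>) + ?c2 * (W \<omega> * mu2 \<theta> \<kappa>) = W \<omega> * (?c0 + ?c1 * mu1 \<theta> + ?c2 * mu2 \<theta> \<kappa>)"
      by (simp add: algebra_simps)
    finally have "(\<lambda>k. v k / m ^ k) \<longlonglongrightarrow> W \<omega> * (t1\<^sup>2 + t2\<^sup>2)" unfolding lin_sq_mean .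
    from late_sum_tendsto[OF supercritical this]
    have num2: "(\<lambda>n. (\<Sum>k\<in>{n div 2..n}. v k) / m ^ n) \<longlonglongrightarrow> W \<omega> * (t1\<^sup>2 + t2\<^sup>2) * tree_factor" by (simp add: tree_factor_def)
    have "(\<lambda>n. noise_var / 2 * (((\<Sum>k\<in>{n div 2..n}. v k) / m ^ n) / ((scale ?x n)\<^sup>2 / m ^ n))) \<longlonglongrightarrow>
      noise_var / 2 * ((W \<omega> * (t1\<^sup>2 + t2\<^sup>2) * tree_factor) / (noise_var * (p\<^sub>1\<^sub>0 \<theta> * tree_factor) * W \<omega>))"
      using noise_var_pos p10_pos tree_factor_pos w by (intro tendsto_mult_left tendsto_divide num2 scale_sq_tendsto[OF tyx w]) simp
    also have "noise_var / 2 * ((W \<omega> * (t1\<^sup>2 + t2\<^sup>2) * tree_factor) / (noise_var * (p\<^sub>1\<^sub>0 \<theta> * tree_factor) * W \<omega>)) = (t1\<^sup>2 + t2\<^sup>2) / (2 * p\<^sub>1\<^sub>0 \<theta>)"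
      using noise_var_pos p10_pos tree_factor_pos w by (simp add: field_simps)
    also have "(\<lambda>n. noise_var / 2 * (((\<Sum>k\<in>{n div 2..n}. v k) / m ^ n) / ((scale ?x n)\<^sup>2 / m ^ n))) = (\<lambda>n. \<Sum>k\<in>{n div 2..n}. load n k \<omega>)"
    proof
      fix n
      have ld: "load n k \<omega> = noise_var / 2 * (v k / (scale ?x n)\<^sup>2)" for k
        unfolding load_def v_def sum_divide_distrib
        by (intro arg_cong[where f="\<lambda>u. noise_var / 2 * u"] sum.cong refl) (auto simp: wt_def pw_def power_divide lin_sq)
      show "noise_var / 2 * (((\<Sum>k\<in>{n div 2..n}. v k) / m ^ n) / ((scale ?x n)\<^sup>2 / m ^ n)) = (\<Sum>k\<in>{n div 2..n}. load n k \<omega>)"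
      proof -
        have "((\<Sum>k\<in>{n div 2..n}. v k) / m ^ n) / ((scale ?x n)\<^sup>2 / m ^ n) = (\<Sum>k\<in>{n div 2..n}. v k) / (scale ?x n)\<^sup>2" by simp
        then show ?thesis by (simp only: ld sum_distrib_left sum_divide_distrib)
      qed
    qed
    finally have "(\<lambda>n. \<Sum>k\<in>{n div 2..n}. load n k \<omega>) \<longlonglongrightarrow> (t1\<^sup>2 + t2\<^sup>2) / (2 * p\<^sub>1\<^sub>0 \<theta>)" .
    then have "\<forall>\<^sub>F n in sequentially. (\<Sum>k\<in>{n div 2..n}. load n k \<omega>) < cap"
      by (rule order_tendstoD(2)) (simp add: cap_def)
    then have "\<forall>\<^sub>F n in sequentially. open_gen n n \<omega>"
      by eventually_elim (simp add: open_gen_def)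
    with 1 show "(\<lambda>n. both_load n \<omega>) \<longlonglongrightarrow> (t1\<^sup>2 + t2\<^sup>2) / 2 \<and> (\<forall>\<^sub>F n in sequentially. open_gen n n \<omega>)" ..
  qed
qed

text \<open>For almost every realisation, being alive at generation \<open>n div 2\<close> is
  eventually equivalent to \<open>W\<close> being nonzero.\<close>

lemma survival_prob_tendsto: "(\<lambda>n. prob {\<omega> \<in> space M. Z (n div 2) \<omega> > 0}) \<longlonglongrightarrow> 1 - ext_prob"
proof -
  have "(\<lambda>n. \<integral>\<omega>. (indicator {\<omega> \<in> space M. Z (n div 2) \<omega> > 0} \<omega> :: real) \<partial>M) \<longlonglongrightarrow> (\<integral>\<omega>. indicator {\<omega> \<in> space M. W \<omega> \<noteq> 0} \<omega> \<partial>M)"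
  proof (rule integral_dominated_convergence[where w="\<lambda>_. 1"])
    show "AE \<omega> in M. (\<lambda>n. indicator {\<omega> \<in> space M. Z (n div 2) \<omega> > 0} \<omega> :: real) \<longlonglongrightarrow> indicator {\<omega> \<in> space M. W \<omega> \<noteq> 0} \<omega>"
      using W_zero_iff_extinct dead_forever' AE_space
    proof eventually_elim
      case (elim \<omega>)
      show ?case
      proof (cases "W \<omega> = 0")
        case True
        then obtain k where "Z k \<omega> = 0" using elim(1) by blast
        with elim(2) have "\<forall>\<^sub>F n in sequentially. Z (n div 2) \<omega> = 0"
          by (intro eventually_sequentiallyI[of "2 * k"]) (simp add: less_eq_div_iff_mult_less_eq mult.commute)
        then have "\<forall>\<^sub>F n in sequentially. indicator {\<omega> \<in> space M. Z (n div 2) \<omega> > 0} \<omega> = (0::real)"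
          by eventually_elim simp
        then show ?thesis using True by (intro tendsto_eventually) simp
      next
        case False
        then show ?thesis using elim by simp
      qed
    qed
  qed auto
  moreover have "{\<omega> \<in> space M. W \<omega> \<noteq> 0} = space M - {\<omega> \<in> space M. W \<omega> = 0}" by auto
  ultimately show ?thesis by (simp add: ext_prob_def prob_compl)
qed

text \<open>On survival the compensator tends to a constant, so the characteristic exponential
  differs from a constant multiple of the martingale by a vanishing bounded quantity; upon
  extinction both are eventually 0. The mean of the martingale is the survival probability at
  generation \<open>n div 2\<close>, whatever happens afterwards.\<close>

lemma clt_char_tendsto:
  assumes H0: "\<alpha>\<^sub>0 \<theta> = \<alpha>\<^sub>1 \<theta>" "\<beta>\<^sub>0 \<theta> = \<beta>\<^sub>1 \<theta>"
  shows "(\<lambda>n. CLINT \<omega>|M. clt_char n \<omega>) \<longlonglongrightarrow> complex_of_real ((1 - ext_prob) * exp (- (t1\<^sup>2 + t2\<^sup>2) / 2))"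
proof -
  let ?q = "(t1\<^sup>2 + t2\<^sup>2) / 2"
  define e where "e = complex_of_real (exp (- ?q))"
  have meas [measurable]: "clt_char n \<in> borel_measurable M" for n
    unfolding clt_char_def by measurable
  have mm [measurable]: "mart n (Suc n) \<in> borel_measurable M" for n
    by (rule measurable_from_F[OF measurable_mart_F]) simp
  have "(\<lambda>n. CLINT \<omega>|M. clt_char n \<omega> - mart n (Suc n) \<omega> * e) \<longlonglongrightarrow> (CLINT \<omega>|M. 0)"
  proof (rule integral_dominated_convergence[where w="\<lambda>_. 1 + exp cap"])
    show "AE \<omega> in M. norm (clt_char n \<omega> - mart n (Suc n) \<omega> * e) \<le> 1 + exp cap" for n
    proof (rule AE_I2)
      fix \<omega>
      have "norm (clt_char n \<omega>) \<le> 1" by (simp add: clt_char_def norm_mult)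
      moreover have "norm (mart n (Suc n) \<omega> * e) \<le> exp cap * 1"
        unfolding norm_mult by (intro mult_mono norm_mart) (auto simp: e_def)
      ultimately show "norm (clt_char n \<omega> - mart n (Suc n) \<omega> * e) \<le> 1 + exp cap"
        using norm_triangle_ineq4[of "clt_char n \<omega>" "mart n (Suc n) \<omega> * e"] by linarith
    qed
    show "AE \<omega> in M. (\<lambda>n. clt_char n \<omega> - mart n (Suc n) \<omega> * e) \<longlonglongrightarrow> 0"
      using load_limits W_zero_iff_extinct dead_forever' dead_daughters W_nonneg
    proof eventually_elim
      case (elim \<omega>)
      show ?case
      proof (cases "W \<omega> = 0")
        case True
        then obtain k where "Z k \<omega> = 0" using elim(2) by blast
        with elim(3) have "\<forall>\<^sub>F n in sequentially. Z (n div 2) \<omega> = 0"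
          by (intro eventually_sequentiallyI[of "2 * k"]) (simp add: less_eq_div_iff_mult_less_eq mult.commute)
        then have "\<forall>\<^sub>F n in sequentially. clt_char n \<omega> - mart n (Suc n) \<omega> * e = 0"
          by eventually_elim (simp add: clt_char_def mart_def)
        then show ?thesis by (rule tendsto_eventually)
      next
        case False
        with elim have L: "(\<lambda>n. both_load n \<omega>) \<longlonglongrightarrow> ?q" "\<forall>\<^sub>F n in sequentially. open_gen n n \<omega>" by auto
        have "(\<lambda>n. 1 - exp (both_load n \<omega>) * exp (- ?q)) \<longlonglongrightarrow> 1 - exp ?q * exp (- ?q)"
          by (intro tendsto_intros L)
        then have "(\<lambda>n. 1 - exp (both_load n \<omega>) * exp (- ?q)) \<longlonglongrightarrow> 0" by (simp add: exp_minus)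
        then have z: "(\<lambda>n. \<bar>1 - exp (both_load n \<omega>) * exp (- ?q)\<bar>) \<longlonglongrightarrow> 0" by (rule tendsto_rabs_zero)
        show ?thesis
        proof (rule Lim_null_comparison[OF _ z])
          show "\<forall>\<^sub>F n in sequentially. norm (clt_char n \<omega> - mart n (Suc n) \<omega> * e) \<le> \<bar>1 - exp (both_load n \<omega>) * exp (- ?q)\<bar>"
            using L(2)
          proof eventually_elim
            case (elim n)
            have "clt_char n \<omega> - mart n (Suc n) \<omega> * e = clt_char n \<omega> * complex_of_real (1 - exp (both_load n \<omega>) * exp (- ?q))"
              using mart_open[OF elim] \<open>\<forall>i. X i \<omega> = None \<longrightarrow> ch i \<omega> = (None, None)\<close> by (simp add: e_def algebra_simps)
            also have "norm \<dots> = norm (clt_char n \<omega>) * \<bar>1 - exp (both_load n \<omega>) * exp (- ?q)\<bar>"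
              unfolding norm_mult norm_of_real ..
            also have "\<dots> \<le> 1 * \<bar>1 - exp (both_load n \<omega>) * exp (- ?q)\<bar>"
              by (intro mult_right_mono) (simp_all add: clt_char_def norm_mult)
            finally show ?case by simp
          qed
        qed
      qed
    qed
  qed auto
  then have diff: "(\<lambda>n. CLINT \<omega>|M. clt_char n \<omega> - mart n (Suc n) \<omega> * e) \<longlonglongrightarrow> 0" by simp
  have ic: "complex_integrable M (clt_char n)" for n
    by (rule integrable_const_bound[where B=1]) (auto simp: clt_char_def norm_mult)
  have eq: "(CLINT \<omega>|M. clt_char n \<omega>) = (CLINT \<omega>|M. clt_char n \<omega> - mart n (Suc n) \<omega> * e) + complex_of_real (prob {\<omega> \<in> space M. Z (n div 2) \<omega> > 0}) * e" for n
    using ic[of n] integrable_mart[of n "Suc n"] mart_expectation[OF H0, of n "Suc n"] by simp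
  have "(\<lambda>n. CLINT \<omega>|M. clt_char n \<omega>) \<longlonglongrightarrow> 0 + complex_of_real (1 - ext_prob) * e"
    unfolding eq by (intro tendsto_intros diff survival_prob_tendsto)
  then show ?thesis by (simp add: e_def minus_divide_left)
qed

end

end

section \<open>The limit law\<close>

text \<open>In the variable \<open>u = exp (- y)\<close> a step function is continuous on the unit interval, hence a uniform
  limit of polynomials, i.e. of combinations of the functions \<open>exp (- k * y)\<close>.\<close>

lemma cts_step_tendsto_of_laplace:
  fixes Y :: "nat \<Rightarrow> 'a \<Rightarrow> real" and V :: "'b \<Rightarrow> real"
  assumes "prob_space M" "prob_space N"
    and Y [measurable]: "\<And>n. Y n \<in> borel_measurable M" and V [measurable]: "V \<in> borel_measurable N"
    and Y0: "\<And>n. AE \<omega> in M. Y n \<omega> \<ge> 0" and V0: "AE \<omega> in N. V \<omega> \<ge> 0"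
    and lap: "\<And>k::nat. (\<lambda>n. \<integral>\<omega>. exp (- real k * Y n \<omega>) \<partial>M) \<longlonglongrightarrow> (\<integral>\<omega>. exp (- real k * V \<omega>) \<partial>N)"
    and ab: "a < b"
  shows "(\<lambda>n. \<integral>\<omega>. cts_step a b (Y n \<omega>) \<partial>M) \<longlonglongrightarrow> (\<integral>\<omega>. cts_step a b (V \<omega>) \<partial>N)"
proof -
  interpret M: prob_space M by fact
  interpret N: prob_space N by fact
  have cmeas [measurable]: "cts_step a b \<in> borel_measurable borel"
    unfolding cts_step_def by measurable
  have unit: "AE \<omega> in M. exp (- Y n \<omega>) \<in> {0..1}" "AE \<omega> in N. exp (- V \<omega>) \<in> {0..1}" for n
    using Y0[of n] V0 by auto
  \<comment> \<open>Bernstein polynomials are built from products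
    \<open>u ^ k * (1 - u) ^ r\<close>. The induction on \<open>r\<close> reduces these to pure
    powers of \<open>exp (- y)\<close>, which are the Laplace transforms at natural numbers.\<close>
  have conv: "(\<forall>n. integrable M (\<lambda>\<omega>. exp (- Y n \<omega>) ^ k * (1 - exp (- Y n \<omega>)) ^ r)) \<and> integrable N (\<lambda>\<omega>. exp (- V \<omega>) ^ k * (1 - exp (- V \<omega>)) ^ r) \<and>
    (\<lambda>n. \<integral>\<omega>. exp (- Y n \<omega>) ^ k * (1 - exp (- Y n \<omega>)) ^ r \<partial>M) \<longlonglongrightarrow> (\<integral>\<omega>. exp (- V \<omega>) ^ k * (1 - exp (- V \<omega>)) ^ r \<partial>N)" for k r
  proof (induction r arbitrary: k)
    case 0
    have e: "exp (- y) ^ k = exp (- real k * y)" for y :: real by (simp add: exp_of_nat_mult[symmetric])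
    have "integrable M (\<lambda>\<omega>. exp (- Y n \<omega>) ^ k)" for n
      by (rule M.integrable_const_bound[where B=1]) (use unit(1)[of n] in \<open>eventually_elim, simp add: power_le_one\<close>, measurable)
    moreover have "integrable N (\<lambda>\<omega>. exp (- V \<omega>) ^ k)"
      by (rule N.integrable_const_bound[where B=1]) (use unit(2) in \<open>eventually_elim, simp add: power_le_one\<close>, measurable)
    ultimately show ?case using lap[of k] by (simp add: e)
  next
    case (Suc r)
    have e: "u ^ k * (1 - u) ^ Suc r = u ^ k * (1 - u) ^ r - u ^ Suc k * (1 - u) ^ r" for u :: real
      by (simp add: algebra_simps)
    note IH = Suc.IH[of k] Suc.IH[of "Suc k"]
    show ?case unfolding e
    proof (intro conjI allI Bochner_Integration.integrable_diff)
      have "(\<integral>\<omega>. exp (- Y n \<omega>) ^ k * (1 - exp (- Y n \<omega>)) ^ r - exp (- Y n \<omega>) ^ Suc k * (1 - exp (- Y n \<omega>)) ^ r \<partial>M) =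
        (\<integral>\<omega>. exp (- Y n \<omega>) ^ k * (1 - exp (- Y n \<omega>)) ^ r \<partial>M) - (\<integral>\<omega>. exp (- Y n \<omega>) ^ Suc k * (1 - exp (- Y n \<omega>)) ^ r \<partial>M)" for n
        by (rule Bochner_Integration.integral_diff) (use IH in blast)+
      moreover have "(\<integral>\<omega>. exp (- V \<omega>) ^ k * (1 - exp (- V \<omega>)) ^ r - exp (- V \<omega>) ^ Suc k * (1 - exp (- V \<omega>)) ^ r \<partial>N) =
        (\<integral>\<omega>. exp (- V \<omega>) ^ k * (1 - exp (- V \<omega>)) ^ r \<partial>N) - (\<integral>\<omega>. exp (- V \<omega>) ^ Suc k * (1 - exp (- V \<omega>)) ^ r \<partial>N)"
        by (rule Bochner_Integration.integral_diff) (use IH in blast)+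
      ultimately show "(\<lambda>n. \<integral>\<omega>. exp (- Y n \<omega>) ^ k * (1 - exp (- Y n \<omega>)) ^ r - exp (- Y n \<omega>) ^ Suc k * (1 - exp (- Y n \<omega>)) ^ r \<partial>M)
        \<longlonglongrightarrow> (\<integral>\<omega>. exp (- V \<omega>) ^ k * (1 - exp (- V \<omega>)) ^ r - exp (- V \<omega>) ^ Suc k * (1 - exp (- V \<omega>)) ^ r \<partial>N)"
        using IH by (simp only:) (intro tendsto_diff, blast+)
    qed (use IH in blast)+
  qed
  \<comment> \<open>The maximum keeps the logarithm away from 0, so that \<open>g\<close> is
    continuous on the closed interval. It changes nothing, as the step function is 0 beyond
    \<open>b\<close>.\<close>
  define g where "g u = cts_step a b (- ln (max u (exp (- (b + 1)))))" for u :: real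
  have g: "g (exp (- y)) = cts_step a b y" for y
  proof (cases "y \<le> b + 1")
    case True
    then have "max (exp (- y)) (exp (- (b + 1))) = exp (- y)" by (simp add: max_def)
    then show ?thesis by (simp add: g_def)
  next
    case False
    then have "max (exp (- y)) (exp (- (b + 1))) = exp (- (b + 1))" by (simp add: max_def)
    then show ?thesis using False ab by (simp add: g_def cts_step_def)
  qed
  have "continuous_on UNIV (cts_step a b)"
    using cts_step_uniformly_continuous[OF ab] by (rule uniformly_continuous_imp_continuous)
  moreover have "continuous_on {0..1} (\<lambda>u. - ln (max u (exp (- (b + 1)))))"
  proof (intro continuous_on_minus continuous_on_ln continuous_on_max continuous_on_id continuous_on_const ballI)
    fix u :: real
    have "max u (exp (- (b + 1))) > 0" by (simp add: less_max_iff_disj)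
    then show "max u (exp (- (b + 1))) \<noteq> 0" by simp
  qed
  ultimately have cg: "continuous_on {0..1} g"
    unfolding g_def by (rule continuous_on_compose2) auto
  show ?thesis
  proof (rule LIMSEQ_I)
    fix e :: real assume e: "e > 0"
    obtain d where d: "\<And>u. u \<in> {0..1} \<Longrightarrow> \<bar>g u - (\<Sum>k\<le>d. g (k / d) * Bernstein d k u)\<bar> < e / 3"
      using Bernstein_Weierstrass[OF cg, of "e / 3"] e by auto
    define P where "P u = (\<Sum>k\<le>d. g (k / d) * Bernstein d k u)" for u
    have Pe: "P u = (\<Sum>k\<le>d. (g (k / d) * real (d choose k)) * (u ^ k * (1 - u) ^ (d - k)))" for u
      by (simp add: P_def Bernstein_def mult.assoc)
    have iP: "integrable M (\<lambda>\<omega>. P (exp (- Y n \<omega>)))" "integrable N (\<lambda>\<omega>. P (exp (- V \<omega>)))" for n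
      unfolding Pe using conv by (auto intro!: Bochner_Integration.integrable_sum integrable_mult_right)
    have "(\<lambda>n. \<Sum>k\<le>d. (g (k / d) * real (d choose k)) * (\<integral>\<omega>. exp (- Y n \<omega>) ^ k * (1 - exp (- Y n \<omega>)) ^ (d - k) \<partial>M)) \<longlonglongrightarrow>
      (\<Sum>k\<le>d. (g (k / d) * real (d choose k)) * (\<integral>\<omega>. exp (- V \<omega>) ^ k * (1 - exp (- V \<omega>)) ^ (d - k) \<partial>N))"
      using conv by (intro tendsto_sum tendsto_mult_left) blast
    moreover have "(\<integral>\<omega>. P (exp (- Y n \<omega>)) \<partial>M) = (\<Sum>k\<le>d. (g (k / d) * real (d choose k)) * (\<integral>\<omega>. exp (- Y n \<omega>) ^ k * (1 - exp (- Y n \<omega>)) ^ (d - k) \<partial>M))" for n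
      unfolding Pe using conv by (subst Bochner_Integration.integral_sum) (auto intro!: integrable_mult_right)
    moreover have "(\<integral>\<omega>. P (exp (- V \<omega>)) \<partial>N) = (\<Sum>k\<le>d. (g (k / d) * real (d choose k)) * (\<integral>\<omega>. exp (- V \<omega>) ^ k * (1 - exp (- V \<omega>)) ^ (d - k) \<partial>N))"
      unfolding Pe using conv by (subst Bochner_Integration.integral_sum) (auto intro!: integrable_mult_right)
    ultimately have "(\<lambda>n. \<integral>\<omega>. P (exp (- Y n \<omega>)) \<partial>M) \<longlonglongrightarrow> (\<integral>\<omega>. P (exp (- V \<omega>)) \<partial>N)" by simp
    from LIMSEQ_D[OF this, of "e / 3"] e obtain n0 where
      n0: "\<And>n. n \<ge> n0 \<Longrightarrow> \<bar>(\<integral>\<omega>. P (exp (- Y n \<omega>)) \<partial>M) - (\<integral>\<omega>. P (exp (- V \<omega>)) \<partial>N)\<bar> < e / 3" by auto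
    have close: "\<bar>(\<integral>\<omega>. cts_step a b (f \<omega>) \<partial>Q) - (\<integral>\<omega>. P (exp (- f \<omega>)) \<partial>Q)\<bar> \<le> e / 3"
      if Q: "prob_space Q" and f [measurable]: "f \<in> borel_measurable Q" and u: "AE \<omega> in Q. exp (- f \<omega>) \<in> {0..1}"
        and i: "integrable Q (\<lambda>\<omega>. P (exp (- f \<omega>)))" for Q :: "'c measure" and f
    proof -
      interpret Q: prob_space Q by fact
      have ic: "integrable Q (\<lambda>\<omega>. cts_step a b (f \<omega>))"
        using ab by (intro Q.integrable_const_bound[where B=1]) (auto simp: cts_step_def)
      have "\<bar>\<integral>\<omega>. cts_step a b (f \<omega>) - P (exp (- f \<omega>)) \<partial>Q\<bar> \<le> (\<integral>\<omega>. \<bar>cts_step a b (f \<omega>) - P (exp (- f \<omega>))\<bar> \<partial>Q)"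
        by (rule integral_abs_bound)
      also have "\<dots> \<le> (\<integral>\<omega>. e / 3 \<partial>Q)"
      proof (rule integral_mono_AE)
        show "AE \<omega> in Q. \<bar>cts_step a b (f \<omega>) - P (exp (- f \<omega>))\<bar> \<le> e / 3"
          using u by eventually_elim (use d in \<open>simp add: g[symmetric] P_def less_imp_le\<close>)
      qed (use ic i in auto)
      finally show ?thesis using ic i Q.prob_space by simp
    qed
    show "\<exists>no. \<forall>n\<ge>no. norm ((\<integral>\<omega>. cts_step a b (Y n \<omega>) \<partial>M) - (\<integral>\<omega>. cts_step a b (V \<omega>) \<partial>N)) < e"
    proof (intro exI allI impI)
      fix n assume "n \<ge> n0"
      then show "norm ((\<integral>\<omega>. cts_step a b (Y n \<omega>) \<partial>M) - (\<integral>\<omega>. cts_step a b (V \<omega>) \<partial>N)) < e"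
        using n0[of n] close[OF M.prob_space_axioms Y[of n] unit(1)[of n] iP(1)[of n]] close[OF N.prob_space_axioms V unit(2) iP(2)]
        unfolding real_norm_def by linarith
    qed
  qed
qed

text \<open>The exponential of a sum of squares splits over the coordinates. It is reassembled as an
  integral over \<open>gauss2\<close>, the form in which the Gaussian mixture argument delivers the
  limit.\<close>

lemma chi_square_laplace:
  "(\<integral>u. exp (- c * u) \<partial>chi_square_law 2) = (\<integral>z. exp (- c * ((fst z)\<^sup>2 + (snd z)\<^sup>2)) \<partial>gauss2)" if "c \<ge> 0"
proof -
  interpret S: prob_space std_normal_distribution by (rule prob_space_std_normal)
  interpret P: product_sigma_finite "\<lambda>_::nat. std_normal_distribution" by standard
  interpret G: pair_prob_space std_normal_distribution std_normal_distribution ..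
  have i1: "integrable std_normal_distribution (\<lambda>x. exp (- c * x\<^sup>2))"
    by (rule S.integrable_const_bound[where B=1]) (use that in auto)
  have "(\<integral>u. exp (- c * u) \<partial>chi_square_law 2) = (\<integral>z. exp (- c * (\<Sum>i<2::nat. (z i)\<^sup>2)) \<partial>(\<Pi>\<^sub>M i\<in>{..<2::nat}. std_normal_distribution))"
    unfolding chi_square_law_def by (subst integral_distr) auto
  also have "\<dots> = (\<integral>z. (\<Prod>i\<in>{..<2}. exp (- c * (z i)\<^sup>2)) \<partial>(\<Pi>\<^sub>M i\<in>{..<2::nat}. std_normal_distribution))"
    by (simp add: exp_sum[symmetric] sum_distrib_left sum_negf)
  also have "\<dots> = (\<Prod>i\<in>{..<2::nat}. \<integral>x. exp (- c * x\<^sup>2) \<partial>std_normal_distribution)"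
    by (rule P.product_integral_prod) (use i1 in auto)
  also have "\<dots> = (\<integral>x. exp (- c * x\<^sup>2) \<partial>std_normal_distribution) * (\<integral>y. exp (- c * y\<^sup>2) \<partial>std_normal_distribution)"
    by (simp add: power2_eq_square)
  also have "\<dots> = (\<integral>x. (\<integral>y. exp (- c * x\<^sup>2) * exp (- c * y\<^sup>2) \<partial>std_normal_distribution) \<partial>std_normal_distribution)"
    by simp
  also have "\<dots> = (\<integral>z. exp (- c * (fst z)\<^sup>2) * exp (- c * (snd z)\<^sup>2) \<partial>gauss2)"
  proof -
    have "integrable gauss2 (\<lambda>z. exp (- c * (fst z)\<^sup>2) * exp (- c * (snd z)\<^sup>2))"
      by (rule finite_measure.integrable_const_bound[OF prob_space.finite_measure[OF prob_space_gauss2], where B=1])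
         (use that in \<open>auto intro!: AE_I2 simp: abs_mult mult_le_one\<close>)
    from G.integral_fst'[OF this] show ?thesis by simp
  qed
  also have "\<dots> = (\<integral>z. exp (- c * ((fst z)\<^sup>2 + (snd z)\<^sup>2)) \<partial>gauss2)"
    by (simp add: exp_add[symmetric] algebra_simps)
  finally show ?thesis .
qed

lemma chi_square_nonneg: "AE u in chi_square_law 2. u \<ge> 0"
  unfolding chi_square_law_def by (subst AE_distr_iff) (auto simp: sum_nonneg)

text \<open>As \<open>V\<close> takes only the values 0 and 1, the exponential is affine in
  \<open>V\<close>: it equals \<open>(1 - V) + exp (- c * U) * V\<close>, and independence
  factorises the mean of the product.\<close>

lemma laplace_chi_bernoulli:
  fixes U V :: "'b \<Rightarrow> real"
  assumes "prob_space N" and p: "0 \<le> p" "p \<le> 1" and c: "c \<ge> 0"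
    and U: "U \<in> borel_measurable N" "distr N borel U = chi_square_law 2"
    and V: "V \<in> borel_measurable N" "distr N borel V = bernoulli_law p"
    and ind: "prob_space.indep_var N borel U borel V"
  shows "AE \<omega> in N. U \<omega> * V \<omega> \<ge> 0"
    "(\<integral>\<omega>. exp (- c * (U \<omega> * V \<omega>)) \<partial>N) = (1 - p) + p * (\<integral>z. exp (- c * ((fst z)\<^sup>2 + (snd z)\<^sup>2)) \<partial>gauss2)"
proof -
  interpret prob_space N by fact
  note [measurable] = U(1) V(1)
  have U0: "AE \<omega> in N. U \<omega> \<ge> 0"
    using chi_square_nonneg unfolding U(2)[symmetric] by (subst (asm) AE_distr_iff) auto
  have "AE v in bernoulli_law p. v = 0 \<or> v = 1"
    unfolding bernoulli_law_def by (subst AE_distr_iff) auto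
  then have V01: "AE \<omega> in N. V \<omega> = 0 \<or> V \<omega> = 1"
    unfolding V(2)[symmetric] by (subst (asm) AE_distr_iff) auto
  show "AE \<omega> in N. U \<omega> * V \<omega> \<ge> 0" using U0 V01 by eventually_elim auto
  have EV: "(\<integral>\<omega>. V \<omega> \<partial>N) = p"
  proof -
    have "(\<integral>\<omega>. V \<omega> \<partial>N) = (\<integral>v. v \<partial>distr N borel V)" by (subst integral_distr) auto
    also have "\<dots> = (\<integral>b. of_bool b \<partial>measure_pmf (bernoulli_pmf p))"
      unfolding V(2) bernoulli_law_def by (subst integral_distr) auto
    also have "\<dots> = p" using p by (subst integral_measure_pmf[where A=UNIV]) (auto simp: UNIV_bool)
    finally show ?thesis .
  qed
  have EU: "(\<integral>\<omega>. exp (- c * U \<omega>) \<partial>N) = (\<integral>z. exp (- c * ((fst z)\<^sup>2 + (snd z)\<^sup>2)) \<partial>gauss2)"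
    unfolding chi_square_laplace[OF c, symmetric] U(2)[symmetric] by (subst integral_distr) auto
  have iV: "integrable N V"
    by (rule integrable_const_bound[where B=1]) (use V01 in auto)
  have iU: "integrable N (\<lambda>\<omega>. exp (- c * U \<omega>))"
    by (rule integrable_const_bound[where B=1]) (use U0 c in auto)
  have ind': "indep_var borel (\<lambda>\<omega>. exp (- c * U \<omega>)) borel V"
  proof -
    have "indep_var borel ((\<lambda>u. exp (- c * u)) \<circ> U) borel ((\<lambda>v. v) \<circ> V)"
      by (rule indep_var_compose[OF ind]) measurable
    then show ?thesis by (simp only: comp_def)
  qed
  have "(\<integral>\<omega>. exp (- c * (U \<omega> * V \<omega>)) \<partial>N) = (\<integral>\<omega>. (1 - V \<omega>) + exp (- c * U \<omega>) * V \<omega> \<partial>N)"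
    by (rule integral_cong_AE) (use V01 in auto)
  also have "\<dots> = (1 - p) + (\<integral>\<omega>. exp (- c * U \<omega>) * V \<omega> \<partial>N)"
    using iV indep_var_integrable[OF ind' iU iV] prob_space by (simp add: EV)
  also have "(\<integral>\<omega>. exp (- c * U \<omega>) * V \<omega> \<partial>N) = (\<integral>\<omega>. exp (- c * U \<omega>) \<partial>N) * (\<integral>\<omega>. V \<omega> \<partial>N)"
    by (rule indep_var_lebesgue_integral[OF ind' iU iV])
  also have "\<dots> = p * (\<integral>z. exp (- c * ((fst z)\<^sup>2 + (snd z)\<^sup>2)) \<partial>gauss2)"
    unfolding EU EV by (rule mult.commute)
  finally show "(\<integral>\<omega>. exp (- c * (U \<omega> * V \<omega>)) \<partial>N) = (1 - p) + p * (\<integral>z. exp (- c * ((fst z)\<^sup>2 + (snd z)\<^sup>2)) \<partial>gauss2)" .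
qed

context supercritical_bar
begin

definition coord_norm :: "nat \<Rightarrow> 'a \<Rightarrow> real" where
  "coord_norm n \<omega> = of_bool (Z (n div 2) \<omega> > 0) * ((coordA (\<lambda>i. X i \<omega>) n)\<^sup>2 + (coordB (\<lambda>i. X i \<omega>) n)\<^sup>2)"

lemma measurable_coord_norm [measurable]: "coord_norm n \<in> borel_measurable M"
  unfolding coord_norm_def by measurable

lemma coord_norm_nonneg: "coord_norm n \<omega> \<ge> 0" by (simp add: coord_norm_def)

text \<open>The Laplace transform of a squared norm is a Gaussian mixture of characteristic functions.\<close>

lemma laplace_coord_norm_tendsto:
  assumes H0: "\<alpha>\<^sub>0 \<theta> = \<alpha>\<^sub>1 \<theta>" "\<beta>\<^sub>0 \<theta> = \<beta>\<^sub>1 \<theta>" and c: "c \<ge> 0"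
  shows "(\<lambda>n. \<integral>\<omega>. exp (- c * coord_norm n \<omega>) \<partial>M) \<longlonglongrightarrow> ext_prob + (1 - ext_prob) * (\<integral>z. exp (- c * ((fst z)\<^sup>2 + (snd z)\<^sup>2)) \<partial>gauss2)"
proof -
  interpret g: prob_space gauss2 by (rule prob_space_gauss2)
  interpret P: pair_prob_space M gauss2 ..
  \<comment> \<open>The Gaussian mean of the characteristic exponential at \<open>r\<close> times a
    vector is \<open>exp (- r * r / 2)\<close> to the power of its squared norm; this choice turns
    the rate into \<open>c\<close>.\<close>
  define r where "r = sqrt (2 * c)"
  have r2: "r\<^sup>2 = 2 * c" using c by (simp add: r_def)
  have sp [measurable_cong]: "sets gauss2 = sets (borel \<Otimes>\<^sub>M borel)" by (intro sets_pair_measure_cong) auto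
  let ?f = "\<lambda>n \<omega> z. clt_char (r * fst z) (r * snd z) n \<omega>"
  have bound: "norm (?f n \<omega> z) \<le> 1" for n \<omega> z by (simp add: clt_char_def norm_mult)
  have meas: "(\<lambda>(\<omega>, z). ?f n \<omega> z) \<in> borel_measurable (M \<Otimes>\<^sub>M gauss2)" for n
    unfolding clt_char_def split_beta' by measurable
  have int: "integrable (M \<Otimes>\<^sub>M gauss2) (case_prod (?f n))" for n
    by (rule P.P.integrable_const_bound[where B=1]) (use meas[of n] bound in \<open>auto simp: split_beta'\<close>)
  have inner: "(CLINT z|gauss2. ?f n \<omega> z) = complex_of_real (of_bool (Z (n div 2) \<omega> > 0) * exp (- c * coord_norm n \<omega>))" for n \<omega>
  proof (cases "Z (n div 2) \<omega> > 0")
    case True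
    let ?A = "coordA (\<lambda>i. X i \<omega>) n" and ?B = "coordB (\<lambda>i. X i \<omega>) n"
    have "(CLINT z|gauss2. ?f n \<omega> z) = (CLINT z|gauss2. iexp ((r * ?A) * fst z + (r * ?B) * snd z))"
      using True by (intro Bochner_Integration.integral_cong) (simp_all add: clt_char_def mult_ac)
    also have "\<dots> = complex_of_real (exp (- ((r * ?A)\<^sup>2 + (r * ?B)\<^sup>2) / 2))" by (rule gauss2_char)
    also have "- ((r * ?A)\<^sup>2 + (r * ?B)\<^sup>2) / 2 = - c * coord_norm n \<omega>"
      using True by (simp add: power_mult_distrib r2 coord_norm_def field_simps)
    finally show ?thesis using True by simp
  next
    case False then show ?thesis by (simp add: clt_char_def)
  qed
  have meas2: "(\<lambda>z. CLINT \<omega>|M. ?f n \<omega> z) \<in> borel_measurable gauss2" for n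
  proof -
    have "(\<lambda>(z, \<omega>). ?f n \<omega> z) \<in> borel_measurable (gauss2 \<Otimes>\<^sub>M M)"
      unfolding clt_char_def split_beta' by measurable
    then show ?thesis by (rule borel_measurable_lebesgue_integral)
  qed
  have "(\<lambda>n. CLINT z|gauss2. (CLINT \<omega>|M. ?f n \<omega> z)) \<longlonglongrightarrow> (CLINT z|gauss2. complex_of_real ((1 - ext_prob) * exp (- ((r * fst z)\<^sup>2 + (r * snd z)\<^sup>2) / 2)))"
  proof (rule integral_dominated_convergence[where w="\<lambda>_. 1"])
    show "AE z in gauss2. (\<lambda>n. CLINT \<omega>|M. ?f n \<omega> z) \<longlonglongrightarrow> complex_of_real ((1 - ext_prob) * exp (- ((r * fst z)\<^sup>2 + (r * snd z)\<^sup>2) / 2))"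
      by (intro AE_I2 clt_char_tendsto[OF H0])
    show "AE z in gauss2. norm (CLINT \<omega>|M. ?f n \<omega> z) \<le> 1" for n
    proof (rule AE_I2)
      fix z
      have "norm (CLINT \<omega>|M. ?f n \<omega> z) \<le> (\<integral>\<omega>. norm (?f n \<omega> z) \<partial>M)" by (rule integral_norm_bound)
      also have "\<dots> \<le> (\<integral>\<omega>. 1 \<partial>M)"
        by (rule integral_mono') (use bound in auto)
      also have "\<dots> = 1" using prob_space by simp
      finally show "norm (CLINT \<omega>|M. ?f n \<omega> z) \<le> 1" .
    qed
  qed (use meas2 in auto)
  also have "(\<lambda>n. CLINT z|gauss2. (CLINT \<omega>|M. ?f n \<omega> z)) = (\<lambda>n. complex_of_real (\<integral>\<omega>. of_bool (Z (n div 2) \<omega> > 0) * exp (- c * coord_norm n \<omega>) \<partial>M))"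
    unfolding P.Fubini_integral[OF int] inner integral_complex_of_real ..
  also have "(CLINT z|gauss2. complex_of_real ((1 - ext_prob) * exp (- ((r * fst z)\<^sup>2 + (r * snd z)\<^sup>2) / 2))) =
    complex_of_real ((1 - ext_prob) * (\<integral>z. exp (- c * ((fst z)\<^sup>2 + (snd z)\<^sup>2)) \<partial>gauss2))"
  proof -
    have "- ((r * x)\<^sup>2 + (r * y)\<^sup>2) / 2 = - c * (x\<^sup>2 + y\<^sup>2)" for x y
      by (simp add: power_mult_distrib r2 field_simps)
    then show ?thesis unfolding integral_complex_of_real by simp
  qed
  finally have lim1: "(\<lambda>n. \<integral>\<omega>. of_bool (Z (n div 2) \<omega> > 0) * exp (- c * coord_norm n \<omega>) \<partial>M) \<longlonglongrightarrow> (1 - ext_prob) * (\<integral>z. exp (- c * ((fst z)\<^sup>2 + (snd z)\<^sup>2)) \<partial>gauss2)"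
    unfolding tendsto_of_real_iff .
  have eq: "(\<integral>\<omega>. exp (- c * coord_norm n \<omega>) \<partial>M) = (\<integral>\<omega>. of_bool (Z (n div 2) \<omega> > 0) * exp (- c * coord_norm n \<omega>) \<partial>M) + (1 - prob {\<omega> \<in> space M. Z (n div 2) \<omega> > 0})" for n
  proof -
    \<comment> \<open>On realisations extinct by generation \<open>n div 2\<close> the norm is 0 by
      definition and the exponential is 1; they account for the complementary probability.\<close>
    have i1: "integrable M (\<lambda>\<omega>. of_bool (Z (n div 2) \<omega> > 0) * exp (- c * coord_norm n \<omega>))"
      by (rule integrable_const_bound[where B=1]) (use c coord_norm_nonneg in \<open>auto simp: abs_mult\<close>)
    have "(\<integral>\<omega>. exp (- c * coord_norm n \<omega>) \<partial>M) = (\<integral>\<omega>. of_bool (Z (n div 2) \<omega> > 0) * exp (- c * coord_norm n \<omega>) + (1 - indicator {\<omega> \<in> space M. Z (n div 2) \<omega> > 0} \<omega>) \<partial>M)"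
      by (intro Bochner_Integration.integral_cong) (auto simp: coord_norm_def)
    also have "\<dots> = (\<integral>\<omega>. of_bool (Z (n div 2) \<omega> > 0) * exp (- c * coord_norm n \<omega>) \<partial>M) + (1 - prob {\<omega> \<in> space M. Z (n div 2) \<omega> > 0})"
      using i1 prob_space by (simp add: less_top[symmetric])
    finally show ?thesis .
  qed
  have "(\<lambda>n. \<integral>\<omega>. exp (- c * coord_norm n \<omega>) \<partial>M) \<longlonglongrightarrow> (1 - ext_prob) * (\<integral>z. exp (- c * ((fst z)\<^sup>2 + (snd z)\<^sup>2)) \<partial>gauss2) + (1 - (1 - ext_prob))"
    unfolding eq by (intro tendsto_intros lim1 survival_prob_tendsto)
  then show ?thesis by (simp add: add.commute)
qed

section \<open>Measurability of the estimators and of the statistic\<close>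

lemma measurable_sum_Tset:
  fixes f :: "node \<Rightarrow> 'a \<Rightarrow> real"
  assumes "\<And>i. f i \<in> borel_measurable M"
  shows "(\<lambda>\<omega>. \<Sum>i\<in>Tset \<tau> (\<lambda>i. X i \<omega>) n. f i \<omega>) \<in> borel_measurable M"
proof -
  note [measurable] = assms
  have eq: "(\<Sum>i\<in>Tset \<tau> (\<lambda>i. X i \<omega>) n. f i \<omega>) = (\<Sum>i\<in>tree_upto n. if X i \<omega> \<noteq> None \<and> (X (i @ [False]) \<omega> \<noteq> None) = fst \<tau> \<and> (X (i @ [True]) \<omega> \<noteq> None) = snd \<tau> then f i \<omega> else 0)" for \<omega>
    unfolding Tset_def by (subst sum.inter_filter) auto
  show ?thesis unfolding eq by measurable
qed

lemma measurable_card_Tset: "(\<lambda>\<omega>. real (card (Tset \<tau> (\<lambda>i. X i \<omega>) n))) \<in> borel_measurable M"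
  using measurable_sum_Tset[of "\<lambda>_ _. 1"] by simp

lemma measurable_avg:
  fixes f :: "node \<Rightarrow> 'a \<Rightarrow> real"
  assumes "\<And>i. f i \<in> borel_measurable M"
  shows "(\<lambda>\<omega>. avg (Tset \<tau> (\<lambda>i. X i \<omega>) n) (\<lambda>i. f i \<omega>)) \<in> borel_measurable M"
proof -
  note [measurable] = measurable_card_Tset measurable_sum_Tset[OF assms]
  show ?thesis unfolding avg_def by measurable
qed

lemma measurable_val: "(\<lambda>\<omega>. the (X i \<omega>)) \<in> borel_measurable M"
  by measurable

lemma measurable_slope_hat [measurable]:
  "(\<lambda>\<omega>. slope_hat (\<lambda>i. X i \<omega>) (Tset \<tau> (\<lambda>i. X i \<omega>) n) \<delta>) \<in> borel_measurable M"
proof -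
  have 1: "(\<lambda>\<omega>. the (X i \<omega>) * the (X (i @ [\<delta>]) \<omega>)) \<in> borel_measurable M"
    "(\<lambda>\<omega>. the (X (i @ [\<delta>]) \<omega>)) \<in> borel_measurable M" "(\<lambda>\<omega>. (the (X i \<omega>))\<^sup>2) \<in> borel_measurable M" for i
    by measurable
  note [measurable] = measurable_avg[OF 1(1)] measurable_avg[OF 1(2)] measurable_avg[OF 1(3)] measurable_avg[OF measurable_val]
  show ?thesis unfolding slope_hat_def by measurable
qed

lemma measurable_intercept_hat [measurable]:
  "(\<lambda>\<omega>. intercept_hat (\<lambda>i. X i \<omega>) (Tset \<tau> (\<lambda>i. X i \<omega>) n) \<delta>) \<in> borel_measurable M"
proof -
  note [measurable] = measurable_avg[OF measurable_val] measurable_avg[OF measurable_val[of "_ @ [\<delta>]"]]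
  show ?thesis unfolding intercept_hat_def by measurable
qed

lemma measurable_residue [measurable]:
  "(\<lambda>\<omega>. residue (\<lambda>i. X i \<omega>) (Tset \<tau> (\<lambda>i. X i \<omega>) n) \<delta> i) \<in> borel_measurable M"
  unfolding residue_def by measurable

lemma measurable_sigma2_hat [measurable]: "(\<lambda>\<omega>. sigma2_hat (\<lambda>i. X i \<omega>) n) \<in> borel_measurable M"
proof -
  have "(\<lambda>\<omega>. (residue (\<lambda>i. X i \<omega>) (Tset both (\<lambda>i. X i \<omega>) n) False i)\<^sup>2 + (residue (\<lambda>i. X i \<omega>) (Tset both (\<lambda>i. X i \<omega>) n) True i)\<^sup>2) \<in> borel_measurable M" for i
    by measurable
  note [measurable] = measurable_card_Tset measurable_sum_Tset[OF this]
  show ?thesis unfolding sigma2_hat_def T_both_Tset by measurable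
qed

lemma measurable_sigma2_only_hat [measurable]: "(\<lambda>\<omega>. sigma2_only_hat \<delta> (\<lambda>i. X i \<omega>) n) \<in> borel_measurable M"
proof -
  have "(\<lambda>\<omega>. (residue (\<lambda>i. X i \<omega>) (Tset (\<not> \<delta>, \<delta>) (\<lambda>i. X i \<omega>) n) \<delta> i)\<^sup>2) \<in> borel_measurable M" for i
    by measurable
  note [measurable] = measurable_card_Tset measurable_sum_Tset[OF this]
  show ?thesis unfolding sigma2_only_hat_def T_only_Tset by measurable
qed

lemma measurable_rho_hat [measurable]: "(\<lambda>\<omega>. rho_hat (\<lambda>i. X i \<omega>) n) \<in> borel_measurable M"
proof -
  have "(\<lambda>\<omega>. residue (\<lambda>i. X i \<omega>) (Tset both (\<lambda>i. X i \<omega>) n) False i * residue (\<lambda>i. X i \<omega>) (Tset both (\<lambda>i. X i \<omega>) n) True i) \<in> borel_measurable M" for i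
    by measurable
  note [measurable] = measurable_card_Tset measurable_sum_Tset[OF this]
  show ?thesis unfolding rho_hat_def T_both_Tset by measurable
qed

lemma measurable_card_alive: "(\<lambda>\<omega>. real (card (alive (\<lambda>i. X i \<omega>) (tree_upto n)))) \<in> borel_measurable M"
  unfolding card_alive_upto by measurable

lemma measurable_zeta [measurable]: "(\<lambda>\<omega>. zeta n (\<lambda>i. X i \<omega>)) \<in> borel_measurable M"
proof -
  note [measurable] = measurable_card_Tset measurable_card_alive
  have t [measurable]: "(\<lambda>\<omega>. f (theta_hat (\<lambda>i. X i \<omega>) n)) \<in> borel_measurable M"
    if "f \<in> {\<alpha>\<^sub>0, \<beta>\<^sub>0, \<alpha>\<^sub>1, \<beta>\<^sub>1, \<alpha>'\<^sub>0, \<beta>'\<^sub>0, \<alpha>'\<^sub>1, \<beta>'\<^sub>1, p\<^sub>1\<^sub>0, p\<^sub>0, p\<^sub>1}" for f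
    using that by (auto simp: theta_hat_def T_both_Tset T_only_Tset)
  have k [measurable]: "(\<lambda>\<omega>. f (kappa_hat (\<lambda>i. X i \<omega>) n)) \<in> borel_measurable M"
    if "f \<in> {\<sigma>, \<rho>, \<sigma>\<^sub>0, \<sigma>\<^sub>1}" for f
    using that by (auto simp: kappa_hat_def)
  note [measurable] = t[of \<alpha>\<^sub>0, simplified] t[of \<beta>\<^sub>0, simplified] t[of \<alpha>\<^sub>1, simplified] t[of \<beta>\<^sub>1, simplified]
    t[of \<alpha>'\<^sub>0, simplified] t[of \<beta>'\<^sub>0, simplified] t[of \<alpha>'\<^sub>1, simplified] t[of \<beta>'\<^sub>1, simplified]
    t[of p\<^sub>1\<^sub>0, simplified] t[of p\<^sub>0, simplified] t[of p\<^sub>1, simplified]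
    k[of \<sigma>, simplified] k[of \<rho>, simplified] k[of \<sigma>\<^sub>0, simplified] k[of \<sigma>\<^sub>1, simplified]
  show ?thesis
    unfolding zeta_def Let_def mu1_def mu2_def alpha_bar_def beta_bar_def alpha2_bar_def beta2_bar_def alpha_beta_bar_def
      sigma2_bar_def mean_offspring_def T_both_Tset
    by measurable
qed

definition stat_n :: "nat \<Rightarrow> 'a \<Rightarrow> real" where
  "stat_n n \<omega> = indicator {\<omega>. Z n \<omega> > 0} \<omega> * zeta n (\<lambda>i. X i \<omega>)"

lemma measurable_stat_n [measurable]: "stat_n n \<in> borel_measurable M"
proof -
  have "stat_n n = (\<lambda>\<omega>. of_bool (Z n \<omega> > 0) * zeta n (\<lambda>i. X i \<omega>))" by (auto simp: stat_n_def fun_eq_iff)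
  then show ?thesis by simp
qed

text \<open>The comparison is made path by path. On survival both indicators are 1 and the relative
  error vanishes; on extinction both quantities are eventually 0, although one looks at generation
  \<open>n\<close> and the other at \<open>n div 2\<close>.\<close>

lemma stat_n_close:
  assumes H0: "\<alpha>\<^sub>0 \<theta> = \<alpha>\<^sub>1 \<theta>" "\<beta>\<^sub>0 \<theta> = \<beta>\<^sub>1 \<theta>" and ab: "a < b"
  shows "(\<lambda>n. (\<integral>\<omega>. cts_step a b (stat_n n \<omega>) \<partial>M) - (\<integral>\<omega>. cts_step a b (coord_norm n \<omega>) \<partial>M)) \<longlonglongrightarrow> 0"
proof -
  have [measurable]: "cts_step a b \<in> borel_measurable borel" unfolding cts_step_def by measurable
  have i: "integrable M (\<lambda>\<omega>. cts_step a b (f \<omega>))" if [measurable]: "f \<in> borel_measurable M" for f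
    using ab by (intro integrable_const_bound[where B=1]) (auto simp: cts_step_def)
  have "(\<lambda>n. \<integral>\<omega>. cts_step a b (stat_n n \<omega>) - cts_step a b (coord_norm n \<omega>) \<partial>M) \<longlonglongrightarrow> (\<integral>\<omega>. 0 \<partial>M)"
  proof (rule integral_dominated_convergence[where w="\<lambda>_. 1"])
    show "AE \<omega> in M. norm (cts_step a b (stat_n n \<omega>) - cts_step a b (coord_norm n \<omega>)) \<le> 1" for n
    proof (rule AE_I2)
      fix \<omega>
      have "0 \<le> cts_step a b p" "cts_step a b p \<le> 1" for p using ab by (auto simp: cts_step_def)
      from this[of "stat_n n \<omega>"] this[of "coord_norm n \<omega>"]
      show "norm (cts_step a b (stat_n n \<omega>) - cts_step a b (coord_norm n \<omega>)) \<le> 1" by simp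
    qed
    show "AE \<omega> in M. (\<lambda>n. cts_step a b (stat_n n \<omega>) - cts_step a b (coord_norm n \<omega>)) \<longlonglongrightarrow> 0"
      using AE_typical W_zero_iff_extinct dead_forever' W_nonneg
    proof eventually_elim
      case (elim \<omega>)
      show ?case
      proof (cases "W \<omega> = 0")
        case True
        then obtain k where "Z k \<omega> = 0" using elim(2) by blast
        have "Z (n div 2) \<omega> = 0 \<and> Z n \<omega> = 0" if "2 * k \<le> n" for n
        proof -
          have "k \<le> n div 2" "k \<le> n" using that by auto
          with elim(3) \<open>Z k \<omega> = 0\<close> show ?thesis by blast
        qed
        then have "\<forall>\<^sub>F n in sequentially. Z (n div 2) \<omega> = 0 \<and> Z n \<omega> = 0"
          by (rule eventually_sequentiallyI)
        then have "\<forall>\<^sub>F n in sequentially. cts_step a b (stat_n n \<omega>) - cts_step a b (coord_norm n \<omega>) = 0"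
          by eventually_elim (simp add: stat_n_def coord_norm_def)
        then show ?thesis by (rule tendsto_eventually)
      next
        case False
        then have w: "W \<omega> > 0" using elim(4) by simp
        have al: "Z k \<omega> > 0" for k using False elim(2) by (metis gr0I)
        have "stat_n n \<omega> = zeta n (\<lambda>i. X i \<omega>)" "coord_norm n \<omega> = (coordA (\<lambda>i. X i \<omega>) n)\<^sup>2 + (coordB (\<lambda>i. X i \<omega>) n)\<^sup>2" for n
          using al by (simp_all add: stat_n_def coord_norm_def)
        then show ?thesis
          using zeta_close_H0[OF elim(1) w H0] coord_norm_nonneg[of _ \<omega>] ab
          by (intro cts_step_diff_null) simp_all
      qed
    qed
  qed auto
  then show ?thesis using i by simp
qed

text \<open>Weak convergence is tested on \<open>cts_step\<close>, for which the statistic may be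
  replaced by \<open>coord_norm\<close>. The Laplace transform of the latter tends to that of
  \<open>U * V\<close>; the constant term \<open>ext_prob\<close> comes from the event that
  \<open>V\<close> is 0.\<close>

lemma stat_n_weak_conv:
  fixes N :: "'b measure" and U V :: "'b \<Rightarrow> real"
  assumes H0: "\<alpha>\<^sub>0 \<theta> = \<alpha>\<^sub>1 \<theta>" "\<beta>\<^sub>0 \<theta> = \<beta>\<^sub>1 \<theta>"
    and N: "prob_space N"
    and U: "U \<in> borel_measurable N" "distr N borel U = chi_square_law 2"
    and V: "V \<in> borel_measurable N" "distr N borel V = bernoulli_law (1 - ext_prob)"
    and ind: "prob_space.indep_var N borel U borel V"
  shows "weak_conv_m (\<lambda>n. distr M borel (stat_n n)) (distr N borel (\<lambda>\<omega>. U \<omega> * V \<omega>))"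
proof -
  interpret N: prob_space N by (rule N)
  note [measurable] = U(1) V(1)
  have p: "0 \<le> 1 - ext_prob" "1 - ext_prob \<le> 1" by (simp_all add: ext_prob_def)
  note L = laplace_chi_bernoulli[OF N p _ U V ind]
  show ?thesis
  proof (rule integral_cts_step_conv_imp_weak_conv)
    show "real_distribution (distr M borel (stat_n n))" for n
      by (intro real_distribution_distr) simp
    show "real_distribution (distr N borel (\<lambda>\<omega>. U \<omega> * V \<omega>))"
      by (intro N.real_distribution_distr) simp
    fix a b :: real assume ab: "a < b"
    have [measurable]: "cts_step a b \<in> borel_measurable borel" unfolding cts_step_def by measurable
    have "(\<lambda>n. \<integral>\<omega>. cts_step a b (coord_norm n \<omega>) \<partial>M) \<longlonglongrightarrow> (\<integral>\<omega>. cts_step a b (U \<omega> * V \<omega>) \<partial>N)"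
    proof (rule cts_step_tendsto_of_laplace)
      show "prob_space M" by unfold_locales
      show "AE \<omega> in N. U \<omega> * V \<omega> \<ge> 0" by (rule L(1)[of 0]) simp
      show "(\<lambda>n. \<integral>\<omega>. exp (- real k * coord_norm n \<omega>) \<partial>M) \<longlonglongrightarrow> (\<integral>\<omega>. exp (- real k * (U \<omega> * V \<omega>)) \<partial>N)" for k
        using laplace_coord_norm_tendsto[OF H0, of "real k"] L(2)[of "real k"] by simp
    qed (use N ab coord_norm_nonneg in auto)
    from tendsto_add[OF stat_n_close[OF H0 ab] this]
    have "(\<lambda>n. \<integral>\<omega>. cts_step a b (stat_n n \<omega>) \<partial>M) \<longlonglongrightarrow> (\<integral>\<omega>. cts_step a b (U \<omega> * V \<omega>) \<partial>N)" by simp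
    then show "(\<lambda>n. integral\<^sup>L (distr M borel (stat_n n)) (cts_step a b)) \<longlonglongrightarrow> integral\<^sup>L (distr N borel (\<lambda>\<omega>. U \<omega> * V \<omega>)) (cts_step a b)"
      by (simp add: integral_distr)
  qed
qed

lemma stat_n_H1:
  assumes H1: "(\<alpha>\<^sub>0 \<theta>, \<beta>\<^sub>0 \<theta>) \<noteq> (\<alpha>\<^sub>1 \<theta>, \<beta>\<^sub>1 \<theta>)"
  shows "AE \<omega> in M. (W \<omega> = 0 \<longrightarrow> (\<lambda>n. stat_n n \<omega>) \<longlonglongrightarrow> 0) \<and> (W \<omega> \<noteq> 0 \<longrightarrow> filterlim (\<lambda>n. stat_n n \<omega>) at_top sequentially)"
  using AE_typical W_zero_iff_extinct dead_forever' W_nonneg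
proof eventually_elim
  case (elim \<omega>)
  show ?case
  proof (intro conjI impI)
    assume "W \<omega> = 0"
    then obtain k where "Z k \<omega> = 0" using elim(2) by blast
    with elim(3) have "\<forall>\<^sub>F n in sequentially. stat_n n \<omega> = 0"
      by (intro eventually_sequentiallyI[of k]) (simp add: stat_n_def)
    then show "(\<lambda>n. stat_n n \<omega>) \<longlonglongrightarrow> 0" by (rule tendsto_eventually)
  next
    assume "W \<omega> \<noteq> 0"
    then have w: "W \<omega> > 0" using elim(4) by simp
    have al: "Z k \<omega> > 0" for k using \<open>W \<omega> \<noteq> 0\<close> elim(2) by (metis gr0I)
    have "stat_n n \<omega> = zeta n (\<lambda>i. X i \<omega>)" for n using al by (simp add: stat_n_def)
    then show "filterlim (\<lambda>n. stat_n n \<omega>) at_top sequentially"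
      using zeta_at_top[OF elim(1) w H1] by simp
  qed
qed

end

theorem proposition6p7:
  fixes M :: "'a measure" and X :: "node \<Rightarrow> 'a \<Rightarrow> real option"
    and \<theta> :: bar_theta and \<kappa> :: bar_kappa
    and N :: "'b measure" and U V :: "'b \<Rightarrow> real"
    and Z :: "nat \<Rightarrow> 'a \<Rightarrow> nat" and W :: "'a \<Rightarrow> real"
    and \<zeta> :: "nat \<Rightarrow> 'a \<Rightarrow> real" and m \<eta> :: real
  defines "m \<equiv> mean_offspring \<theta>"
    and "Z \<equiv> (\<lambda>n \<omega>. card (alive (\<lambda>i. X i \<omega>) (generation n)))"
    and "W \<equiv> (\<lambda>\<omega>. lim (\<lambda>q. real (Z q \<omega>) / m ^ q))"
    and "\<zeta> \<equiv> (\<lambda>n \<omega>. zeta n (\<lambda>i. X i \<omega>))"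
    and "\<eta> \<equiv> measure M {\<omega> \<in> space M. W \<omega> = 0}"
  assumes process: "bifurcating_ar M X \<theta> \<kappa>"
    and supercritical: "m > 1"
    and moments: "\<And>k::nat. integrable M (\<lambda>\<omega>. \<bar>the (X [] \<omega>)\<bar> ^ k)"
    and N: "prob_space N"
    and U: "U \<in> borel_measurable N" "distr N borel U = chi_square_law 2"
    and V: "V \<in> borel_measurable N" "distr N borel V = bernoulli_law (1 - \<eta>)"
    and UV_indep: "prob_space.indep_var N borel U borel V"
  shows "(AE \<omega> in M. (\<lambda>q. real (Z q \<omega>) / m ^ q) \<longlonglongrightarrow> W \<omega>) \<and>
    (\<lambda>q. \<integral>\<^sup>+ \<omega>. ennreal ((real (Z q \<omega>) / m ^ q - W \<omega>)\<^sup>2) \<partial>M) \<longlonglongrightarrow> 0 \<and>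
    \<eta> = 1 - (m - 1) / p\<^sub>1\<^sub>0 \<theta> \<and>
    ((\<alpha>\<^sub>0 \<theta>, \<beta>\<^sub>0 \<theta>) = (\<alpha>\<^sub>1 \<theta>, \<beta>\<^sub>1 \<theta>) \<longrightarrow>
      weak_conv_m (\<lambda>n. distr M borel (\<lambda>\<omega>. indicator {\<omega>. Z n \<omega> > 0} \<omega> * \<zeta> n \<omega>))
        (distr N borel (\<lambda>\<omega>. U \<omega> * V \<omega>))) \<and>
    ((\<alpha>\<^sub>0 \<theta>, \<beta>\<^sub>0 \<theta>) \<noteq> (\<alpha>\<^sub>1 \<theta>, \<beta>\<^sub>1 \<theta>) \<longrightarrow>
      (AE \<omega> in M.
        (W \<omega> = 0 \<longrightarrow> (\<lambda>n. indicator {\<omega>. Z n \<omega> > 0} \<omega> * \<zeta> n \<omega>) \<longlonglongrightarrow> 0) \<and>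
        (W \<omega> \<noteq> 0 \<longrightarrow> filterlim (\<lambda>n. indicator {\<omega>. Z n \<omega> > 0} \<omega> * \<zeta> n \<omega>) at_top sequentially)))"
proof -
  interpret bifurcating_ar M X \<theta> \<kappa> by (rule process)
  interpret S: supercritical_bar M X \<theta> \<kappa>
    using supercritical moments[of 4] by unfold_locales (auto simp: m_def)
  have Z: "Z = S.Z" by (simp add: Z_def S.Z_def fun_eq_iff)
  have S0: "real (Z q \<omega>) / m ^ q = S.S 0 q \<omega>" for q \<omega> by (simp add: Z S.S0_Z m_def)
  have W: "W = S.W" by (simp add: W_def S.W_def S0 fun_eq_iff)
  have \<eta>: "\<eta> = S.ext_prob" by (simp add: \<eta>_def S.ext_prob_def W)
  have st: "(\<lambda>\<omega>. indicator {\<omega>. Z n \<omega> > 0} \<omega> * \<zeta> n \<omega>) = S.stat_n n" for n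
    by (simp add: fun_eq_iff S.stat_n_def Z \<zeta>_def)
  have st': "indicator {\<omega>. Z n \<omega> > 0} \<omega> * \<zeta> n \<omega> = S.stat_n n \<omega>" for n \<omega>
    using st[of n] by (simp only: fun_eq_iff)
  show ?thesis
  proof (intro conjI impI)
    show "AE \<omega> in M. (\<lambda>q. real (Z q \<omega>) / m ^ q) \<longlonglongrightarrow> W \<omega>"
      unfolding S0 W by (rule S.S0_tendsto_W)
    show "(\<lambda>q. \<integral>\<^sup>+ \<omega>. ennreal ((real (Z q \<omega>) / m ^ q - W \<omega>)\<^sup>2) \<partial>M) \<longlonglongrightarrow> 0"
      unfolding S0 W by (rule S.S0_L2)
    show "\<eta> = 1 - (m - 1) / p\<^sub>1\<^sub>0 \<theta>"
      unfolding \<eta> m_def by (rule S.eta_value)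
  next
    assume "(\<alpha>\<^sub>0 \<theta>, \<beta>\<^sub>0 \<theta>) = (\<alpha>\<^sub>1 \<theta>, \<beta>\<^sub>1 \<theta>)"
    then show "weak_conv_m (\<lambda>n. distr M borel (\<lambda>\<omega>. indicator {\<omega>. Z n \<omega> > 0} \<omega> * \<zeta> n \<omega>)) (distr N borel (\<lambda>\<omega>. U \<omega> * V \<omega>))"
      unfolding st using V(2) by (intro S.stat_n_weak_conv N U V(1) UV_indep) (simp_all add: \<eta>)
  next
    assume "(\<alpha>\<^sub>0 \<theta>, \<beta>\<^sub>0 \<theta>) \<noteq> (\<alpha>\<^sub>1 \<theta>, \<beta>\<^sub>1 \<theta>)"
    then show "AE \<omega> in M. (W \<omega> = 0 \<longrightarrow> (\<lambda>n. indicator {\<omega>. Z n \<omega> > 0} \<omega> * \<zeta> n \<omega>) \<longlonglongrightarrow> 0) \<and>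
        (W \<omega> \<noteq> 0 \<longrightarrow> filterlim (\<lambda>n. indicator {\<omega>. Z n \<omega> > 0} \<omega> * \<zeta> n \<omega>) at_top sequentially)"
      unfolding st' W by (rule S.stat_n_H1)
  qed
qed

end
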